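(* Let $U$ be an r.e. sequential theory in a finite language $\mathcal L'$ and let $\mathcal L\subseteq\mathcal L'$. If $U$ imposes $\mathcal L$-elementarity, then $U$ semantically defines $\mathrm{USB}_N(\mathcal L)$ modulo $\mathcal L$ for each interpretation $N:S^1_2\lhd U$.
   Context: All theories are first-order; $\mathcal M\restriction_{\mathcal L}$ is the $\mathcal L$-reduct of $\mathcal M$. A translation is direct if it is one-dimensional, unrelativized and translates identity to identity. Sequentiality. $\mathrm{AS}$ is the theory in the language $\{\in\}$ with axioms $\exists x\forall y\,(y\notin x)$ and $\forall x\forall y\exists z\forall w\,(w\in z\leftrightarrow (w\in x\vee w=y))$. $U$ is sequential if it interprets $\mathrm{AS}$ via a direct, parameter-free interpretation. $S^1_2$ is Buss's arithmetic. $N:S^1_2\lhd U$ means that $N$ is a one-dimensional, parameter-free relative interpretation of $S^1_2$ in $U$ (identity may be translated as a definable equivalence relation). Syntax is coded via $N$: for a natural number $n$, $n(x)$ is the $N$-translation of $x=\underline n$ ($\underline n$ the binary numeral of $n$), and for a predicate $R$, $R(\underline n,\dots)$ abbreviates $\exists x(n(x)\wedge R(x,\dots))$. $\ulcorner\phi\urcorner$ is the Gödel number of $\phi$. $\mathrm{USB}_N(\mathcal L)$ is $U$ plus $\forall x\,(S(\underline{\ulcorner\phi\urcorner},x)\leftrightarrow\phi(x))$ for all $\mathcal L$-formulae $\phi(x)$, where $S$ is a fresh binary predicate. Definability. A theory $W$ syntactically defines $V$ modulo $\mathcal L$ if $W$ interprets $V$ via a direct, parameter-free translation which translates every $\mathcal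 L$-formula to itself; when $V$ is formulated with a single additional predicate $R$, this amounts to the existence of a formula $\phi_R$ in the language of $W$ such that $W\vdash\Phi[\phi_R/R]$ for every axiom $\Phi$ of $V$. $U$ semantically defines $V$ modulo $\mathcal L$ if for every $\mathcal M\models U$ the elementary diagram $\mathrm{ElDiag}(\mathcal M)$ syntactically defines $V$ modulo $\mathcal L_M$ ($\mathcal L$ with constants for all elements of $\mathcal M$); so formulae with parameters from $\mathcal M$ are allowed and may depend on $\mathcal M$. Complexity. $\Sigma^*_0=\Pi^*_0=\emptyset$. By simultaneous induction, $\Sigma^*_{n+1}$ contains the atomic formulae, is closed under $\exists v$, $\wedge$, $\vee$, contains $\neg\phi$ for $\phi\in\Pi^*_{n+1}$ and $\forall v\,\phi$ for $\phi\in\Pi^*_n$; dually $\Pi^*_{n+1}$ contains the atomic formulae, is closed under $\forall v,\wedge,\vee$, contains $\neg\phi$ for $\phi\in\Sigma^*_{n+1}$ and $\exists v\,\phi$ for $\phi\in\Sigma^*_n$. $\mathcal M\preceq_n\mathcal N$ means that every $\Sigma^*_n$ sentence with parameters from $\mathcal M$ that is true in $\mathcal M$ is true in $\mathcal N$. $U$ imposes $\mathcal L$-elementarity if for every $\mathcal M\models U$ there is $n\in\mathbb N$ such that for every $\mathcal N\models U$, $\mathcal M\preceq_n\mathcal N$ implies $\mathcal M\restriction_{\mathcal L}\preceq\mathcal N\restriction_{\mathcal L}$. *)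

theory Defs
  imports Main
begin

section \<open>First-order logic\<close>

text \<open>Variables are de Bruijn indices. A symbol carries no arity of its own; it is the pair of a
  symbol and an arity that belongs to a language.\<close>

datatype 'f tm = Var nat | Fn 'f "'f tm list"

datatype ('f, 'r) fm =
    Eq "'f tm" "'f tm"
  | Rel 'r "'f tm list"
  | Neg "('f, 'r) fm"
  | And "('f, 'r) fm" "('f, 'r) fm"
  | Or "('f, 'r) fm" "('f, 'r) fm"
  | Ex "('f, 'r) fm"
  | All "('f, 'r) fm"

abbreviation Imp :: "('f, 'r) fm \<Rightarrow> ('f, 'r) fm \<Rightarrow> ('f, 'r) fm"
  where "Imp \<phi> \<psi> \<equiv> Or (Neg \<phi>) \<psi>"

abbreviation Iff :: "('f, 'r) fm \<Rightarrow> ('f, 'r) fm \<Rightarrow> ('f, 'r) fm"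
  where "Iff \<phi> \<psi> \<equiv> And (Imp \<phi> \<psi>) (Imp \<psi> \<phi>)"

definition conjs :: "('f, 'r) fm list \<Rightarrow> ('f, 'r) fm"
  where "conjs \<phi>s = foldr And \<phi>s (All (Eq (Var 0) (Var 0)))"

definition exs :: "nat \<Rightarrow> ('f, 'r) fm \<Rightarrow> ('f, 'r) fm" where "exs k = Ex ^^ k"

definition alls :: "nat \<Rightarrow> ('f, 'r) fm \<Rightarrow> ('f, 'r) fm" where "alls k = All ^^ k"

record ('f, 'r) lang =
  funs :: "('f \<times> nat) set"
  rels :: "('r \<times> nat) set"

definition finite_lang :: "('f, 'r) lang \<Rightarrow> bool"
  where "finite_lang L \<longleftrightarrow> finite (funs L) \<and> finite (rels L)"

definition sublang :: "('f, 'r) lang \<Rightarrow> ('f, 'r) lang \<Rightarrow> bool"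
  where "sublang L L' \<longleftrightarrow> funs L \<subseteq> funs L' \<and> rels L \<subseteq> rels L'"

definition add_rel :: "'r \<Rightarrow> nat \<Rightarrow> ('f, 'r) lang \<Rightarrow> ('f, 'r) lang"
  where "add_rel R k L = L\<lparr>rels := insert (R, k) (rels L)\<rparr>"

text \<open>\<open>wf_fm L k \<phi>\<close>: \<open>\<phi>\<close> is a formula of \<open>L\<close> whose free variables are among \<open>0, \<dots>, k - 1\<close>.\<close>

primrec wf_tm :: "('f, 'r) lang \<Rightarrow> nat \<Rightarrow> 'f tm \<Rightarrow> bool" where
  "wf_tm L k (Var i) \<longleftrightarrow> i < k"
| "wf_tm L k (Fn f ts) \<longleftrightarrow> (f, length ts) \<in> funs L \<and> list_all (wf_tm L k) ts"

primrec wf_fm :: "('f, 'r) lang \<Rightarrow> nat \<Rightarrow> ('f, 'r) fm \<Rightarrow> bool" where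
  "wf_fm L k (Eq s t) \<longleftrightarrow> wf_tm L k s \<and> wf_tm L k t"
| "wf_fm L k (Rel R ts) \<longleftrightarrow> (R, length ts) \<in> rels L \<and> list_all (wf_tm L k) ts"
| "wf_fm L k (Neg \<phi>) \<longleftrightarrow> wf_fm L k \<phi>"
| "wf_fm L k (And \<phi> \<psi>) \<longleftrightarrow> wf_fm L k \<phi> \<and> wf_fm L k \<psi>"
| "wf_fm L k (Or \<phi> \<psi>) \<longleftrightarrow> wf_fm L k \<phi> \<and> wf_fm L k \<psi>"
| "wf_fm L k (Ex \<phi>) \<longleftrightarrow> wf_fm L (Suc k) \<phi>"
| "wf_fm L k (All \<phi>) \<longleftrightarrow> wf_fm L (Suc k) \<phi>"

definition formula_of :: "('f, 'r) lang \<Rightarrow> ('f, 'r) fm \<Rightarrow> bool"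
  where "formula_of L \<phi> \<longleftrightarrow> (\<exists>k. wf_fm L k \<phi>)"

abbreviation sentence_of :: "('f, 'r) lang \<Rightarrow> ('f, 'r) fm \<Rightarrow> bool"
  where "sentence_of L \<phi> \<equiv> wf_fm L 0 \<phi>"

definition theory_in :: "('f, 'r) lang \<Rightarrow> ('f, 'r) fm set \<Rightarrow> bool"
  where "theory_in L T \<longleftrightarrow> (\<forall>\<phi>\<in>T. sentence_of L \<phi>)"

subsection \<open>Substitution\<close>

primrec subst_tm :: "(nat \<Rightarrow> 'f tm) \<Rightarrow> 'f tm \<Rightarrow> 'f tm" where
  "subst_tm \<sigma> (Var i) = \<sigma> i"
| "subst_tm \<sigma> (Fn f ts) = Fn f (map (subst_tm \<sigma>) ts)"

abbreviation lift_tm :: "'f tm \<Rightarrow> 'f tm" where "lift_tm \<equiv> subst_tm (\<lambda>i. Var (Suc i))"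

definition up :: "(nat \<Rightarrow> 'f tm) \<Rightarrow> nat \<Rightarrow> 'f tm"
  where "up \<sigma> = case_nat (Var 0) (\<lambda>i. lift_tm (\<sigma> i))"

primrec subst :: "(nat \<Rightarrow> 'f tm) \<Rightarrow> ('f, 'r) fm \<Rightarrow> ('f, 'r) fm" where
  "subst \<sigma> (Eq s t) = Eq (subst_tm \<sigma> s) (subst_tm \<sigma> t)"
| "subst \<sigma> (Rel R ts) = Rel R (map (subst_tm \<sigma>) ts)"
| "subst \<sigma> (Neg \<phi>) = Neg (subst \<sigma> \<phi>)"
| "subst \<sigma> (And \<phi> \<psi>) = And (subst \<sigma> \<phi>) (subst \<sigma> \<psi>)"
| "subst \<sigma> (Or \<phi> \<psi>) = Or (subst \<sigma> \<phi>) (subst \<sigma> \<psi>)"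
| "subst \<sigma> (Ex \<phi>) = Ex (subst (up \<sigma>) \<phi>)"
| "subst \<sigma> (All \<phi>) = All (subst (up \<sigma>) \<phi>)"

abbreviation lift :: "('f, 'r) fm \<Rightarrow> ('f, 'r) fm" where "lift \<equiv> subst (\<lambda>i. Var (Suc i))"

definition inst :: "'f tm \<Rightarrow> ('f, 'r) fm \<Rightarrow> ('f, 'r) fm"
  where "inst t = subst (case_nat t Var)"

text \<open>\<open>vapp \<phi> [i\<^sub>0, \<dots>, i\<^sub>m]\<close> is \<open>\<phi>(v\<^bsub>i\<^sub>0\<^esub>, \<dots>, v\<^bsub>i\<^sub>m\<^esub>)\<close>; it is used only when the free variables of \<open>\<phi>\<close>
  are among \<open>0, \<dots>, m\<close>.\<close>

definition vapp :: "('f, 'r) fm \<Rightarrow> nat list \<Rightarrow> ('f, 'r) fm"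
  where "vapp \<phi> is = subst (\<lambda>j. Var (if j < length is then is ! j else j)) \<phi>"

subsection \<open>Provability\<close>

inductive proves :: "('f, 'r) fm set \<Rightarrow> ('f, 'r) fm \<Rightarrow> bool" (infix "\<turnstile>" 50) where
  Hyp: "\<phi> \<in> \<Gamma> \<Longrightarrow> \<Gamma> \<turnstile> \<phi>"
| NegI: "insert \<phi> \<Gamma> \<turnstile> \<psi> \<Longrightarrow> insert \<phi> \<Gamma> \<turnstile> Neg \<psi> \<Longrightarrow> \<Gamma> \<turnstile> Neg \<phi>"
| Contr: "insert (Neg \<phi>) \<Gamma> \<turnstile> \<psi> \<Longrightarrow> insert (Neg \<phi>) \<Gamma> \<turnstile> Neg \<psi> \<Longrightarrow> \<Gamma> \<turnstile> \<phi>"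
| AndI: "\<Gamma> \<turnstile> \<phi> \<Longrightarrow> \<Gamma> \<turnstile> \<psi> \<Longrightarrow> \<Gamma> \<turnstile> And \<phi> \<psi>"
| AndE1: "\<Gamma> \<turnstile> And \<phi> \<psi> \<Longrightarrow> \<Gamma> \<turnstile> \<phi>"
| AndE2: "\<Gamma> \<turnstile> And \<phi> \<psi> \<Longrightarrow> \<Gamma> \<turnstile> \<psi>"
| OrI1: "\<Gamma> \<turnstile> \<phi> \<Longrightarrow> \<Gamma> \<turnstile> Or \<phi> \<psi>"
| OrI2: "\<Gamma> \<turnstile> \<psi> \<Longrightarrow> \<Gamma> \<turnstile> Or \<phi> \<psi>"
| OrE: "\<Gamma> \<turnstile> Or \<phi> \<psi> \<Longrightarrow> insert \<phi> \<Gamma> \<turnstile> \<chi> \<Longrightarrow> insert \<psi> \<Gamma> \<turnstile> \<chi> \<Longrightarrow> \<Gamma> \<turnstile> \<chi>"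
| AllI: "lift ` \<Gamma> \<turnstile> \<phi> \<Longrightarrow> \<Gamma> \<turnstile> All \<phi>"
| AllE: "\<Gamma> \<turnstile> All \<phi> \<Longrightarrow> \<Gamma> \<turnstile> inst t \<phi>"
| ExI: "\<Gamma> \<turnstile> inst t \<phi> \<Longrightarrow> \<Gamma> \<turnstile> Ex \<phi>"
| ExE: "\<Gamma> \<turnstile> Ex \<phi> \<Longrightarrow> insert \<phi> (lift ` \<Gamma>) \<turnstile> lift \<psi> \<Longrightarrow> \<Gamma> \<turnstile> \<psi>"
| EqI: "\<Gamma> \<turnstile> Eq t t"
| EqE: "\<Gamma> \<turnstile> Eq s t \<Longrightarrow> \<Gamma> \<turnstile> inst s \<phi> \<Longrightarrow> \<Gamma> \<turnstile> inst t \<phi>"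

subsection \<open>Structures\<close>

record ('f, 'r, 'a) struct =
  dom :: "'a set"
  fun_of :: "'f \<Rightarrow> 'a list \<Rightarrow> 'a"
  rel_of :: "'r \<Rightarrow> 'a list \<Rightarrow> bool"

definition structure_for :: "('f, 'r) lang \<Rightarrow> ('f, 'r, 'a) struct \<Rightarrow> bool" where
  "structure_for L M \<longleftrightarrow> dom M \<noteq> {} \<and>
    (\<forall>(f, k)\<in>funs L. \<forall>xs. length xs = k \<and> set xs \<subseteq> dom M \<longrightarrow> fun_of M f xs \<in> dom M)"

primrec eval_tm :: "('f, 'r, 'a) struct \<Rightarrow> (nat \<Rightarrow> 'a) \<Rightarrow> 'f tm \<Rightarrow> 'a" where
  "eval_tm M v (Var i) = v i"
| "eval_tm M v (Fn f ts) = fun_of M f (map (eval_tm M v) ts)"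

primrec sat :: "('f, 'r, 'a) struct \<Rightarrow> (nat \<Rightarrow> 'a) \<Rightarrow> ('f, 'r) fm \<Rightarrow> bool" where
  "sat M v (Eq s t) \<longleftrightarrow> eval_tm M v s = eval_tm M v t"
| "sat M v (Rel R ts) \<longleftrightarrow> rel_of M R (map (eval_tm M v) ts)"
| "sat M v (Neg \<phi>) \<longleftrightarrow> \<not> sat M v \<phi>"
| "sat M v (And \<phi> \<psi>) \<longleftrightarrow> sat M v \<phi> \<and> sat M v \<psi>"
| "sat M v (Or \<phi> \<psi>) \<longleftrightarrow> sat M v \<phi> \<or> sat M v \<psi>"
| "sat M v (Ex \<phi>) \<longleftrightarrow> (\<exists>a\<in>dom M. sat M (case_nat a v) \<phi>)"
| "sat M v (All \<phi>) \<longleftrightarrow> (\<forall>a\<in>dom M. sat M (case_nat a v) \<phi>)"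

definition model :: "('f, 'r) lang \<Rightarrow> ('f, 'r) fm set \<Rightarrow> ('f, 'r, 'a) struct \<Rightarrow> bool" where
  "model L T M \<longleftrightarrow> structure_for L M \<and> (\<forall>\<phi>\<in>T. \<forall>v. range v \<subseteq> dom M \<longrightarrow> sat M v \<phi>)"

text \<open>Constants for the elements of a structure: \<open>Inr a\<close> names the element \<open>a\<close>.\<close>

definition lang_diag :: "('f, 'r) lang \<Rightarrow> ('f, 'r, 'a) struct \<Rightarrow> ('f + 'a, 'r) lang" where
  "lang_diag L M =
    \<lparr>funs = map_prod Inl id ` funs L \<union> (\<lambda>a. (Inr a, 0)) ` dom M, rels = rels L\<rparr>"

definition struct_diag :: "('f, 'r, 'a) struct \<Rightarrow> ('f + 'a, 'r, 'a) struct" where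
  "struct_diag M =
    \<lparr>dom = dom M, fun_of = case_sum (fun_of M) (\<lambda>a _. a), rel_of = rel_of M\<rparr>"

definition ElDiag :: "('f, 'r) lang \<Rightarrow> ('f, 'r, 'a) struct \<Rightarrow> ('f + 'a, 'r) fm set" where
  "ElDiag L M = {\<phi>. sentence_of (lang_diag L M) \<phi> \<and>
    (\<forall>v. range v \<subseteq> dom M \<longrightarrow> sat (struct_diag M) v \<phi>)}"

section \<open>Interpretations\<close>

text \<open>A one-dimensional translation, given by the domain formula (in variable 0), the formula for
  identity (in 0, 1), for a \<open>k\<close>-ary function symbol a formula for its graph (arguments
  \<open>0, \<dots>, k - 1\<close>, value \<open>k\<close>), and for a \<open>k\<close>-ary relation symbol a formula in \<open>0, \<dots>, k - 1\<close>.\<close>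

record ('f, 'r, 'g, 's) trans =
  tr_dom :: "('g, 's) fm"
  tr_eq :: "('g, 's) fm"
  tr_fun :: "'f \<times> nat \<Rightarrow> ('g, 's) fm"
  tr_rel :: "'r \<times> nat \<Rightarrow> ('g, 's) fm"

definition wf_trans :: "('f, 'r, 'g, 's) trans \<Rightarrow> ('f, 'r) lang \<Rightarrow> ('g, 's) lang \<Rightarrow> bool" where
  "wf_trans \<tau> LV LW \<longleftrightarrow> wf_fm LW 1 (tr_dom \<tau>) \<and> wf_fm LW 2 (tr_eq \<tau>) \<and>
    (\<forall>(f, k)\<in>funs LV. wf_fm LW (Suc k) (tr_fun \<tau> (f, k))) \<and>
    (\<forall>(R, k)\<in>rels LV. wf_fm LW k (tr_rel \<tau> (R, k)))"

abbreviation dom_at :: "('f, 'r, 'g, 's) trans \<Rightarrow> nat \<Rightarrow> ('g, 's) fm"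
  where "dom_at \<tau> i \<equiv> vapp (tr_dom \<tau>) [i]"

abbreviation eq_at :: "('f, 'r, 'g, 's) trans \<Rightarrow> nat \<Rightarrow> nat \<Rightarrow> ('g, 's) fm"
  where "eq_at \<tau> i j \<equiv> vapp (tr_eq \<tau>) [i, j]"

text \<open>Nested terms are unravelled. \<open>tr_tm \<tau> t \<rho> y\<close> translates \<open>t = v\<^sub>y\<close>, where \<open>\<rho>\<close> renames the
  variables of \<open>t\<close>. If \<open>gs\<close> are the translations of the terms \<open>t\<^sub>0, \<dots>, t\<^bsub>k-1\<^esub>\<close>, then
  \<open>tr_args \<tau> \<rho> gs \<chi>\<close> says that \<open>\<chi>\<close> holds for values \<open>v\<^sub>0, \<dots>, v\<^bsub>k-1\<^esub>\<close> in the domain of these terms.\<close>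

definition tr_args :: "('f, 'r, 'g, 's) trans \<Rightarrow> (nat \<Rightarrow> nat) \<Rightarrow>
    ((nat \<Rightarrow> nat) \<Rightarrow> nat \<Rightarrow> ('g, 's) fm) list \<Rightarrow> ('g, 's) fm \<Rightarrow> ('g, 's) fm" where
  "tr_args \<tau> \<rho> gs \<chi> = (let k = length gs in
    exs k (And (conjs (map (\<lambda>i. And (dom_at \<tau> i) ((gs ! i) (\<lambda>j. \<rho> j + k) i)) [0..<k])) \<chi>))"

primrec tr_tm :: "('f, 'r, 'g, 's) trans \<Rightarrow> 'f tm \<Rightarrow> (nat \<Rightarrow> nat) \<Rightarrow> nat \<Rightarrow> ('g, 's) fm" where
  "tr_tm \<tau> (Var i) = (\<lambda>\<rho> y. eq_at \<tau> (\<rho> i) y)"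
| "tr_tm \<tau> (Fn f ts) = (\<lambda>\<rho> y. tr_args \<tau> \<rho> (map (tr_tm \<tau>) ts)
    (vapp (tr_fun \<tau> (f, length ts)) ([0..<length ts] @ [y + length ts])))"

primrec tr_fm :: "('f, 'r, 'g, 's) trans \<Rightarrow> ('f, 'r) fm \<Rightarrow> ('g, 's) fm" where
  "tr_fm \<tau> (Eq s t) = tr_args \<tau> id [tr_tm \<tau> s, tr_tm \<tau> t] (tr_eq \<tau>)"
| "tr_fm \<tau> (Rel R ts) = tr_args \<tau> id (map (tr_tm \<tau>) ts) (tr_rel \<tau> (R, length ts))"
| "tr_fm \<tau> (Neg \<phi>) = Neg (tr_fm \<tau> \<phi>)"
| "tr_fm \<tau> (And \<phi> \<psi>) = And (tr_fm \<tau> \<phi>) (tr_fm \<tau> \<psi>)"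
| "tr_fm \<tau> (Or \<phi> \<psi>) = Or (tr_fm \<tau> \<phi>) (tr_fm \<tau> \<psi>)"
| "tr_fm \<tau> (Ex \<phi>) = Ex (And (tr_dom \<tau>) (tr_fm \<tau> \<phi>))"
| "tr_fm \<tau> (All \<phi>) = All (Imp (tr_dom \<tau>) (tr_fm \<tau> \<phi>))"

text \<open>The translations of the axioms of identity, together with non-emptiness of the domain and
  the totality and uniqueness conditions for function symbols.\<close>

definition congruence :: "('f, 'r, 'g, 's) trans \<Rightarrow> nat \<Rightarrow> ('g, 's) fm \<Rightarrow> ('g, 's) fm" where
  "congruence \<tau> k \<chi> = alls (2 * k)
    (Imp (conjs (map (dom_at \<tau>) [0..<2 * k] @ map (\<lambda>i. eq_at \<tau> i (k + i)) [0..<k]))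
      (Imp (vapp \<chi> [0..<k]) (vapp \<chi> [k..<2 * k])))"

definition trans_conditions :: "('f, 'r, 'g, 's) trans \<Rightarrow> ('f, 'r) lang \<Rightarrow> ('g, 's) fm set" where
  "trans_conditions \<tau> L =
    {exs 1 (dom_at \<tau> 0),
     alls 1 (Imp (dom_at \<tau> 0) (eq_at \<tau> 0 0)),
     alls 2 (Imp (conjs [dom_at \<tau> 0, dom_at \<tau> 1, eq_at \<tau> 0 1]) (eq_at \<tau> 1 0)),
     alls 3 (Imp (conjs [dom_at \<tau> 0, dom_at \<tau> 1, dom_at \<tau> 2, eq_at \<tau> 0 1, eq_at \<tau> 1 2])
       (eq_at \<tau> 0 2))}
    \<union> {congruence \<tau> k (tr_rel \<tau> (R, k)) | R k. (R, k) \<in> rels L}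
    \<union> {congruence \<tau> (Suc k) (tr_fun \<tau> (f, k)) | f k. (f, k) \<in> funs L}
    \<union> {alls k (Imp (conjs (map (dom_at \<tau>) [0..<k]))
         (Ex (And (dom_at \<tau> 0) (vapp (tr_fun \<tau> (f, k)) ([1..<Suc k] @ [0]))))) | f k.
         (f, k) \<in> funs L}
    \<union> {alls (k + 2) (Imp (conjs (map (dom_at \<tau>) [0..<k + 2] @
           [vapp (tr_fun \<tau> (f, k)) ([0..<k] @ [k]), vapp (tr_fun \<tau> (f, k)) ([0..<k] @ [k + 1])]))
         (eq_at \<tau> k (k + 1))) | f k. (f, k) \<in> funs L}"

text \<open>\<open>interprets \<tau> LV V LW W\<close>: \<open>\<tau>\<close> is a parameter-free interpretation of \<open>V\<close> in \<open>W\<close>.\<close>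

definition interprets :: "('f, 'r, 'g, 's) trans \<Rightarrow> ('f, 'r) lang \<Rightarrow> ('f, 'r) fm set \<Rightarrow>
    ('g, 's) lang \<Rightarrow> ('g, 's) fm set \<Rightarrow> bool" where
  "interprets \<tau> LV V LW W \<longleftrightarrow> wf_trans \<tau> LV LW \<and>
    (\<forall>\<phi>\<in>trans_conditions \<tau> LV. W \<turnstile> \<phi>) \<and> (\<forall>\<phi>\<in>V. W \<turnstile> tr_fm \<tau> \<phi>)"

definition direct :: "('f, 'r, 'g, 's) trans \<Rightarrow> bool" where
  "direct \<tau> \<longleftrightarrow> tr_dom \<tau> = Eq (Var 0) (Var 0) \<and> tr_eq \<tau> = Eq (Var 0) (Var 1)"

definition identity_on :: "('f, 'r) lang \<Rightarrow> ('f, 'r, 'f, 'r) trans \<Rightarrow> bool" where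
  "identity_on L \<tau> \<longleftrightarrow>
    (\<forall>(f, k)\<in>funs L. tr_fun \<tau> (f, k) = Eq (Fn f (map Var [0..<k])) (Var k)) \<and>
    (\<forall>(R, k)\<in>rels L. tr_rel \<tau> (R, k) = Rel R (map Var [0..<k]))"

subsection \<open>Sequential theories\<close>

datatype as_rel = Mem

definition lang_AS :: "(unit, as_rel) lang"
  where "lang_AS = \<lparr>funs = {}, rels = {(Mem, 2)}\<rparr>"

abbreviation mem :: "nat \<Rightarrow> nat \<Rightarrow> (unit, as_rel) fm"
  where "mem i j \<equiv> Rel Mem [Var i, Var j]"

definition AS :: "(unit, as_rel) fm set" where
  "AS = {Ex (All (Neg (mem 0 1))),
         All (All (Ex (All (Iff (mem 0 1) (Or (mem 0 3) (Eq (Var 0) (Var 2)))))))}"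

definition sequential :: "('f, 'r) lang \<Rightarrow> ('f, 'r) fm set \<Rightarrow> bool" where
  "sequential L U \<longleftrightarrow> (\<exists>\<tau>. direct \<tau> \<and> interprets \<tau> lang_AS AS L U)"

subsection \<open>Definability\<close>

definition syntactically_defines :: "('f, 'r) lang \<Rightarrow> ('f, 'r) fm set \<Rightarrow>
    ('f, 'r) lang \<Rightarrow> ('f, 'r) fm set \<Rightarrow> ('f, 'r) lang \<Rightarrow> bool" where
  "syntactically_defines LW W LV V L \<longleftrightarrow>
    (\<exists>\<tau>. direct \<tau> \<and> identity_on L \<tau> \<and> interprets \<tau> LV V LW W)"

text \<open>Quantification over all models is over those with carrier inside the type \<open>'a\<close>.\<close>

definition semantically_defines :: "'a itself \<Rightarrow> ('f, 'r) lang \<Rightarrow> ('f, 'r) fm set \<Rightarrow>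
    ('f, 'r) lang \<Rightarrow> ('f, 'r) fm set \<Rightarrow> ('f, 'r) lang \<Rightarrow> bool" where
  "semantically_defines TYPE('a) LU U LV V L \<longleftrightarrow>
    (\<forall>M :: ('f, 'r, 'a) struct. model LU U M \<longrightarrow>
      syntactically_defines (lang_diag LU M) (ElDiag LU M)
        (lang_diag LV M) (map_fm Inl id ` V) (lang_diag L M))"

section \<open>Elementarity\<close>

inductive Sigma_star :: "nat \<Rightarrow> ('f, 'r) fm \<Rightarrow> bool"
  and Pi_star :: "nat \<Rightarrow> ('f, 'r) fm \<Rightarrow> bool" where
  "Sigma_star (Suc n) (Eq s t)"
| "Sigma_star (Suc n) (Rel R ts)"
| "Sigma_star (Suc n) \<phi> \<Longrightarrow> Sigma_star (Suc n) (Ex \<phi>)"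
| "Sigma_star (Suc n) \<phi> \<Longrightarrow> Sigma_star (Suc n) \<psi> \<Longrightarrow> Sigma_star (Suc n) (And \<phi> \<psi>)"
| "Sigma_star (Suc n) \<phi> \<Longrightarrow> Sigma_star (Suc n) \<psi> \<Longrightarrow> Sigma_star (Suc n) (Or \<phi> \<psi>)"
| "Pi_star (Suc n) \<phi> \<Longrightarrow> Sigma_star (Suc n) (Neg \<phi>)"
| "Pi_star n \<phi> \<Longrightarrow> Sigma_star (Suc n) (All \<phi>)"
| "Pi_star (Suc n) (Eq s t)"
| "Pi_star (Suc n) (Rel R ts)"
| "Pi_star (Suc n) \<phi> \<Longrightarrow> Pi_star (Suc n) (All \<phi>)"
| "Pi_star (Suc n) \<phi> \<Longrightarrow> Pi_star (Suc n) \<psi> \<Longrightarrow> Pi_star (Suc n) (And \<phi> \<psi>)"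
| "Pi_star (Suc n) \<phi> \<Longrightarrow> Pi_star (Suc n) \<psi> \<Longrightarrow> Pi_star (Suc n) (Or \<phi> \<psi>)"
| "Sigma_star (Suc n) \<phi> \<Longrightarrow> Pi_star (Suc n) (Neg \<phi>)"
| "Sigma_star n \<phi> \<Longrightarrow> Pi_star (Suc n) (Ex \<phi>)"

text \<open>Since carriers live in one type, which \<open>dom M\<close> may exhaust, \<open>M \<subseteq> N\<close> is replaced by an
  injection \<open>h\<close> of \<open>dom M\<close> into \<open>dom N\<close> along which the parameters are read in \<open>N\<close>; up to an
  isomorphic copy of \<open>N\<close> this is an inclusion.\<close>

definition sigma_elementary :: "('f, 'r) lang \<Rightarrow> nat \<Rightarrow> ('a \<Rightarrow> 'b) \<Rightarrow>
    ('f, 'r, 'a) struct \<Rightarrow> ('f, 'r, 'b) struct \<Rightarrow> bool" where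
  "sigma_elementary L n h M N \<longleftrightarrow> inj_on h (dom M) \<and> h ` dom M \<subseteq> dom N \<and>
    (\<forall>\<phi> v. formula_of L \<phi> \<and> Sigma_star n \<phi> \<and> range v \<subseteq> dom M \<and> sat M v \<phi> \<longrightarrow> sat N (h \<circ> v) \<phi>)"

definition elementary :: "('f, 'r) lang \<Rightarrow> ('a \<Rightarrow> 'b) \<Rightarrow>
    ('f, 'r, 'a) struct \<Rightarrow> ('f, 'r, 'b) struct \<Rightarrow> bool" where
  "elementary L h M N \<longleftrightarrow> inj_on h (dom M) \<and> h ` dom M \<subseteq> dom N \<and>
    (\<forall>\<phi> v. formula_of L \<phi> \<and> range v \<subseteq> dom M \<longrightarrow> (sat M v \<phi> \<longleftrightarrow> sat N (h \<circ> v) \<phi>))"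

text \<open>\<open>elementary L\<close> only looks at \<open>L\<close>-formulas, so no reducts need to be formed.\<close>

definition imposes_elementarity ::
    "'a itself \<Rightarrow> ('f, 'r) lang \<Rightarrow> ('f, 'r) fm set \<Rightarrow> ('f, 'r) lang \<Rightarrow> bool" where
  "imposes_elementarity TYPE('a) L' U L \<longleftrightarrow>
    (\<forall>M :: ('f, 'r, 'a) struct. model L' U M \<longrightarrow>
      (\<exists>n. \<forall>(N :: ('f, 'r, 'a) struct) h. model L' U N \<longrightarrow>
        sigma_elementary L' n h M N \<longrightarrow> elementary L h M N))"

section \<open>Recursively enumerable theories\<close>

datatype recf = Zr | Sr | Pr nat | Comp recf "recf list" | Prec recf recf | Mn recf

inductive computes :: "recf \<Rightarrow> nat list \<Rightarrow> nat \<Rightarrow> bool" where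
  "computes Zr xs 0"
| "computes Sr (x # xs) (Suc x)"
| "i < length xs \<Longrightarrow> computes (Pr i) xs (xs ! i)"
| "list_all2 (\<lambda>g y. computes g xs y) gs ys \<Longrightarrow> computes f ys z \<Longrightarrow> computes (Comp f gs) xs z"
| "computes f xs y \<Longrightarrow> computes (Prec f g) (0 # xs) y"
| "computes (Prec f g) (n # xs) y \<Longrightarrow> computes g (n # y # xs) z \<Longrightarrow>
    computes (Prec f g) (Suc n # xs) z"
| "computes f (n # xs) 0 \<Longrightarrow> (\<And>m. m < n \<Longrightarrow> \<exists>y. computes f (m # xs) (Suc y)) \<Longrightarrow>
    computes (Mn f) xs n"

definition re_set :: "nat set \<Rightarrow> bool" where
  "re_set A \<longleftrightarrow> (\<exists>f. \<forall>n. n \<in> A \<longleftrightarrow> (\<exists>y. computes f [n] y))"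

text \<open>Formulas are written as bit strings in Polish notation, and a bit string is read as the
  binary number obtained by putting a 1 in front of it. Numbers are written with the binary digits
  (least significant first) each preceded by \<open>True\<close>, and with \<open>False\<close> at the end.\<close>

fun code_nat :: "nat \<Rightarrow> bool list" where
  "code_nat n = (if n = 0 then [False] else True # odd n # code_nat (n div 2))"

declare code_nat.simps [simp del]

primrec code_tm :: "nat tm \<Rightarrow> bool list" where
  "code_tm (Var i) = False # code_nat i"
| "code_tm (Fn f ts) = True # code_nat f @ code_nat (length ts) @ concat (map code_tm ts)"

primrec code_fm :: "(nat, nat) fm \<Rightarrow> bool list" where
  "code_fm (Eq s t) = code_nat 0 @ code_tm s @ code_tm t"
| "code_fm (Rel R ts) =
    code_nat 1 @ code_nat R @ code_nat (length ts) @ concat (map code_tm ts)"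
| "code_fm (Neg \<phi>) = code_nat 2 @ code_fm \<phi>"
| "code_fm (And \<phi> \<psi>) = code_nat 3 @ code_fm \<phi> @ code_fm \<psi>"
| "code_fm (Or \<phi> \<psi>) = code_nat 4 @ code_fm \<phi> @ code_fm \<psi>"
| "code_fm (Ex \<phi>) = code_nat 5 @ code_fm \<phi>"
| "code_fm (All \<phi>) = code_nat 6 @ code_fm \<phi>"

definition godel :: "(nat, nat) fm \<Rightarrow> nat"
  where "godel \<phi> = foldl (\<lambda>n b. 2 * n + of_bool b) 1 (code_fm \<phi>)"

definition re_theory :: "(nat, nat) fm set \<Rightarrow> bool"
  where "re_theory U \<longleftrightarrow> re_set (godel ` U)"

section \<open>Buss's arithmetic\<close>

datatype ba_fun = Zero | Succ | Plus | Times | Smash | Len | Half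

datatype ba_rel = Le

type_synonym ba_tm = "ba_fun tm"
type_synonym ba_fm = "(ba_fun, ba_rel) fm"

definition lang_S12 :: "(ba_fun, ba_rel) lang" where
  "lang_S12 = \<lparr>funs = {(Zero, 0), (Succ, 1), (Plus, 2), (Times, 2), (Smash, 2), (Len, 1), (Half, 1)},
    rels = {(Le, 2)}\<rparr>"

context
begin

private abbreviation (input) zero ("\<^bold>0") where "\<^bold>0 \<equiv> Fn Zero []"
private abbreviation (input) suc ("\<^bold>S") where "\<^bold>S s \<equiv> Fn Succ [s]"
private abbreviation (input) len ("\<^bold>\<bar>_\<^bold>\<bar>" [0] 1000) where "\<^bold>\<bar>s\<^bold>\<bar> \<equiv> Fn Len [s]"
private abbreviation (input) half ("\<^bold>\<lfloor>_'/\<^bold>2\<^bold>\<rfloor>" [0] 1000) where "\<^bold>\<lfloor>s/\<^bold>2\<^bold>\<rfloor> \<equiv> Fn Half [s]"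
private abbreviation (input) plus (infixl "\<^bold>+" 75) where "s \<^bold>+ t \<equiv> Fn Plus [s, t]"
private abbreviation (input) times (infixl "\<^bold>*" 80) where "s \<^bold>* t \<equiv> Fn Times [s, t]"
private abbreviation (input) smash (infixl "\<^bold>#" 80) where "s \<^bold># t \<equiv> Fn Smash [s, t]"
private abbreviation (input) eq (infix "\<^bold>=" 70) where "s \<^bold>= t \<equiv> Eq s t"
private abbreviation (input) neq (infix "\<^bold>\<noteq>" 70) where "s \<^bold>\<noteq> t \<equiv> Neg (Eq s t)"
private abbreviation (input) le (infix "\<^bold>\<le>" 70) where "s \<^bold>\<le> t \<equiv> Rel Le [s, t]"
private abbreviation (input) land (infixr "\<^bold>\<and>" 65) where "\<phi> \<^bold>\<and> \<psi> \<equiv> And \<phi> \<psi>"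
private abbreviation (input) lor (infixr "\<^bold>\<or>" 60) where "\<phi> \<^bold>\<or> \<psi> \<equiv> Or \<phi> \<psi>"
private abbreviation (input) limp (infixr "\<^bold>\<longrightarrow>" 55) where "\<phi> \<^bold>\<longrightarrow> \<psi> \<equiv> Imp \<phi> \<psi>"
private abbreviation (input) liff (infixr "\<^bold>\<longleftrightarrow>" 55) where "\<phi> \<^bold>\<longleftrightarrow> \<psi> \<equiv> Iff \<phi> \<psi>"
private abbreviation (input) one ("\<^bold>1") where "\<^bold>1 \<equiv> \<^bold>S \<^bold>0"
private abbreviation (input) two ("\<^bold>2") where "\<^bold>2 \<equiv> \<^bold>S (\<^bold>S \<^bold>0)"
private abbreviation (input) x :: ba_tm where "x \<equiv> Var 0"
private abbreviation (input) y :: ba_tm where "y \<equiv> Var 1"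
private abbreviation (input) z :: ba_tm where "z \<equiv> Var 2"
private abbreviation (input) u :: ba_tm where "u \<equiv> Var 3"

text \<open>The 32 axioms of \<open>BASIC\<close>, in Buss's order.\<close>

definition BASIC :: "ba_fm set" where
  "BASIC = {
    y \<^bold>\<le> x \<^bold>\<longrightarrow> y \<^bold>\<le> \<^bold>S x,
    x \<^bold>\<noteq> \<^bold>S x,
    \<^bold>0 \<^bold>\<le> x,
    x \<^bold>\<le> y \<^bold>\<and> x \<^bold>\<noteq> y \<^bold>\<longleftrightarrow> \<^bold>S x \<^bold>\<le> y,
    x \<^bold>\<noteq> \<^bold>0 \<^bold>\<longrightarrow> \<^bold>2 \<^bold>* x \<^bold>\<noteq> \<^bold>0,
    y \<^bold>\<le> x \<^bold>\<or> x \<^bold>\<le> y,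
    x \<^bold>\<le> y \<^bold>\<and> y \<^bold>\<le> x \<^bold>\<longrightarrow> x \<^bold>= y,
    x \<^bold>\<le> y \<^bold>\<and> y \<^bold>\<le> z \<^bold>\<longrightarrow> x \<^bold>\<le> z,
    \<^bold>\<bar>\<^bold>0\<^bold>\<bar> \<^bold>= \<^bold>0,
    x \<^bold>\<noteq> \<^bold>0 \<^bold>\<longrightarrow> \<^bold>\<bar>\<^bold>2 \<^bold>* x\<^bold>\<bar> \<^bold>= \<^bold>S \<^bold>\<bar>x\<^bold>\<bar> \<^bold>\<and> \<^bold>\<bar>\<^bold>S (\<^bold>2 \<^bold>* x)\<^bold>\<bar> \<^bold>= \<^bold>S \<^bold>\<bar>x\<^bold>\<bar>,
    \<^bold>\<bar>\<^bold>1\<^bold>\<bar> \<^bold>= \<^bold>1,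
    x \<^bold>\<le> y \<^bold>\<longrightarrow> \<^bold>\<bar>x\<^bold>\<bar> \<^bold>\<le> \<^bold>\<bar>y\<^bold>\<bar>,
    \<^bold>\<bar>x \<^bold># y\<^bold>\<bar> \<^bold>= \<^bold>S (\<^bold>\<bar>x\<^bold>\<bar> \<^bold>* \<^bold>\<bar>y\<^bold>\<bar>),
    \<^bold>0 \<^bold># y \<^bold>= \<^bold>1,
    x \<^bold>\<noteq> \<^bold>0 \<^bold>\<longrightarrow> \<^bold>1 \<^bold># (\<^bold>2 \<^bold>* x) \<^bold>= \<^bold>2 \<^bold>* (\<^bold>1 \<^bold># x) \<^bold>\<and> \<^bold>1 \<^bold># \<^bold>S (\<^bold>2 \<^bold>* x) \<^bold>= \<^bold>2 \<^bold>* (\<^bold>1 \<^bold># x),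
    x \<^bold># y \<^bold>= y \<^bold># x,
    \<^bold>\<bar>x\<^bold>\<bar> \<^bold>= \<^bold>\<bar>y\<^bold>\<bar> \<^bold>\<longrightarrow> x \<^bold># z \<^bold>= y \<^bold># z,
    \<^bold>\<bar>x\<^bold>\<bar> \<^bold>= \<^bold>\<bar>u\<^bold>\<bar> \<^bold>+ \<^bold>\<bar>z\<^bold>\<bar> \<^bold>\<longrightarrow> x \<^bold># y \<^bold>= (u \<^bold># y) \<^bold>* (z \<^bold># y),
    x \<^bold>\<le> x \<^bold>+ y,
    x \<^bold>\<le> y \<^bold>\<and> x \<^bold>\<noteq> y \<^bold>\<longrightarrow> \<^bold>S (\<^bold>2 \<^bold>* x) \<^bold>\<le> \<^bold>2 \<^bold>* y \<^bold>\<and> \<^bold>S (\<^bold>2 \<^bold>* x) \<^bold>\<noteq> \<^bold>2 \<^bold>* y,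
    x \<^bold>+ y \<^bold>= y \<^bold>+ x,
    x \<^bold>+ \<^bold>0 \<^bold>= x,
    x \<^bold>+ \<^bold>S y \<^bold>= \<^bold>S (x \<^bold>+ y),
    (x \<^bold>+ y) \<^bold>+ z \<^bold>= x \<^bold>+ (y \<^bold>+ z),
    x \<^bold>+ y \<^bold>\<le> x \<^bold>+ z \<^bold>\<longleftrightarrow> y \<^bold>\<le> z,
    x \<^bold>* \<^bold>0 \<^bold>= \<^bold>0,
    x \<^bold>* \<^bold>S y \<^bold>= (x \<^bold>* y) \<^bold>+ x,
    x \<^bold>* y \<^bold>= y \<^bold>* x,
    x \<^bold>* (y \<^bold>+ z) \<^bold>= (x \<^bold>* y) \<^bold>+ (x \<^bold>* z),
    \<^bold>1 \<^bold>\<le> x \<^bold>\<longrightarrow> (x \<^bold>* y \<^bold>\<le> x \<^bold>* z \<^bold>\<longleftrightarrow> y \<^bold>\<le> z),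
    x \<^bold>\<noteq> \<^bold>0 \<^bold>\<longrightarrow> \<^bold>\<bar>x\<^bold>\<bar> \<^bold>= \<^bold>S \<^bold>\<bar>\<^bold>\<lfloor>x/\<^bold>2\<^bold>\<rfloor>\<^bold>\<bar>,
    x \<^bold>= \<^bold>\<lfloor>y/\<^bold>2\<^bold>\<rfloor> \<^bold>\<longleftrightarrow> \<^bold>2 \<^bold>* x \<^bold>= y \<^bold>\<or> \<^bold>S (\<^bold>2 \<^bold>* x) \<^bold>= y}"

text \<open>Lifting the bound keeps the quantified variable out of it.\<close>

definition bEx :: "ba_tm \<Rightarrow> ba_fm \<Rightarrow> ba_fm" where "bEx t \<phi> = Ex (x \<^bold>\<le> lift_tm t \<^bold>\<and> \<phi>)"

definition bAll :: "ba_tm \<Rightarrow> ba_fm \<Rightarrow> ba_fm" where "bAll t \<phi> = All (x \<^bold>\<le> lift_tm t \<^bold>\<longrightarrow> \<phi>)"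

inductive Delta_b0 :: "ba_fm \<Rightarrow> bool" where
  "Delta_b0 (Eq s t)"
| "Delta_b0 (Rel R ts)"
| "Delta_b0 \<phi> \<Longrightarrow> Delta_b0 (Neg \<phi>)"
| "Delta_b0 \<phi> \<Longrightarrow> Delta_b0 \<psi> \<Longrightarrow> Delta_b0 (And \<phi> \<psi>)"
| "Delta_b0 \<phi> \<Longrightarrow> Delta_b0 \<psi> \<Longrightarrow> Delta_b0 (Or \<phi> \<psi>)"
| "Delta_b0 \<phi> \<Longrightarrow> Delta_b0 (bEx \<^bold>\<bar>t\<^bold>\<bar> \<phi>)"
| "Delta_b0 \<phi> \<Longrightarrow> Delta_b0 (bAll \<^bold>\<bar>t\<^bold>\<bar> \<phi>)"

inductive Sigma_b1 :: "ba_fm \<Rightarrow> bool" and Pi_b1 :: "ba_fm \<Rightarrow> bool" where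
  "Delta_b0 \<phi> \<Longrightarrow> Sigma_b1 \<phi>"
| "Sigma_b1 \<phi> \<Longrightarrow> Sigma_b1 \<psi> \<Longrightarrow> Sigma_b1 (And \<phi> \<psi>)"
| "Sigma_b1 \<phi> \<Longrightarrow> Sigma_b1 \<psi> \<Longrightarrow> Sigma_b1 (Or \<phi> \<psi>)"
| "Pi_b1 \<phi> \<Longrightarrow> Sigma_b1 (Neg \<phi>)"
| "Sigma_b1 \<phi> \<Longrightarrow> Sigma_b1 (bEx t \<phi>)"
| "Sigma_b1 \<phi> \<Longrightarrow> Sigma_b1 (bAll \<^bold>\<bar>t\<^bold>\<bar> \<phi>)"
| "Delta_b0 \<phi> \<Longrightarrow> Pi_b1 \<phi>"
| "Pi_b1 \<phi> \<Longrightarrow> Pi_b1 \<psi> \<Longrightarrow> Pi_b1 (And \<phi> \<psi>)"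
| "Pi_b1 \<phi> \<Longrightarrow> Pi_b1 \<psi> \<Longrightarrow> Pi_b1 (Or \<phi> \<psi>)"
| "Sigma_b1 \<phi> \<Longrightarrow> Pi_b1 (Neg \<phi>)"
| "Pi_b1 \<phi> \<Longrightarrow> Pi_b1 (bAll t \<phi>)"
| "Pi_b1 \<phi> \<Longrightarrow> Pi_b1 (bEx \<^bold>\<bar>t\<^bold>\<bar> \<phi>)"

text \<open>\<open>\<phi>(0) \<and> \<forall>x (\<phi>(\<lfloor>x/2\<rfloor>) \<longrightarrow> \<phi>(x)) \<longrightarrow> \<forall>x \<phi>(x)\<close>, where \<open>x\<close> is variable 0 of \<open>\<phi>\<close>.\<close>

definition PIND :: "ba_fm \<Rightarrow> ba_fm" where
  "PIND \<phi> = (inst \<^bold>0 \<phi> \<^bold>\<and> All (subst (case_nat \<^bold>\<lfloor>x/\<^bold>2\<^bold>\<rfloor> (\<lambda>i. Var (Suc i))) \<phi> \<^bold>\<longrightarrow> \<phi>) \<^bold>\<longrightarrow> All \<phi>)"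

definition S12 :: "ba_fm set" where
  "S12 = alls 4 ` BASIC \<union> {alls k (PIND \<phi>) | k \<phi>. Sigma_b1 \<phi> \<and> wf_fm lang_S12 (Suc k) \<phi>}"

fun numeral_tm :: "nat \<Rightarrow> ba_tm" where
  "numeral_tm n = (if n = 0 then \<^bold>0
    else if even n then \<^bold>2 \<^bold>* numeral_tm (n div 2) else \<^bold>S (numeral_tm (n - 1)))"

end

declare numeral_tm.simps [simp del]

section \<open>Uniform satisfaction\<close>

text \<open>The formula \<open>n(x)\<close>, \<open>x\<close> being variable 0. The translation of an open formula constrains its
  free variables only through identity, so membership of \<open>x\<close> in the domain is added.\<close>

definition numeral_fm :: "(ba_fun, ba_rel, 'f, 'r) trans \<Rightarrow> nat \<Rightarrow> ('f, 'r) fm" where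
  "numeral_fm N n = And (tr_dom N) (tr_fm N (Eq (Var 0) (numeral_tm n)))"

definition USB :: "(nat, nat) fm set \<Rightarrow> (ba_fun, ba_rel, nat, nat) trans \<Rightarrow> nat \<Rightarrow>
    (nat, nat) lang \<Rightarrow> (nat, nat) fm set" where
  "USB U N Sat L = U \<union>
    {All (Iff (Ex (And (numeral_fm N (godel \<phi>)) (Rel Sat [Var 0, Var 1]))) \<phi>) | \<phi>. wf_fm L 1 \<phi>}"

end

theory Submission
  imports Defs "HOL-Library.Nat_Bijection"
begin

text \<open>
  Let \<open>M\<close> be a model of \<open>U\<close>, and let \<open>n\<close> be given by the hypothesis. If an \<open>L\<close>-formula \<open>\<phi>(a)\<close> is true in
  \<open>M\<close>, then \<open>U\<close> with the \<open>\<Sigma>\<^sup>*\<^sub>n\<close> diagram of \<open>M\<close> and \<open>\<not> \<phi>(a)\<close> has no model, since a model would be a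
  \<open>\<Sigma>\<^sup>*\<^sub>n\<close>-elementary extension of \<open>M\<close>. By compactness some \<open>\<Sigma>\<^sup>*\<^sub>n\<close> formula \<open>\<sigma>\<close> has \<open>M \<Turnstile> \<sigma>(a)\<close> and
  \<open>U \<turnstile> \<sigma>(x) \<longrightarrow> \<phi>(x)\<close>. Sequentiality gives a definable satisfaction predicate for \<open>\<Sigma>\<^sup>*\<^sub>n\<close> formulas on
  standard codes, and provability from \<open>U\<close> is recursively enumerable, hence definable on standard numbers.
  So satisfaction for \<open>L\<close> could be defined as: some \<open>\<sigma>\<close> that is true of \<open>a\<close> implies \<open>\<phi>\<close>. As proofs and
  codes may be nonstandard, one asks, following Rosser, for a witness for \<open>\<phi>\<close> below which there is none for
  \<open>\<not> \<phi>\<close>; exactly one of \<open>\<phi>(a)\<close>, \<open>\<not> \<phi>(a)\<close> has a standard witness, and that one wins.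

  Only fragments of arithmetic and set theory are available in \<open>M\<close>. Relations on standard numbers are defined
  by finite certificates coded with the help of sequentiality, and provability is expressed as the
  propositional unsatisfiability of a finite set of Henkin clauses.
\<close>

section \<open>First-order logic\<close>

text \<open>The standard numbers need not be definable in \<open>M\<close>, so the arithmetical
  definitions are required to be correct on standard arguments only. What makes this workable is
  that the standard numbers form an initial segment of the interpreted arithmetic: a quantifier
  bounded by a standard number ranges over standard values only, so bounded definitions are
  absolute. Unbounded searches are therefore cut off at a stage \<open>w\<close>, and
  \<open>w\<close> itself is quantified only in the Rosser comparison. The Henkin clauses serve
  twice. With numbers as constants they are arithmetised and give the consequence relation of
  \<open>U\<close>; with elements of the carrier type as constants they give the compactness
  argument, whose model must live in the very type over which \<open>imposes_elementarity\<close>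
  quantifies. There is room for it because Russell's paradox excludes a finite carrier, and an
  infinite type contains a free term algebra over itself. The first use only needs models built from
  numbers, hence \<open>uniform_sigma\<close> concludes about structures on
  \<open>nat\<close>.\<close>

lemma eval_tm_subst: "eval_tm M v (subst_tm \<sigma> t) = eval_tm M (\<lambda>i. eval_tm M v (\<sigma> i)) t"
proof (induct t)
  case (Fn f ts)
  then have "map (eval_tm M v \<circ> subst_tm \<sigma>) ts = map (eval_tm M (\<lambda>i. eval_tm M v (\<sigma> i))) ts"
    by simp
  then show ?case by (simp only: subst_tm.simps eval_tm.simps map_map)
qed simp

lemma eval_tm_subst_map: "map (\<lambda>t. eval_tm M v (subst_tm \<sigma> t)) ts = map (eval_tm M (\<lambda>i. eval_tm M v (\<sigma> i))) ts"
  by (simp add: eval_tm_subst)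

lemma eval_up: "(\<lambda>i. eval_tm M (case_nat a v) (up \<sigma> i)) = case_nat a (\<lambda>i. eval_tm M v (\<sigma> i))"
  by (rule ext) (simp add: up_def eval_tm_subst split: nat.split)

lemma sat_subst: "sat M v (subst \<sigma> \<phi>) = sat M (\<lambda>i. eval_tm M v (\<sigma> i)) \<phi>"
  by (induct \<phi> arbitrary: v \<sigma>) (simp_all add: eval_tm_subst eval_tm_subst_map comp_def eval_up)

lemma sat_lift: "sat M (case_nat a v) (lift \<phi>) = sat M v \<phi>"
  by (simp add: sat_subst)

lemma sat_inst: "sat M v (inst t \<phi>) = sat M (case_nat (eval_tm M v t) v) \<phi>"
proof -
  have "(\<lambda>i. eval_tm M v (case_nat t Var i)) = case_nat (eval_tm M v t) v"
    by (rule ext) (simp split: nat.split)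
  then show ?thesis by (simp add: inst_def sat_subst)
qed

lemma range_case_nat: "range (case_nat a v) \<subseteq> D \<longleftrightarrow> a \<in> D \<and> range v \<subseteq> D"
proof -
  have "(\<forall>i. case_nat a v i \<in> D) \<longleftrightarrow> a \<in> D \<and> (\<forall>i. v i \<in> D)"
    by (metis nat.case(1) nat.case(2) not0_implies_Suc)
  then show ?thesis by (simp add: image_subset_iff)
qed

text \<open>\<open>proves\<close> instantiates quantifiers with any term, also one with symbols
  foreign to the language, while \<open>structure_for\<close> controls only the symbols of the
  language at their arity. Soundness is therefore stated for structures closed under all
  symbols.\<close>

definition total :: "('f, 'r, 'a) struct \<Rightarrow> bool" where
  "total M \<longleftrightarrow> dom M \<noteq> {} \<and> (\<forall>f xs. set xs \<subseteq> dom M \<longrightarrow> fun_of M f xs \<in> dom M)"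

lemma total_eval: "total M \<Longrightarrow> range v \<subseteq> dom M \<Longrightarrow> eval_tm M v t \<in> dom M"
  by (induct t) (auto simp: total_def image_subset_iff)

lemma proves_sound:
  "\<Gamma> \<turnstile> \<phi> \<Longrightarrow> total M \<Longrightarrow> range v \<subseteq> dom M \<Longrightarrow> \<forall>\<gamma>\<in>\<Gamma>. sat M v \<gamma> \<Longrightarrow> sat M v \<phi>"
proof (induct arbitrary: v rule: proves.induct)
  case (NegI \<phi> \<Gamma> \<psi>)
  then show ?case by (metis insert_iff sat.simps(3))
next
  case (Contr \<phi> \<Gamma> \<psi>)
  then show ?case by (metis insert_iff sat.simps(3))
next
  case (OrE \<Gamma> \<phi> \<psi> \<chi>)
  then show ?case by (metis insert_iff sat.simps(5))
next
  case (AllI \<Gamma> \<phi>)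
  then show ?case by (auto simp: range_case_nat sat_lift)
next
  case (AllE \<Gamma> \<phi> t)
  then show ?case by (simp add: sat_inst total_eval)
next
  case (ExI \<Gamma> t \<phi>)
  have "sat M (case_nat (eval_tm M v t) v) \<phi>" using ExI by (simp add: sat_inst)
  then show ?case using total_eval[OF ExI(3,4)] by auto
next
  case (ExE \<Gamma> \<phi> \<psi>)
  from ExE(2)[OF ExE(5,6,7)] obtain a where a: "a \<in> dom M" "sat M (case_nat a v) \<phi>" by auto
  have "sat M (case_nat a v) (lift \<psi>)"
    using ExE(4)[of "case_nat a v"] ExE(5-7) a by (auto simp: range_case_nat sat_lift)
  then show ?case by (simp add: sat_lift)
next
  case (EqE \<Gamma> s t \<phi>)
  then show ?case by (simp add: sat_inst)
qed auto

text \<open>Repairs a structure outside its language: a stray value is replaced by a fixed element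
  of the domain. Formulas of the language do not notice (\<open>sat_tot\<close>), which reduces
  soundness for \<open>structure_for\<close> to soundness for \<open>total\<close>.\<close>

definition tot :: "('f, 'r, 'a) struct \<Rightarrow> ('f, 'r, 'a) struct" where
  "tot M = M\<lparr>fun_of := \<lambda>f xs. if fun_of M f xs \<in> dom M then fun_of M f xs else SOME x. x \<in> dom M\<rparr>"

lemma tot_simps [simp]: "dom (tot M) = dom M" "rel_of (tot M) = rel_of M"
  by (simp_all add: tot_def)

lemma fun_of_tot:
  "fun_of (tot M) f xs = (if fun_of M f xs \<in> dom M then fun_of M f xs else SOME x. x \<in> dom M)"
  by (simp add: tot_def)

lemma total_tot: "dom M \<noteq> {} \<Longrightarrow> total (tot M)"
  by (auto simp: total_def fun_of_tot some_in_eq)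

lemma eval_in_dom:
  "structure_for L M \<Longrightarrow> wf_tm L k t \<Longrightarrow> \<forall>i<k. v i \<in> dom M \<Longrightarrow> eval_tm M v t \<in> dom M"
proof (induct t)
  case (Fn f ts)
  then have "set (map (eval_tm M v) ts) \<subseteq> dom M" by (auto simp: list_all_iff)
  then show ?case using Fn by (fastforce simp: structure_for_def)
qed simp

lemma eval_tot:
  "structure_for L M \<Longrightarrow> wf_tm L k t \<Longrightarrow> \<forall>i<k. v i \<in> dom M \<Longrightarrow> eval_tm (tot M) v t = eval_tm M v t"
proof (induct t)
  case (Fn f ts)
  then have "map (eval_tm (tot M) v) ts = map (eval_tm M v) ts" by (simp add: list_all_iff)
  then show ?case using eval_in_dom[OF Fn(2,3,4)] by (simp add: fun_of_tot del: map_eq_conv)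
qed simp

lemma sat_tot:
  "structure_for L M \<Longrightarrow> wf_fm L k \<phi> \<Longrightarrow> \<forall>i<k. v i \<in> dom M \<Longrightarrow> sat (tot M) v \<phi> = sat M v \<phi>"
proof (induct \<phi> arbitrary: k v)
  case (Rel R ts)
  then have "map (eval_tm (tot M) v) ts = map (eval_tm M v) ts"
    by (auto simp: list_all_iff intro: eval_tot)
  then show ?case by (simp del: map_eq_conv)
next
  case (Ex \<phi>)
  then have "sat (tot M) (case_nat a v) \<phi> = sat M (case_nat a v) \<phi>" if "a \<in> dom M" for a
    using that by (intro Ex(1)) (auto split: nat.split)
  then show ?case by simp
next
  case (All \<phi>)
  then have "sat (tot M) (case_nat a v) \<phi> = sat M (case_nat a v) \<phi>" if "a \<in> dom M" for a
    using that by (intro All(1)) (auto split: nat.split)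
  then show ?case by simp
qed (auto simp: eval_tot)

section \<open>Well-formedness and dependence on the free variables\<close>

lemma wf_tm_mono: "wf_tm L k t \<Longrightarrow> k \<le> m \<Longrightarrow> wf_tm L m t"
  by (induct t) (auto simp: list_all_iff)

lemma wf_fm_mono: "wf_fm L k \<phi> \<Longrightarrow> k \<le> m \<Longrightarrow> wf_fm L m \<phi>"
proof (induct \<phi> arbitrary: k m)
  case (Ex \<phi>)
  then show ?case by (metis wf_fm.simps(6) Suc_le_mono)
next
  case (All \<phi>)
  then show ?case by (metis wf_fm.simps(7) Suc_le_mono)
qed (auto simp: list_all_iff intro: wf_tm_mono)

lemma eval_cong: "wf_tm L k t \<Longrightarrow> \<forall>i<k. v i = w i \<Longrightarrow> eval_tm M v t = eval_tm M w t"
proof (induct t)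
  case (Fn f ts)
  then have "map (eval_tm M v) ts = map (eval_tm M w) ts" by (simp add: list_all_iff)
  then show ?case by (simp del: map_eq_conv)
qed simp

lemma sat_cong: "wf_fm L k \<phi> \<Longrightarrow> \<forall>i<k. v i = w i \<Longrightarrow> sat M v \<phi> = sat M w \<phi>"
proof (induct \<phi> arbitrary: k v w)
  case (Eq s t)
  then show ?case using eval_cong[of L k s v w M] eval_cong[of L k t v w M] by simp
next
  case (Rel R ts)
  then have "map (eval_tm M v) ts = map (eval_tm M w) ts"
    by (auto simp: list_all_iff intro: eval_cong)
  then show ?case by (simp del: map_eq_conv)
next
  case (Ex \<phi>)
  then have "sat M (case_nat a v) \<phi> = sat M (case_nat a w) \<phi>" for a
    by (intro Ex(1)) (auto split: nat.split)
  then show ?case by simp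
next
  case (All \<phi>)
  then have "sat M (case_nat a v) \<phi> = sat M (case_nat a w) \<phi>" for a
    by (intro All(1)) (auto split: nat.split)
  then show ?case by simp
next
  case (And \<phi> \<psi>)
  then show ?case by (metis sat.simps(4) wf_fm.simps(4))
next
  case (Or \<phi> \<psi>)
  then show ?case by (metis sat.simps(5) wf_fm.simps(5))
qed auto

lemma wf_tm_subst: "wf_tm L k t \<Longrightarrow> \<forall>i<k. wf_tm L m (\<sigma> i) \<Longrightarrow> wf_tm L m (subst_tm \<sigma> t)"
  by (induct t) (auto simp: list_all_iff)

lemma wf_fm_subst: "wf_fm L k \<phi> \<Longrightarrow> \<forall>i<k. wf_tm L m (\<sigma> i) \<Longrightarrow> wf_fm L m (subst \<sigma> \<phi>)"
proof (induct \<phi> arbitrary: k m \<sigma>)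
  case (Ex \<phi>)
  have "\<forall>i<Suc k. wf_tm L (Suc m) (up \<sigma> i)"
    using Ex by (auto simp: up_def split: nat.split intro: wf_tm_subst)
  then show ?case using Ex by auto
next
  case (All \<phi>)
  have "\<forall>i<Suc k. wf_tm L (Suc m) (up \<sigma> i)"
    using All by (auto simp: up_def split: nat.split intro: wf_tm_subst)
  then show ?case using All by auto
qed (auto simp: list_all_iff intro: wf_tm_subst)

lemma model_proves:
  assumes "model L U M" "theory_in L U" "U \<turnstile> \<phi>" "wf_fm L 0 \<phi>" "range v \<subseteq> dom M"
  shows "sat M v \<phi>"
proof -
  have st: "structure_for L M" using assms(1) by (simp add: model_def)
  have "\<forall>\<gamma>\<in>U. sat (tot M) v \<gamma>"
    using assms(1,2,5) sat_tot[OF st] by (auto simp: model_def theory_in_def)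
  then have "sat (tot M) v \<phi>"
    using proves_sound[OF assms(3) total_tot, of M v] assms(5) st by (simp add: structure_for_def)
  then show ?thesis using sat_tot[OF st assms(4)] by simp
qed

section \<open>The language with constants for the elements\<close>

lemma struct_diag_simps [simp]:
  "dom (struct_diag M) = dom M" "rel_of (struct_diag M) = rel_of M"
  "fun_of (struct_diag M) (Inl f) = fun_of M f" "fun_of (struct_diag M) (Inr a) xs = a"
  by (simp_all add: struct_diag_def)

lemma eval_map_tm: "eval_tm (struct_diag M) v (map_tm Inl t) = eval_tm M v t"
proof (induct t)
  case (Fn f ts)
  then have "map (eval_tm (struct_diag M) v \<circ> map_tm Inl) ts = map (eval_tm M v) ts" by simp
  then show ?case by (simp del: map_eq_conv)
qed simp

lemma sat_map_fm: "sat (struct_diag M) v (map_fm Inl id \<phi>) = sat M v \<phi>"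
proof (induct \<phi> arbitrary: v)
  case (Rel R ts)
  have "map (eval_tm (struct_diag M) v \<circ> map_tm Inl) ts = map (eval_tm M v) ts"
    by (simp add: eval_map_tm)
  then show ?case by (simp del: map_eq_conv)
qed (simp_all add: eval_map_tm)

lemma lang_diag_simps [simp]:
  "(Inl f, k) \<in> funs (lang_diag L M) \<longleftrightarrow> (f, k) \<in> funs L"
  "(Inr a, k) \<in> funs (lang_diag L M) \<longleftrightarrow> a \<in> dom M \<and> k = 0"
  "rels (lang_diag L M) = rels L"
  by (auto simp: lang_diag_def image_iff map_prod_def split: prod.split)

lemma wf_map_tm: "wf_tm (lang_diag L M) k (map_tm Inl t) \<longleftrightarrow> wf_tm L k t"
proof (induct t)
  case (Fn f ts)
  then show ?case by (auto simp: list_all_iff)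
qed simp

lemma wf_map_fm: "wf_fm (lang_diag L M) k (map_fm Inl id \<phi>) \<longleftrightarrow> wf_fm L k \<phi>"
  by (induct \<phi> arbitrary: k) (simp_all add: list_all_iff wf_map_tm)

lemma structure_diag: "structure_for L M \<Longrightarrow> structure_for (lang_diag L M) (struct_diag M)"
  by (fastforce simp: structure_for_def lang_diag_def struct_diag_def)

section \<open>Semantics of translations\<close>

text \<open>The effect of a block of de Bruijn quantifiers on an assignment: the values are put in
  front and the old variables are shifted up.\<close>

definition ext :: "'a list \<Rightarrow> (nat \<Rightarrow> 'a) \<Rightarrow> nat \<Rightarrow> 'a" where
  "ext xs v i = (if i < length xs then xs ! i else v (i - length xs))"

lemma ext_Nil [simp]: "ext [] v = v"
  by (rule HOL.ext) (simp add: ext_def)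

text \<open>The outermost quantifier of a block is evaluated first but ends up with the highest
  index, so a peeled quantifier contributes the last entry of the list.\<close>

lemma ext_snoc: "ext xs (case_nat a v) = ext (xs @ [a]) v"
proof (rule HOL.ext)
  fix i
  show "ext xs (case_nat a v) i = ext (xs @ [a]) v i"
  proof (cases "i \<le> length xs")
    case False
    then obtain d where "i = Suc (length xs + d)" by (metis less_imp_Suc_add not_le)
    then show ?thesis by (simp add: ext_def)
  qed (auto simp: ext_def nth_append)
qed

lemma ext_nth: "i < length xs \<Longrightarrow> ext xs v i = xs ! i"
  by (simp add: ext_def)

lemma ext_add: "ext xs v (i + length xs) = v i"
  by (simp add: ext_def)

lemma sat_exs: "sat M v (exs k \<phi>) \<longleftrightarrow> (\<exists>xs. length xs = k \<and> set xs \<subseteq> dom M \<and> sat M (ext xs v) \<phi>)"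
proof (induct k arbitrary: v)
  case 0
  then show ?case by (simp add: exs_def)
next
  case (Suc k)
  have "sat M v (exs (Suc k) \<phi>) \<longleftrightarrow> (\<exists>a\<in>dom M. sat M (case_nat a v) (exs k \<phi>))"
    by (simp add: exs_def)
  also have "\<dots> \<longleftrightarrow> (\<exists>a\<in>dom M. \<exists>xs. length xs = k \<and> set xs \<subseteq> dom M \<and> sat M (ext (xs @ [a]) v) \<phi>)"
    by (simp add: Suc ext_snoc)
  also have "\<dots> \<longleftrightarrow> (\<exists>xs. length xs = Suc k \<and> set xs \<subseteq> dom M \<and> sat M (ext xs v) \<phi>)"
    by (simp add: length_Suc_conv_rev) fastforce
  finally show ?case .
qed

lemma sat_alls: "sat M v (alls k \<phi>) \<longleftrightarrow> (\<forall>xs. length xs = k \<longrightarrow> set xs \<subseteq> dom M \<longrightarrow> sat M (ext xs v) \<phi>)"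
proof (induct k arbitrary: v)
  case 0
  then show ?case by (simp add: alls_def)
next
  case (Suc k)
  have "sat M v (alls (Suc k) \<phi>) \<longleftrightarrow> (\<forall>a\<in>dom M. sat M (case_nat a v) (alls k \<phi>))"
    by (simp add: alls_def)
  also have "\<dots> \<longleftrightarrow> (\<forall>a\<in>dom M. \<forall>xs. length xs = k \<longrightarrow> set xs \<subseteq> dom M \<longrightarrow> sat M (ext (xs @ [a]) v) \<phi>)"
    by (simp add: Suc ext_snoc)
  also have "\<dots> \<longleftrightarrow> (\<forall>xs. length xs = Suc k \<longrightarrow> set xs \<subseteq> dom M \<longrightarrow> sat M (ext xs v) \<phi>)"
    by (simp add: length_Suc_conv_rev) fastforce
  finally show ?case .
qed

lemma nth_in: "set xs \<subseteq> A \<Longrightarrow> i < length xs \<Longrightarrow> xs ! i \<in> A"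
  by (meson nth_mem subsetD)

lemma sat_allsD:
  "sat M v (alls k \<phi>) \<Longrightarrow> length xs = k \<Longrightarrow> set xs \<subseteq> dom M \<Longrightarrow> sat M (ext xs v) \<phi>"
  by (simp add: sat_alls)

lemma sat_conjs: "sat M v (conjs \<phi>s) \<longleftrightarrow> (\<forall>\<phi>\<in>set \<phi>s. sat M v \<phi>)"
  by (induct \<phi>s) (auto simp: conjs_def)

text \<open>Indices beyond the list give unspecified values of \<open>!\<close>; this form is meant
  for formulas whose free variables are covered by the list.\<close>

definition satl :: "('f, 'r, 'a) struct \<Rightarrow> ('f, 'r) fm \<Rightarrow> 'a list \<Rightarrow> bool" where
  "satl M \<phi> xs = sat M (\<lambda>i. xs ! i) \<phi>"

lemma satlI: "wf_fm L (length xs) \<phi> \<Longrightarrow> \<forall>i<length xs. v i = xs ! i \<Longrightarrow> sat M v \<phi> = satl M \<phi> xs"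
  unfolding satl_def by (erule sat_cong) simp

lemma sat_vapp:
  "wf_fm L (length is) \<phi> \<Longrightarrow> sat M v (vapp \<phi> is) = satl M \<phi> (map v is)"
proof -
  assume wf: "wf_fm L (length is) \<phi>"
  have "sat M v (vapp \<phi> is) = sat M (\<lambda>j. v (if j < length is then is ! j else j)) \<phi>"
    by (simp add: vapp_def sat_subst)
  also have "\<dots> = satl M \<phi> (map v is)" using wf by (intro satlI[of L]) simp_all
  finally show ?thesis .
qed

section \<open>Well-formedness of translated formulas\<close>

lemma wf_exs: "wf_fm L k (exs n \<phi>) \<longleftrightarrow> wf_fm L (n + k) \<phi>"
  by (induct n arbitrary: k) (simp_all add: exs_def)

lemma wf_alls: "wf_fm L k (alls n \<phi>) \<longleftrightarrow> wf_fm L (n + k) \<phi>"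
  by (induct n arbitrary: k) (simp_all add: alls_def)

lemma wf_conjs: "wf_fm L k (conjs \<phi>s) \<longleftrightarrow> (\<forall>\<phi>\<in>set \<phi>s. wf_fm L k \<phi>)"
  by (induct \<phi>s) (auto simp: conjs_def)

lemma wf_vapp: "wf_fm L n \<phi> \<Longrightarrow> n = length is \<Longrightarrow> \<forall>i\<in>set is. i < k \<Longrightarrow> wf_fm L k (vapp \<phi> is)"
  unfolding vapp_def by (erule wf_fm_subst) simp

lemma wf_tr_args:
  assumes "wf_fm LW 1 (tr_dom \<tau>)" "wf_fm LW (length gs + m) \<chi>"
    and "\<forall>i<length gs. wf_fm LW (length gs + m) ((gs ! i) (\<lambda>j. \<rho> j + length gs) i)"
  shows "wf_fm LW m (tr_args \<tau> \<rho> gs \<chi>)"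
  using assms by (auto simp: tr_args_def Let_def wf_exs wf_conjs intro!: wf_vapp)

lemma wf_tr_tm:
  "wf_trans \<tau> LV LW \<Longrightarrow> wf_tm LV k t \<Longrightarrow> \<forall>i<k. \<rho> i < m \<Longrightarrow> y < m \<Longrightarrow> wf_fm LW m (tr_tm \<tau> t \<rho> y)"
proof (induct t arbitrary: \<rho> m y)
  case (Var i)
  then show ?case by (auto simp: wf_trans_def intro!: wf_vapp)
next
  case (Fn f ts)
  have "wf_fm LW (Suc (length ts)) (tr_fun \<tau> (f, length ts))"
    using Fn.prems by (auto simp: wf_trans_def)
  then have "wf_fm LW (length ts + m)
      (vapp (tr_fun \<tau> (f, length ts)) ([0..<length ts] @ [y + length ts]))"
    using Fn.prems by (intro wf_vapp) auto
  moreover have "wf_fm LW (length ts + m) (tr_tm \<tau> (ts ! i) (\<lambda>j. \<rho> j + length ts) i)"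
    if "i < length ts" for i
    using that Fn.prems by (intro Fn.hyps) (auto simp: list_all_length)
  ultimately show ?case using Fn.prems
    by (auto simp: wf_trans_def intro!: wf_tr_args)
qed

lemma wf_tr_fm: "wf_trans \<tau> LV LW \<Longrightarrow> wf_fm LV k \<phi> \<Longrightarrow> wf_fm LW k (tr_fm \<tau> \<phi>)"
proof (induct \<phi> arbitrary: k)
  case (Eq s t)
  have "wf_fm LW (2 + k) (tr_tm \<tau> s (\<lambda>j. j + 2) 0)" "wf_fm LW (2 + k) (tr_tm \<tau> t (\<lambda>j. j + 2) 1)"
    using Eq by (intro wf_tr_tm[of _ LV _ k]; simp)+
  then have "\<forall>i<length (map (tr_tm \<tau>) [s, t]). wf_fm LW (length (map (tr_tm \<tau>) [s, t]) + k)
      ((map (tr_tm \<tau>) [s, t] ! i) (\<lambda>j. id j + length (map (tr_tm \<tau>) [s, t])) i)"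
    by (simp add: All_less_Suc)
  then have "wf_fm LW k (tr_args \<tau> id (map (tr_tm \<tau>) [s, t]) (tr_eq \<tau>))"
    using Eq by (intro wf_tr_args) (auto simp: wf_trans_def intro: wf_fm_mono)
  then show ?case by simp
next
  case (Rel R ts)
  have "wf_fm LW (length ts + k) (tr_tm \<tau> (ts ! i) (\<lambda>j. j + length ts) i)" if "i < length ts" for i
    using that Rel by (intro wf_tr_tm[of _ LV _ k]) (auto simp: list_all_length)
  moreover have "wf_fm LW (length ts) (tr_rel \<tau> (R, length ts))"
    using Rel by (auto simp: wf_trans_def)
  ultimately have "wf_fm LW k (tr_args \<tau> id (map (tr_tm \<tau>) ts) (tr_rel \<tau> (R, length ts)))"
    using Rel by (intro wf_tr_args) (auto simp: wf_trans_def intro: wf_fm_mono)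
  then show ?case by simp
next
  case (Ex \<phi>)
  then show ?case by (auto simp: wf_trans_def intro: wf_fm_mono)
next
  case (All \<phi>)
  then show ?case by (auto simp: wf_trans_def intro: wf_fm_mono)
qed simp_all

lemma wf_congruence:
  "wf_trans \<tau> LV LW \<Longrightarrow> wf_fm LW k \<chi> \<Longrightarrow> wf_fm LW 0 (congruence \<tau> k \<chi>)"
  by (auto simp: congruence_def wf_alls wf_conjs wf_trans_def intro!: wf_vapp)

lemma wf_trans_conditions:
  assumes "wf_trans \<tau> LV LW" "\<phi> \<in> trans_conditions \<tau> LV"
  shows "wf_fm LW 0 \<phi>"
proof -
  have d: "wf_fm LW 1 (tr_dom \<tau>)" "wf_fm LW 2 (tr_eq \<tau>)" using assms(1) by (simp_all add: wf_trans_def)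
  have f: "wf_fm LW (Suc k) (tr_fun \<tau> (f, k))" if "(f, k) \<in> funs LV" for f k
    using assms(1) that by (auto simp: wf_trans_def)
  have r: "wf_fm LW k (tr_rel \<tau> (R, k))" if "(R, k) \<in> rels LV" for R k
    using assms(1) that by (auto simp: wf_trans_def)
  from assms(2) show ?thesis unfolding trans_conditions_def
    by (elim UnE insertE CollectE exE conjE emptyE)
      (auto simp: wf_exs wf_alls wf_conjs intro!: wf_vapp[OF d(1)] wf_vapp[OF d(2)] wf_vapp[OF f]
        wf_congruence[OF assms(1)] f r)
qed

lemma ex_map_image: "set es \<subseteq> r ` A \<Longrightarrow> \<exists>xs. set xs \<subseteq> A \<and> map r xs = es"
proof (induct es)
  case (Cons e es)
  then obtain xs x where "set xs \<subseteq> A" "map r xs = es" "x \<in> A" "r x = e" by auto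
  then have "set (x # xs) \<subseteq> A \<and> map r (x # xs) = e # es" by simp
  then show ?case by (intro exI[of _ "x # xs"])
qed simp

definition tdom :: "('f, 'r, 'g, 's) trans \<Rightarrow> ('g, 's, 'a) struct \<Rightarrow> 'a set" where
  "tdom \<tau> M = {a \<in> dom M. satl M (tr_dom \<tau>) [a]}"

text \<open>\<open>Q\<close> is (isomorphic to) the structure which \<open>\<tau>\<close> defines in \<open>M\<close>, and \<open>r\<close> is the quotient map.\<close>

locale interp_struct =
  fixes \<tau> :: "('f, 'r, 'g, 's) trans" and LV :: "('f, 'r) lang" and LW :: "('g, 's) lang"
    and M :: "('g, 's, 'a) struct" and Q :: "('f, 'r, 'b) struct" and r :: "'a \<Rightarrow> 'b"
  assumes wft: "wf_trans \<tau> LV LW"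
    and stQ: "structure_for LV Q"
    and rdom: "r ` tdom \<tau> M = dom Q"
    and req: "\<And>a b. a \<in> tdom \<tau> M \<Longrightarrow> b \<in> tdom \<tau> M \<Longrightarrow> satl M (tr_eq \<tau>) [a, b] \<longleftrightarrow> r a = r b"
    and rfun: "\<And>f xs y. (f, length xs) \<in> funs LV \<Longrightarrow> set xs \<subseteq> tdom \<tau> M \<Longrightarrow> y \<in> tdom \<tau> M \<Longrightarrow>
      satl M (tr_fun \<tau> (f, length xs)) (xs @ [y]) \<longleftrightarrow> fun_of Q f (map r xs) = r y"
    and rrel: "\<And>R xs. (R, length xs) \<in> rels LV \<Longrightarrow> set xs \<subseteq> tdom \<tau> M \<Longrightarrow>
      satl M (tr_rel \<tau> (R, length xs)) xs \<longleftrightarrow> rel_of Q R (map r xs)"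
begin

lemma wfd: "wf_fm LW 1 (tr_dom \<tau>)" "wf_fm LW 2 (tr_eq \<tau>)"
  using wft by (simp_all add: wf_trans_def)

lemma sat_dom_at: "v i \<in> dom M \<Longrightarrow> sat M v (dom_at \<tau> i) \<longleftrightarrow> v i \<in> tdom \<tau> M"
  using sat_vapp[of LW "[i]" "tr_dom \<tau>" M v] wfd by (simp add: tdom_def)

lemma sat_tr_args:
  "sat M v (tr_args \<tau> \<rho> gs \<chi>) \<longleftrightarrow> (\<exists>xs. length xs = length gs \<and> set xs \<subseteq> tdom \<tau> M \<and>
    (\<forall>i<length gs. sat M (ext xs v) ((gs ! i) (\<lambda>j. \<rho> j + length gs) i)) \<and> sat M (ext xs v) \<chi>)"
  (is "?l \<longleftrightarrow> ?r")
proof -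
  have "?l \<longleftrightarrow> (\<exists>xs. length xs = length gs \<and> set xs \<subseteq> dom M \<and>
    (\<forall>i<length gs. sat M (ext xs v) (dom_at \<tau> i) \<and>
      sat M (ext xs v) ((gs ! i) (\<lambda>j. \<rho> j + length gs) i)) \<and> sat M (ext xs v) \<chi>)"
    by (auto simp: tr_args_def Let_def sat_exs sat_conjs)
  also have "\<dots> \<longleftrightarrow> ?r"
  proof (intro ex_cong1 iffI conjI; elim conjE)
    fix xs assume *: "length xs = length gs" "set xs \<subseteq> dom M" "\<forall>i<length gs. sat M (ext xs v) (dom_at \<tau> i) \<and>
      sat M (ext xs v) ((gs ! i) (\<lambda>j. \<rho> j + length gs) i)"
    show "set xs \<subseteq> tdom \<tau> M"
    proof
      fix x assume "x \<in> set xs"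
      then obtain i where i: "i < length xs" "x = xs ! i" by (auto simp: in_set_conv_nth)
      then have "ext xs v i \<in> dom M" using * nth_mem[OF i(1)] by (auto simp: ext_nth)
      then show "x \<in> tdom \<tau> M" using * sat_dom_at[of "ext xs v" i] i by (auto simp: ext_nth)
    qed
  next
    fix xs assume *: "length xs = length gs" "set xs \<subseteq> tdom \<tau> M"
      "\<forall>i<length gs. sat M (ext xs v) ((gs ! i) (\<lambda>j. \<rho> j + length gs) i)"
    show sd: "set xs \<subseteq> dom M" using *(2) by (auto simp: tdom_def)
    show "\<forall>i<length gs. sat M (ext xs v) (dom_at \<tau> i) \<and>
      sat M (ext xs v) ((gs ! i) (\<lambda>j. \<rho> j + length gs) i)"
    proof (intro allI impI conjI)
      fix i assume i: "i < length gs"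
      then have "xs ! i \<in> set xs" using * by simp
      then have "xs ! i \<in> dom M" using sd by blast
      then show "sat M (ext xs v) (dom_at \<tau> i)"
        using sat_dom_at[of "ext xs v" i] * i \<open>xs ! i \<in> set xs\<close> by (auto simp: ext_nth)
    qed (use * in auto)
  qed auto
  finally show ?thesis .
qed

text \<open>The claim about each single term is a hypothesis, so that the lemma can be used inside
  the induction on terms, where it is the induction hypothesis, and again for atomic formulas, where
  it is \<open>sat_tr_tm\<close>.\<close>

lemma sat_tr_terms:
  assumes "\<And>t w \<rho> y. t \<in> set ts \<Longrightarrow> \<forall>i<k. w (\<rho> i) \<in> tdom \<tau> M \<Longrightarrow> w y \<in> tdom \<tau> M \<Longrightarrow>
      sat M w (tr_tm \<tau> t \<rho> y) \<longleftrightarrow> eval_tm Q (\<lambda>i. r (w (\<rho> i))) t = r (w y)"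
    and v: "\<forall>i<k. v (\<rho> i) \<in> tdom \<tau> M"
  shows "sat M v (tr_args \<tau> \<rho> (map (tr_tm \<tau>) ts) \<chi>) \<longleftrightarrow>
    (\<exists>xs. set xs \<subseteq> tdom \<tau> M \<and> map r xs = map (eval_tm Q (\<lambda>i. r (v (\<rho> i)))) ts \<and> sat M (ext xs v) \<chi>)"
proof -
  have "sat M (ext xs v) (tr_tm \<tau> (ts ! i) (\<lambda>j. \<rho> j + length ts) i) \<longleftrightarrow>
      eval_tm Q (\<lambda>i. r (v (\<rho> i))) (ts ! i) = r (xs ! i)"
    if xs: "set xs \<subseteq> tdom \<tau> M" "length xs = length ts" and i: "i < length ts" for xs i
  proof -
    have e: "ext xs v (\<rho> j + length ts) = v (\<rho> j)" for j
      using ext_add[of xs v "\<rho> j"] xs by simp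
    have "ext xs v i \<in> tdom \<tau> M" using xs i by (auto simp: ext_nth)
    then show ?thesis using assms(1)[of "ts ! i" "ext xs v" "\<lambda>j. \<rho> j + length ts" i] v i xs
      by (simp add: e ext_nth)
  qed
  then show ?thesis unfolding sat_tr_args
    by (intro ex_cong1) (auto simp: list_eq_iff_nth_eq)
qed

lemma sat_tr_tm:
  "wf_tm LV k t \<Longrightarrow> \<forall>i<k. v (\<rho> i) \<in> tdom \<tau> M \<Longrightarrow> v y \<in> tdom \<tau> M \<Longrightarrow>
    sat M v (tr_tm \<tau> t \<rho> y) \<longleftrightarrow> eval_tm Q (\<lambda>i. r (v (\<rho> i))) t = r (v y)"
proof (induct t arbitrary: v \<rho> y)
  case (Var i)
  then show ?case using sat_vapp[of LW "[\<rho> i, y]" "tr_eq \<tau>" M v] wfd req by (simp add: numeral_2_eq_2)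
next
  case (Fn f ts)
  let ?e = "eval_tm Q (\<lambda>i. r (v (\<rho> i)))"
  have f: "(f, length ts) \<in> funs LV" using Fn by simp
  have wf: "wf_fm LW (Suc (length ts)) (tr_fun \<tau> (f, length ts))" using f wft by (auto simp: wf_trans_def)
  have dm: "set (map ?e ts) \<subseteq> r ` tdom \<tau> M"
    using Fn.prems rdom by (auto simp: list_all_iff intro!: eval_in_dom[OF stQ])
  have "sat M (ext xs v) (vapp (tr_fun \<tau> (f, length ts)) ([0..<length ts] @ [y + length ts]))
      \<longleftrightarrow> fun_of Q f (map r xs) = r (v y)" if "set xs \<subseteq> tdom \<tau> M" "length xs = length ts" for xs
  proof -
    have "map (ext xs v) ([0..<length ts] @ [y + length ts]) = xs @ [v y]"
      using that by (intro nth_equalityI) (simp_all add: ext_def nth_append)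
    then show ?thesis
      using sat_vapp[of LW "[0..<length ts] @ [y + length ts]" "tr_fun \<tau> (f, length ts)" M "ext xs v"] wf
        rfun[of f xs "v y"] that f Fn.prems by simp
  qed
  moreover have "length xs = length ts" if "map r xs = map ?e ts" for xs
    using that map_eq_imp_length_eq by blast
  ultimately have "sat M v (tr_tm \<tau> (Fn f ts) \<rho> y) \<longleftrightarrow>
      (\<exists>xs. set xs \<subseteq> tdom \<tau> M \<and> map r xs = map ?e ts \<and> fun_of Q f (map r xs) = r (v y))"
    using Fn by (simp add: sat_tr_terms[where k = k] list_all_iff) (smt (verit))
  \<comment> \<open>Every value of an argument term lies in the image of \<open>r\<close>, so
    suitable \<open>xs\<close> exist and only the evaluation in \<open>Q\<close> remains.\<close>
  also have "\<dots> \<longleftrightarrow> ?e (Fn f ts) = r (v y)"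
    using ex_map_image[OF dm] by (auto simp del: map_eq_conv) 
  finally show ?case .
qed

text \<open>The assumption that the free variables take values in the translated domain survives the
  induction because translated quantifiers are relativised to \<open>tr_dom\<close>.\<close>

lemma sat_tr_fm:
  "wf_fm LV k \<phi> \<Longrightarrow> \<forall>i<k. v i \<in> tdom \<tau> M \<Longrightarrow> sat M v (tr_fm \<tau> \<phi>) \<longleftrightarrow> sat Q (\<lambda>i. r (v i)) \<phi>"
proof (induct \<phi> arbitrary: k v)
  case (Eq s t)
  let ?e = "eval_tm Q (\<lambda>i. r (v i))"
  have dm: "set (map ?e [s, t]) \<subseteq> r ` tdom \<tau> M"
    using Eq.prems rdom by (auto intro!: eval_in_dom[OF stQ])
  have "sat M v (tr_args \<tau> id (map (tr_tm \<tau>) [s, t]) (tr_eq \<tau>)) \<longleftrightarrow>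
    (\<exists>xs. set xs \<subseteq> tdom \<tau> M \<and> map r xs = map (eval_tm Q (\<lambda>i. r (v (id i)))) [s, t] \<and> sat M (ext xs v) (tr_eq \<tau>))"
    using Eq.prems by (intro sat_tr_terms[where k = k] sat_tr_tm[where k = k]) auto
  also have "\<dots> \<longleftrightarrow> (\<exists>a\<in>tdom \<tau> M. \<exists>b\<in>tdom \<tau> M. r a = ?e s \<and> r b = ?e t \<and> r a = r b)"
  proof -
    have "sat M (ext [a, b] v) (tr_eq \<tau>) \<longleftrightarrow> r a = r b" if "a \<in> tdom \<tau> M" "b \<in> tdom \<tau> M" for a b
      using satlI[of LW "[a, b]" "tr_eq \<tau>" "ext [a, b] v" M] req[OF that] wfd
      by (simp add: numeral_2_eq_2 ext_nth)
    moreover have "(\<exists>xs. set xs \<subseteq> A \<and> map r xs = [x, y] \<and> P xs) \<longleftrightarrow>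
        (\<exists>a\<in>A. \<exists>b\<in>A. r a = x \<and> r b = y \<and> P [a, b])" (is "?l \<longleftrightarrow> ?r") for A x y P
    proof
      assume ?l
      then show ?r by (auto simp: map_eq_Cons_conv) blast
    next
      assume ?r
      then obtain a b where "a \<in> A" "b \<in> A" "r a = x" "r b = y" "P [a, b]" by blast
      then show ?l by (intro exI[of _ "[a, b]"]) simp
    qed
    ultimately show ?thesis by (simp cong: bex_cong) 
  qed
  also have "\<dots> \<longleftrightarrow> ?e s = ?e t" using dm by auto metis
  finally show ?case by simp
next
  case (Rel R ts)
  let ?e = "eval_tm Q (\<lambda>i. r (v i))"
  have R: "(R, length ts) \<in> rels LV" using Rel by simp
  have wf: "wf_fm LW (length ts) (tr_rel \<tau> (R, length ts))" using R wft by (auto simp: wf_trans_def)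
  have dm: "set (map ?e ts) \<subseteq> r ` tdom \<tau> M"
    using Rel.prems rdom by (auto simp: list_all_iff intro!: eval_in_dom[OF stQ])
  have "sat M v (tr_fm \<tau> (Rel R ts)) \<longleftrightarrow> (\<exists>xs. set xs \<subseteq> tdom \<tau> M \<and>
      map r xs = map (eval_tm Q (\<lambda>i. r (v (id i)))) ts \<and> sat M (ext xs v) (tr_rel \<tau> (R, length ts)))"
    unfolding tr_fm.simps
    using Rel.prems by (intro sat_tr_terms[where k = k] sat_tr_tm[where k = k]) (auto simp: list_all_iff)
  also have "\<dots> \<longleftrightarrow> (\<exists>xs. set xs \<subseteq> tdom \<tau> M \<and> map r xs = map ?e ts \<and> rel_of Q R (map r xs))"
  proof -
    have "sat M (ext xs v) (tr_rel \<tau> (R, length ts)) \<longleftrightarrow> rel_of Q R (map r xs)"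
      if "set xs \<subseteq> tdom \<tau> M" "map r xs = map ?e ts" for xs
    proof -
      have "length xs = length ts" using that(2) map_eq_imp_length_eq by blast
      then show ?thesis using satlI[of LW xs "tr_rel \<tau> (R, length ts)" "ext xs v" M] wf R that(1) rrel[of R xs]
        by (simp add: ext_nth)
    qed
    then show ?thesis by auto
  qed
  also have "\<dots> \<longleftrightarrow> sat Q (\<lambda>i. r (v i)) (Rel R ts)"
    using ex_map_image[OF dm] by (auto simp del: map_eq_conv)
  finally show ?case .
next
  case (Ex \<phi>)
  have d: "sat M (case_nat a v) (tr_dom \<tau>) \<longleftrightarrow> a \<in> tdom \<tau> M" if "a \<in> dom M" for a
    using satlI[of LW "[a]" "tr_dom \<tau>" "case_nat a v" M] wfd that by (simp add: tdom_def)
  have i: "sat M (case_nat a v) (tr_fm \<tau> \<phi>) \<longleftrightarrow> sat Q (case_nat (r a) (\<lambda>i. r (v i))) \<phi>"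
    if "a \<in> tdom \<tau> M" for a
  proof -
    have "(\<lambda>i. r (case_nat a v i)) = case_nat (r a) (\<lambda>i. r (v i))"
      by (rule HOL.ext) (simp split: nat.split)
    then show ?thesis using Ex that by (subst Ex(1)[of "Suc k"]) (auto split: nat.split)
  qed
  show ?case using d i rdom[symmetric] by (auto simp: tdom_def)
next
  case (All \<phi>)
  have d: "sat M (case_nat a v) (tr_dom \<tau>) \<longleftrightarrow> a \<in> tdom \<tau> M" if "a \<in> dom M" for a
    using satlI[of LW "[a]" "tr_dom \<tau>" "case_nat a v" M] wfd that by (simp add: tdom_def)
  have i: "sat M (case_nat a v) (tr_fm \<tau> \<phi>) \<longleftrightarrow> sat Q (case_nat (r a) (\<lambda>i. r (v i))) \<phi>"
    if "a \<in> tdom \<tau> M" for a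
  proof -
    have "(\<lambda>i. r (case_nat a v i)) = case_nat (r a) (\<lambda>i. r (v i))"
      by (rule HOL.ext) (simp split: nat.split)
    then show ?thesis using All that by (subst All(1)[of "Suc k"]) (auto split: nat.split)
  qed
  show ?case using d i rdom[symmetric] by (auto simp: tdom_def)
next
  case (Neg \<phi>)
  then show ?case using Neg(1)[of k v] by simp
next
  case (And \<phi> \<psi>)
  then show ?case using And(1)[of k v] And(2)[of k v] by simp
next
  case (Or \<phi> \<psi>)
  then show ?case using Or(1)[of k v] Or(2)[of k v] by simp
qed

end

text \<open>The quotient by the defined identity is realised by a system of representatives, so that
  \<open>Q\<close> has its carrier inside that of \<open>M\<close>. The sentences in
  \<open>trans_conditions\<close> make the operations independent of the representatives.\<close>

lemma interp_exists:
  fixes \<tau> :: "('f, 'r, 'g, 's) trans" and M :: "('g, 's, 'a) struct"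
  assumes ne: "dom M \<noteq> {}" and wft: "wf_trans \<tau> LV LW"
    and tc: "\<And>\<phi> v. \<phi> \<in> trans_conditions \<tau> LV \<Longrightarrow> range v \<subseteq> dom M \<Longrightarrow> sat M v \<phi>"
  shows "\<exists>(Q :: ('f, 'r, 'a) struct) r. interp_struct \<tau> LV LW M Q r"
proof -
  let ?\<delta> = "tdom \<tau> M"
  obtain d where d: "d \<in> dom M" using ne by blast
  define v0 where "v0 = (\<lambda>i :: nat. d)"
  have v0: "range v0 \<subseteq> dom M" using d by (auto simp: v0_def)
  note tc = tc[OF _ v0, unfolded trans_conditions_def]
  have wfd: "wf_fm LW 1 (tr_dom \<tau>)" "wf_fm LW 2 (tr_eq \<tau>)" using wft by (simp_all add: wf_trans_def)
  have \<delta>: "\<And>xs. set xs \<subseteq> ?\<delta> \<Longrightarrow> set xs \<subseteq> dom M" by (auto simp: tdom_def)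
  have dat: "sat M (ext xs v0) (dom_at \<tau> i) \<longleftrightarrow> xs ! i \<in> ?\<delta>" if "i < length xs" "set xs \<subseteq> dom M" for xs i
    using sat_vapp[of LW "[i]" "tr_dom \<tau>" M "ext xs v0"] wfd that nth_mem[OF that(1)]
    by (auto simp: tdom_def ext_nth)
  have eat: "sat M (ext xs v0) (eq_at \<tau> i j) \<longleftrightarrow> satl M (tr_eq \<tau>) [xs ! i, xs ! j]"
    if "i < length xs" "j < length xs" for xs i j
    using sat_vapp[of LW "[i, j]" "tr_eq \<tau>" M "ext xs v0"] wfd that by (simp add: ext_nth numeral_2_eq_2)
  define eqv where "eqv a b = satl M (tr_eq \<tau>) [a, b]" for a b
  have nempty: "?\<delta> \<noteq> {}"
  proof -
    have "sat M v0 (exs 1 (dom_at \<tau> 0))" by (rule tc) blast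
    then obtain xs where "length xs = 1" "set xs \<subseteq> dom M" "sat M (ext xs v0) (dom_at \<tau> 0)"
      by (auto simp: sat_exs)
    then show ?thesis using dat[of 0 xs] by auto
  qed
  have erefl: "eqv a a" if "a \<in> ?\<delta>" for a
  proof -
    have "sat M v0 (alls 1 (Imp (dom_at \<tau> 0) (eq_at \<tau> 0 0)))" by (rule tc) blast
    then have "sat M (ext [a] v0) (Imp (dom_at \<tau> 0) (eq_at \<tau> 0 0))"
      using that \<delta>[of "[a]"] by (auto simp: sat_alls)
    then show ?thesis using that \<delta>[of "[a]"] dat[of 0 "[a]"] eat[of 0 "[a]" 0] by (simp add: eqv_def)
  qed
  have esym: "eqv b a" if "a \<in> ?\<delta>" "b \<in> ?\<delta>" "eqv a b" for a b
  proof -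
    have "sat M v0 (alls 2 (Imp (conjs [dom_at \<tau> 0, dom_at \<tau> 1, eq_at \<tau> 0 1]) (eq_at \<tau> 1 0)))" by (rule tc) blast
    then have "sat M (ext [a, b] v0) (Imp (conjs [dom_at \<tau> 0, dom_at \<tau> 1, eq_at \<tau> 0 1]) (eq_at \<tau> 1 0))"
      by (rule sat_allsD) (use that \<delta>[of "[a, b]"] in auto)
    then show ?thesis using that \<delta>[of "[a, b]"] dat[of 0 "[a, b]"] dat[of 1 "[a, b]"] eat[of _ "[a, b]"]
      by (simp add: eqv_def sat_conjs)
  qed
  have etrans: "eqv a c" if "a \<in> ?\<delta>" "b \<in> ?\<delta>" "c \<in> ?\<delta>" "eqv a b" "eqv b c" for a b c
  proof -
    let ?\<phi> = "Imp (conjs [dom_at \<tau> 0, dom_at \<tau> 1, dom_at \<tau> 2, eq_at \<tau> 0 1, eq_at \<tau> 1 2]) (eq_at \<tau> 0 2)"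
    have sub: "set [a, b, c] \<subseteq> dom M" using that \<delta>[of "[a, b, c]"] by simp
    have "sat M v0 (alls 3 ?\<phi>)" by (rule tc) blast
    then have "sat M (ext [a, b, c] v0) ?\<phi>"
      by (rule sat_allsD) (use sub in auto)
    then show ?thesis using that sub dat[of _ "[a, b, c]"] eat[of _ "[a, b, c]"]
      by (simp add: eqv_def sat_conjs)
  qed
  \<comment> \<open>The two argument lists are joined to one block of \<open>2 * k\<close> values,
    as in \<open>congruence\<close>.\<close>
  have congr: "satl M \<chi> ys"
    if "sat M v0 (congruence \<tau> k \<chi>)" "wf_fm LW k \<chi>" "length xs = k" "length ys = k" "set xs \<subseteq> ?\<delta>" "set ys \<subseteq> ?\<delta>"
      "\<forall>i<k. eqv (xs ! i) (ys ! i)" "satl M \<chi> xs" for \<chi> k xs ys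
  proof -
    let ?zs = "xs @ ys"
    have z: "set ?zs \<subseteq> dom M" "length ?zs = 2 * k" using that \<delta> by auto
    have zd: "?zs ! i \<in> ?\<delta>" if "i < 2 * k" for i
      by (rule nth_in) (use that z \<open>set xs \<subseteq> ?\<delta>\<close> \<open>set ys \<subseteq> ?\<delta>\<close> in auto)
    have m: "map (ext ?zs v0) [0..<k] = xs" "map (ext ?zs v0) [k..<2 * k] = ys"
      using that by (auto intro!: nth_equalityI simp: ext_def nth_append)
    have x: "sat M (ext ?zs v0) (vapp \<chi> [0..<k]) \<longleftrightarrow> satl M \<chi> xs"
      using sat_vapp[of LW "[0..<k]" \<chi> M "ext ?zs v0"] that(2) m by simp
    have y: "sat M (ext ?zs v0) (vapp \<chi> [k..<2 * k]) \<longleftrightarrow> satl M \<chi> ys"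
      using sat_vapp[of LW "[k..<2 * k]" \<chi> M "ext ?zs v0"] that(2) m by simp
    have c: "sat M (ext ?zs v0) (conjs (map (dom_at \<tau>) [0..<2 * k] @ map (\<lambda>i. eq_at \<tau> i (k + i)) [0..<k]))"
      using zd z dat[of _ ?zs] eat[of _ ?zs] that by (auto simp: sat_conjs nth_append eqv_def)
    have "sat M (ext ?zs v0) (Imp (conjs (map (dom_at \<tau>) [0..<2 * k] @ map (\<lambda>i. eq_at \<tau> i (k + i)) [0..<k]))
      (Imp (vapp \<chi> [0..<k]) (vapp \<chi> [k..<2 * k])))"
      by (rule sat_allsD[OF that(1)[unfolded congruence_def]]) (use z in auto)
    then show ?thesis using c x y that by simp
  qed
  define r where "r a = (SOME b. b \<in> ?\<delta> \<and> eqv a b)" for a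
  have r: "r a \<in> ?\<delta> \<and> eqv a (r a)" if "a \<in> ?\<delta>" for a
    unfolding r_def by (rule someI_ex) (use that erefl in blast)
  have r_eq: "eqv a b \<longleftrightarrow> r a = r b" if ab: "a \<in> ?\<delta>" "b \<in> ?\<delta>" for a b
  proof
    assume "eqv a b"
    \<comment> \<open>Equivalent elements have the same candidates for \<open>SOME\<close>, hence
      the same representative.\<close>
    then have "x \<in> ?\<delta> \<and> eqv a x \<longleftrightarrow> x \<in> ?\<delta> \<and> eqv b x" for x using ab esym etrans by metis
    then show "r a = r b" by (simp add: r_def)
  next
    assume "r a = r b"
    then show "eqv a b" using r ab esym etrans by metis
  qed
  have rr: "r (r a) = r a" if "a \<in> ?\<delta>" for a using r[OF that] r_eq[of a "r a"] that by auto
  have r_list: "length xs = length ys" "\<forall>i<length xs. eqv (xs ! i) (ys ! i)"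
    if "map r xs = map r ys" "set xs \<subseteq> ?\<delta>" "set ys \<subseteq> ?\<delta>" for xs ys
  proof -
    show l: "length xs = length ys" using that(1) map_eq_imp_length_eq by blast
    show "\<forall>i<length xs. eqv (xs ! i) (ys ! i)"
    proof (intro allI impI)
      fix i assume i: "i < length xs"
      then have "r (xs ! i) = r (ys ! i)" using that(1) l by (metis nth_map)
      moreover have "xs ! i \<in> ?\<delta>" "ys ! i \<in> ?\<delta>" using i l that(2,3) by (simp_all add: nth_in)
      ultimately show "eqv (xs ! i) (ys ! i)" using r_eq by simp
    qed
  qed
  have wff: "wf_fm LW (Suc k) (tr_fun \<tau> (f, k))" if "(f, k) \<in> funs LV" for f k
    using wft that by (auto simp: wf_trans_def)
  have wfr: "wf_fm LW k (tr_rel \<tau> (R, k))" if "(R, k) \<in> rels LV" for R k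
    using wft that by (auto simp: wf_trans_def)
  have tot: "\<exists>y\<in>?\<delta>. satl M (tr_fun \<tau> (f, length xs)) (xs @ [y])" if "(f, length xs) \<in> funs LV" "set xs \<subseteq> ?\<delta>" for f xs
  proof -
    let ?k = "length xs" let ?g = "tr_fun \<tau> (f, ?k)"
    let ?\<phi> = "Imp (conjs (map (dom_at \<tau>) [0..<?k])) (Ex (And (dom_at \<tau> 0) (vapp ?g ([1..<Suc ?k] @ [0]))))"
    have "sat M v0 (alls ?k ?\<phi>)" by (rule tc) (use that in blast)
    then have s: "sat M (ext xs v0) ?\<phi>" by (rule sat_allsD) (use that \<delta> in auto)
    have nd: "xs ! i \<in> ?\<delta>" if "i < ?k" for i using nth_in[OF \<open>set xs \<subseteq> ?\<delta>\<close> that] .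
    have "sat M (ext xs v0) (conjs (map (dom_at \<tau>) [0..<?k]))"
      using nd dat[of _ xs] \<delta>[OF that(2)] by (auto simp: sat_conjs)
    then obtain y where y: "y \<in> dom M" "sat M (case_nat y (ext xs v0)) (dom_at \<tau> 0)"
      "sat M (case_nat y (ext xs v0)) (vapp ?g ([1..<Suc ?k] @ [0]))" using s by auto
    have "y \<in> ?\<delta>" using sat_vapp[of LW "[0]" "tr_dom \<tau>" M "case_nat y (ext xs v0)"] wfd y by (simp add: tdom_def)
    moreover have "map (case_nat y (ext xs v0)) ([1..<Suc ?k] @ [0]) = xs @ [y]"
    proof -
      have "[1..<Suc ?k] = map Suc [0..<?k]" by (simp add: map_Suc_upt)
      moreover have "map (ext xs v0) [0..<?k] = xs" by (intro nth_equalityI) (simp_all add: ext_nth)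
      ultimately show ?thesis by (simp add: comp_def del: upt_Suc)
    qed
    then have "satl M ?g (xs @ [y])"
      using sat_vapp[of LW "[1..<Suc ?k] @ [0]" ?g M "case_nat y (ext xs v0)"] wff[OF that(1)] y(3)
        by (simp del: upt_Suc)
    ultimately show ?thesis by blast
  qed
  have uni: "eqv y z" if "(f, length xs) \<in> funs LV" "set xs \<subseteq> ?\<delta>" "y \<in> ?\<delta>" "z \<in> ?\<delta>"
    "satl M (tr_fun \<tau> (f, length xs)) (xs @ [y])" "satl M (tr_fun \<tau> (f, length xs)) (xs @ [z])" for f xs y z
  proof -
    let ?k = "length xs" let ?g = "tr_fun \<tau> (f, ?k)" let ?zs = "xs @ [y, z]"
    let ?\<phi> = "Imp (conjs (map (dom_at \<tau>) [0..<?k + 2] @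
      [vapp ?g ([0..<?k] @ [?k]), vapp ?g ([0..<?k] @ [?k + 1])])) (eq_at \<tau> ?k (?k + 1))"
    have "sat M v0 (alls (?k + 2) ?\<phi>)" by (rule tc) (use that in blast)
    moreover have zs: "set ?zs \<subseteq> dom M" "length ?zs = ?k + 2" "set ?zs \<subseteq> ?\<delta>" using that \<delta> by (auto simp: tdom_def)
    ultimately have s: "sat M (ext ?zs v0) ?\<phi>" by (intro sat_allsD)
    have m: "map (ext ?zs v0) ([0..<?k] @ [?k]) = xs @ [y]" "map (ext ?zs v0) ([0..<?k] @ [?k + 1]) = xs @ [z]"
      by (intro nth_equalityI; simp add: ext_def nth_append)+
    have "sat M (ext ?zs v0) (vapp ?g ([0..<?k] @ [?k]))" "sat M (ext ?zs v0) (vapp ?g ([0..<?k] @ [?k + 1]))"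
      using sat_vapp[of LW "[0..<?k] @ [?k]" ?g M "ext ?zs v0"] sat_vapp[of LW "[0..<?k] @ [?k + 1]" ?g M "ext ?zs v0"]
        wff[OF that(1)] m that by simp_all
    moreover have "?zs ! i \<in> ?\<delta>" if "i < ?k + 2" for i using nth_in[OF zs(3), of i] zs(2) that by simp
    ultimately have "sat M (ext ?zs v0) (eq_at \<tau> ?k (?k + 1))"
      using s dat[of _ ?zs] zs by (auto simp: sat_conjs)
    then show ?thesis using eat[of ?k ?zs "?k + 1"] by (simp add: eqv_def nth_append)
  qed
  define Q :: "('f, 'r, 'a) struct" where
    "Q = \<lparr>dom = r ` ?\<delta>, fun_of = \<lambda>f xs. r (SOME y. y \<in> ?\<delta> \<and> satl M (tr_fun \<tau> (f, length xs)) (xs @ [y])),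
      rel_of = \<lambda>R xs. satl M (tr_rel \<tau> (R, length xs)) xs\<rparr>"
  have Qf: "\<exists>y\<in>?\<delta>. fun_of Q f xs = r y \<and> satl M (tr_fun \<tau> (f, length xs)) (xs @ [y])"
    if "(f, length xs) \<in> funs LV" "set xs \<subseteq> ?\<delta>" for f xs
  proof -
    have "\<exists>y. y \<in> ?\<delta> \<and> satl M (tr_fun \<tau> (f, length xs)) (xs @ [y])" using tot[OF that] by blast
    from someI_ex[OF this] show ?thesis by (auto simp: Q_def)
  qed
  have rmap: "set (map r xs) \<subseteq> ?\<delta>" "map r (map r xs) = map r xs" if "set xs \<subseteq> ?\<delta>" for xs
    using that r rr by (auto simp: subset_iff)
  have "interp_struct \<tau> LV LW M Q r"
  proof
    show "structure_for LV Q"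
    proof -
      have "fun_of Q f xs \<in> dom Q" if "(f, length xs) \<in> funs LV" "set xs \<subseteq> dom Q" for f xs
      proof -
        have "set xs \<subseteq> ?\<delta>" using that r by (auto simp: Q_def)
        then show ?thesis using Qf[OF that(1)] by (auto simp: Q_def)
      qed
      then show ?thesis using nempty by (auto simp: structure_for_def Q_def)
    qed
    show "satl M (tr_fun \<tau> (f, length xs)) (xs @ [y]) = (fun_of Q f (map r xs) = r y)"
      if f: "(f, length xs) \<in> funs LV" and xs: "set xs \<subseteq> ?\<delta>" and y: "y \<in> ?\<delta>" for f xs y
    proof -
      let ?g = "tr_fun \<tau> (f, length xs)"
      have rx: "set (map r xs) \<subseteq> ?\<delta>" using rmap[OF xs] by simp
      obtain z where z: "z \<in> ?\<delta>" "fun_of Q f (map r xs) = r z" "satl M ?g (map r xs @ [z])"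
        using Qf[of f "map r xs"] f rx by auto
      have cg: "sat M v0 (congruence \<tau> (Suc (length xs)) ?g)" by (rule tc) (use f in blast)
      have e: "length (map r xs @ [z]) = length (xs @ [z])"
        "\<forall>i<length (map r xs @ [z]). eqv ((map r xs @ [z]) ! i) ((xs @ [z]) ! i)"
        using r_list[of "map r xs @ [z]" "xs @ [z]"] rmap[OF xs] xs z rx by auto
      \<comment> \<open>Congruence moves the value from the representatives \<open>map r xs\<close>
        back to \<open>xs\<close> itself; uniqueness can then compare it with any
        \<open>y\<close>.\<close>
      have xz: "satl M ?g (xs @ [z])"
        by (rule congr[OF cg wff[OF f], of "map r xs @ [z]"]) (use e z rx xs in auto)
      show ?thesis
      proof
        assume "satl M ?g (xs @ [y])"
        then show "fun_of Q f (map r xs) = r y" using uni[OF f xs y z(1) _ xz] z(2) r_eq y z(1) by auto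
      next
        assume "fun_of Q f (map r xs) = r y"
        then have "map r (xs @ [z]) = map r (xs @ [y])" using z(2) by simp
        from r_list(2)[OF this] have e2: "\<forall>i<length (xs @ [z]). eqv ((xs @ [z]) ! i) ((xs @ [y]) ! i)"
          using xs y z by simp
        show "satl M ?g (xs @ [y])"
          by (rule congr[OF cg wff[OF f], of "xs @ [z]"]) (use e2 xz xs y z in simp_all)
      qed
    qed
    show "satl M (tr_rel \<tau> (R, length xs)) xs = rel_of Q R (map r xs)"
      if R: "(R, length xs) \<in> rels LV" and xs: "set xs \<subseteq> ?\<delta>" for R xs
    proof -
      have cg: "sat M v0 (congruence \<tau> (length xs) (tr_rel \<tau> (R, length xs)))" by (rule tc) (use R in blast)
      have e: "\<forall>i<length xs. eqv (xs ! i) (map r xs ! i)" "\<forall>i<length xs. eqv (map r xs ! i) (xs ! i)"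
        using r_list[of xs "map r xs"] r_list[of "map r xs" xs] rmap[OF xs] xs by auto
      show ?thesis
        using congr[OF cg wfr[OF R], of xs "map r xs"] congr[OF cg wfr[OF R], of "map r xs" xs] e rmap[OF xs] xs
        by (auto simp: Q_def)
    qed
  qed (use wft r_eq in \<open>auto simp: Q_def eqv_def\<close>)
  then show ?thesis by blast
qed

section \<open>Propositional compactness\<close>

definition csat :: "'x set \<Rightarrow> (bool \<times> 'x) list \<Rightarrow> bool" where
  "csat X c \<longleftrightarrow> (\<exists>(s, x)\<in>set c. (x \<in> X) = s)"

definition finsat :: "(bool \<times> 'x) list set \<Rightarrow> bool" where
  "finsat S \<longleftrightarrow> (\<forall>F. finite F \<longrightarrow> F \<subseteq> S \<longrightarrow> (\<exists>X. \<forall>c\<in>F. csat X c))"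

text \<open>A maximal finitely satisfiable set of clauses contains, for every atom, one of its two
  unit clauses; these unit clauses are the valuation.\<close>

theorem prop_compactness:
  assumes "finsat S"
  shows "\<exists>X. \<forall>c\<in>S. csat X c"
proof -
  let ?A = "{T. S \<subseteq> T \<and> finsat T}"
  have "\<exists>T\<in>?A. \<forall>T'\<in>?A. T \<subseteq> T' \<longrightarrow> T' = T"
  proof (rule subset_Zorn_nonempty)
    show "?A \<noteq> {}" using assms by auto
    fix C assume C: "C \<noteq> {}" "subset.chain ?A C"
    have "finsat (\<Union>C)" unfolding finsat_def
    proof (intro allI impI)
      fix F assume F: "finite F" "F \<subseteq> \<Union>C"
      obtain B where B: "B \<in> C" "F \<subseteq> B" by (rule finite_subset_Union_chain[OF F C])
      have "finsat B" using B(1) C(2) by (auto simp: subset_chain_def)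
      then show "\<exists>X. \<forall>c\<in>F. csat X c" using B(2) F(1) by (simp add: finsat_def)
    qed
    moreover have "S \<subseteq> B" if "B \<in> C" for B using that C(2) by (auto simp: subset_chain_def)
    then have "S \<subseteq> \<Union>C" using C(1) by blast
    ultimately show "\<Union>C \<in> ?A" by simp
  qed
  then obtain T where TA: "T \<in> ?A" and Tm: "\<forall>T'\<in>?A. T \<subseteq> T' \<longrightarrow> T' = T" by (elim bexE)
  have T: "S \<subseteq> T" "finsat T" using TA by simp_all
  have max: "T' = T" if "S \<subseteq> T'" "finsat T'" "T \<subseteq> T'" for T'
    using Tm that by simp
  \<comment> \<open>If neither unit clause belonged to \<open>T\<close>, maximality would give two
    finite subsets of \<open>T\<close>, one not satisfiable with \<open>x\<close> true and one not
    with \<open>x\<close> false. Their union is satisfiable, and the valuation gives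
    \<open>x\<close> one of the two values.\<close>
  have dec: "[(True, x)] \<in> T \<or> [(False, x)] \<in> T" for x
  proof (rule ccontr)
    assume n: "\<not> ?thesis"
    have "\<exists>F. finite F \<and> F \<subseteq> T \<and> \<not> (\<exists>X. (x \<in> X) = b \<and> (\<forall>c\<in>F. csat X c))" for b
    proof -
      have "[(b, x)] \<notin> T" using n by (cases b) auto
      then have "\<not> finsat (insert [(b, x)] T)" using max[of "insert [(b, x)] T"] T(1) by auto
      then obtain F where F: "finite F" "F \<subseteq> insert [(b, x)] T" "\<not> (\<exists>X. \<forall>c\<in>F. csat X c)"
        by (auto simp: finsat_def)
      have "\<not> (\<forall>c\<in>F - {[(b, x)]}. csat X c)" if "(x \<in> X) = b" for X
      proof
        assume a: "\<forall>c\<in>F - {[(b, x)]}. csat X c"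
        have "csat X [(b, x)]" using that by (simp add: csat_def)
        then have "\<forall>c\<in>F. csat X c" using a by (metis DiffI singletonD)
        then show False using F(3) by blast
      qed
      then show ?thesis using F(1,2) by (intro exI[of _ "F - {[(b, x)]}"]) auto
    qed
    then obtain F where F: "finite (F b)" "F b \<subseteq> T" "\<not> (\<exists>X. (x \<in> X) = b \<and> (\<forall>c\<in>F b. csat X c))" for b
      by metis
    have "\<exists>X. \<forall>c\<in>F True \<union> F False. csat X c"
      using T(2) F(1,2) by (simp add: finsat_def)
    then obtain X where "\<forall>c\<in>F True \<union> F False. csat X c" by blast
    then have "\<forall>c\<in>F b. csat X c" for b by (cases b) auto
    then show False using F(3)[of "x \<in> X"] by blast
  qed
  let ?X = "{x. [(True, x)] \<in> T}"
  have "csat ?X c" if c: "c \<in> S" for c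
  proof (rule ccontr)
    assume n: "\<not> csat ?X c"
    \<comment> \<open>A clause false under \<open>?X\<close> clashes with the unit clauses for the
      complements of its literals, all of which are in \<open>T\<close>.\<close>
    let ?F = "insert c ((\<lambda>(s, x). [(\<not> s, x)]) ` set c)"
    have nn: "(x \<in> ?X) \<noteq> s" if "(s, x) \<in> set c" for s x
      using n that unfolding csat_def by blast
    have "[(\<not> s, x)] \<in> T" if "(s, x) \<in> set c" for s x
      using nn[OF that] dec[of x] by (cases s) simp_all
    then have "?F \<subseteq> T" using c T(1) by auto
    moreover have "finite ?F" by simp
    ultimately have "\<exists>Y. \<forall>c\<in>?F. csat Y c" using T(2) unfolding finsat_def by (elim allE impE)
    then obtain Y where Y: "\<forall>c\<in>?F. csat Y c" by (elim exE)
    then obtain s x where sx: "(s, x) \<in> set c" "(x \<in> Y) = s" by (auto simp: csat_def)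
    then have "csat Y [(\<not> s, x)]" using Y by auto
    then show False using sx by (simp add: csat_def)
  qed
  then show ?thesis by blast
qed

section \<open>Henkin theories\<close>

text \<open>Smullyan's unifying notation for signed formulas. A formula under an environment of constants
  takes the place of a substitution instance.\<close>

type_synonym sfm = "bool \<times> (nat, nat) fm"

text \<open>Negation counts as a conjunction with two equal components, so it forms no kind of its
  own.\<close>

inductive conjS :: "sfm \<Rightarrow> sfm \<Rightarrow> sfm \<Rightarrow> bool" where
  "conjS (True, And p q) (True, p) (True, q)"
| "conjS (False, Or p q) (False, p) (False, q)"
| "conjS (s, Neg p) (\<not> s, p) (\<not> s, p)"

inductive disjS :: "sfm \<Rightarrow> sfm \<Rightarrow> sfm \<Rightarrow> bool" where
  "disjS (True, Or p q) (True, p) (True, q)"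
| "disjS (False, And p q) (False, p) (False, q)"

inductive exS :: "sfm \<Rightarrow> sfm \<Rightarrow> bool" where
  "exS (True, Ex p) (True, p)"
| "exS (False, All p) (False, p)"

inductive allS :: "sfm \<Rightarrow> sfm \<Rightarrow> bool" where
  "allS (True, All p) (True, p)"
| "allS (False, Ex p) (False, p)"

definition ssat :: "(nat, nat, 'a) struct \<Rightarrow> (nat \<Rightarrow> 'a) \<Rightarrow> sfm \<Rightarrow> bool" where
  "ssat M v k \<longleftrightarrow> sat M v (snd k) = fst k"

lemma ssat_conj: "conjS k k1 k2 \<Longrightarrow> ssat M v k \<longleftrightarrow> ssat M v k1 \<and> ssat M v k2"
  by (erule conjS.cases) (auto simp: ssat_def)

lemma ssat_disj: "disjS k k1 k2 \<Longrightarrow> ssat M v k \<longleftrightarrow> ssat M v k1 \<or> ssat M v k2"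
  by (erule disjS.cases) (auto simp: ssat_def)

lemma ssat_ex: "exS k k' \<Longrightarrow> ssat M v k \<longleftrightarrow> (\<exists>a\<in>dom M. ssat M (case_nat a v) k')"
  by (erule exS.cases) (auto simp: ssat_def)

lemma ssat_all: "allS k k' \<Longrightarrow> ssat M v k \<longleftrightarrow> (\<forall>a\<in>dom M. ssat M (case_nat a v) k')"
  by (erule allS.cases) (auto simp: ssat_def)

inductive near :: "'c \<Rightarrow> 'c \<Rightarrow> 'c list \<Rightarrow> 'c list \<Rightarrow> bool" for c d where
  near_same: "near c d cs cs"
| near_here: "near c d (c # cs) (d # cs)"
| near_step: "near c d cs ds \<Longrightarrow> near c d (x # cs) (x # ds)"

lemma near_append: "near c d (xs @ c # ys) (xs @ d # ys)"
  by (induct xs) (auto intro: near.intros)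

lemma near_map: "near c d cs ds \<Longrightarrow> f c = f d \<Longrightarrow> map f cs = map f ds"
  by (induct rule: near.induct) auto

lemma near_length: "near c d cs ds \<Longrightarrow> length cs = length ds"
  by (induct rule: near.induct) auto

text \<open>Under the environment \<open>[c, d]\<close> this says that \<open>c\<close> and \<open>d\<close> name the same element.\<close>

definition q0 :: "(nat, nat) fm" where "q0 = Eq (Var 0) (Var 1)"

abbreviation lit :: "sfm \<Rightarrow> 'c list \<Rightarrow> bool \<times> (nat, nat) fm \<times> 'c list" where
  "lit k e \<equiv> (fst k, snd k, e)"

abbreviation nlit :: "sfm \<Rightarrow> 'c list \<Rightarrow> bool \<times> (nat, nat) fm \<times> 'c list" where
  "nlit k e \<equiv> (\<not> fst k, snd k, e)"

text \<open>The constants are elements of an arbitrary type. \<open>fnc\<close> names function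
  values and \<open>wit\<close> names Henkin witnesses; a freeness property is demanded of them only
  where the clauses are to be satisfied in a given structure.\<close>

locale henkin =
  fixes L :: "(nat, nat) lang"
    and fnc :: "nat \<Rightarrow> 'c list \<Rightarrow> 'c" and wit :: "sfm \<Rightarrow> 'c list \<Rightarrow> 'c"
begin

primrec val :: "'c list \<Rightarrow> nat tm \<Rightarrow> 'c" where
  "val e (Var i) = e ! i"
| "val e (Fn f ts) = fnc f (map (val e) ts)"

text \<open>No clause has more than three literals, which the arithmetical coding by triples relies
  on. Only the unit clauses depend on \<open>T\<close>. Equations are reduced to \<open>q0\<close>
  between constants, and \<open>cl_rel\<close> makes the truth of a relational atom depend only on
  the values of its arguments.\<close>

inductive_set clauses :: "(sfm \<times> 'c list) set \<Rightarrow> (bool \<times> (nat, nat) fm \<times> 'c list) list set"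
  for T where
  cl_unit: "(k, e) \<in> T \<Longrightarrow> [lit k e] \<in> clauses T"
| cl_conj1: "conjS k k1 k2 \<Longrightarrow> formula_of L (snd k) \<Longrightarrow> [nlit k e, lit k1 e] \<in> clauses T"
| cl_conj2: "conjS k k1 k2 \<Longrightarrow> formula_of L (snd k) \<Longrightarrow> [nlit k e, lit k2 e] \<in> clauses T"
| cl_disj: "disjS k k1 k2 \<Longrightarrow> formula_of L (snd k) \<Longrightarrow> [nlit k e, lit k1 e, lit k2 e] \<in> clauses T"
| cl_ex: "exS k k' \<Longrightarrow> formula_of L (snd k) \<Longrightarrow> [nlit k e, lit k' (wit k' e # e)] \<in> clauses T"
| cl_all: "allS k k' \<Longrightarrow> formula_of L (snd k) \<Longrightarrow> [nlit k e, lit k' (c # e)] \<in> clauses T"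
| cl_eq: "wf_tm L (length e) t \<Longrightarrow> wf_tm L (length e) u \<Longrightarrow>
    [nlit (s, Eq t u) e, lit (s, q0) [val e t, val e u]] \<in> clauses T"
| cl_refl: "[lit (True, q0) [c, c]] \<in> clauses T"
| cl_eucl: "[nlit (True, q0) [c, d], nlit (True, q0) [c, d'], lit (True, q0) [d, d']] \<in> clauses T"
| cl_fun: "near c d cs ds \<Longrightarrow> [nlit (True, q0) [c, d], lit (True, q0) [fnc f cs, fnc f ds]] \<in> clauses T"
| cl_rel: "(R, length ts) \<in> rels L \<Longrightarrow> list_all (wf_tm L (length e)) ts \<Longrightarrow>
    list_all (wf_tm L (length e')) ts' \<Longrightarrow> near c d (map (val e) ts) (map (val e') ts') \<Longrightarrow>
    [nlit (True, q0) [c, d], nlit (True, Rel R ts) e, lit (True, Rel R ts') e'] \<in> clauses T"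

text \<open>The term model: its elements are representatives of the constants modulo the equalities
  true in \<open>X\<close>. The logical clauses are the induction steps of the truth lemma
  \<open>main\<close>.\<close>

theorem model_existence:
  assumes X: "\<forall>c\<in>clauses T. csat X c"
  shows "\<exists>(K :: (nat, nat, 'c) struct) \<rho>. total K \<and> range \<rho> = dom K \<and>
    (\<forall>(k, e)\<in>T. \<forall>v. wf_fm L (length e) (snd k) \<longrightarrow> range v \<subseteq> dom K \<longrightarrow>
      (\<forall>i<length e. v i = \<rho> (e ! i)) \<longrightarrow> ssat K v k)"
proof -
  define E where "E c d \<longleftrightarrow> (q0, [c, d]) \<in> X" for c d
  note cs = bspec[OF X, unfolded csat_def, simplified]
  have E_refl: "E c c" for c using cs[OF cl_refl, of c] by (simp add: E_def)
  have E_eucl: "E c d \<Longrightarrow> E c d' \<Longrightarrow> E d d'" for c d d'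
    using cs[OF cl_eucl, of c d d'] by (auto simp: E_def)
  define \<rho> where "\<rho> c = (SOME d. E c d)" for c
  have E\<rho>: "E c (\<rho> c)" for c unfolding \<rho>_def by (rule someI[of _ c]) (rule E_refl)
  \<comment> \<open>A reflexive Euclidean relation is an equivalence relation, so equivalent
    constants have the same candidates in the choice of \<open>\<rho>\<close>.\<close>
  have E_eq: "E c d \<longleftrightarrow> \<rho> c = \<rho> d" for c d
  proof
    assume "E c d"
    then have "E c x \<longleftrightarrow> E d x" for x by (meson E_eucl E_refl)
    then show "\<rho> c = \<rho> d" by (simp add: \<rho>_def)
  next
    assume "\<rho> c = \<rho> d"
    then show "E c d" by (metis E\<rho> E_eucl E_refl)
  qed
  have E_fun1: "E c d \<Longrightarrow> near c d cs ds \<Longrightarrow> E (fnc f cs) (fnc f ds)" for c d cs ds f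
    using cs[OF cl_fun, of c d cs ds f] by (auto simp: E_def)
  \<comment> \<open>The prefix \<open>xs\<close> holds the places that have been replaced already,
    so one-place congruence can be applied from left to right.\<close>
  have E_fun: "list_all2 E cs ds \<Longrightarrow> E (fnc f (xs @ cs)) (fnc f (xs @ ds))" for cs ds xs f
  proof (induct arbitrary: xs rule: list_all2_induct)
    case Nil
    then show ?case by (simp add: E_refl)
  next
    case (Cons c cs d ds)
    have "E (fnc f (xs @ c # cs)) (fnc f (xs @ d # cs))"
      by (rule E_fun1[OF Cons(1) near_append])
    moreover have "E (fnc f (xs @ d # cs)) (fnc f (xs @ d # ds))"
      using Cons(3)[of "xs @ [d]"] by simp
    ultimately show ?case by (simp add: E_eq)
  qed
  \<comment> \<open>The relations of \<open>K\<close> take constants, while the atoms in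
    \<open>X\<close> carry terms under environments. Any presentation of the constants as values of
    terms may be used, since \<open>cl_rel\<close> makes all presentations agree.\<close>
  define P where "P R cs \<longleftrightarrow> (\<exists>ts e. (R, length ts) \<in> rels L \<and> list_all (wf_tm L (length e)) ts \<and>
    map (val e) ts = cs \<and> (Rel R ts, e) \<in> X)" for R cs
  have X_near: "(Rel R ts', e') \<in> X" if "(Rel R ts, e) \<in> X" "E c d" "(R, length ts) \<in> rels L"
    "list_all (wf_tm L (length e)) ts" "list_all (wf_tm L (length e')) ts'"
    "near c d (map (val e) ts) (map (val e') ts')" for R ts e ts' e' c d
    using cs[OF cl_rel[OF that(3-6)]] that(1,2) by (auto simp: E_def)
  have P_near: "P R ds" if "P R cs" "E c d" "near c d cs ds" for R c d cs ds
  proof -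
    from \<open>P R cs\<close> obtain ts e where te: "(R, length ts) \<in> rels L" "list_all (wf_tm L (length e)) ts"
      "map (val e) ts = cs" "(Rel R ts, e) \<in> X" by (auto simp: P_def)
    \<comment> \<open>The variables under the environment \<open>ds\<close> are the canonical
      presentation of \<open>ds\<close>.\<close>
    have vs: "map (val ds) (map Var [0..<length ds]) = ds"
      by (intro nth_equalityI) simp_all
    have wv: "list_all (wf_tm L (length ds)) (map Var [0..<length ds])" by (simp add: list_all_iff)
    have "(Rel R (map Var [0..<length ds]), ds) \<in> X"
      using X_near[OF te(4) that(2) te(1,2) wv] that(3) te(3) vs by simp
    moreover have "length ds = length ts" using near_length[OF that(3)] te(3) by auto
    ultimately show ?thesis unfolding P_def using te(1) wv vs
      by (intro exI[of _ "map Var [0..<length ds]"] exI[of _ ds]) simp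
  qed
  have P_X: "(Rel R ts, e) \<in> X \<longleftrightarrow> P R (map (val e) ts)"
    if "(R, length ts) \<in> rels L" "list_all (wf_tm L (length e)) ts" for R ts e
  proof
    assume "P R (map (val e) ts)"
    then obtain ts' e' where te: "(R, length ts') \<in> rels L" "list_all (wf_tm L (length e')) ts'"
      "map (val e') ts' = map (val e) ts" "(Rel R ts', e') \<in> X" by (auto simp: P_def)
    \<comment> \<open>The two value lists coincide, so \<open>cl_rel\<close> applies with the
      trivial equality of \<open>c\<close> with itself.\<close>
    have "near c c (map (val e') ts') (map (val e) ts)" for c
      unfolding te(3) by (rule near_same)
    then show "(Rel R ts, e) \<in> X" using X_near[OF te(4) E_refl te(1,2) that(2)] by blast
  qed (use that in \<open>auto simp: P_def\<close>)
  have P_all: "list_all2 E cs ds \<Longrightarrow> P R (xs @ cs) \<Longrightarrow> P R (xs @ ds)" for cs ds xs R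
  proof (induct arbitrary: xs rule: list_all2_induct)
    case (Cons c cs d ds)
    have "P R (xs @ d # cs)"
      by (rule P_near[OF Cons(4) Cons(1) near_append])
    then show ?case using Cons(3)[of "xs @ [d]"] by simp
  qed simp
  have E_map: "list_all2 E cs (map \<rho> cs)" "list_all2 E (map \<rho> cs) cs" for cs
    using E\<rho> by (simp_all add: list_all2_map2 list_all2_map1 list_all2_same) (metis E_eq)+
  have P_map: "P R (map \<rho> cs) \<longleftrightarrow> P R cs" for R cs
    using P_all[of cs "map \<rho> cs" R "[]"] P_all[of "map \<rho> cs" cs R "[]"] E_map by auto
  define K :: "(nat, nat, 'c) struct" where
    "K = \<lparr>dom = range \<rho>, fun_of = \<lambda>f xs. \<rho> (fnc f xs), rel_of = P\<rparr>"
  have K: "dom K = range \<rho>" "fun_of K f xs = \<rho> (fnc f xs)" "rel_of K R xs = P R xs" for f xs R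
    by (simp_all add: K_def)
  have ev: "wf_tm L (length e) t \<Longrightarrow> \<forall>i<length e. v i = \<rho> (e ! i) \<Longrightarrow> eval_tm K v t = \<rho> (val e t)"
    for e v t
  proof (induct t)
    case (Fn f ts)
    then have "map (eval_tm K v) ts = map \<rho> (map (val e) ts)" by (simp add: list_all_iff)
    then have "eval_tm K v (Fn f ts) = \<rho> (fnc f (map \<rho> (map (val e) ts)))"
      by (simp add: K del: map_map map_eq_conv)
    also have "\<dots> = \<rho> (fnc f (map (val e) ts))"
      using E_fun[of "map \<rho> (map (val e) ts)" "map (val e) ts" f "[]"] E_map(2)[of "map (val e) ts"]
      by (simp add: E_eq del: map_map map_eq_conv)
    finally show ?case by simp
  qed simp
  have main: "wf_fm L (length e) \<phi> \<Longrightarrow> \<forall>i<length e. v i = \<rho> (e ! i) \<Longrightarrow> (\<phi>, e) \<in> X \<longleftrightarrow> sat K v \<phi>"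
    for e v \<phi>
  proof (induct \<phi> arbitrary: e v)
    case (Eq s t)
    have "(Eq s t, e) \<in> X \<longleftrightarrow> E (val e s) (val e t)"
      using cs[OF cl_eq, of e s t True] cs[OF cl_eq, of e s t False] Eq by (auto simp: E_def)
    also have "\<dots> \<longleftrightarrow> sat K v (Eq s t)" using Eq ev[of e s v] ev[of e t v] by (simp add: E_eq)
    finally show ?case .
  next
    case (Rel R ts)
    have "map (eval_tm K v) ts = map \<rho> (map (val e) ts)" using Rel by (simp add: list_all_iff ev)
    then show ?case using Rel P_X[of R ts e] P_map[of R "map (val e) ts"]
      by (simp add: K del: map_map map_eq_conv)
  next
    case (Neg p)
    have fo: "formula_of L (Neg p)" using Neg by (auto simp: formula_of_def)
    show ?case using Neg fo cs[OF cl_conj1[OF conjS.intros(3), of True p e]]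
        cs[OF cl_conj1[OF conjS.intros(3), of False p e]] by auto
  next
    case (And p q)
    have fo: "formula_of L (And p q)" using And(3) by (auto simp: formula_of_def)
    show ?case using And fo cs[OF cl_conj1[OF conjS.intros(1), of p q e]]
        cs[OF cl_conj2[OF conjS.intros(1), of p q e]] cs[OF cl_disj[OF disjS.intros(2), of p q e]] by auto
  next
    case (Or p q)
    have fo: "formula_of L (Or p q)" using Or(3) by (auto simp: formula_of_def)
    show ?case using Or fo cs[OF cl_conj1[OF conjS.intros(2), of p q e]]
        cs[OF cl_conj2[OF conjS.intros(2), of p q e]] cs[OF cl_disj[OF disjS.intros(1), of p q e]] by auto
  next
    case (Ex p)
    have fo: "formula_of L (Ex p)" using Ex(2) by (auto simp: formula_of_def)
    have IH: "(p, c # e) \<in> X \<longleftrightarrow> sat K (case_nat (\<rho> c) v) p" for c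
      using Ex by (intro Ex(1)) (auto split: nat.split)
    have "(Ex p, e) \<in> X \<longleftrightarrow> (\<exists>c. (p, c # e) \<in> X)"
      using fo cs[OF cl_ex[OF exS.intros(1), of p e]] cs[OF cl_all[OF allS.intros(2), of p e]] by auto
    then show ?case by (auto simp: IH K)
  next
    case (All p)
    have fo: "formula_of L (All p)" using All(2) by (auto simp: formula_of_def)
    have IH: "(p, c # e) \<in> X \<longleftrightarrow> sat K (case_nat (\<rho> c) v) p" for c
      using All by (intro All(1)) (auto split: nat.split)
    have "(All p, e) \<in> X \<longleftrightarrow> (\<forall>c. (p, c # e) \<in> X)"
      using fo cs[OF cl_ex[OF exS.intros(2), of p e]] cs[OF cl_all[OF allS.intros(1), of p e]] by auto
    then show ?case by (auto simp: IH K)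
  qed
  have "total K" by (auto simp: total_def K)
  moreover have "ssat K v k" if "(k, e) \<in> T" "wf_fm L (length e) (snd k)"
    "\<forall>i<length e. v i = \<rho> (e ! i)" for k e v
    using cs[OF cl_unit[OF that(1)]] main[OF that(2,3)] by (simp add: ssat_def)
  ultimately show ?thesis using K(1) by (intro exI[of _ K] exI[of _ \<rho>]) auto
qed

text \<open>The assumption \<open>free\<close> is the universal property of a term algebra: values
  for parameters, function constants and witnesses may be prescribed. Prescribing Skolem functions
  for the witnesses makes every clause true in \<open>N\<close>.\<close>

theorem clauses_satisfiable:
  fixes N :: "(nat, nat, 'n) struct" and par :: "'p \<Rightarrow> 'c"
  assumes free: "\<And>D (hp :: 'p \<Rightarrow> 'n) hf hw. range hp \<subseteq> D \<Longrightarrow> (\<And>f xs. hf f xs \<in> D) \<Longrightarrow> (\<And>k xs. hw k xs \<in> D) \<Longrightarrow>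
      \<exists>I. range I \<subseteq> D \<and> (\<forall>p. I (par p) = hp p) \<and> (\<forall>f cs. I (fnc f cs) = hf f (map I cs)) \<and>
        (\<forall>k cs. I (wit k cs) = hw k (map I cs))"
    and N: "total N" and hp: "range hp \<subseteq> dom N" and a0: "a0 \<in> dom N"
    and T: "\<And>k e. (k, e) \<in> T \<Longrightarrow> \<exists>ps. e = map par ps \<and> ssat N (ext (map hp ps) (\<lambda>_. a0)) k"
  shows "\<exists>X. \<forall>c\<in>clauses T. csat X c"
proof -
  \<comment> \<open>The default \<open>a0\<close> keeps the value in \<open>dom N\<close> for all
    argument lists, as \<open>free\<close> demands.\<close>
  define hf where "hf f xs = (if set xs \<subseteq> dom N then fun_of N f xs else a0)" for f xs
  define hw where "hw k xs = (SOME a. a \<in> dom N \<and>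
    ((\<exists>a\<in>dom N. ssat N (case_nat a (ext xs (\<lambda>_. a0))) k) \<longrightarrow> ssat N (case_nat a (ext xs (\<lambda>_. a0))) k))" for k xs
  have hw: "hw k xs \<in> dom N \<and> ((\<exists>a\<in>dom N. ssat N (case_nat a (ext xs (\<lambda>_. a0))) k) \<longrightarrow>
    ssat N (case_nat (hw k xs) (ext xs (\<lambda>_. a0))) k)" for k xs
    unfolding hw_def by (rule someI_ex) (use a0 in blast)
  have hf: "hf f xs \<in> dom N" for f xs using N a0 by (auto simp: hf_def total_def)
  obtain I where I: "range I \<subseteq> dom N" "\<forall>p. I (par p) = hp p" "\<forall>f cs. I (fnc f cs) = hf f (map I cs)"
    "\<forall>k cs. I (wit k cs) = hw k (map I cs)"
    using free[of hp "dom N" hf hw] hp hf hw by blast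
  have If: "I (fnc f cs) = fun_of N f (map I cs)" for f cs using I(1,3) by (auto simp: hf_def)
  define V where "V e = ext (map I e) (\<lambda>_. a0)" for e
  have V_Cons: "V (c # e) = case_nat (I c) (V e)" for c e
    by (rule ext) (auto simp: V_def ext_def split: nat.split)
  have V_nth: "i < length e \<Longrightarrow> V e i = I (e ! i)" for e i by (simp add: V_def ext_nth)
  have ev: "wf_tm L (length e) t \<Longrightarrow> eval_tm N (V e) t = I (val e t)" for e t
  proof (induct t)
    case (Fn f ts)
    then have "map (eval_tm N (V e)) ts = map I (map (val e) ts)" by (simp add: list_all_iff)
    then show ?case by (simp add: If del: map_map map_eq_conv)
  qed (simp add: V_nth)
  have evs: "map (eval_tm N (V e)) ts = map I (map (val e) ts)" if "list_all (wf_tm L (length e)) ts" for e ts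
    using that by (simp add: list_all_iff ev)
  \<comment> \<open>Environments are completed by \<open>a0\<close>. Thus atoms whose environment is
    too short for the formula, which the clauses admit, get a consistent truth value too.\<close>
  define X where "X = {(\<phi>, e). sat N (V e) \<phi>}"
  have q: "(q0, [c, d]) \<in> X \<longleftrightarrow> I c = I d" for c d
    by (simp add: X_def q0_def V_nth)
  have l1: "csat X [lit k e] \<longleftrightarrow> ssat N (V e) k" for k e by (simp add: csat_def X_def ssat_def)
  have l2: "csat X [nlit k e, lit k1 e1] \<longleftrightarrow> (ssat N (V e) k \<longrightarrow> ssat N (V e1) k1)" for k e k1 e1
    by (auto simp: csat_def X_def ssat_def)
  have l3: "csat X [nlit k e, lit k1 e1, lit k2 e2] \<longleftrightarrow>
      (ssat N (V e) k \<longrightarrow> ssat N (V e1) k1 \<or> ssat N (V e2) k2)" for k e k1 e1 k2 e2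
    by (auto simp: csat_def X_def ssat_def)
  have "csat X c" if "c \<in> clauses T" for c
    using that
  proof cases
    case (cl_unit k e)
    then show ?thesis using T[OF cl_unit(2)] I(2) by (auto simp only: cl_unit(1) l1 V_def map_map comp_def)
  next
    case (cl_conj1 k k1 k2 e)
    then show ?thesis using ssat_conj[OF cl_conj1(2)] by (simp only: cl_conj1(1) l2 l3) blast
  next
    case (cl_conj2 k k1 k2 e)
    then show ?thesis using ssat_conj[OF cl_conj2(2)] by (simp only: cl_conj2(1) l2 l3) blast
  next
    case (cl_disj k k1 k2 e)
    then show ?thesis using ssat_disj[OF cl_disj(2)] by (simp only: cl_disj(1) l2 l3) blast
  next
    case (cl_ex k k' e)
    have "ssat N (V e) k \<Longrightarrow> ssat N (V (wit k' e # e)) k'"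
      using ssat_ex[OF cl_ex(2), of N "V e"] hw[of k' "map I e", folded V_def] I(4)[rule_format, of k' e]
      by (simp add: V_Cons)
    then show ?thesis by (simp only: cl_ex(1) l2) blast
  next
    case (cl_all k k' e c)
    have "ssat N (V e) k \<Longrightarrow> ssat N (V (c # e)) k'"
      using ssat_all[OF cl_all(2), of N "V e"] I(1) by (auto simp: V_Cons)
    then show ?thesis by (simp only: cl_all(1) l2) blast
  next
    case (cl_eq e t u s)
    then show ?thesis using q[of "val e t" "val e u"] ev by (auto simp: csat_def X_def)
  next
    case (cl_refl c)
    then show ?thesis using q by (simp add: csat_def)
  next
    case (cl_eucl c d d')
    then show ?thesis using q by (auto simp: csat_def)
  next
    case (cl_fun c d cs ds f)
    then show ?thesis using q near_map[OF cl_fun(2), of I] by (auto simp: csat_def If simp del: map_eq_conv)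
  next
    case (cl_rel R ts e e' ts' c d)
    have "I c = I d \<Longrightarrow> sat N (V e) (Rel R ts) \<longleftrightarrow> sat N (V e') (Rel R ts')"
      using near_map[OF cl_rel(5), of I] evs[OF cl_rel(3)] evs[OF cl_rel(4)]
      by (simp del: map_eq_conv map_map)
    then show ?thesis using cl_rel(1) q by (auto simp: csat_def X_def simp del: sat.simps)
  qed
  then show ?thesis by blast
qed

lemma clauses_decomp: "c \<in> clauses T \<Longrightarrow> (\<exists>(k, e)\<in>T. c = [lit k e]) \<or> c \<in> clauses {}"
proof (induct rule: clauses.induct)
  case (cl_unit k e)
  then show ?case by blast
qed (rule disjI2, rule clauses.intros; assumption)+

lemma clauses_mono_empty: "c \<in> clauses {} \<Longrightarrow> c \<in> clauses T"
proof (induct rule: clauses.induct)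
  case (cl_unit k e)
  then show ?case by blast
qed (rule clauses.intros; assumption)+

lemma clauses_mono: "T \<subseteq> T' \<Longrightarrow> clauses T \<subseteq> clauses T'"
  using clauses_decomp clauses_mono_empty cl_unit by blast

lemma clauses_compact:
  assumes "finite F" "F \<subseteq> clauses T"
  shows "\<exists>T0. finite T0 \<and> T0 \<subseteq> T \<and> F \<subseteq> clauses T0"
  using assms
proof (induct F)
  case (insert c F)
  then obtain T0 where T0: "finite T0" "T0 \<subseteq> T" "F \<subseteq> clauses T0" by auto
  have "\<exists>T1. finite T1 \<and> T1 \<subseteq> T \<and> c \<in> clauses T1"
  proof (cases "c \<in> clauses {}")
    case True
    then show ?thesis by (intro exI[of _ "{}"]) simp
  next
    case False
    then obtain k e where ke: "(k, e) \<in> T" "c = [lit k e]" using clauses_decomp[of c T] insert by auto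
    then show ?thesis using cl_unit[of k e "{(k, e)}"] by (intro exI[of _ "{(k, e)}"]) simp
  qed
  then obtain T1 where "finite T1" "T1 \<subseteq> T" "c \<in> clauses T1" by blast
  then show ?case using T0 clauses_mono[of T0 "T0 \<union> T1"] clauses_mono[of T1 "T0 \<union> T1"]
    by (intro exI[of _ "T0 \<union> T1"]) auto
qed auto

end

section \<open>Definable relations\<close>

locale defmodel =
  fixes L' :: "(nat, nat) lang" and M :: "(nat, nat, 'a) struct"
  assumes stM: "structure_for L' M"
begin

abbreviation "D \<equiv> dom M"

text \<open>Definability with parameters, stated for predicates on assignments rather than for
  formulas, so that it can be derived by introduction rules along the shape of a predicate.\<close>

definition dfn :: "((nat \<Rightarrow> 'a) \<Rightarrow> bool) \<Rightarrow> bool" where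
  "dfn P \<longleftrightarrow> (\<exists>\<psi> k. wf_fm (lang_diag L' M) k \<psi> \<and> (\<forall>v. range v \<subseteq> D \<longrightarrow> (sat (struct_diag M) v \<psi> \<longleftrightarrow> P v)))"

text \<open>The arguments at which definable relations get evaluated: variables and parameters. Both
  remain of this kind under the shift of variables in \<open>dfn_ex\<close>.\<close>

definition pt :: "((nat \<Rightarrow> 'a) \<Rightarrow> 'a) \<Rightarrow> bool" where
  "pt f \<longleftrightarrow> (\<exists>j. f = (\<lambda>v. v j)) \<or> (\<exists>a\<in>D. f = (\<lambda>_. a))"

lemma pt_var: "pt (\<lambda>v. v j)" and pt_const: "a \<in> D \<Longrightarrow> pt (\<lambda>_. a)"
  by (auto simp: pt_def)

lemma pt_in: "pt f \<Longrightarrow> range v \<subseteq> D \<Longrightarrow> f v \<in> D"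
  by (auto simp: pt_def)

lemma dfn_cong: "dfn P \<Longrightarrow> (\<And>v. range v \<subseteq> D \<Longrightarrow> P v \<longleftrightarrow> Q v) \<Longrightarrow> dfn Q"
  unfolding dfn_def by metis

lemma dfn_not: "dfn P \<Longrightarrow> dfn (\<lambda>v. \<not> P v)"
proof -
  assume "dfn P"
  then obtain \<psi> k where "wf_fm (lang_diag L' M) k \<psi>"
    "\<forall>v. range v \<subseteq> D \<longrightarrow> (sat (struct_diag M) v \<psi> \<longleftrightarrow> P v)" by (auto simp: dfn_def)
  then show ?thesis unfolding dfn_def by (intro exI[of _ "Neg \<psi>"] exI[of _ k]) simp
qed

lemma dfn_conj: "dfn P \<Longrightarrow> dfn Q \<Longrightarrow> dfn (\<lambda>v. P v \<and> Q v)"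
proof -
  assume "dfn P" "dfn Q"
  then obtain \<psi> k \<psi>' k' where "wf_fm (lang_diag L' M) k \<psi>"
    "\<forall>v. range v \<subseteq> D \<longrightarrow> (sat (struct_diag M) v \<psi> \<longleftrightarrow> P v)" "wf_fm (lang_diag L' M) k' \<psi>'"
    "\<forall>v. range v \<subseteq> D \<longrightarrow> (sat (struct_diag M) v \<psi>' \<longleftrightarrow> Q v)" unfolding dfn_def by blast
  then show ?thesis unfolding dfn_def
    by (intro exI[of _ "And \<psi> \<psi>'"] exI[of _ "max k k'"]) (auto intro: wf_fm_mono)
qed

lemma dfn_ex: "dfn (\<lambda>v. Q (\<lambda>i. v (Suc i)) (v 0)) \<Longrightarrow> dfn (\<lambda>v. \<exists>a\<in>D. Q v a)"
proof -
  assume "dfn (\<lambda>v. Q (\<lambda>i. v (Suc i)) (v 0))"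
  then obtain \<psi> k where *: "wf_fm (lang_diag L' M) k \<psi>"
    "\<And>v. range v \<subseteq> D \<Longrightarrow> sat (struct_diag M) v \<psi> \<longleftrightarrow> Q (\<lambda>i. v (Suc i)) (v 0)" unfolding dfn_def by blast
  have "sat (struct_diag M) v (Ex \<psi>) \<longleftrightarrow> (\<exists>a\<in>D. Q v a)" if "range v \<subseteq> D" for v
    using *(2)[of "case_nat _ v"] that by (simp add: range_case_nat)
  moreover have "wf_fm (lang_diag L' M) k (Ex \<psi>)" using wf_fm_mono[OF *(1), of "Suc k"] by simp
  ultimately show ?thesis unfolding dfn_def by (intro exI conjI allI impI)
qed

lemma dfn_disj: "dfn P \<Longrightarrow> dfn Q \<Longrightarrow> dfn (\<lambda>v. P v \<or> Q v)"
proof -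
  assume a: "dfn P" "dfn Q"
  have "dfn (\<lambda>v. \<not> (\<not> P v \<and> \<not> Q v))" by (intro dfn_not dfn_conj a)
  then show ?thesis by (rule dfn_cong) blast
qed

lemma dfn_imp: "dfn P \<Longrightarrow> dfn Q \<Longrightarrow> dfn (\<lambda>v. P v \<longrightarrow> Q v)"
proof -
  assume a: "dfn P" "dfn Q"
  have "dfn (\<lambda>v. \<not> (P v \<and> \<not> Q v))" by (intro dfn_not dfn_conj a)
  then show ?thesis by (rule dfn_cong) blast
qed

lemma dfn_iff: "dfn P \<Longrightarrow> dfn Q \<Longrightarrow> dfn (\<lambda>v. P v \<longleftrightarrow> Q v)"
proof -
  assume a: "dfn P" "dfn Q"
  have "dfn (\<lambda>v. (P v \<longrightarrow> Q v) \<and> (Q v \<longrightarrow> P v))" by (intro dfn_conj dfn_imp a)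
  then show ?thesis by (rule dfn_cong) blast
qed

lemma dfn_all: "dfn (\<lambda>v. Q (\<lambda>i. v (Suc i)) (v 0)) \<Longrightarrow> dfn (\<lambda>v. \<forall>a\<in>D. Q v a)"
proof -
  assume a: "dfn (\<lambda>v. Q (\<lambda>i. v (Suc i)) (v 0))"
  have "dfn (\<lambda>v. \<not> (\<exists>a\<in>D. \<not> Q v a))" by (intro dfn_not dfn_ex a)
  then show ?thesis by (rule dfn_cong) blast
qed

lemma pt_term: "pt f \<Longrightarrow> \<exists>t k. wf_tm (lang_diag L' M) k t \<and> (\<forall>v. eval_tm (struct_diag M) v t = f v)"
  unfolding pt_def
proof (elim disjE exE bexE)
  fix j assume "f = (\<lambda>v. v j)"
  then show ?thesis by (intro exI[of _ "Var j"] exI[of _ "Suc j"]) simp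
next
  fix a assume "a \<in> D" "f = (\<lambda>_. a)"
  then show ?thesis by (intro exI[of _ "Fn (Inr a) []"]) simp
qed

lemma dfn_subst:
  assumes "dfn P" "\<And>i. pt (f i)"
  shows "dfn (\<lambda>v. P (\<lambda>i. f i v))"
proof -
  obtain \<psi> k where *: "wf_fm (lang_diag L' M) k \<psi>"
    "\<And>v. range v \<subseteq> D \<Longrightarrow> sat (struct_diag M) v \<psi> \<longleftrightarrow> P v" using assms(1) unfolding dfn_def by blast
  obtain t m where t: "\<And>i. wf_tm (lang_diag L' M) (m i) (t i)" "\<And>i v. eval_tm (struct_diag M) v (t i) = f i v"
    using pt_term[OF assms(2)] by metis
  \<comment> \<open>The sum of the individual bounds serves as a common bound for the free
    variables.\<close>
  have "wf_tm (lang_diag L' M) (sum m {..<k}) (t i)" if "i < k" for i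
    by (rule wf_tm_mono[OF t(1)]) (use that in \<open>simp add: member_le_sum\<close>)
  then have "wf_fm (lang_diag L' M) (sum m {..<k}) (subst t \<psi>)" using *(1) by (blast intro: wf_fm_subst)
  moreover have "sat (struct_diag M) v (subst t \<psi>) \<longleftrightarrow> P (\<lambda>i. f i v)" if "range v \<subseteq> D" for v
  proof -
    have "range (\<lambda>i. f i v) \<subseteq> D" using pt_in[OF assms(2) that] by blast
    then show ?thesis using *(2)[of "\<lambda>i. f i v"] by (simp add: sat_subst t(2))
  qed
  ultimately show ?thesis unfolding dfn_def by (intro exI conjI allI impI)
qed

lemma dfn_eq: "pt f \<Longrightarrow> pt g \<Longrightarrow> dfn (\<lambda>v. f v = g v)"
proof -
  assume "pt f" "pt g"
  from pt_term[OF this(1)] pt_term[OF this(2)] obtain t k u m where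
    "wf_tm (lang_diag L' M) k t" "\<forall>v. eval_tm (struct_diag M) v t = f v"
    "wf_tm (lang_diag L' M) m u" "\<forall>v. eval_tm (struct_diag M) v u = g v" by blast
  then show ?thesis unfolding dfn_def
    by (intro exI[of _ "Eq t u"] exI[of _ "max k m"]) (auto intro: wf_tm_mono)
qed

lemma dfn_True: "dfn (\<lambda>_. b)"
  by (cases b) (use dfn_eq[OF pt_var pt_var, of 0 0] dfn_not[OF dfn_eq[OF pt_var pt_var, of 0 0]] in simp_all)

lemma dfn_fm: "wf_fm L' k \<psi> \<Longrightarrow> dfn (\<lambda>v. sat M v \<psi>)"
  unfolding dfn_def by (intro exI[of _ "map_fm Inl id \<psi>"] exI[of _ k]) (simp add: wf_map_fm sat_map_fm)

lemmas dfn_intros = pt_var pt_const dfn_not dfn_conj dfn_disj dfn_imp dfn_iff dfn_ex dfn_all dfn_eq dfn_True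

text \<open>Definability of a relation is to be checked at the first few variables only; this lemma
  and its companions transport it to other arguments.\<close>

lemma dfn_inst1: "dfn (\<lambda>v. R (v 0)) \<Longrightarrow> pt f \<Longrightarrow> dfn (\<lambda>v. R (f v))"
  using dfn_subst[of "\<lambda>v. R (v 0)" "\<lambda>i. f"] by simp

lemma dfn_inst2: "dfn (\<lambda>v. R (v 0) (v 1)) \<Longrightarrow> pt f \<Longrightarrow> pt g \<Longrightarrow> dfn (\<lambda>v. R (f v) (g v))"
  using dfn_subst[of "\<lambda>v. R (v 0) (v 1)" "\<lambda>i. if i = 0 then f else g"] by simp

lemma dfn_inst3: "dfn (\<lambda>v. R (v 0) (v 1) (v 2)) \<Longrightarrow> pt f \<Longrightarrow> pt g \<Longrightarrow> pt h \<Longrightarrow> dfn (\<lambda>v. R (f v) (g v) (h v))"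
  using dfn_subst[of "\<lambda>v. R (v 0) (v 1) (v 2)" "\<lambda>i. if i = 0 then f else if i = 1 then g else h"] by simp

lemma dfn_inst4: "dfn (\<lambda>v. R (v 0) (v 1) (v 2) (v 3)) \<Longrightarrow> pt f \<Longrightarrow> pt g \<Longrightarrow> pt h \<Longrightarrow> pt k \<Longrightarrow>
    dfn (\<lambda>v. R (f v) (g v) (h v) (k v))"
  using dfn_subst[of "\<lambda>v. R (v 0) (v 1) (v 2) (v 3)"
      "\<lambda>i. if i = 0 then f else if i = 1 then g else if i = 2 then h else k"] by simp

end

text \<open>\<open>E\<close> is the membership relation that sequentiality provides and
  \<open>Q\<close> the arithmetic that \<open>N\<close> defines. Membership is not assumed to be
  extensional, so a set may have several codes.\<close>

locale seqmodel = defmodel L' M + interp_struct N lang_S12 L' M Q r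
  for L' :: "(nat, nat) lang" and M :: "(nat, nat, 'a) struct"
    and N :: "(ba_fun, ba_rel, nat, nat) trans" and Q :: "(ba_fun, ba_rel, 'a) struct" and r +
  fixes E :: "'a \<Rightarrow> 'a \<Rightarrow> bool"
  assumes E_dfn0: "dfn (\<lambda>v. E (v 0) (v 1))"
    and E_empty: "\<exists>s\<in>dom M. \<forall>x\<in>dom M. \<not> E x s"
    and E_adj: "\<And>s y. s \<in> dom M \<Longrightarrow> y \<in> dom M \<Longrightarrow> \<exists>t\<in>dom M. \<forall>x\<in>dom M. E x t \<longleftrightarrow> E x s \<or> x = y"
    and basic: "\<And>\<phi> v. \<phi> \<in> BASIC \<Longrightarrow> range v \<subseteq> dom Q \<Longrightarrow> sat Q v \<phi>"
begin

lemmas E_dfn = dfn_inst2[of E, OF E_dfn0]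

lemma finite_set_code:
  assumes "finite C" "C \<subseteq> D"
  shows "\<exists>s\<in>D. \<forall>x\<in>D. E x s \<longleftrightarrow> x \<in> C"
  using assms
proof (induct C)
  case (insert y C)
  then obtain s where s: "s \<in> D" "\<forall>x\<in>D. E x s \<longleftrightarrow> x \<in> C" by auto
  obtain t where "t \<in> D" "\<forall>x\<in>D. E x t \<longleftrightarrow> E x s \<or> x = y" using E_adj[OF s(1), of y] insert by auto
  then show ?case using s(2) by (intro bexI[of _ t]) auto
qed (use E_empty in simp)

subsection \<open>Pairs\<close>

definition upair :: "'a \<Rightarrow> 'a \<Rightarrow> 'a \<Rightarrow> bool" where
  "upair a b u \<longleftrightarrow> (\<forall>x\<in>D. E x u \<longleftrightarrow> x = a \<or> x = b)"

text \<open>Kuratowski pairs. Without extensionality singletons and pairs need not have unique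
  codes, so pairing is a relation. Still a code \<open>p\<close> determines its members
  \<open>s\<close> and \<open>t\<close>, and these determine both components.\<close>

definition pr :: "'a \<Rightarrow> 'a \<Rightarrow> 'a \<Rightarrow> bool" where
  "pr a b p \<longleftrightarrow> (\<exists>s\<in>D. \<exists>t\<in>D. upair a a s \<and> upair a b t \<and> upair s t p)"

lemma upair_dfn: "pt f \<Longrightarrow> pt g \<Longrightarrow> pt h \<Longrightarrow> dfn (\<lambda>v. upair (f v) (g v) (h v))"
  by (rule dfn_inst3) (unfold upair_def, intro dfn_intros E_dfn)

lemma pr_dfn: "pt f \<Longrightarrow> pt g \<Longrightarrow> pt h \<Longrightarrow> dfn (\<lambda>v. pr (f v) (g v) (h v))"
  by (rule dfn_inst3) (unfold pr_def, intro dfn_intros upair_dfn)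

lemma upair_ex: "a \<in> D \<Longrightarrow> b \<in> D \<Longrightarrow> \<exists>u\<in>D. upair a b u"
  using finite_set_code[of "{a, b}"] by (auto simp: upair_def)

lemma pr_ex: "a \<in> D \<Longrightarrow> b \<in> D \<Longrightarrow> \<exists>p\<in>D. pr a b p"
  unfolding pr_def using upair_ex by meson

lemma upair_inj: "upair a b u \<Longrightarrow> upair c d u \<Longrightarrow> a \<in> D \<Longrightarrow> b \<in> D \<Longrightarrow> c \<in> D \<Longrightarrow> d \<in> D \<Longrightarrow>
    a = c \<and> b = d \<or> a = d \<and> b = c"
  unfolding upair_def by metis

lemma upair_same: "upair a a s \<Longrightarrow> upair c d s \<Longrightarrow> a \<in> D \<Longrightarrow> c \<in> D \<Longrightarrow> d \<in> D \<Longrightarrow> c = a \<and> d = a"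
  using upair_inj by blast

lemma pr_inj:
  assumes "pr a b p" "pr c d p" and D: "a \<in> D" "b \<in> D" "c \<in> D" "d \<in> D"
  shows "a = c \<and> b = d"
proof -
  obtain s t s' t' where st: "s \<in> D" "t \<in> D" "upair a a s" "upair a b t" "upair s t p"
    "s' \<in> D" "t' \<in> D" "upair c c s'" "upair c d t'" "upair s' t' p"
    using assms by (auto simp: pr_def)
  from upair_inj[OF st(5,10) st(1,2,6,7)] show ?thesis
  proof (elim disjE conjE)
    assume e: "s = s'" "t = t'"
    have ac: "a = c" using upair_same[OF st(3), of c c] st(8) e D by simp
    have "a = c \<and> b = d \<or> a = d \<and> b = c" using upair_inj[OF st(4), of c d] st(9) e D by simp
    then show ?thesis using ac by blast
  next
    assume e: "s = t'" "t = s'"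
    have 1: "c = a \<and> d = a" using upair_same[OF st(3), of c d] st(9) e D by simp
    have "a = c \<and> b = c" using upair_same[OF st(8), of a b] st(4) e D by simp
    then show ?thesis using 1 by simp
  qed
qed

definition mem2 :: "'a \<Rightarrow> 'a \<Rightarrow> 'a \<Rightarrow> bool" where
  "mem2 x y s \<longleftrightarrow> (\<exists>p\<in>D. pr x y p \<and> E p s)"

lemma mem2_dfn: "pt f \<Longrightarrow> pt g \<Longrightarrow> pt h \<Longrightarrow> dfn (\<lambda>v. mem2 (f v) (g v) (h v))"
  by (rule dfn_inst3) (unfold mem2_def, intro dfn_intros pr_dfn E_dfn)

lemma finite_rel_code:
  assumes "finite C" "C \<subseteq> D \<times> D"
  shows "\<exists>s\<in>D. \<forall>x\<in>D. \<forall>y\<in>D. mem2 x y s \<longleftrightarrow> (x, y) \<in> C"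
proof -
  have "\<exists>p. p \<in> D \<and> pr (fst c) (snd c) p" if "c \<in> C" for c
    using pr_ex[of "fst c" "snd c"] subsetD[OF assms(2) that] by (auto simp: mem_Times_iff)
  \<comment> \<open>One code is fixed for each pair; by \<open>pr_inj\<close> no other pair can be
    read off it.\<close>
  then obtain f where f: "\<And>c. c \<in> C \<Longrightarrow> f c \<in> D \<and> pr (fst c) (snd c) (f c)" by metis
  have "f ` C \<subseteq> D" using f by (intro image_subsetI) simp
  then obtain s where s: "s \<in> D" "\<forall>x\<in>D. E x s \<longleftrightarrow> x \<in> f ` C"
    using finite_set_code[of "f ` C"] assms(1) by auto
  have "mem2 x y s \<longleftrightarrow> (x, y) \<in> C" if "x \<in> D" "y \<in> D" for x y
  proof
    assume "mem2 x y s"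
    then obtain p where "p \<in> D" "pr x y p" "E p s" by (auto simp: mem2_def)
    then obtain c where "c \<in> C" "pr x y (f c)" using s by auto
    then show "(x, y) \<in> C" using pr_inj[of x y "f c" "fst c" "snd c"] f[of c] that assms(2) by auto
  next
    assume "(x, y) \<in> C"
    then show "mem2 x y s" using f[of "(x, y)"] s by (auto simp: mem2_def)
  qed
  then show ?thesis using s(1) by blast
qed

subsection \<open>Certificates\<close>

text \<open>Only finite unions of sets need exist, so an inductive definition cannot be internalised as a
  fixed point. The certificate formula lies above the external least fixed point and can be unfolded;
  on arguments where the induction is well-founded this determines it.\<close>

inductive ind :: "('a \<Rightarrow> 'a \<Rightarrow> bool) \<Rightarrow> ('a \<Rightarrow> 'a \<Rightarrow> 'a \<Rightarrow> 'a \<Rightarrow> 'a \<Rightarrow> 'a \<Rightarrow> bool) \<Rightarrow> 'a \<Rightarrow> 'a \<Rightarrow> bool"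
  for A B where
  ind_base: "A x y \<Longrightarrow> x \<in> D \<Longrightarrow> y \<in> D \<Longrightarrow> ind A B x y"
| ind_step: "B x y x1 y1 x2 y2 \<Longrightarrow> ind A B x1 y1 \<Longrightarrow> ind A B x2 y2 \<Longrightarrow> x \<in> D \<Longrightarrow> y \<in> D \<Longrightarrow> ind A B x y"

definition cert :: "('a \<Rightarrow> 'a \<Rightarrow> bool) \<Rightarrow> ('a \<Rightarrow> 'a \<Rightarrow> 'a \<Rightarrow> 'a \<Rightarrow> 'a \<Rightarrow> 'a \<Rightarrow> bool) \<Rightarrow> 'a \<Rightarrow> 'a \<Rightarrow> bool" where
  "cert A B x y \<longleftrightarrow> (\<exists>s\<in>D. mem2 x y s \<and> (\<forall>x'\<in>D. \<forall>y'\<in>D. mem2 x' y' s \<longrightarrow> A x' y' \<or>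
    (\<exists>x1\<in>D. \<exists>y1\<in>D. \<exists>x2\<in>D. \<exists>y2\<in>D. B x' y' x1 y1 x2 y2 \<and> mem2 x1 y1 s \<and> mem2 x2 y2 s)))"

text \<open>A set that certifies one of its members certifies all of them, in particular the
  premises.\<close>

lemma cert_unfold:
  assumes "cert A B x y" "x \<in> D" "y \<in> D"
  shows "A x y \<or> (\<exists>x1\<in>D. \<exists>y1\<in>D. \<exists>x2\<in>D. \<exists>y2\<in>D. B x y x1 y1 x2 y2 \<and> cert A B x1 y1 \<and> cert A B x2 y2)"
proof -
  obtain s where s: "s \<in> D" "mem2 x y s" "\<forall>x'\<in>D. \<forall>y'\<in>D. mem2 x' y' s \<longrightarrow> A x' y' \<or>
    (\<exists>x1\<in>D. \<exists>y1\<in>D. \<exists>x2\<in>D. \<exists>y2\<in>D. B x' y' x1 y1 x2 y2 \<and> mem2 x1 y1 s \<and> mem2 x2 y2 s)"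
    using assms(1) unfolding cert_def by blast
  then have "cert A B x' y'" if "mem2 x' y' s" for x' y' using that unfolding cert_def by blast
  then show ?thesis using s assms(2,3) by blast
qed

text \<open>A derivation is finite, so the judgements in it form a finite relation, which has a
  code.\<close>

lemma ind_cert: "ind A B x y \<Longrightarrow> cert A B x y"
proof -
  assume "ind A B x y"
  then have "x \<in> D \<and> y \<in> D \<and> (\<exists>C. finite C \<and> C \<subseteq> D \<times> D \<and> (x, y) \<in> C \<and> (\<forall>x' y'. (x', y') \<in> C \<longrightarrow> A x' y' \<or>
    (\<exists>x1 y1 x2 y2. B x' y' x1 y1 x2 y2 \<and> (x1, y1) \<in> C \<and> (x2, y2) \<in> C)))"
  proof induct
    case (ind_base x y)
    then show ?case by (intro conjI exI[of _ "{(x, y)}"]) auto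
  next
    case (ind_step x y x1 y1 x2 y2)
    then obtain C1 C2 where C1: "finite C1" "C1 \<subseteq> D \<times> D" "(x1, y1) \<in> C1" "\<forall>x' y'. (x', y') \<in> C1 \<longrightarrow> A x' y' \<or>
        (\<exists>x1 y1 x2 y2. B x' y' x1 y1 x2 y2 \<and> (x1, y1) \<in> C1 \<and> (x2, y2) \<in> C1)"
      and C2: "finite C2" "C2 \<subseteq> D \<times> D" "(x2, y2) \<in> C2" "\<forall>x' y'. (x', y') \<in> C2 \<longrightarrow> A x' y' \<or>
        (\<exists>x1 y1 x2 y2. B x' y' x1 y1 x2 y2 \<and> (x1, y1) \<in> C2 \<and> (x2, y2) \<in> C2)" by blast
    let ?C = "insert (x, y) (C1 \<union> C2)"
    have "A x' y' \<or> (\<exists>x1 y1 x2 y2. B x' y' x1 y1 x2 y2 \<and> (x1, y1) \<in> ?C \<and> (x2, y2) \<in> ?C)"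
      if "(x', y') \<in> ?C" for x' y'
      using that
    proof (elim insertE UnE)
      assume "(x', y') = (x, y)"
      then show ?thesis using ind_step(1) C1(3) C2(3) by auto
    next
      assume "(x', y') \<in> C1"
      then show ?thesis using C1(4) by fast
    next
      assume "(x', y') \<in> C2"
      then show ?thesis using C2(4) by fast
    qed
    then show ?case using C1(1,2) C2(1,2) ind_step by (intro conjI exI[of _ ?C]) auto
  qed
  then obtain C where C: "finite C" "C \<subseteq> D \<times> D" "(x, y) \<in> C" and C4: "\<forall>x' y'. (x', y') \<in> C \<longrightarrow> A x' y' \<or>
    (\<exists>x1 y1 x2 y2. B x' y' x1 y1 x2 y2 \<and> (x1, y1) \<in> C \<and> (x2, y2) \<in> C)" by (elim conjE exE)
  obtain s where s: "s \<in> D" "\<And>x y. x \<in> D \<Longrightarrow> y \<in> D \<Longrightarrow> mem2 x y s \<longleftrightarrow> (x, y) \<in> C"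
    using finite_rel_code[OF C(1,2)] by (elim bexE) blast
  have CD: "x \<in> D \<and> y \<in> D" if "(x, y) \<in> C" for x y using C(2) that by blast
  show ?thesis unfolding cert_def
  proof (intro bexI[of _ s] conjI ballI impI)
    show "mem2 x y s" using s(2) CD C(3) by blast
    fix x' y' assume "x' \<in> D" "y' \<in> D" "mem2 x' y' s"
    then have "(x', y') \<in> C" using s(2) by blast
    from C4[rule_format, OF this] show "A x' y' \<or> (\<exists>x1\<in>D. \<exists>y1\<in>D. \<exists>x2\<in>D. \<exists>y2\<in>D. B x' y' x1 y1 x2 y2 \<and>
        mem2 x1 y1 s \<and> mem2 x2 y2 s)"
    proof (elim disjE exE conjE)
      fix x1 y1 x2 y2 assume *: "B x' y' x1 y1 x2 y2" "(x1, y1) \<in> C" "(x2, y2) \<in> C"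
      then show ?thesis using CD[OF *(2)] CD[OF *(3)] s(2) by blast
    qed simp
  qed (rule s(1))
qed

lemma cert_dfn:
  assumes "dfn (\<lambda>v. A (v 0) (v 1))"
    and "dfn (\<lambda>v. B (v 0) (v 1) (v 2) (v 3) (v 4) (v 5))"
    and "pt f" "pt g"
  shows "dfn (\<lambda>v. cert A B (f v) (g v))"
proof (rule dfn_inst2[OF _ assms(3,4)])
  have A: "pt f \<Longrightarrow> pt g \<Longrightarrow> dfn (\<lambda>v. A (f v) (g v))" for f g by (rule dfn_inst2[OF assms(1)])
  \<comment> \<open>Below the quantifiers of \<open>cert\<close> the six arguments occur at other
    indices, so definability is transported to arbitrary ones.\<close>
  have B: "dfn (\<lambda>v. B (v i0) (v i1) (v i2) (v i3) (v i4) (v i5))" for i0 i1 i2 i3 i4 i5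
    using dfn_subst[OF assms(2), of "\<lambda>i v. v ([i0, i1, i2, i3, i4, i5] ! i)"] pt_var
    by (simp add: numeral_nat)
  show "dfn (\<lambda>v. cert A B (v 0) (v 1))"
    unfolding cert_def by (intro dfn_intros mem2_dfn A B)
qed

end

context seqmodel
begin

section \<open>Standard numbers\<close>

abbreviation "zQ \<equiv> fun_of Q Zero []"
abbreviation "sQ x \<equiv> fun_of Q Succ [x]"
abbreviation "aQ x y \<equiv> fun_of Q Plus [x, y]"
abbreviation "mQ x y \<equiv> fun_of Q Times [x, y]"
abbreviation "lQ x y \<equiv> rel_of Q Le [x, y]"

lemma Q_closed:
  "zQ \<in> dom Q" "x \<in> dom Q \<Longrightarrow> sQ x \<in> dom Q"
  "x \<in> dom Q \<Longrightarrow> y \<in> dom Q \<Longrightarrow> aQ x y \<in> dom Q" "x \<in> dom Q \<Longrightarrow> y \<in> dom Q \<Longrightarrow> mQ x y \<in> dom Q"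
  using stQ unfolding structure_for_def lang_S12_def by auto

lemma basic2:
  assumes "\<phi> \<in> BASIC" "x \<in> dom Q" "y \<in> dom Q"
  shows "sat Q (case_nat x (\<lambda>_. y)) \<phi>"
  by (rule basic[OF assms(1)]) (use assms in \<open>auto simp: range_case_nat\<close>)

lemma lQ_suc: "x \<in> dom Q \<Longrightarrow> y \<in> dom Q \<Longrightarrow> lQ y x \<Longrightarrow> lQ y (sQ x)"
  using basic2[of "Imp (Rel Le [Var 1, Var 0]) (Rel Le [Var 1, Fn Succ [Var 0]])" x y]
  by (simp add: BASIC_def)

lemma lQ_zero: "x \<in> dom Q \<Longrightarrow> lQ zQ x"
  using basic2[of "Rel Le [Fn Zero [], Var 0]" x x] by (simp add: BASIC_def)

lemma lQ_less: "x \<in> dom Q \<Longrightarrow> y \<in> dom Q \<Longrightarrow> lQ x y \<and> x \<noteq> y \<longleftrightarrow> lQ (sQ x) y"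
  using basic2[of "Iff (And (Rel Le [Var 0, Var 1]) (Neg (Eq (Var 0) (Var 1)))) (Rel Le [Fn Succ [Var 0], Var 1])" x y]
  by (auto simp add: BASIC_def)

lemma lQ_total: "x \<in> dom Q \<Longrightarrow> y \<in> dom Q \<Longrightarrow> lQ x y \<or> lQ y x"
  using basic2[of "Or (Rel Le [Var 1, Var 0]) (Rel Le [Var 0, Var 1])" x y]
  by (auto simp add: BASIC_def)

lemma lQ_antisym: "x \<in> dom Q \<Longrightarrow> y \<in> dom Q \<Longrightarrow> lQ x y \<Longrightarrow> lQ y x \<Longrightarrow> x = y"
  using basic2[of "Imp (And (Rel Le [Var 0, Var 1]) (Rel Le [Var 1, Var 0])) (Eq (Var 0) (Var 1))" x y]
  by (simp add: BASIC_def)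

lemma aQ_zero: "x \<in> dom Q \<Longrightarrow> aQ x zQ = x"
  using basic2[of "Eq (Fn Plus [Var 0, Fn Zero []]) (Var 0)" x x] by (simp add: BASIC_def)

lemma aQ_suc: "x \<in> dom Q \<Longrightarrow> y \<in> dom Q \<Longrightarrow> aQ x (sQ y) = sQ (aQ x y)"
  using basic2[of "Eq (Fn Plus [Var 0, Fn Succ [Var 1]]) (Fn Succ [Fn Plus [Var 0, Var 1]])" x y]
  by (simp add: BASIC_def)

lemma mQ_zero: "x \<in> dom Q \<Longrightarrow> mQ x zQ = zQ"
  using basic2[of "Eq (Fn Times [Var 0, Fn Zero []]) (Fn Zero [])" x x] by (simp add: BASIC_def)

lemma mQ_suc: "x \<in> dom Q \<Longrightarrow> y \<in> dom Q \<Longrightarrow> mQ x (sQ y) = aQ (mQ x y) x"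
  using basic2[of "Eq (Fn Times [Var 0, Fn Succ [Var 1]]) (Fn Plus [Fn Times [Var 0, Var 1], Var 0])" x y]
  by (simp add: BASIC_def)

primrec num :: "nat \<Rightarrow> 'a" where
  "num 0 = zQ"
| "num (Suc n) = sQ (num n)"

lemma num_in: "num n \<in> dom Q"
  by (induct n) (simp_all add: Q_closed)

lemma aQ_num: "aQ (num m) (num n) = num (m + n)"
  by (induct n) (simp_all add: aQ_zero aQ_suc num_in)

lemma mQ_num: "mQ (num m) (num n) = num (m * n)"
  by (induct n) (simp_all add: mQ_zero mQ_suc num_in aQ_num add.commute)

lemma lQ_refl: "x \<in> dom Q \<Longrightarrow> lQ x x"
  using lQ_total by blast

lemma lQ_num_add: "lQ (num m) (num (m + d))"
  by (induct d) (simp_all add: lQ_refl lQ_suc num_in)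

lemma num_neq: "num m \<noteq> num (Suc (m + d))"
  using lQ_less[OF num_in num_in, of m "Suc (m + d)"] lQ_num_add[of "Suc m" d] by simp

lemma num_inj: "num m = num n \<longleftrightarrow> m = n"
proof
  assume e: "num m = num n"
  show "m = n"
  proof (rule ccontr)
    assume "m \<noteq> n"
    then show False using e num_neq by (metis less_imp_Suc_add linorder_neqE_nat)
  qed
qed simp

lemma lQ_num: "lQ (num m) (num n) \<longleftrightarrow> m \<le> n"
proof
  assume "lQ (num m) (num n)"
  then show "m \<le> n"
    using lQ_num_add lQ_antisym[OF num_in num_in] num_inj by (metis le_add_diff_inverse nat_le_linear)
next
  assume "m \<le> n"
  then show "lQ (num m) (num n)" using lQ_num_add by (metis le_add_diff_inverse)
qed

text \<open>The standard numbers are an initial segment of \<open>Q\<close>, by external induction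
  on the bound and discreteness of the order. The absoluteness of bounded quantifiers rests on
  this.\<close>

lemma lQ_numD: "x \<in> dom Q \<Longrightarrow> lQ x (num n) \<Longrightarrow> \<exists>m\<le>n. x = num m"
proof (induct n)
  case 0
  then show ?case using lQ_antisym[OF 0(1) num_in, of 0] lQ_zero by auto
next
  case (Suc n)
  show ?case
  proof (cases "x = num (Suc n)")
    case False
    then have "\<not> lQ (num (Suc n)) x" using lQ_antisym[OF Suc(2) num_in] Suc by blast
    then have "\<not> lQ (num n) x \<or> num n = x" using lQ_less[OF num_in Suc(2), of n] by auto
    then have "lQ x (num n)" using lQ_total[OF num_in Suc(2), of n] lQ_refl[OF Suc(2)] by auto
    then show ?thesis using Suc by (metis le_SucI)
  qed blast
qed

lemma eval_numeral: "eval_tm Q v (numeral_tm n) = num n"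
proof (induct n rule: less_induct)
  case (less n)
  consider "n = 0" | "n \<noteq> 0" "even n" | "odd n" by blast
  then show ?case
  proof cases
    case 1
    then show ?thesis by (simp add: numeral_tm.simps)
  next
    case 2
    then have "eval_tm Q v (numeral_tm n) = mQ (num 2) (num (n div 2))"
      using less[of "n div 2"] by (subst numeral_tm.simps) (simp add: numeral_2_eq_2)
    then show ?thesis using 2 by (simp only: mQ_num dvd_mult_div_cancel)
  next
    case 3
    then obtain m where m: "n = Suc m" by (metis odd_pos gr0_implies_Suc)
    then show ?thesis using 3 less[of m] by (subst numeral_tm.simps) simp
  qed
qed

lemma wf_numeral: "wf_tm lang_S12 k (numeral_tm n)"
proof (induct n rule: less_induct)
  case (less n)
  then show ?case by (subst numeral_tm.simps) (auto simp: lang_S12_def odd_pos)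
qed

text \<open>Identity may be translated as a mere equivalence relation, so a number can have many
  representatives in \<open>M\<close>.\<close>

definition Nn :: "nat \<Rightarrow> 'a \<Rightarrow> bool" where
  "Nn n x \<longleftrightarrow> x \<in> tdom N M \<and> r x = num n"

definition leM :: "'a \<Rightarrow> 'a \<Rightarrow> bool" where
  "leM x y \<longleftrightarrow> x \<in> tdom N M \<and> y \<in> tdom N M \<and> lQ (r x) (r y)"

definition eqM :: "'a \<Rightarrow> 'a \<Rightarrow> bool" where
  "eqM x y \<longleftrightarrow> x \<in> tdom N M \<and> y \<in> tdom N M \<and> r x = r y"

definition addM :: "'a \<Rightarrow> 'a \<Rightarrow> 'a \<Rightarrow> bool" where
  "addM x y z \<longleftrightarrow> x \<in> tdom N M \<and> y \<in> tdom N M \<and> z \<in> tdom N M \<and> aQ (r x) (r y) = r z"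

definition mulM :: "'a \<Rightarrow> 'a \<Rightarrow> 'a \<Rightarrow> bool" where
  "mulM x y z \<longleftrightarrow> x \<in> tdom N M \<and> y \<in> tdom N M \<and> z \<in> tdom N M \<and> mQ (r x) (r y) = r z"

lemma tdom_D: "x \<in> tdom N M \<Longrightarrow> x \<in> D"
  by (simp add: tdom_def)

lemma r_in: "x \<in> tdom N M \<Longrightarrow> r x \<in> dom Q"
  using rdom by blast

lemma Nn_ex: "\<exists>x\<in>D. Nn n x"
  using num_in[of n] rdom tdom_D by (force simp: Nn_def)

lemma Nn_D: "Nn n x \<Longrightarrow> x \<in> D"
  by (simp add: Nn_def tdom_D)

lemma Nn_unique: "Nn n x \<Longrightarrow> Nn m x \<Longrightarrow> n = m"
  by (simp add: Nn_def num_inj)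

lemma Nn_eqM: "Nn n x \<Longrightarrow> eqM x y \<longleftrightarrow> Nn n y"
  by (auto simp: Nn_def eqM_def)

lemma Nn_leM: "Nn n x \<Longrightarrow> Nn m y \<Longrightarrow> leM x y \<longleftrightarrow> n \<le> m"
  by (auto simp: Nn_def leM_def lQ_num)

lemma Nn_leMD: "Nn n y \<Longrightarrow> leM x y \<Longrightarrow> \<exists>m\<le>n. Nn m x"
  using lQ_numD[OF r_in] by (fastforce simp: Nn_def leM_def)

text \<open>Here \<open>y\<close> may be nonstandard. This comparison later forces a candidate below
  a standard element, which makes it standard.\<close>

lemma Nn_le_total: "Nn n x \<Longrightarrow> y \<in> tdom N M \<Longrightarrow> leM x y \<or> leM y x"
  unfolding Nn_def leM_def by (metis lQ_total r_in)

lemma Nn_addM: "Nn n x \<Longrightarrow> Nn m y \<Longrightarrow> addM x y z \<longleftrightarrow> Nn (n + m) z"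
  by (auto simp: Nn_def addM_def aQ_num)

lemma Nn_mulM: "Nn n x \<Longrightarrow> Nn m y \<Longrightarrow> mulM x y z \<longleftrightarrow> Nn (n * m) z"
  by (auto simp: Nn_def mulM_def mQ_num)

lemma tdom_dfn: "pt f \<Longrightarrow> dfn (\<lambda>v. f v \<in> tdom N M)"
proof (rule dfn_inst1)
  have "sat M v (tr_dom N) \<longleftrightarrow> v 0 \<in> tdom N M" if "range v \<subseteq> D" for v
  proof -
    have "v 0 \<in> D" using that by (rule subsetD) simp
    moreover have "sat M v (tr_dom N) = satl M (tr_dom N) [v 0]"
      by (rule satlI[of L']) (use wfd(1) in simp_all)
    ultimately show ?thesis by (simp add: tdom_def)
  qed
  then show "dfn (\<lambda>v. v 0 \<in> tdom N M)" by (rule dfn_cong[OF dfn_fm[OF wfd(1)]])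
qed

lemma tr_dfn:
  assumes "wf_fm lang_S12 k \<psi>"
  shows "dfn (\<lambda>v. (\<forall>i<k. v i \<in> tdom N M) \<and> sat Q (\<lambda>i. r (v i)) \<psi>)"
proof -
  have "dfn (\<lambda>v. \<forall>i<k. v i \<in> tdom N M)" for k
    by (induct k) (simp_all add: dfn_True All_less_Suc dfn_conj tdom_dfn pt_var)
  from dfn_conj[OF this[of k] dfn_fm[OF wf_tr_fm[OF wft assms]]] show ?thesis
    by (rule dfn_cong) (use sat_tr_fm[OF assms] in blast)
qed

lemma Nn_dfn: "pt f \<Longrightarrow> dfn (\<lambda>v. Nn n (f v))"
proof (rule dfn_inst1)
  have "wf_fm lang_S12 1 (Eq (Var 0) (numeral_tm n))" by (simp add: wf_numeral)
  from tr_dfn[OF this] show "dfn (\<lambda>v. Nn n (v 0))"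
    by (rule dfn_cong) (simp add: Nn_def eval_numeral)
qed

lemma leM_dfn: "pt f \<Longrightarrow> pt g \<Longrightarrow> dfn (\<lambda>v. leM (f v) (g v))"
proof (rule dfn_inst2)
  have "wf_fm lang_S12 2 (Rel Le [Var 0, Var 1])" by (simp add: lang_S12_def)
  from tr_dfn[OF this] show "dfn (\<lambda>v. leM (v 0) (v 1))"
    by (rule dfn_cong) (auto simp: leM_def numeral_2_eq_2 All_less_Suc)
qed

lemma eqM_dfn: "pt f \<Longrightarrow> pt g \<Longrightarrow> dfn (\<lambda>v. eqM (f v) (g v))"
proof (rule dfn_inst2)
  have "wf_fm lang_S12 2 (Eq (Var 0) (Var 1))" by simp
  from tr_dfn[OF this] show "dfn (\<lambda>v. eqM (v 0) (v 1))"
    by (rule dfn_cong) (auto simp: eqM_def numeral_2_eq_2 All_less_Suc)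
qed

lemma addM_dfn: "pt f \<Longrightarrow> pt g \<Longrightarrow> pt h \<Longrightarrow> dfn (\<lambda>v. addM (f v) (g v) (h v))"
proof (rule dfn_inst3)
  have "wf_fm lang_S12 3 (Eq (Fn Plus [Var 0, Var 1]) (Var 2))" by (simp add: lang_S12_def)
  from tr_dfn[OF this] show "dfn (\<lambda>v. addM (v 0) (v 1) (v 2))"
    by (rule dfn_cong) (auto simp: addM_def numeral_2_eq_2 numeral_3_eq_3 All_less_Suc)
qed

lemma mulM_dfn: "pt f \<Longrightarrow> pt g \<Longrightarrow> pt h \<Longrightarrow> dfn (\<lambda>v. mulM (f v) (g v) (h v))"
proof (rule dfn_inst3)
  have "wf_fm lang_S12 3 (Eq (Fn Times [Var 0, Var 1]) (Var 2))" by (simp add: lang_S12_def)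
  from tr_dfn[OF this] show "dfn (\<lambda>v. mulM (v 0) (v 1) (v 2))"
    by (rule dfn_cong) (auto simp: mulM_def numeral_2_eq_2 numeral_3_eq_3 All_less_Suc)
qed

section \<open>Representable relations on the natural numbers\<close>

definition nenv :: "(nat \<Rightarrow> nat) \<Rightarrow> (nat \<Rightarrow> 'a) \<Rightarrow> bool" where
  "nenv n v \<longleftrightarrow> (\<forall>i. Nn (n i) (v i))"

text \<open>Correctness is required for standard arguments only; elsewhere \<open>X\<close> may
  behave arbitrarily.\<close>

definition rep :: "((nat \<Rightarrow> nat) \<Rightarrow> bool) \<Rightarrow> bool" where
  "rep P \<longleftrightarrow> (\<exists>X. dfn X \<and> (\<forall>v n. nenv n v \<longrightarrow> (X v \<longleftrightarrow> P n)))"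

text \<open>Unlike the arguments, the value \<open>y\<close> ranges over all of \<open>D\<close>, so
  the defining predicate must also reject nonstandard values.\<close>

definition repf :: "((nat \<Rightarrow> nat) \<Rightarrow> nat) \<Rightarrow> bool" where
  "repf f \<longleftrightarrow> (\<exists>G. dfn G \<and> (\<forall>v n y. nenv n v \<longrightarrow> y \<in> D \<longrightarrow> (G (case_nat y v) \<longleftrightarrow> Nn (f n) y)))"

lemma nenv_Cons: "nenv (case_nat m n) (case_nat x v) \<longleftrightarrow> Nn m x \<and> nenv n v"
  unfolding nenv_def by (metis nat.case(1) nat.case(2) not0_implies_Suc)

lemma repI: "dfn X \<Longrightarrow> (\<And>v n. nenv n v \<Longrightarrow> X v \<longleftrightarrow> P n) \<Longrightarrow> rep P"
  unfolding rep_def by blast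

lemma repfI: "dfn G \<Longrightarrow> (\<And>v n y. nenv n v \<Longrightarrow> y \<in> D \<Longrightarrow> G (case_nat y v) \<longleftrightarrow> Nn (f n) y) \<Longrightarrow> repf f"
  unfolding repf_def by blast

lemma rep_const: "rep (\<lambda>_. b)"
  by (rule repI[OF dfn_True]) simp

lemma rep_not: "rep P \<Longrightarrow> rep (\<lambda>n. \<not> P n)"
  unfolding rep_def by (elim exE conjE, rule exI, rule conjI, erule dfn_not) simp

lemma rep_conj: "rep P \<Longrightarrow> rep P' \<Longrightarrow> rep (\<lambda>n. P n \<and> P' n)"
  unfolding rep_def by (elim exE conjE, rule exI, rule conjI, erule (1) dfn_conj) simp

lemma rep_disj: "rep P \<Longrightarrow> rep P' \<Longrightarrow> rep (\<lambda>n. P n \<or> P' n)"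
  unfolding rep_def by (elim exE conjE, rule exI, rule conjI, erule (1) dfn_disj) simp

lemma rep_imp: "rep P \<Longrightarrow> rep P' \<Longrightarrow> rep (\<lambda>n. P n \<longrightarrow> P' n)"
  unfolding rep_def by (elim exE conjE, rule exI, rule conjI, erule (1) dfn_imp) simp

lemma rep_iff: "rep P \<Longrightarrow> rep P' \<Longrightarrow> rep (\<lambda>n. P n \<longleftrightarrow> P' n)"
  unfolding rep_def by (elim exE conjE, rule exI, rule conjI, erule (1) dfn_iff) simp

lemma repf_var: "repf (\<lambda>n. n i)"
proof (rule repfI)
  show "dfn (\<lambda>v. eqM (v (Suc i)) (v 0))" by (intro eqM_dfn pt_var)
qed (auto simp: nenv_def Nn_eqM)

lemma repf_const: "repf (\<lambda>_. c)"
proof (rule repfI)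
  show "dfn (\<lambda>v. Nn c (v 0))" by (intro Nn_dfn pt_var)
qed simp

lemma pt_case: "pt f \<Longrightarrow> (\<And>i. pt (g i)) \<Longrightarrow> pt (\<lambda>v. case i of 0 \<Rightarrow> f v | Suc j \<Rightarrow> g j v)"
  by (cases i) simp_all

lemma dfn_skip: "dfn G \<Longrightarrow> dfn (\<lambda>v. G (case_nat (v j) (\<lambda>i. v (i + k))))"
  by (erule dfn_subst[of G]) (intro pt_case pt_var)

lemma repf_op2:
  assumes "repf f" "repf g"
    and op: "\<And>f g h. pt f \<Longrightarrow> pt g \<Longrightarrow> pt h \<Longrightarrow> dfn (\<lambda>v. R (f v) (g v) (h v))"
      "\<And>n m x y z. Nn n x \<Longrightarrow> Nn m y \<Longrightarrow> R x y z \<longleftrightarrow> Nn (h n m) z"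
  shows "repf (\<lambda>n. h (f n) (g n))"
proof -
  obtain F where F: "dfn F" "\<And>v n y. nenv n v \<Longrightarrow> y \<in> D \<Longrightarrow> F (case_nat y v) \<longleftrightarrow> Nn (f n) y"
    using assms(1) unfolding repf_def by (elim exE conjE) (rule that, assumption, blast)
  obtain G where G: "dfn G" "\<And>v n y. nenv n v \<Longrightarrow> y \<in> D \<Longrightarrow> G (case_nat y v) \<longleftrightarrow> Nn (g n) y"
    using assms(2) unfolding repf_def by (elim exE conjE) (rule that, assumption, blast)
  show ?thesis
  proof (rule repfI)
    show "dfn (\<lambda>v. \<exists>a\<in>D. \<exists>b\<in>D. F (case_nat a (\<lambda>i. v (Suc i))) \<and> G (case_nat b (\<lambda>i. v (Suc i))) \<and> R a b (v 0))"
      using dfn_skip[OF F(1), of 1 3] dfn_skip[OF G(1), of 0 3]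
      by (intro dfn_ex dfn_conj op pt_var) (simp_all add: numeral_3_eq_3)
    show "(\<exists>a\<in>D. \<exists>b\<in>D. F (case_nat a (\<lambda>i. case_nat y v (Suc i))) \<and> G (case_nat b (\<lambda>i. case_nat y v (Suc i))) \<and>
        R a b (case_nat y v 0)) \<longleftrightarrow> Nn (h (f n) (g n)) y" if "nenv n v" "y \<in> D" for v n y
    proof -
      have "(\<exists>a\<in>D. \<exists>b\<in>D. Nn (f n) a \<and> Nn (g n) b \<and> R a b y) \<longleftrightarrow> Nn (h (f n) (g n)) y"
        using Nn_ex[of "f n"] Nn_ex[of "g n"] op(2) by blast
      then show ?thesis by (simp add: F(2)[OF that(1)] G(2)[OF that(1)])
    qed
  qed
qed

lemma repf_add: "repf f \<Longrightarrow> repf g \<Longrightarrow> repf (\<lambda>n. f n + g n)"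
  by (rule repf_op2[where R = addM]) (auto intro: addM_dfn simp: Nn_addM)

lemma repf_mult: "repf f \<Longrightarrow> repf g \<Longrightarrow> repf (\<lambda>n. f n * g n)"
  by (rule repf_op2[where R = mulM]) (auto intro: mulM_dfn simp: Nn_mulM)

lemma repf_Suc: "repf f \<Longrightarrow> repf (\<lambda>n. Suc (f n))"
  using repf_add[OF _ repf_const, of f 1] by simp

lemma rep_op2:
  assumes "repf f" "repf g"
    and op: "\<And>f g. pt f \<Longrightarrow> pt g \<Longrightarrow> dfn (\<lambda>v. R (f v) (g v))"
      "\<And>n m x y. Nn n x \<Longrightarrow> Nn m y \<Longrightarrow> R x y \<longleftrightarrow> P n m"
  shows "rep (\<lambda>n. P (f n) (g n))"
proof -
  obtain F where F: "dfn F" "\<And>v n y. nenv n v \<Longrightarrow> y \<in> D \<Longrightarrow> F (case_nat y v) \<longleftrightarrow> Nn (f n) y"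
    using assms(1) unfolding repf_def by (elim exE conjE) (rule that, assumption, blast)
  obtain G where G: "dfn G" "\<And>v n y. nenv n v \<Longrightarrow> y \<in> D \<Longrightarrow> G (case_nat y v) \<longleftrightarrow> Nn (g n) y"
    using assms(2) unfolding repf_def by (elim exE conjE) (rule that, assumption, blast)
  show ?thesis
  proof (rule repI)
    show "dfn (\<lambda>v. \<exists>a\<in>D. \<exists>b\<in>D. F (case_nat a v) \<and> G (case_nat b v) \<and> R a b)"
      using dfn_skip[OF F(1), of 1 2] dfn_skip[OF G(1), of 0 2]
      by (intro dfn_ex dfn_conj op pt_var) (simp_all add: numeral_2_eq_2)
    show "(\<exists>a\<in>D. \<exists>b\<in>D. F (case_nat a v) \<and> G (case_nat b v) \<and> R a b) \<longleftrightarrow> P (f n) (g n)" if "nenv n v" for v n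
    proof -
      have "(\<exists>a\<in>D. \<exists>b\<in>D. Nn (f n) a \<and> Nn (g n) b \<and> R a b) \<longleftrightarrow> P (f n) (g n)"
        using Nn_ex[of "f n"] Nn_ex[of "g n"] op(2) by blast
      then show ?thesis by (simp add: F(2)[OF that] G(2)[OF that])
    qed
  qed
qed

lemma rep_eq: "repf f \<Longrightarrow> repf g \<Longrightarrow> rep (\<lambda>n. f n = g n)"
  by (rule rep_op2[where R = eqM]) (auto intro: eqM_dfn simp: Nn_eqM Nn_unique)

lemma rep_le: "repf f \<Longrightarrow> repf g \<Longrightarrow> rep (\<lambda>n. f n \<le> g n)"
  by (rule rep_op2[where R = leM]) (auto intro: leM_dfn simp: Nn_leM)

lemma rep_less: "repf f \<Longrightarrow> repf g \<Longrightarrow> rep (\<lambda>n. f n < g n)"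
  using rep_le[OF repf_Suc] by (simp add: Suc_le_eq)

lemma rep_comp:
  assumes "rep (\<lambda>n. P (n 0))" "repf f"
  shows "rep (\<lambda>n. P (f n))"
proof -
  obtain X where X: "dfn X" "\<And>v n. nenv n v \<Longrightarrow> X v \<longleftrightarrow> P (n 0)" using assms(1) unfolding rep_def by (elim exE conjE) (rule that, assumption, blast)
  show ?thesis
  proof (rule rep_op2[OF assms(2,2), where R = "\<lambda>x y. X (\<lambda>_. x)" and P = "\<lambda>n m. P n"])
    show "dfn (\<lambda>v. X (\<lambda>_. f v))" if "pt f" for f
      using dfn_subst[OF X(1), of "\<lambda>_. f"] that by simp
    show "X (\<lambda>_. x) \<longleftrightarrow> P n" if "Nn n x" for n x
      using X(2)[of "\<lambda>_. n" "\<lambda>_. x"] that by (simp add: nenv_def)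
  qed
qed

lemma repf_comp2:
  assumes "repf (\<lambda>n. h (n 0) (n 1))" "repf f" "repf g"
  shows "repf (\<lambda>n. h (f n) (g n))"
proof -
  obtain H where H: "dfn H" "\<And>v n y. nenv n v \<Longrightarrow> y \<in> D \<Longrightarrow> H (case_nat y v) \<longleftrightarrow> Nn (h (n 0) (n 1)) y"
    using assms(1) unfolding repf_def by (elim exE conjE) (rule that, assumption, blast)
  show ?thesis
  proof (rule repf_op2[OF assms(2,3), where R = "\<lambda>x y z. z \<in> D \<and> H (case_nat z (case_nat x (\<lambda>_. y)))"])
    show "dfn (\<lambda>v. h v \<in> D \<and> H (case_nat (h v) (case_nat (f v) (\<lambda>_. g v))))" if "pt f" "pt g" "pt h" for f g h
    proof -
      have "dfn (\<lambda>v. H (\<lambda>i. case i of 0 \<Rightarrow> h v | Suc i \<Rightarrow> (case i of 0 \<Rightarrow> f v | Suc i \<Rightarrow> g v)))"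
        by (rule dfn_subst[OF H(1)]) (intro pt_case that)
      then show ?thesis by (rule dfn_cong) (use that pt_in in simp)
    qed
    show "z \<in> D \<and> H (case_nat z (case_nat x (\<lambda>_. y))) \<longleftrightarrow> Nn (h n m) z" if "Nn n x" "Nn m y" for n m x y z
      using H(2)[of "case_nat n (\<lambda>_. m)" "case_nat x (\<lambda>_. y)" z] that Nn_D
      by (auto simp: nenv_Cons) (simp_all add: nenv_def)
  qed
qed

lemma repf_comp:
  assumes "repf (\<lambda>n. h (n 0))" "repf f"
  shows "repf (\<lambda>n. h (f n))"
  using repf_comp2[of "\<lambda>a b. h a", OF assms(1) assms(2,2)] .

text \<open>Elements below a standard bound are standard, so the bounded quantifier over
  \<open>D\<close> agrees with the one over numbers.\<close>

lemma rep_ex: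
  assumes "repf b" "rep (\<lambda>n. P (n 0) (\<lambda>i. n (Suc i)))"
  shows "rep (\<lambda>n. \<exists>m\<le>b n. P m n)"
proof -
  obtain G where G: "dfn G" "\<And>v n y. nenv n v \<Longrightarrow> y \<in> D \<Longrightarrow> G (case_nat y v) \<longleftrightarrow> Nn (b n) y"
    using assms(1) unfolding repf_def by (elim exE conjE) (rule that, assumption, blast)
  obtain X where X: "dfn X" "\<And>v n. nenv n v \<Longrightarrow> X v \<longleftrightarrow> P (n 0) (\<lambda>i. n (Suc i))"
    using assms(2) unfolding rep_def by (elim exE conjE) (rule that, assumption, blast)
  show ?thesis
  proof (rule repI)
    show "dfn (\<lambda>v. \<exists>y\<in>D. \<exists>a\<in>D. G (case_nat y v) \<and> leM a y \<and> X (case_nat a v))"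
      using dfn_skip[OF G(1), of 1 2] dfn_skip[OF X(1), of 0 2]
      by (intro dfn_ex dfn_conj leM_dfn pt_var) (simp_all add: numeral_2_eq_2)
    show "(\<exists>y\<in>D. \<exists>a\<in>D. G (case_nat y v) \<and> leM a y \<and> X (case_nat a v)) \<longleftrightarrow> (\<exists>m\<le>b n. P m n)"
      (is "?l \<longleftrightarrow> ?r") if nv: "nenv n v" for v n
    proof
      assume ?l
      then obtain y a where *: "y \<in> D" "a \<in> D" "G (case_nat y v)" "leM a y" "X (case_nat a v)" by blast
      then have y: "Nn (b n) y" using G(2)[OF nv] by simp
      then obtain m where m: "m \<le> b n" "Nn m a" using Nn_leMD *(4) by blast
      then have "P m n" using X(2)[of "case_nat m n" "case_nat a v"] nv *(5) by (simp add: nenv_Cons)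
      then show ?r using m by blast
    next
      assume ?r
      then obtain m where m: "m \<le> b n" "P m n" by blast
      obtain y a where "y \<in> D" "a \<in> D" "Nn (b n) y" "Nn m a" using Nn_ex by blast
      then show ?l using X(2)[of "case_nat m n" "case_nat a v"] nv m G(2)[OF nv]
        by (intro bexI[of _ y] bexI[of _ a]) (simp_all add: nenv_Cons Nn_leM)
    qed
  qed
qed

lemma rep_all:
  assumes "repf b" "rep (\<lambda>n. P (n 0) (\<lambda>i. n (Suc i)))"
  shows "rep (\<lambda>n. \<forall>m\<le>b n. P m n)"
proof -
  have "rep (\<lambda>n. \<not> (\<exists>m\<le>b n. \<not> P m n))" by (intro rep_not rep_ex assms)
  then show ?thesis by simp
qed

text \<open>A representation of the graph may accept nonstandard values. Requiring that there be no
  smaller solution removes them: the true value is standard, comparable with every candidate, and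
  the only standard solution.\<close>

lemma repf_graph:
  assumes "rep (\<lambda>n. n 0 = f (\<lambda>i. n (Suc i)))"
  shows "repf f"
proof -
  obtain X where X: "dfn X" "\<And>v n. nenv n v \<Longrightarrow> X v \<longleftrightarrow> n 0 = f (\<lambda>i. n (Suc i))"
    using assms unfolding rep_def by (elim exE conjE) (rule that, assumption, blast)
  show ?thesis
  proof (rule repfI)
    show "dfn (\<lambda>v. v 0 \<in> tdom N M \<and> X v \<and> (\<forall>z\<in>D. leM z (v 0) \<and> X (case_nat z (\<lambda>i. v (Suc i))) \<longrightarrow> eqM z (v 0)))"
      using dfn_skip[OF X(1), of 0 2]
      by (intro dfn_all dfn_conj dfn_imp leM_dfn eqM_dfn tdom_dfn pt_var X(1)) (simp_all add: numeral_2_eq_2)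
    fix v n y assume nv: "nenv n v" and y: "y \<in> D"
    have X': "X (case_nat z v) \<longleftrightarrow> m = f n" if "Nn m z" for m z
      using X(2)[of "case_nat m n" "case_nat z v"] nv that by (simp add: nenv_Cons)
    obtain x where x: "x \<in> D" "Nn (f n) x" using Nn_ex by blast
    have "y \<in> tdom N M \<and> X (case_nat y v) \<and> (\<forall>z\<in>D. leM z y \<and> X (case_nat z v) \<longrightarrow> eqM z y) \<longleftrightarrow> Nn (f n) y"
    proof (intro iffI; (elim conjE)?)
      assume *: "y \<in> tdom N M" "X (case_nat y v)" "\<forall>z\<in>D. leM z y \<and> X (case_nat z v) \<longrightarrow> eqM z y"
      have "leM x y \<or> leM y x" using Nn_le_total[OF x(2) *(1)] .
      then show "Nn (f n) y"
      proof
        assume "leM x y"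
        then have "eqM x y" using *(3) x X'[OF x(2)] by simp
        then show ?thesis using Nn_eqM[OF x(2)] by simp
      next
        assume "leM y x"
        then obtain m where m: "Nn m y" using Nn_leMD[OF x(2)] by blast
        then show ?thesis using X'[OF m] *(2) by simp
      qed
    next
      assume *: "Nn (f n) y"
      have "eqM z y" if le: "leM z y" and z: "X (case_nat z v)" for z
      proof -
        obtain m where m: "Nn m z" using Nn_leMD[OF * le] by blast
        then show ?thesis using X'[OF m] z * Nn_eqM[OF m] by simp
      qed
      then show "y \<in> tdom N M \<and> X (case_nat y v) \<and> (\<forall>z\<in>D. leM z y \<and> X (case_nat z v) \<longrightarrow> eqM z y)"
        using * X'[OF *] by (simp add: Nn_def)
    qed
    then show "case_nat y v 0 \<in> tdom N M \<and> X (case_nat y v) \<and>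
        (\<forall>z\<in>D. leM z (case_nat y v 0) \<and> X (case_nat z (\<lambda>i. case_nat y v (Suc i))) \<longrightarrow> eqM z (case_nat y v 0)) \<longleftrightarrow>
        Nn (f n) y" by simp
  qed
qed

lemmas rep_intros0 = rep_const rep_not rep_conj rep_disj rep_imp rep_iff repf_var repf_const repf_add
  repf_mult repf_Suc rep_eq rep_le rep_less rep_ex rep_all

lemma repf_prod: "repf f \<Longrightarrow> repf g \<Longrightarrow> repf (\<lambda>n. prod_encode (f n, g n))"
proof (rule repf_comp2[where h = "\<lambda>a b. prod_encode (a, b)"])
  \<comment> \<open>Twice the triangular number is a polynomial, so the doubled equation avoids
    division.\<close>
  have t: "2 * triangle k = k * Suc k" for k by (induct k) auto
  have e: "x = prod_encode (y, z) \<longleftrightarrow> 2 * x = (y + z) * Suc (y + z) + 2 * y" for x y z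
    unfolding prod_encode_def prod.case t[symmetric] by arith
  have "rep (\<lambda>n. 2 * n 0 = (n (Suc 0) + n (Suc 1)) * Suc (n (Suc 0) + n (Suc 1)) + 2 * n (Suc 0))"
    by (intro rep_intros0)
  then show "repf (\<lambda>n. prod_encode (n 0, n 1))"
    by (intro repf_graph) (simp only: e One_nat_def)
qed assumption

subsection \<open>Inductive definitions\<close>

text \<open>Recursions with two calls are represented by certificates; a rule with a single call
  repeats it as \<open>q = p\<close>. Since \<open>b\<close> keeps the calls standard and
  \<open>m\<close> decreases, unfolding a certificate ends after finitely many steps, even if the
  certifying set is infinite.\<close>

lemma rep_ind:
  fixes m b :: "nat \<Rightarrow> nat"
  assumes P: "\<And>n. P n \<longleftrightarrow> A n \<or> (\<exists>p\<le>b n. \<exists>q\<le>b n. B n p q \<and> P p \<and> P q)"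
    and dec: "\<And>n p q. B n p q \<Longrightarrow> p \<le> b n \<Longrightarrow> q \<le> b n \<Longrightarrow> m p < m n \<and> m q < m n"
    and A: "rep (\<lambda>n. A (n 0))" and B: "rep (\<lambda>n. B (n 0) (n 1) (n 2))" and b: "repf (\<lambda>n. b (n 0))"
  shows "rep (\<lambda>n. P (n 0))"
proof -
  obtain XA where XA: "dfn XA" "\<And>v n. nenv n v \<Longrightarrow> XA v \<longleftrightarrow> A (n 0)" using A unfolding rep_def by (elim exE conjE) (rule that, assumption, blast)
  obtain XB where XB: "dfn XB" "\<And>v n. nenv n v \<Longrightarrow> XB v \<longleftrightarrow> B (n 0) (n 1) (n 2)" using B unfolding rep_def by (elim exE conjE) (rule that, assumption, blast)
  obtain G where G: "dfn G" "\<And>v n y. nenv n v \<Longrightarrow> y \<in> D \<Longrightarrow> G (case_nat y v) \<longleftrightarrow> Nn (b (n 0)) y"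
    using b unfolding repf_def by (elim exE conjE) (rule that, assumption, blast)
  define A' :: "'a \<Rightarrow> 'a \<Rightarrow> bool" where "A' x y = XA (\<lambda>_. x)" for x y
  define B' :: "'a \<Rightarrow> 'a \<Rightarrow> 'a \<Rightarrow> 'a \<Rightarrow> 'a \<Rightarrow> 'a \<Rightarrow> bool" where
    "B' x y x1 y1 x2 y2 = (\<exists>z\<in>D. G (case_nat z (\<lambda>_. x)) \<and> leM x1 z \<and> leM x2 z \<and>
      XB (case_nat x (case_nat x1 (\<lambda>_. x2))))" for x y x1 y1 x2 y2
  have A': "A' x y \<longleftrightarrow> A n" if "Nn n x" for n x y
    using XA(2)[of "\<lambda>_. n" "\<lambda>_. x"] that by (simp add: A'_def nenv_def)
  have B': "B' x y x1 y1 x2 y2 \<longleftrightarrow> (\<exists>p\<le>b n. \<exists>q\<le>b n. B n p q \<and> Nn p x1 \<and> Nn q x2)"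
    if n: "Nn n x" for n x y x1 y1 x2 y2
  proof -
    have XB': "XB (case_nat x (case_nat x1 (\<lambda>_. x2))) \<longleftrightarrow> B n p q" if "Nn p x1" "Nn q x2" for p q
      using XB(2)[of "case_nat n (case_nat p (\<lambda>_. q))" "case_nat x (case_nat x1 (\<lambda>_. x2))"] n that
      by (auto simp: nenv_Cons numeral_2_eq_2) (simp_all add: nenv_def)
    have G': "G (case_nat z (\<lambda>_. x)) \<longleftrightarrow> Nn (b n) z" if "z \<in> D" for z
      using G(2)[of "\<lambda>_. n" "\<lambda>_. x" z] n that by (simp add: nenv_def)
    show ?thesis (is "?l \<longleftrightarrow> ?r")
    proof
      assume ?l
      then obtain z where z: "z \<in> D" "Nn (b n) z" "leM x1 z" "leM x2 z" "XB (case_nat x (case_nat x1 (\<lambda>_. x2)))"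
        using G' by (auto simp: B'_def)
      obtain p q where "p \<le> b n" "q \<le> b n" "Nn p x1" "Nn q x2"
        using Nn_leMD[OF z(2,3)] Nn_leMD[OF z(2,4)] by blast
      then show ?r using XB' z(5) by blast
    next
      assume ?r
      then obtain p q where pq: "p \<le> b n" "q \<le> b n" "Nn p x1" "Nn q x2" "B n p q" by blast
      obtain z where "z \<in> D" "Nn (b n) z" using Nn_ex by blast
      then show ?l using pq XB' G' Nn_leM unfolding B'_def by blast
    qed
  qed
  \<comment> \<open>Certificates are for binary relations; \<open>c\<close> is a fixed filler in the
    second place.\<close>
  obtain c where c: "c \<in> D" using Nn_ex by blast
  have sound: "Nn n x \<Longrightarrow> y \<in> D \<Longrightarrow> cert A' B' x y \<Longrightarrow> P n" for n x y
  proof (induct "m n" arbitrary: n x y rule: less_induct)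
    case less
    from cert_unfold[OF less(4) Nn_D[OF less(2)] less(3)] show ?case
    proof (elim disjE bexE conjE)
      assume "A' x y"
      then show ?thesis using A'[OF less(2)] P by blast
    next
      fix x1 y1 x2 y2 assume "B' x y x1 y1 x2 y2" and *: "cert A' B' x1 y1" "cert A' B' x2 y2" "y1 \<in> D" "y2 \<in> D"
      then obtain p q where pq: "p \<le> b n" "q \<le> b n" "B n p q" "Nn p x1" "Nn q x2" using B'[OF less(2)] by blast
      then have "P p \<and> P q" using less(1) dec[OF pq(3,1,2)] * by blast
      then show ?thesis using pq P by blast
    qed
  qed
  have compl: "P n \<Longrightarrow> Nn n x \<Longrightarrow> y \<in> D \<Longrightarrow> ind A' B' x y" for n x y
  proof (induct "m n" arbitrary: n x y rule: less_induct)
    case less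
    from less(2)[unfolded P[of n]] show ?case
    proof (elim disjE exE conjE)
      assume "A n"
      then show ?thesis using A'[OF less(3)] less(4) Nn_D[OF less(3)] by (intro ind_base) simp_all
    next
      fix p q assume pq: "p \<le> b n" "q \<le> b n" "B n p q" "P p" "P q"
      obtain x1 x2 where x: "Nn p x1" "Nn q x2" using Nn_ex by blast
      have i: "ind A' B' x1 c" "ind A' B' x2 c" using less(1) dec[OF pq(3,1,2)] pq x c by blast+
      have "B' x y x1 c x2 c" using B'[OF less(3)] pq x by blast
      then show ?thesis by (rule ind_step[OF _ i Nn_D[OF less(3)] less(4)])
    qed
  qed
  show ?thesis
  proof (rule repI)
    show "dfn (\<lambda>v. cert A' B' (v 0) c)"
    proof (rule cert_dfn)
      show "dfn (\<lambda>v. A' (v 0) (v 1))" unfolding A'_def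
        using dfn_subst[OF XA(1), of "\<lambda>_ v. v 0"] pt_var by simp
      show "dfn (\<lambda>v. B' (v 0) (v 1) (v 2) (v 3) (v 4) (v 5))" unfolding B'_def
        by (intro dfn_ex dfn_conj leM_dfn pt_var)
          (rule dfn_subst[OF G(1)], intro pt_case pt_var, rule dfn_subst[OF XB(1)], intro pt_case pt_var)
    qed (intro pt_var pt_const c)+
    show "cert A' B' (v 0) c \<longleftrightarrow> P (n 0)" if "nenv n v" for v n
      using sound[of "n 0" "v 0" c] compl[of "n 0" "v 0" c] ind_cert c that by (auto simp: nenv_def)
  qed
qed

subsection \<open>Finite sets of numbers\<close>

text \<open>A number codes a literal: its half is the atom and its parity the sign.\<close>

abbreviation holds_in :: "nat \<Rightarrow> nat set \<Rightarrow> bool" where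
  "holds_in a X \<equiv> (a div 2 \<in> X) = odd a"

text \<open>A quantifier over sets of numbers becomes a quantifier over elements of
  \<open>M\<close>. Only the part of \<open>X\<close> up to the bound matters; it is finite and
  hence has a code. Conversely every element \<open>s\<close> of \<open>M\<close> determines the set
  \<open>xs s\<close>, which can serve as a valuation.\<close>

lemma rep_clauses:
  assumes C: "rep (\<lambda>n. C (n 0) (n 1) (n 2) (n 3))" and w: "repf (\<lambda>n. w (n 0))"
  shows "rep (\<lambda>n. \<exists>X. \<forall>a\<le>w (n 0). \<forall>b\<le>w (n 0). \<forall>c\<le>w (n 0). C (n 0) a b c \<longrightarrow>
    holds_in a X \<or> holds_in b X \<or> holds_in c X)"
proof -
  obtain XC where XC: "dfn XC" "\<And>v n. nenv n v \<Longrightarrow> XC v \<longleftrightarrow> C (n 0) (n 1) (n 2) (n 3)" using C unfolding rep_def by (elim exE conjE) (rule that, assumption, blast)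
  obtain G where G: "dfn G" "\<And>v n y. nenv n v \<Longrightarrow> y \<in> D \<Longrightarrow> G (case_nat y v) \<longleftrightarrow> Nn (w (n 0)) y"
    using w unfolding repf_def by (elim exE conjE) (rule that, assumption, blast)
  have "rep (\<lambda>n. 2 * n 1 = n 0)" "rep (\<lambda>n. Suc (2 * n 1) = n 0)" by (intro rep_intros0)+
  note r01 = this
  obtain X0 where X0: "dfn X0" "\<And>v n. nenv n v \<Longrightarrow> X0 v \<longleftrightarrow> 2 * n 1 = n 0" using r01(1) unfolding rep_def by (elim exE conjE) (rule that, assumption, blast)
  obtain X1 where X1: "dfn X1" "\<And>v n. nenv n v \<Longrightarrow> X1 v \<longleftrightarrow> Suc (2 * n 1) = n 0" using r01(2) unfolding rep_def by (elim exE conjE) (rule that, assumption, blast)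
  \<comment> \<open>Membership is read up to \<open>eqM\<close>, because a number may have several
    representatives.\<close>
  define memN where "memN x s \<longleftrightarrow> (\<exists>y\<in>D. eqM x y \<and> E y s)" for x s
  define holdsM where "holdsM x s \<longleftrightarrow> (\<exists>h\<in>D. leM h x \<and> (X0 (case_nat x (\<lambda>_. h)) \<and> \<not> memN h s \<or>
    X1 (case_nat x (\<lambda>_. h)) \<and> memN h s))" for x s
  define xs where "xs s = {n. \<exists>x. Nn n x \<and> E x s}" for s
  have memN: "memN x s \<longleftrightarrow> n \<in> xs s" if "Nn n x" for n x s
    using Nn_eqM[OF that] Nn_D by (auto simp: memN_def xs_def)
  have X0': "X0 (case_nat x (\<lambda>_. h)) \<longleftrightarrow> 2 * k = n" and X1': "X1 (case_nat x (\<lambda>_. h)) \<longleftrightarrow> Suc (2 * k) = n"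
    if "Nn n x" "Nn k h" for n x k h
    using X0(2)[of "case_nat n (\<lambda>_. k)" "case_nat x (\<lambda>_. h)"] X1(2)[of "case_nat n (\<lambda>_. k)" "case_nat x (\<lambda>_. h)"] that
    by (auto simp: nenv_Cons) (simp_all add: nenv_def)
  have holdsM: "holdsM x s \<longleftrightarrow> holds_in n (xs s)" if nx: "Nn n x" for n x s
  proof
    assume "holdsM x s"
    then obtain h where h: "leM h x" "X0 (case_nat x (\<lambda>_. h)) \<and> \<not> memN h s \<or> X1 (case_nat x (\<lambda>_. h)) \<and> memN h s"
      by (auto simp: holdsM_def)
    obtain k where k: "Nn k h" using Nn_leMD[OF nx h(1)] by blast
    have "2 * k = n \<and> k \<notin> xs s \<or> Suc (2 * k) = n \<and> k \<in> xs s"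
      using h(2) unfolding X0'[OF nx k] X1'[OF nx k] memN[OF k] .
    then show "holds_in n (xs s)" by (elim disjE conjE; hypsubst) simp_all
  next
    assume *: "holds_in n (xs s)"
    obtain h where h: "h \<in> D" "Nn (n div 2) h" using Nn_ex by blast
    have "leM h x" using Nn_leM[OF h(2) nx] by simp
    moreover have "2 * (n div 2) = n \<and> n div 2 \<notin> xs s \<or> Suc (2 * (n div 2)) = n \<and> n div 2 \<in> xs s"
      using * by (cases "even n") simp_all
    then have "X0 (case_nat x (\<lambda>_. h)) \<and> \<not> memN h s \<or> X1 (case_nat x (\<lambda>_. h)) \<and> memN h s"
      unfolding X0'[OF nx h(2)] X1'[OF nx h(2)] memN[OF h(2)] .
    ultimately show "holdsM x s" using h(1) unfolding holdsM_def by blast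
  qed
  have memN_dfn: "pt f \<Longrightarrow> pt g \<Longrightarrow> dfn (\<lambda>v. memN (f v) (g v))" for f g
    by (rule dfn_inst2) (unfold memN_def, intro dfn_intros eqM_dfn E_dfn)
  have X0_dfn: "dfn (\<lambda>v. X0 (case_nat (v 1) (\<lambda>_. v 0)))" "dfn (\<lambda>v. X1 (case_nat (v 1) (\<lambda>_. v 0)))"
    by (rule dfn_subst[OF X0(1)], intro pt_case pt_var) (rule dfn_subst[OF X1(1)], intro pt_case pt_var)
  have holdsM_dfn: "pt f \<Longrightarrow> pt g \<Longrightarrow> dfn (\<lambda>v. holdsM (f v) (g v))" for f g
    by (rule dfn_inst2) (unfold holdsM_def, intro dfn_ex dfn_conj dfn_disj dfn_not leM_dfn memN_dfn pt_var,
      use X0_dfn in simp_all)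
  define XC' where "XC' p a b c = XC (case_nat p (case_nat a (case_nat b (\<lambda>_. c))))" for p a b c
  have XC': "XC' p a b c \<longleftrightarrow> C np na nb nc" if "Nn np p" "Nn na a" "Nn nb b" "Nn nc c" for p a b c np na nb nc
    using XC(2)[of "case_nat np (case_nat na (case_nat nb (\<lambda>_. nc)))"
        "case_nat p (case_nat a (case_nat b (\<lambda>_. c)))"] that
    by (auto simp: nenv_Cons XC'_def eval_nat_numeral) (simp_all add: nenv_def)
  have XC'_dfn: "pt f \<Longrightarrow> pt g \<Longrightarrow> pt h \<Longrightarrow> pt k \<Longrightarrow> dfn (\<lambda>v. XC' (f v) (g v) (h v) (k v))" for f g h k
  proof (rule dfn_inst4)
    show "dfn (\<lambda>v. XC' (v 0) (v 1) (v 2) (v 3))" unfolding XC'_def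
      by (rule dfn_subst[OF XC(1)]) (intro pt_case pt_var)
  qed
  define G' where "G' z p = G (case_nat z (\<lambda>_. p))" for z p
  have G': "G' z p \<longleftrightarrow> Nn (w np) z" if "Nn np p" "z \<in> D" for z p np
    using G(2)[of "\<lambda>_. np" "\<lambda>_. p" z] that by (simp add: G'_def nenv_def)
  have G'_dfn: "pt f \<Longrightarrow> pt g \<Longrightarrow> dfn (\<lambda>v. G' (f v) (g v))" for f g
  proof (rule dfn_inst2)
    show "dfn (\<lambda>v. G' (v 0) (v 1))" unfolding G'_def
      by (rule dfn_subst[OF G(1)]) (intro pt_case pt_var)
  qed
  show ?thesis
  proof (rule repI)
    show "dfn (\<lambda>v. \<exists>z\<in>D. G' z (v 0) \<and> (\<exists>s\<in>D. \<forall>a\<in>D. \<forall>b\<in>D. \<forall>c\<in>D. leM a z \<and> leM b z \<and> leM c z \<and>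
        XC' (v 0) a b c \<longrightarrow> holdsM a s \<or> holdsM b s \<or> holdsM c s))"
      by (intro dfn_intros G'_dfn XC'_dfn holdsM_dfn leM_dfn)
    fix v n assume nv: "nenv n v"
    let ?W = "w (n 0)"
    have p: "Nn (n 0) (v 0)" using nv by (simp add: nenv_def)
    obtain z where z: "z \<in> D" "Nn ?W z" using Nn_ex by blast
    show "(\<exists>z\<in>D. G' z (v 0) \<and> (\<exists>s\<in>D. \<forall>a\<in>D. \<forall>b\<in>D. \<forall>c\<in>D. leM a z \<and> leM b z \<and> leM c z \<and>
        XC' (v 0) a b c \<longrightarrow> holdsM a s \<or> holdsM b s \<or> holdsM c s)) \<longleftrightarrow>
      (\<exists>X. \<forall>a\<le>?W. \<forall>b\<le>?W. \<forall>c\<le>?W. C (n 0) a b c \<longrightarrow> holds_in a X \<or> holds_in b X \<or> holds_in c X)" (is "?l \<longleftrightarrow> ?r")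
    proof
      assume ?l
      then obtain z s where z: "z \<in> D" "Nn ?W z" and s: "s \<in> D" "\<And>a b c. a \<in> D \<Longrightarrow> b \<in> D \<Longrightarrow> c \<in> D \<Longrightarrow>
        leM a z \<Longrightarrow> leM b z \<Longrightarrow> leM c z \<Longrightarrow> XC' (v 0) a b c \<Longrightarrow> holdsM a s \<or> holdsM b s \<or> holdsM c s"
        using G'[OF p] by blast
      show ?r
      proof (intro exI[of _ "xs s"] allI impI)
        fix a b c assume le: "a \<le> ?W" "b \<le> ?W" "c \<le> ?W" and c: "C (n 0) a b c"
        obtain xa xb xc where x: "xa \<in> D" "Nn a xa" "xb \<in> D" "Nn b xb" "xc \<in> D" "Nn c xc" using Nn_ex by meson
        have "XC' (v 0) xa xb xc" using XC'[OF p x(2,4,6)] c by simp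
        moreover have "leM xa z" "leM xb z" "leM xc z" using Nn_leM[OF _ z(2)] x le by simp_all
        ultimately show "holds_in a (xs s) \<or> holds_in b (xs s) \<or> holds_in c (xs s)"
          using s(2)[of xa xb xc] x holdsM by simp
      qed
    next
      assume ?r
      then obtain X where "\<forall>a\<le>?W. \<forall>b\<le>?W. \<forall>c\<le>?W. C (n 0) a b c \<longrightarrow>
        holds_in a X \<or> holds_in b X \<or> holds_in c X" ..
      note X = this[rule_format]
      define e where "e k = (SOME x. Nn k x)" for k
      have e: "Nn k (e k)" for k unfolding e_def using Nn_ex by (metis someI_ex)
      have "e ` (X \<inter> {..?W}) \<subseteq> D" using Nn_D[OF e] by (rule image_subsetI)
      then obtain s where s: "s \<in> D" "\<forall>x\<in>D. E x s \<longleftrightarrow> x \<in> e ` (X \<inter> {..?W})"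
        using finite_set_code[of "e ` (X \<inter> {..?W})"] by auto
      have xs: "k \<in> xs s \<longleftrightarrow> k \<in> X \<inter> {..?W}" for k
      proof
        assume "k \<in> xs s"
        then obtain x where x: "Nn k x" "E x s" by (auto simp: xs_def)
        then have "x \<in> e ` (X \<inter> {..?W})" using s(2) Nn_D by blast
        then obtain k' where k': "k' \<in> X \<inter> {..?W}" "x = e k'" by blast
        then show "k \<in> X \<inter> {..?W}" using Nn_unique[OF x(1), of k'] e by simp
      next
        assume "k \<in> X \<inter> {..?W}"
        then have "E (e k) s" using s(2) Nn_D[OF e] by blast
        then show "k \<in> xs s" using e by (auto simp: xs_def)
      qed
      have "holdsM a s \<or> holdsM b s \<or> holdsM c s" if le: "leM a z" "leM b z" "leM c z" and c: "XC' (v 0) a b c" for a b c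
      proof -
        obtain na nb nc where x: "na \<le> ?W" "Nn na a" "nb \<le> ?W" "Nn nb b" "nc \<le> ?W" "Nn nc c"
          using Nn_leMD[OF z(2)] le by meson
        have hX: "holds_in k (xs s) \<longleftrightarrow> holds_in k X" if "k \<le> ?W" for k using that xs[of "k div 2"] by auto
        have "C (n 0) na nb nc" using XC'[OF p x(2,4,6)] c by simp
        then show ?thesis using X[OF x(1,3,5)] holdsM x hX by simp
      qed
      then show ?l using z s(1) G'[OF p] by blast
    qed
  qed
qed

end

section \<open>Coding of syntax\<close>

text \<open>The numbering in \<open>godel\<close>, isolated from formulas. The leading 1 keeps
  initial \<open>False\<close> bits significant, so the code is injective.\<close>

definition gb :: "bool list \<Rightarrow> nat" where
  "gb bs = foldl (\<lambda>n b. 2 * n + of_bool b) 1 bs"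

text \<open>Concatenation on the codes of bit strings. The case \<open>y \<le> 1\<close> covers the
  code 1 of the empty string together with 0, which is not a code.\<close>

fun cat :: "nat \<Rightarrow> nat \<Rightarrow> nat" where
  "cat x y = (if y \<le> 1 then x else 2 * cat x (y div 2) + y mod 2)"

declare cat.simps [simp del]

lemma cat_le1: "y \<le> 1 \<Longrightarrow> cat x y = x"
  by (simp add: cat.simps)

lemma cat_step: "1 < y \<Longrightarrow> cat x y = 2 * cat x (y div 2) + y mod 2"
  by (simp add: cat.simps)

lemma gb_Nil [simp]: "gb [] = 1"
  by (simp add: gb_def)

lemma gb_snoc: "gb (bs @ [b]) = 2 * gb bs + of_bool b"
  by (simp add: gb_def)

lemma gb_pos: "0 < gb bs"
  by (induct bs rule: rev_induct) (simp_all add: gb_snoc)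

lemma gb_append: "gb (xs @ ys) = cat (gb xs) (gb ys)"
proof (induct ys rule: rev_induct)
  case Nil
  then show ?case by (simp add: cat_le1)
next
  case (snoc b ys)
  have "gb (xs @ ys @ [b]) = 2 * cat (gb xs) (gb ys) + of_bool b"
    using snoc gb_snoc[of "xs @ ys" b] by simp
  also have "\<dots> = cat (gb xs) (gb (ys @ [b]))"
    using gb_pos[of ys] by (subst (2) cat.simps) (auto simp: gb_snoc)
  finally show ?case .
qed

lemma gb_inj: "gb xs = gb ys \<Longrightarrow> xs = ys"
proof (induct xs arbitrary: ys rule: rev_induct)
  case Nil
  show ?case
  proof (cases ys rule: rev_cases)
    case (snoc ys' b)
    then show ?thesis using Nil gb_pos[of ys'] by (simp add: gb_snoc)
  qed simp
next
  case (snoc b xs)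
  show ?case
  proof (cases ys rule: rev_cases)
    case Nil
    then show ?thesis using snoc gb_pos[of xs] by (simp add: gb_snoc)
  next
    case (snoc ys' b')
    then have e: "2 * gb xs + of_bool b = 2 * gb ys' + (of_bool b' :: nat)"
      using snoc.prems by (simp add: gb_snoc)
    then have "even (2 * gb xs + of_bool b :: nat) = even (2 * gb ys' + of_bool b' :: nat)" by simp
    then have "b = b'" by (cases b; cases b') simp_all
    then show ?thesis using e snoc snoc.hyps by simp
  qed
qed

lemma cat_ge1: "x \<le> cat x y"
proof (induct x y rule: cat.induct)
  case (1 x y)
  then show ?case by (cases "y \<le> 1") (simp_all add: cat_le1 cat_step)
qed

lemma cat_gt2: "1 < x \<Longrightarrow> 0 < y \<Longrightarrow> y < cat x y"
proof (induct x y rule: cat.induct)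
  case (1 x y)
  show ?case
  proof (cases "y \<le> 1")
    case True
    then show ?thesis using 1 by (simp add: cat_le1)
  next
    case False
    then have "y div 2 < cat x (y div 2)" using 1 by simp
    then have "2 * (y div 2) + y mod 2 < 2 * cat x (y div 2) + y mod 2" by simp
    then show ?thesis using False by (simp add: cat_step)
  qed
qed

lemma cat_ge2: "0 < x \<Longrightarrow> y \<le> cat x y"
proof (induct x y rule: cat.induct)
  case (1 x y)
  show ?case
  proof (cases "y \<le> 1")
    case False
    then have "y div 2 \<le> cat x (y div 2)" using 1 by simp
    moreover have "cat x y = 2 * cat x (y div 2) + y mod 2" using False by (simp add: cat_step)
    ultimately show ?thesis using mult_div_mod_eq[of 2 y] by linarith
  qed (use 1 in \<open>simp add: cat_le1\<close>)
qed

text \<open>A digit of \<open>code_nat\<close> contributes two bits in front, with code 6 or 7. That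
  this more than triples the code is the growth needed for \<open>n < cnat n\<close>.\<close>

lemma cat_ge3: "6 \<le> x \<Longrightarrow> 0 < y \<Longrightarrow> 3 * y + 2 \<le> cat x y"
proof (induct x y rule: cat.induct)
  case (1 x y)
  show ?case
  proof (cases "y \<le> 1")
    case False
    then have "3 * (y div 2) + 2 \<le> cat x (y div 2)" using 1 by simp
    moreover have "cat x y = 2 * cat x (y div 2) + y mod 2" using False by (simp add: cat_step)
    moreover have "2 * (y div 2) + y mod 2 = y" "y mod 2 < 2" by simp_all
    ultimately show ?thesis by linarith
  qed (use 1 in \<open>simp add: cat_le1\<close>)
qed

lemma gb_gt1: "bs \<noteq> [] \<Longrightarrow> 1 < gb bs"
proof (cases bs rule: rev_cases)
  case (snoc ys b)
  then show ?thesis using gb_pos[of ys] by (simp add: gb_snoc)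
qed simp

definition cnat :: "nat \<Rightarrow> nat" where "cnat n = gb (code_nat n)"

lemma code_nat_rec: "code_nat n = (if n = 0 then [False] else [True, odd n] @ code_nat (n div 2))"
  by (subst code_nat.simps) simp

lemma code_nat_ne: "code_nat n \<noteq> []"
  by (subst code_nat.simps) simp

lemma cnat_rec: "cnat n = (if n = 0 then 2 else cat (6 + n mod 2) (cnat (n div 2)))"
proof (cases "n = 0")
  case True
  then show ?thesis by (simp add: cnat_def gb_def code_nat.simps[of 0])
next
  case False
  \<comment> \<open>These are the binary numbers 110 and 111.\<close>
  have "gb [True, odd n] = 6 + n mod 2" by (auto simp: gb_def odd_iff_mod_2_eq_one)
  then show ?thesis using False
    by (simp add: cnat_def code_nat_rec[of n] gb_append[of "[True, odd n]" "code_nat (n div 2)", simplified])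
qed

lemma cnat_gt: "n < cnat n"
proof (induct n rule: less_induct)
  case (less n)
  show ?case
  proof (cases "n = 0")
    case False
    then have "n div 2 < cnat (n div 2)" using less by simp
    then have "3 * cnat (n div 2) + 2 \<le> cnat n" using False cat_ge3[of "6 + n mod 2" "cnat (n div 2)"]
      by (simp add: cnat_rec[of n])
    then show ?thesis using \<open>n div 2 < cnat (n div 2)\<close> by linarith
  qed (simp add: cnat_rec[of 0])
qed

text \<open>Unique readability: the code is prefix-free, since each digit is announced by
  \<open>True\<close> and the end by \<open>False\<close>. The tails make the statement applicable
  inside larger codes.\<close>

lemma code_nat_append: "code_nat m @ xs = code_nat n @ ys \<longleftrightarrow> m = n \<and> xs = ys"
proof (induct m arbitrary: n rule: less_induct)
  case (less m)
  show ?case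
  proof (cases "m = 0 \<or> n = 0")
    case True
    then show ?thesis by (auto simp: code_nat_rec[of m] code_nat_rec[of n])
  next
    case False
    then have "code_nat m @ xs = code_nat n @ ys \<longleftrightarrow> odd m = odd n \<and> m div 2 = n div 2 \<and> xs = ys"
      using less[of "m div 2" "n div 2"] by (simp add: code_nat_rec[of m] code_nat_rec[of n])
    also have "\<dots> \<longleftrightarrow> m = n \<and> xs = ys"
      by (metis bit_eq_rec)
    finally show ?thesis .
  qed
qed

lemma code_tm_append: "code_tm t @ xs = code_tm u @ ys \<longleftrightarrow> t = u \<and> xs = ys"
proof (induct t arbitrary: u xs ys)
  case (Var i)
  then show ?case by (cases u) (auto simp: code_nat_append)
next
  case (Fn f ts)
  have list: "concat (map code_tm ts) @ xs = concat (map code_tm us) @ ys \<longleftrightarrow> ts = us \<and> xs = ys"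
    if "length ts = length us" for us xs ys
    using that Fn
  proof (induct ts us rule: list_induct2)
    case (Cons t ts u us)
    have "code_tm t @ (concat (map code_tm ts) @ xs) = code_tm u @ (concat (map code_tm us) @ ys) \<longleftrightarrow>
        t = u \<and> concat (map code_tm ts) @ xs = concat (map code_tm us) @ ys"
      by (rule Cons.prems) simp
    moreover have "concat (map code_tm ts) @ xs = concat (map code_tm us) @ ys \<longleftrightarrow> ts = us \<and> xs = ys"
      by (rule Cons.hyps(2), rule Cons.prems) simp
    ultimately show ?case by (simp only: list.map concat.simps append_assoc) auto
  qed simp
  show ?case
  proof (cases u)
    case (Fn g us)
    then show ?thesis using list[of us xs ys] by (auto simp: code_nat_append)
  qed simp
qed

lemma code_tms_append: "length ts = length us \<Longrightarrow>
    concat (map code_tm ts) @ xs = concat (map code_tm us) @ ys \<longleftrightarrow> ts = us \<and> xs = ys"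
proof (induct ts us rule: list_induct2)
  case (Cons t ts u us)
  then show ?case by (simp only: list.map concat.simps append_assoc code_tm_append) auto
qed simp

lemma code_fm_append: "code_fm \<phi> @ xs = code_fm \<psi> @ ys \<longleftrightarrow> \<phi> = \<psi> \<and> xs = ys"
proof (induct \<phi> arbitrary: \<psi> xs ys)
  case (Rel R ts)
  show ?case
  proof (cases \<psi>)
    case (Rel S us)
    then show ?thesis using code_tms_append[of ts us xs ys] by (auto simp: code_nat_append)
  qed (simp_all add: code_nat_append)
qed (case_tac \<psi>; auto simp: code_nat_append code_tm_append)+

lemma godel_gb: "godel \<phi> = gb (code_fm \<phi>)"
  by (simp add: godel_def gb_def)

lemma godel_inj: "godel \<phi> = godel \<psi> \<longleftrightarrow> \<phi> = \<psi>"
  using gb_inj[of "code_fm \<phi>" "code_fm \<psi>"] code_fm_append[of \<phi> "[]" \<psi> "[]"] by (auto simp: godel_gb)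

section \<open>Codes of signed formulas and of term lists\<close>

definition sc :: "sfm \<Rightarrow> nat" where
  "sc k = 2 * godel (snd k) + of_bool (fst k)"

lemma odd_sc: "odd (sc k) = fst k"
  by (simp add: sc_def)

lemma sc_inj: "sc k = sc k' \<longleftrightarrow> k = k'"
proof
  assume e: "sc k = sc k'"
  then have "fst k = fst k'" using odd_sc by metis
  then show "k = k'" using e godel_inj by (simp add: sc_def prod_eq_iff)
qed simp

text \<open>Lists of terms are coded rather than single terms. The mutual recursion between terms
  and argument lists thus becomes one recursion on codes with two calls, one for the tail and one
  for the arguments of the head.\<close>

definition ctms :: "nat tm list \<Rightarrow> nat" where
  "ctms ts = gb (concat (map code_tm ts))"

lemma ctms_simps:
  "ctms [] = 1"
  "ctms (Var i # ts) = cat (cat 2 (cnat i)) (ctms ts)"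
  "ctms (Fn f us # ts) = cat (cat 3 (cat (cnat f) (cat (cnat (length us)) (ctms us)))) (ctms ts)"
proof -
  have 2: "gb [False] = 2" "gb [True] = 3" by (simp_all add: gb_def)
  show "ctms (Var i # ts) = cat (cat 2 (cnat i)) (ctms ts)"
    by (simp add: ctms_def cnat_def flip: gb_append 2(1))
  show "ctms (Fn f us # ts) = cat (cat 3 (cat (cnat f) (cat (cnat (length us)) (ctms us)))) (ctms ts)"
    by (simp add: ctms_def cnat_def flip: gb_append 2(2))
qed (simp add: ctms_def)

lemma ctms_pos: "0 < ctms ts" by (simp add: ctms_def gb_pos)

text \<open>The length is not part of the code and has to be known separately.\<close>

lemma ctms_inj: "length ts = length us \<Longrightarrow> ctms ts = ctms us \<Longrightarrow> ts = us"
  using gb_inj code_tms_append[of ts us "[]" "[]"] by (auto simp: ctms_def)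

lemma godel_simps:
  "godel (Eq s t) = cat (cnat 0) (ctms [s, t])"
  "godel (Rel R ts) = cat (cnat 1) (cat (cnat R) (cat (cnat (length ts)) (ctms ts)))"
  "godel (Neg \<phi>) = cat (cnat 2) (godel \<phi>)"
  "godel (And \<phi> \<psi>) = cat (cnat 3) (cat (godel \<phi>) (godel \<psi>))"
  "godel (Or \<phi> \<psi>) = cat (cnat 4) (cat (godel \<phi>) (godel \<psi>))"
  "godel (Ex \<phi>) = cat (cnat 5) (godel \<phi>)"
  "godel (All \<phi>) = cat (cnat 6) (godel \<phi>)"
  by (simp_all add: godel_gb ctms_def cnat_def flip: gb_append)

lemma cnat_gt1: "1 < cnat n" unfolding cnat_def by (rule gb_gt1[OF code_nat_ne])

lemma cat_less2: "y < cat (cnat n) y" if "0 < y"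
  by (rule cat_gt2[OF cnat_gt1 that])

lemma cat_gt0: "0 < x \<Longrightarrow> 0 < cat x y"
  using cat_ge1[of x y] by simp

lemma godel_pos: "0 < godel \<phi>" by (simp add: godel_gb gb_pos)

text \<open>These inequalities supply the bounds for quantifiers over codes of immediate
  parts.\<close>

lemma godel_sub:
  "ctms [s, t] < godel (Eq s t)" "R < godel (Rel R ts)" "length ts < godel (Rel R ts)" "ctms ts < godel (Rel R ts)"
  "godel \<phi> < godel (Neg \<phi>)" "godel \<phi> < godel (And \<phi> \<psi>)" "godel \<psi> < godel (And \<phi> \<psi>)"
  "godel \<phi> < godel (Or \<phi> \<psi>)" "godel \<psi> < godel (Or \<phi> \<psi>)" "godel \<phi> < godel (Ex \<phi>)" "godel \<phi> < godel (All \<phi>)"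
proof -
  have c: "y < cat (cnat k) y" "x < cat (cnat k) (cat x y)" "y < cat (cnat k) (cat x y)" if "0 < x" "0 < y" for x y k
    using cat_less2[of y k] cat_less2[of "cat x y" k] cat_ge1[of x y] cat_ge2[of x y] that
    by (simp_all del: One_nat_def)
  have p: "0 < cnat k" for k using cnat_gt1[of k] by simp
  show "R < godel (Rel R ts)" "length ts < godel (Rel R ts)" "ctms ts < godel (Rel R ts)"
    using c(2)[of "cnat R" "cat (cnat (length ts)) (ctms ts)" 1] c(3)[of "cnat R" "cat (cnat (length ts)) (ctms ts)" 1]
      cnat_gt[of R] cnat_gt[of "length ts"] cat_ge1[of "cnat (length ts)" "ctms ts"]
      cat_less2[of "ctms ts" "length ts"] p ctms_pos cat_gt0[OF p]
    by (simp_all add: godel_simps(2))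
  show "godel \<phi> < godel (And \<phi> \<psi>)" "godel \<psi> < godel (And \<phi> \<psi>)"
    "godel \<phi> < godel (Or \<phi> \<psi>)" "godel \<psi> < godel (Or \<phi> \<psi>)"
    using c(2,3)[OF godel_pos godel_pos] by (simp_all add: godel_simps)
qed (simp_all only: godel_simps cat_less2 ctms_pos godel_pos)

lemma ctms_sub:
  "i < ctms (Var i # ts)" "ctms ts < ctms (Var i # ts)" "f < ctms (Fn f us # ts)"
  "length us < ctms (Fn f us # ts)" "ctms us < ctms (Fn f us # ts)" "ctms ts < ctms (Fn f us # ts)"
proof -
  let ?c = "cat (cnat (length us)) (ctms us)"
  have p: "0 < cnat k" for k using cnat_gt1[of k] by simp
  have v: "1 < cat 2 (cnat i)" using cat_ge1[of 2 "cnat i"] by simp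
  then show "ctms ts < ctms (Var i # ts)" using ctms_pos cat_gt2 by (simp add: ctms_simps)
  have "cnat i \<le> cat 2 (cnat i)" by (rule cat_ge2) simp
  then show "i < ctms (Var i # ts)" using cat_ge1[of "cat 2 (cnat i)" "ctms ts"] cnat_gt[of i]
    by (simp add: ctms_simps)
  have w: "1 < cat 3 (cat (cnat f) ?c)" using cat_ge1[of 3] by (meson le_less_trans le_trans less_le_not_le not_le numeral_le_iff one_less_numeral_iff semiring_norm(77) order_less_le_trans)
  then show "ctms ts < ctms (Fn f us # ts)" using ctms_pos cat_gt2 by (simp add: ctms_simps)
  have k: "cat (cnat f) ?c \<le> ctms (Fn f us # ts)"
    using cat_ge2[of 3 "cat (cnat f) ?c"] cat_ge1[of "cat 3 (cat (cnat f) ?c)" "ctms ts"] by (simp add: ctms_simps)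
  show "f < ctms (Fn f us # ts)" using k cat_ge1[of "cnat f" ?c] cnat_gt[of f] by simp
  have k': "?c \<le> ctms (Fn f us # ts)" using k cat_ge2[of "cnat f" ?c] p[of f] by simp
  show "length us < ctms (Fn f us # ts)" using k' cat_ge1[of "cnat (length us)" "ctms us"] cnat_gt[of "length us"] by simp
  show "ctms us < ctms (Fn f us # ts)" using k' cat_less2[OF ctms_pos, of us "length us"] by simp
qed

section \<open>Tuples of numbers, and numbers as Henkin constants\<close>

definition p1 :: "nat \<Rightarrow> nat" where "p1 n = fst (prod_decode n)"
definition p2 :: "nat \<Rightarrow> nat" where "p2 n = snd (prod_decode n)"

lemma p12 [simp]: "p1 (prod_encode (a, b)) = a" "p2 (prod_encode (a, b)) = b"
  by (simp_all add: p1_def p2_def)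

lemma p12_cases: "(\<And>a b. n = prod_encode (a, b) \<Longrightarrow> thesis) \<Longrightarrow> thesis"
  by (metis prod_decode_inverse surj_pair)

abbreviation "t3 x y z \<equiv> prod_encode (x, prod_encode (y, z))"
abbreviation "t4 x y z u \<equiv> prod_encode (x, t3 y z u)"

lemma t3_cases: "(\<And>a b c. n = t3 a b c \<Longrightarrow> thesis) \<Longrightarrow> thesis"
  by (metis p12_cases)

lemma t4_cases: "(\<And>a b c d. n = t4 a b c d \<Longrightarrow> thesis) \<Longrightarrow> thesis"
  by (metis p12_cases)

lemma prod_mono: "a \<le> a' \<Longrightarrow> b \<le> b' \<Longrightarrow> prod_encode (a, b) \<le> prod_encode (a', b')"
  unfolding prod_encode_def prod.case triangle_def
  by (intro add_mono div_le_mono mult_le_mono) simp_all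

lemma le_t3: "a \<le> t3 a b c" "b \<le> t3 a b c" "c \<le> t3 a b c"
  by (rule le_prod_encode_1, rule order_trans[OF le_prod_encode_1 le_prod_encode_2],
      rule order_trans[OF le_prod_encode_2 le_prod_encode_2])

lemma le_t4: "a \<le> t4 a b c d" "b \<le> t4 a b c d" "c \<le> t4 a b c d" "d \<le> t4 a b c d"
  by (rule le_prod_encode_1, rule order_trans[OF le_t3(1) le_prod_encode_2],
      rule order_trans[OF le_t3(2) le_prod_encode_2], rule order_trans[OF le_t3(3) le_prod_encode_2])

lemma cat_gt: "1 < x \<Longrightarrow> y < cat x y"
  using cat_gt2[of x y] cat_le1[of y x] by (cases "y = 0") auto

lemma cat_ge: "0 < x \<Longrightarrow> y \<le> cat x y"
  by (rule cat_ge2)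

text \<open>The three residue classes modulo 3 hold the parameters, the function constants and the
  witnesses, so the sort of a number and its components can be decoded.\<close>

definition parN :: "nat \<Rightarrow> nat" where "parN i = 3 * i"
definition fncN :: "nat \<Rightarrow> nat list \<Rightarrow> nat" where "fncN f cs = Suc (3 * prod_encode (f, list_encode cs))"
definition witN :: "sfm \<Rightarrow> nat list \<Rightarrow> nat" where "witN k cs = Suc (Suc (3 * prod_encode (sc k, list_encode cs)))"

abbreviation "vN \<equiv> henkin.val fncN"

locale arith = seqmodel +
  assumes finL: "finite_lang L'"
begin

lemma repf_p1: "repf f \<Longrightarrow> repf (\<lambda>n. p1 (f n))"
proof (erule repf_comp[rotated])
  have "x = p1 m \<longleftrightarrow> (\<exists>y\<le>m. m = prod_encode (x, y))" for x m
    by (rule p12_cases[of m]) (auto simp: le_prod_encode_2)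
  then show "repf (\<lambda>n. p1 (n 0))"
    by (intro repf_graph) (simp only:, intro rep_intros0 repf_prod)
qed

lemma repf_p2: "repf f \<Longrightarrow> repf (\<lambda>n. p2 (f n))"
proof (erule repf_comp[rotated])
  have "x = p2 m \<longleftrightarrow> (\<exists>y\<le>m. m = prod_encode (y, x))" for x m
    by (rule p12_cases[of m]) (auto simp: le_prod_encode_1)
  then show "repf (\<lambda>n. p2 (n 0))"
    by (intro repf_graph) (simp only:, intro rep_intros0 repf_prod)
qed

lemma repf_div2: "repf f \<Longrightarrow> repf (\<lambda>n. f n div 2)"
proof (erule repf_comp[rotated])
  have "x = m div 2 \<longleftrightarrow> m = 2 * x \<or> m = Suc (2 * x)" for x m :: nat by arith
  then show "repf (\<lambda>n. n 0 div 2)"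
    by (intro repf_graph) (simp only:, intro rep_intros0)
qed

lemma repf_mod2: "repf f \<Longrightarrow> repf (\<lambda>n. f n mod 2)"
proof (erule repf_comp[rotated])
  have "x = m mod 2 \<longleftrightarrow> x \<le> 1 \<and> m = 2 * (m div 2) + x" for x m :: nat by arith
  then show "repf (\<lambda>n. n 0 mod 2)"
    by (intro repf_graph) (simp only:, intro rep_intros0 repf_div2)
qed

text \<open>Finiteness of the language turns membership of a symbol into a finite
  disjunction.\<close>

lemma rep_finite: "finite F \<Longrightarrow> repf f \<Longrightarrow> repf g \<Longrightarrow> rep (\<lambda>n. (f n, g n) \<in> F)"
proof (induct F rule: finite_induct)
  case empty
  show ?case using rep_const[of False] by simp
next
  case (insert p F)
  have "rep (\<lambda>n. (f n = fst p \<and> g n = snd p) \<or> (f n, g n) \<in> F)"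
    using insert by (intro rep_disj rep_conj rep_eq repf_const)
  then show ?case by (simp add: prod_eq_iff)
qed

lemma rep_funs: "repf f \<Longrightarrow> repf g \<Longrightarrow> rep (\<lambda>n. (f n, g n) \<in> funs L')"
  and rep_rels: "repf f \<Longrightarrow> repf g \<Longrightarrow> rep (\<lambda>n. (f n, g n) \<in> rels L')"
  using finL by (simp_all add: rep_finite finite_lang_def)

lemmas rep_intros1 = rep_intros0 repf_prod repf_p1 repf_p2 repf_div2 repf_mod2 rep_funs rep_rels

text \<open>The recursion halves the second argument and the value together, so the recursive call
  is no larger than the triple itself and the identity can serve as bound.\<close>

lemma rep_cat0: "rep (\<lambda>n. p2 (p2 (n 0)) = cat (p1 (n 0)) (p1 (p2 (n 0))))"
proof (rule rep_ind[where P = "\<lambda>m. p2 (p2 m) = cat (p1 m) (p1 (p2 m))"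
      and A = "\<lambda>m. p1 (p2 m) \<le> 1 \<and> p2 (p2 m) = p1 m"
      and B = "\<lambda>m p q. 1 < p1 (p2 m) \<and> p = t3 (p1 m) (p1 (p2 m) div 2) (p2 (p2 m) div 2) \<and>
        p2 (p2 m) mod 2 = p1 (p2 m) mod 2 \<and> q = p"
      and b = "\<lambda>m. m" and m = "\<lambda>m. p1 (p2 m)"])
  fix n
  obtain x y z where n: "n = t3 x y z" by (rule t3_cases)
  have le: "t3 x (y div 2) (z div 2) \<le> t3 x y z" by (intro prod_mono) simp_all
  have "z = cat x y \<longleftrightarrow> y \<le> 1 \<and> z = x \<or> 1 < y \<and> z mod 2 = y mod 2 \<and> z div 2 = cat x (y div 2)"
  proof (cases "y \<le> 1")
    case False
    have "z = 2 * c + k \<longleftrightarrow> z mod 2 = k \<and> z div 2 = c" if "k < 2" for c k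
    proof
      assume "z mod 2 = k \<and> z div 2 = c"
      then show "z = 2 * c + k" using mult_div_mod_eq[of 2 z] by simp
    qed (use that in simp)
    from this[of "y mod 2"] show ?thesis using False by (simp add: cat_step)
  qed (auto simp: cat_le1)
  then show "p2 (p2 n) = cat (p1 n) (p1 (p2 n)) \<longleftrightarrow> (p1 (p2 n) \<le> 1 \<and> p2 (p2 n) = p1 n) \<or>
    (\<exists>p\<le>n. \<exists>q\<le>n. (1 < p1 (p2 n) \<and> p = t3 (p1 n) (p1 (p2 n) div 2) (p2 (p2 n) div 2) \<and>
        p2 (p2 n) mod 2 = p1 (p2 n) mod 2 \<and> q = p) \<and> p2 (p2 p) = cat (p1 p) (p1 (p2 p)) \<and> p2 (p2 q) = cat (p1 q) (p1 (p2 q)))"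
    using le by (auto simp: n simp del: One_nat_def)
next
  show "rep (\<lambda>n. 1 < p1 (p2 (n 0)) \<and> n 1 = t3 (p1 (n 0)) (p1 (p2 (n 0)) div 2) (p2 (p2 (n 0)) div 2) \<and>
      p2 (p2 (n 0)) mod 2 = p1 (p2 (n 0)) mod 2 \<and> n 2 = n 1)" by (intro rep_intros1)
qed (auto intro!: rep_intros1)

lemma repf_cat: "repf f \<Longrightarrow> repf g \<Longrightarrow> repf (\<lambda>n. cat (f n) (g n))"
proof (rule repf_comp2[where h = cat])
  have "repf (\<lambda>n. t3 (n 1) (n 2) (n 0))" by (intro rep_intros1)
  from rep_comp[OF rep_cat0 this] show "repf (\<lambda>n. cat (n 0) (n 1))"
    by (intro repf_graph) (simp add: eval_nat_numeral)
qed assumption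

lemma rep_cnat0: "rep (\<lambda>n. p2 (n 0) = cnat (p1 (n 0)))"
proof (rule rep_ind[where P = "\<lambda>m. p2 m = cnat (p1 m)"
      and A = "\<lambda>m. p1 m = 0 \<and> p2 m = 2"
      and B = "\<lambda>m p q. 0 < p1 m \<and> (\<exists>z\<le>p2 m. p = prod_encode (p1 m div 2, z) \<and> p2 m = cat (6 + p1 m mod 2) z) \<and> q = p"
      and b = "\<lambda>m. m" and m = p1])
  fix n
  obtain a z where n: "n = prod_encode (a, z)" by (rule p12_cases)
  have "z = cnat a \<longleftrightarrow> a = 0 \<and> z = 2 \<or> 0 < a \<and> z = cat (6 + a mod 2) (cnat (a div 2))"
    by (subst cnat_rec) auto
  moreover have "cnat (a div 2) \<le> cat (6 + a mod 2) (cnat (a div 2))" by (rule cat_ge) simp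
  moreover have "prod_encode (a div 2, z') \<le> prod_encode (a, z)" if "z' \<le> z" for z'
    using that by (intro prod_mono) simp_all
  ultimately show "p2 n = cnat (p1 n) \<longleftrightarrow> (p1 n = 0 \<and> p2 n = 2) \<or> (\<exists>p\<le>n. \<exists>q\<le>n. (0 < p1 n \<and>
      (\<exists>z\<le>p2 n. p = prod_encode (p1 n div 2, z) \<and> p2 n = cat (6 + p1 n mod 2) z) \<and> q = p) \<and>
      p2 p = cnat (p1 p) \<and> p2 q = cnat (p1 q))"
    unfolding n p12 by (smt (verit) p12)
next
  show "rep (\<lambda>n. 0 < p1 (n 0) \<and> (\<exists>z\<le>p2 (n 0). n 1 = prod_encode (p1 (n 0) div 2, z) \<and>
      p2 (n 0) = cat (6 + p1 (n 0) mod 2) z) \<and> n 2 = n 1)" by (intro rep_intros1 repf_cat)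
qed (auto intro!: rep_intros1)

lemma repf_cnat: "repf f \<Longrightarrow> repf (\<lambda>n. cnat (f n))"
proof (erule repf_comp[rotated])
  have "repf (\<lambda>n. prod_encode (n 1, n 0))" by (intro rep_intros1)
  from rep_comp[OF rep_cnat0 this] show "repf (\<lambda>n. cnat (n 0))"
    by (intro repf_graph) (simp add: eval_nat_numeral)
qed

lemmas rep_intros2 = rep_intros1 repf_cat repf_cnat

subsection \<open>Terms and formulas\<close>

definition TL :: "nat \<Rightarrow> nat \<Rightarrow> nat \<Rightarrow> bool" where
  "TL b k z \<longleftrightarrow> (\<exists>ts. length ts = k \<and> list_all (wf_tm L' b) ts \<and> z = ctms ts)"

abbreviation "cFn f j z1 z \<equiv> cat (cat 3 (cat (cnat f) (cat (cnat j) z1))) z"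

lemma cFn_less: "z1 < cFn f j z1 z" "z < cFn f j z1 z"
proof -
  have "z1 < cat (cnat j) z1" by (rule cat_gt[OF cnat_gt1])
  also have "\<dots> \<le> cat (cnat f) (cat (cnat j) z1)" using cat_gt[OF cnat_gt1] by (rule less_imp_le)
  also have "\<dots> \<le> cat 3 (cat (cnat f) (cat (cnat j) z1))" by (rule cat_ge) simp
  finally have *: "z1 < cat 3 (cat (cnat f) (cat (cnat j) z1))" .
  then show "z1 < cFn f j z1 z" using cat_ge1 by (rule less_le_trans)
  show "z < cFn f j z1 z" using cat_ge1[of 3 "cat (cnat f) (cat (cnat j) z1)"] by (intro cat_gt) simp
qed

lemma cVar_less: "z < cat (cat 2 (cnat i)) z"
  using cat_ge1[of 2 "cnat i"] by (intro cat_gt) simp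

text \<open>The rule relation for \<open>rep_ind\<close>: \<open>p\<close> is the call for the tail
  of the list, and \<open>q\<close> the call for the arguments of the head, or \<open>p\<close> once
  more if the head is a variable.\<close>

definition TL_B :: "nat \<Rightarrow> nat \<Rightarrow> nat \<Rightarrow> bool" where
  "TL_B m p q \<longleftrightarrow> (\<exists>k\<le>p1 (p2 m). p1 (p2 m) = Suc k \<and> (\<exists>z\<le>p2 (p2 m). p = t3 (p1 m) k z \<and>
    ((\<exists>i\<le>p2 (p2 m). i < p1 m \<and> p2 (p2 m) = cat (cat 2 (cnat i)) z \<and> q = p) \<or>
     (\<exists>f\<le>p2 (p2 m). \<exists>j\<le>p2 (p2 m). \<exists>z1\<le>p2 (p2 m). (f, j) \<in> funs L' \<and> p2 (p2 m) = cFn f j z1 z \<and>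
        q = t3 (p1 m) j z1))))"

lemma TL_rec: "TL b k z \<longleftrightarrow> k = 0 \<and> z = 1 \<or> (\<exists>k'. k = Suc k' \<and> (\<exists>z'\<le>z. TL b k' z' \<and>
    ((\<exists>i\<le>z. i < b \<and> z = cat (cat 2 (cnat i)) z') \<or>
     (\<exists>f\<le>z. \<exists>j\<le>z. \<exists>z1\<le>z. (f, j) \<in> funs L' \<and> z = cFn f j z1 z' \<and> TL b j z1))))" (is "?l \<longleftrightarrow> ?r")
proof
  assume ?l
  then obtain ts where ts: "length ts = k" "list_all (wf_tm L' b) ts" "z = ctms ts" by (auto simp: TL_def)
  show ?r
  proof (cases ts)
    case Nil
    then show ?thesis using ts by (simp add: ctms_simps)
  next
    case (Cons t us)
    then have k: "k = Suc (length us)" and us: "TL b (length us) (ctms us)" using ts by (auto simp: TL_def)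
    show ?thesis
    proof (cases t)
      case (Var i)
      then have "ctms us \<le> z" "i \<le> z" "i < b" "z = cat (cat 2 (cnat i)) (ctms us)"
        using ts Cons ctms_sub(1)[of i us] ctms_sub(2)[of us i] by (auto simp: ctms_simps)
      then show ?thesis using k us by blast
    next
      case (Fn f ws)
      then have "ctms us \<le> z" "f \<le> z" "length ws \<le> z" "ctms ws \<le> z" "(f, length ws) \<in> funs L'"
        "z = cFn f (length ws) (ctms ws) (ctms us)" "TL b (length ws) (ctms ws)"
        using ts Cons ctms_sub(3-6)[where f = f and us = ws and ts = us] by (auto simp: ctms_simps TL_def)
      then show ?thesis using k us by blast
    qed
  qed
next
  assume ?r
  then show ?l
  proof (elim disjE exE conjE)
    assume "k = 0" "z = 1"
    then show ?l by (auto simp: TL_def ctms_simps)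
  next
    fix k' z' i assume "k = Suc k'" "TL b k' z'" "i < b" "z = cat (cat 2 (cnat i)) z'"
    then obtain us where "length us = k'" "list_all (wf_tm L' b) us" "z' = ctms us" by (auto simp: TL_def)
    then show ?l unfolding TL_def using \<open>k = Suc k'\<close> \<open>i < b\<close> \<open>z = _\<close>
      by (intro exI[of _ "Var i # us"]) (simp add: ctms_simps)
  next
    fix k' z' f j z1 assume *: "k = Suc k'" "TL b k' z'" "(f, j) \<in> funs L'" "z = cFn f j z1 z'" "TL b j z1"
    obtain us where "length us = k'" "list_all (wf_tm L' b) us" "z' = ctms us" using *(2) by (auto simp: TL_def)
    moreover obtain ws where "length ws = j" "list_all (wf_tm L' b) ws" "z1 = ctms ws" using *(5) by (auto simp: TL_def)
    ultimately show ?l unfolding TL_def using * by (intro exI[of _ "Fn f ws # us"]) (simp add: ctms_simps)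
  qed
qed

lemma rep_TL0: "rep (\<lambda>n. TL (p1 (n 0)) (p1 (p2 (n 0))) (p2 (p2 (n 0))))"
\<comment> \<open>The arity of the head symbol may exceed the length of the list, so a call need not
  be below the triple \<open>m\<close> as a number; its components are, whence the bound
  \<open>t3 m m m\<close>. The code of the list is what decreases.\<close>
proof (rule rep_ind[where P = "\<lambda>m. TL (p1 m) (p1 (p2 m)) (p2 (p2 m))" and A = "\<lambda>m. p1 (p2 m) = 0 \<and> p2 (p2 m) = 1"
      and B = TL_B and b = "\<lambda>m. t3 m m m" and m = "\<lambda>m. p2 (p2 m)"])
  fix n
  obtain b k z where n: "n = t3 b k z" by (rule t3_cases)
  have le: "t3 x y u \<le> t3 n n n" if "x \<le> n" "y \<le> n" "u \<le> n" for x y u using that by (intro prod_mono)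
  have nn: "b \<le> n" "k \<le> n" "z \<le> n" unfolding n by (rule le_t3)+
  show "TL (p1 n) (p1 (p2 n)) (p2 (p2 n)) \<longleftrightarrow> (p1 (p2 n) = 0 \<and> p2 (p2 n) = 1) \<or>
      (\<exists>p\<le>t3 n n n. \<exists>q\<le>t3 n n n. TL_B n p q \<and> TL (p1 p) (p1 (p2 p)) (p2 (p2 p)) \<and> TL (p1 q) (p1 (p2 q)) (p2 (p2 q)))"
    (is "?l \<longleftrightarrow> ?a \<or> ?r")
  proof
    assume ?l
    then have "TL b k z" by (simp add: n)
    then show "?a \<or> ?r" unfolding TL_rec[of b k z]
    proof (elim disjE exE conjE)
      fix k' z' i assume *: "k = Suc k'" "z' \<le> z" "TL b k' z'" "i \<le> z" "i < b" "z = cat (cat 2 (cnat i)) z'"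
      have "TL_B n (t3 b k' z') (t3 b k' z')" using * unfolding TL_B_def n p12 by auto
      moreover have "t3 b k' z' \<le> t3 n n n" using * nn by (intro le) simp_all
      ultimately show ?thesis using *(3) by (metis p12)
    next
      fix k' z' f j z1 assume *: "k = Suc k'" "z' \<le> z" "TL b k' z'" "f \<le> z" "j \<le> z" "z1 \<le> z"
        "(f, j) \<in> funs L'" "z = cFn f j z1 z'" "TL b j z1"
      have "TL_B n (t3 b k' z') (t3 b j z1)" using * unfolding TL_B_def n p12 by auto
      moreover have "t3 b k' z' \<le> t3 n n n" "t3 b j z1 \<le> t3 n n n" using * nn by (intro le; simp)+
      ultimately show ?thesis using *(3,9) by (metis p12)
    qed (simp add: n)
  next
    assume "?a \<or> ?r"
    then show ?l
    proof
      assume ?a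
      then show ?l using TL_rec[of b k z] by (simp add: n)
    next
      assume ?r
      then obtain p q where "TL_B n p q" "TL (p1 p) (p1 (p2 p)) (p2 (p2 p))" "TL (p1 q) (p1 (p2 q)) (p2 (p2 q))"
        by blast
      then have "TL b k z" unfolding TL_rec[of b k z] unfolding TL_B_def n p12
        by (elim exE conjE disjE) (simp only: p12; blast)+
      then show ?l by (simp add: n)
    qed
  qed
next
  fix n p q assume "TL_B n p q"
  then show "p2 (p2 p) < p2 (p2 n) \<and> p2 (p2 q) < p2 (p2 n)"
    unfolding TL_B_def using cVar_less cFn_less by (elim exE conjE disjE) simp_all
next
  show "rep (\<lambda>n. TL_B (n 0) (n 1) (n 2))" unfolding TL_B_def by (intro rep_intros2)
qed (auto intro!: rep_intros1)

lemma rep_TL: "repf f \<Longrightarrow> repf g \<Longrightarrow> repf h \<Longrightarrow> rep (\<lambda>n. TL (f n) (g n) (h n))"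
  using rep_comp[OF rep_TL0, of "\<lambda>n. t3 (f n) (g n) (h n)"] by (simp add: repf_prod)

definition FmC :: "nat \<Rightarrow> nat \<Rightarrow> bool" where
  "FmC b g \<longleftrightarrow> (\<exists>\<phi>. wf_fm L' b \<phi> \<and> g = godel \<phi>)"

definition FmA :: "nat \<Rightarrow> nat \<Rightarrow> bool" where
  "FmA b g \<longleftrightarrow> (\<exists>z\<le>g. TL b 2 z \<and> g = cat (cnat 0) z) \<or> (\<exists>R\<le>g. \<exists>k\<le>g. \<exists>z\<le>g. (R, k) \<in> rels L' \<and> TL b k z \<and>
     g = cat (cnat 1) (cat (cnat R) (cat (cnat k) z)))"

definition Fm1 :: "nat \<Rightarrow> nat \<Rightarrow> nat \<Rightarrow> nat \<Rightarrow> bool" where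
  "Fm1 b g b' g' \<longleftrightarrow> g = cat (cnat 2) g' \<and> b' = b \<or> (g = cat (cnat 5) g' \<or> g = cat (cnat 6) g') \<and> b' = Suc b"

lemma FmC_rec: "FmC b g \<longleftrightarrow> FmA b g \<or> (\<exists>b' g'. g' < g \<and> Fm1 b g b' g' \<and> FmC b' g') \<or>
    (\<exists>g1 g2. g1 < g \<and> g2 < g \<and> (g = cat (cnat 3) (cat g1 g2) \<or> g = cat (cnat 4) (cat g1 g2)) \<and> FmC b g1 \<and> FmC b g2)"
  (is "?l \<longleftrightarrow> ?r")
proof
  assume ?l
  then obtain \<phi> where \<phi>: "wf_fm L' b \<phi>" "g = godel \<phi>" by (auto simp: FmC_def)
  show ?r
  proof (cases \<phi>)
    case (Eq s t)
    have "TL b 2 (ctms [s, t])" unfolding TL_def by (rule exI[of _ "[s, t]"]) (use \<phi> Eq in simp)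
    then have "FmA b g" unfolding FmA_def using \<phi> Eq godel_sub(1)[of s t]
      by (intro disjI1 exI[of _ "ctms [s, t]"]) (simp add: godel_simps less_imp_le)
    then show ?thesis by blast
  next
    case (Rel R ts)
    have "TL b (length ts) (ctms ts)" unfolding TL_def by (rule exI[of _ ts]) (use \<phi> Rel in simp)
    moreover have "R \<le> g" "length ts \<le> g" "ctms ts \<le> g" "(R, length ts) \<in> rels L'"
      "g = cat (cnat 1) (cat (cnat R) (cat (cnat (length ts)) (ctms ts)))"
      using \<phi> Rel godel_sub(2)[of R ts] godel_sub(3)[of ts R] godel_sub(4)[of ts R] by (simp_all add: godel_simps)
    ultimately have "FmA b g" unfolding FmA_def by blast
    then show ?thesis by blast
  next
    case (Neg \<psi>)
    then have "godel \<psi> < g" "Fm1 b g b (godel \<psi>)" "FmC b (godel \<psi>)"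
      using \<phi> godel_sub by (auto simp: Fm1_def FmC_def godel_simps)
    then show ?thesis by blast
  next
    case (Ex \<psi>)
    then have "godel \<psi> < g" "Fm1 b g (Suc b) (godel \<psi>)" "FmC (Suc b) (godel \<psi>)"
      using \<phi> godel_sub by (auto simp: Fm1_def FmC_def godel_simps)
    then show ?thesis by blast
  next
    case (All \<psi>)
    then have "godel \<psi> < g" "Fm1 b g (Suc b) (godel \<psi>)" "FmC (Suc b) (godel \<psi>)"
      using \<phi> godel_sub by (auto simp: Fm1_def FmC_def godel_simps)
    then show ?thesis by blast
  next
    case (And \<psi> \<chi>)
    then have "godel \<psi> < g" "godel \<chi> < g" "g = cat (cnat 3) (cat (godel \<psi>) (godel \<chi>))" "FmC b (godel \<psi>)" "FmC b (godel \<chi>)"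
      using \<phi> godel_sub by (auto simp: FmC_def godel_simps)
    then show ?thesis by blast
  next
    case (Or \<psi> \<chi>)
    then have "godel \<psi> < g" "godel \<chi> < g" "g = cat (cnat 4) (cat (godel \<psi>) (godel \<chi>))" "FmC b (godel \<psi>)" "FmC b (godel \<chi>)"
      using \<phi> godel_sub by (auto simp: FmC_def godel_simps)
    then show ?thesis by blast
  qed
next
  assume ?r
  then show ?l
  proof (elim disjE exE conjE)
    assume "FmA b g"
    then show ?l unfolding FmA_def
    proof (elim disjE exE conjE)
      fix z assume "TL b 2 z" and g: "g = cat (cnat 0) z"
      then obtain ts where "length ts = 2" "list_all (wf_tm L' b) ts" "z = ctms ts" by (auto simp: TL_def)
      then obtain s t where "wf_tm L' b s" "wf_tm L' b t" "z = ctms [s, t]"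
        by (auto simp: numeral_2_eq_2 length_Suc_conv)
      then show ?l using g unfolding FmC_def by (intro exI[of _ "Eq s t"]) (simp add: godel_simps)
    next
      fix R k z assume "TL b k z" and g: "(R, k) \<in> rels L'" "g = cat (cnat 1) (cat (cnat R) (cat (cnat k) z))"
      then obtain ts where "length ts = k" "list_all (wf_tm L' b) ts" "z = ctms ts" by (auto simp: TL_def)
      then show ?l using g unfolding FmC_def by (intro exI[of _ "Rel R ts"]) (simp add: godel_simps)
    qed
  next
    fix b' g' assume "Fm1 b g b' g'" "FmC b' g'"
    then obtain \<phi> where \<phi>: "wf_fm L' b' \<phi>" "g' = godel \<phi>" by (auto simp: FmC_def)
    show ?l using \<open>Fm1 b g b' g'\<close> unfolding Fm1_def
    proof (elim disjE conjE)
      assume "g = cat (cnat 2) g'" "b' = b"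
      then show ?l using \<phi> unfolding FmC_def by (intro exI[of _ "Neg \<phi>"]) (simp add: godel_simps)
    next
      assume "g = cat (cnat 5) g'" "b' = Suc b"
      then show ?l using \<phi> unfolding FmC_def by (intro exI[of _ "Ex \<phi>"]) (simp add: godel_simps)
    next
      assume "g = cat (cnat 6) g'" "b' = Suc b"
      then show ?l using \<phi> unfolding FmC_def by (intro exI[of _ "All \<phi>"]) (simp add: godel_simps)
    qed
  next
    fix g1 g2 assume "FmC b g1" "FmC b g2" and g: "g = cat (cnat 3) (cat g1 g2)"
    then obtain \<phi> \<psi> where "wf_fm L' b \<phi>" "g1 = godel \<phi>" "wf_fm L' b \<psi>" "g2 = godel \<psi>" by (auto simp: FmC_def)
    then show ?l using g unfolding FmC_def by (intro exI[of _ "And \<phi> \<psi>"]) (simp add: godel_simps)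
  next
    fix g1 g2 assume "FmC b g1" "FmC b g2" and g: "g = cat (cnat 4) (cat g1 g2)"
    then obtain \<phi> \<psi> where "wf_fm L' b \<phi>" "g1 = godel \<phi>" "wf_fm L' b \<psi>" "g2 = godel \<psi>" by (auto simp: FmC_def)
    then show ?l using g unfolding FmC_def by (intro exI[of _ "Or \<phi> \<psi>"]) (simp add: godel_simps)
  qed
qed

lemma rep_FmC0: "rep (\<lambda>n. FmC (p1 (n 0)) (p2 (n 0)))"
\<comment> \<open>A quantifier raises the number of admissible variables by one, hence
  \<open>Suc m\<close> in the bound, while the code of the formula decreases.\<close>
proof (rule rep_ind[where P = "\<lambda>m. FmC (p1 m) (p2 m)" and A = "\<lambda>m. FmA (p1 m) (p2 m)"
      and B = "\<lambda>m p q. p2 p < p2 m \<and> p2 q < p2 m \<and> (Fm1 (p1 m) (p2 m) (p1 p) (p2 p) \<and> q = p \<or>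
        (p2 m = cat (cnat 3) (cat (p2 p) (p2 q)) \<or> p2 m = cat (cnat 4) (cat (p2 p) (p2 q))) \<and> p1 p = p1 m \<and> p1 q = p1 m)"
      and b = "\<lambda>m. prod_encode (Suc m, m)" and m = p2])
  fix n
  obtain b g where n: "n = prod_encode (b, g)" by (rule p12_cases)
  have nn: "b \<le> n" "g \<le> n" by (simp_all add: n le_prod_encode_1 le_prod_encode_2)
  have le: "prod_encode (x, y) \<le> prod_encode (Suc n, n)" if "x \<le> Suc n" "y \<le> n" for x y
    using that by (intro prod_mono)
  show "FmC (p1 n) (p2 n) \<longleftrightarrow> FmA (p1 n) (p2 n) \<or> (\<exists>p\<le>prod_encode (Suc n, n). \<exists>q\<le>prod_encode (Suc n, n).
      (p2 p < p2 n \<and> p2 q < p2 n \<and> (Fm1 (p1 n) (p2 n) (p1 p) (p2 p) \<and> q = p \<or>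
        (p2 n = cat (cnat 3) (cat (p2 p) (p2 q)) \<or> p2 n = cat (cnat 4) (cat (p2 p) (p2 q))) \<and> p1 p = p1 n \<and> p1 q = p1 n)) \<and>
      FmC (p1 p) (p2 p) \<and> FmC (p1 q) (p2 q))" (is "?l \<longleftrightarrow> ?a \<or> ?r")
  proof
    assume ?l
    then have "FmC b g" by (simp add: n)
    then show "?a \<or> ?r" unfolding FmC_rec[of b g]
    proof (elim disjE exE conjE)
      fix b' g' assume *: "g' < g" "Fm1 b g b' g'" "FmC b' g'"
      then have "prod_encode (b', g') \<le> prod_encode (Suc n, n)" using nn by (intro le) (auto simp: Fm1_def)
      then show ?thesis using * by - (rule disjI2, rule exI[of _ "prod_encode (b', g')"], rule conjI,
          (simp add: n), rule exI[of _ "prod_encode (b', g')"], simp add: n)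
    next
      fix g1 g2 assume *: "g1 < g" "g2 < g" "g = cat (cnat 3) (cat g1 g2)" "FmC b g1" "FmC b g2"
      then have "prod_encode (b, g1) \<le> prod_encode (Suc n, n)" "prod_encode (b, g2) \<le> prod_encode (Suc n, n)"
        using nn by (intro le; simp)+
      then show ?thesis using *(1,2,4,5) *(3)[symmetric]
        by - (rule disjI2, rule exI[of _ "prod_encode (b, g1)"], rule conjI,
          (simp add: n), rule exI[of _ "prod_encode (b, g2)"], simp add: n)
    next
      fix g1 g2 assume *: "g1 < g" "g2 < g" "g = cat (cnat 4) (cat g1 g2)" "FmC b g1" "FmC b g2"
      then have "prod_encode (b, g1) \<le> prod_encode (Suc n, n)" "prod_encode (b, g2) \<le> prod_encode (Suc n, n)"
        using nn by (intro le; simp)+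
      then show ?thesis using *(1,2,4,5) *(3)[symmetric]
        by - (rule disjI2, rule exI[of _ "prod_encode (b, g1)"], rule conjI,
          (simp add: n), rule exI[of _ "prod_encode (b, g2)"], simp add: n)
    qed (simp add: n)
  next
    assume "?a \<or> ?r"
    then show ?l
    proof
      assume ?a
      then show ?l using FmC_rec by blast
    next
      assume ?r
      then obtain p q where pq: "p2 p < p2 n" "p2 q < p2 n" "FmC (p1 p) (p2 p)" "FmC (p1 q) (p2 q)"
        and d: "Fm1 (p1 n) (p2 n) (p1 p) (p2 p) \<and> q = p \<or>
          (p2 n = cat (cnat 3) (cat (p2 p) (p2 q)) \<or> p2 n = cat (cnat 4) (cat (p2 p) (p2 q))) \<and> p1 p = p1 n \<and> p1 q = p1 n"
        by blast
      from d show ?l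
      proof
        assume "Fm1 (p1 n) (p2 n) (p1 p) (p2 p) \<and> q = p"
        then show ?l using pq FmC_rec[of "p1 n" "p2 n"] by blast
      next
        assume *: "(p2 n = cat (cnat 3) (cat (p2 p) (p2 q)) \<or> p2 n = cat (cnat 4) (cat (p2 p) (p2 q))) \<and> p1 p = p1 n \<and> p1 q = p1 n"
        then have "FmC (p1 n) (p2 p)" "FmC (p1 n) (p2 q)" using pq by simp_all
        then show ?l using * pq(1,2) FmC_rec[of "p1 n" "p2 n"] by blast
      qed
    qed
  qed
next
  show "rep (\<lambda>n. p2 (n 1) < p2 (n 0) \<and> p2 (n 2) < p2 (n 0) \<and> (Fm1 (p1 (n 0)) (p2 (n 0)) (p1 (n 1)) (p2 (n 1)) \<and> n 2 = n 1 \<or>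
        (p2 (n 0) = cat (cnat 3) (cat (p2 (n 1)) (p2 (n 2))) \<or> p2 (n 0) = cat (cnat 4) (cat (p2 (n 1)) (p2 (n 2)))) \<and>
        p1 (n 1) = p1 (n 0) \<and> p1 (n 2) = p1 (n 0)))"
    unfolding Fm1_def by (intro rep_intros2)
  show "rep (\<lambda>n. FmA (p1 (n 0)) (p2 (n 0)))" unfolding FmA_def by (intro rep_intros2 rep_TL)
  show "repf (\<lambda>n. prod_encode (Suc (n 0), n 0))" by (intro rep_intros2)
qed auto

lemma rep_FmC: "repf f \<Longrightarrow> repf g \<Longrightarrow> rep (\<lambda>n. FmC (f n) (g n))"
  using rep_comp[OF rep_FmC0, of "\<lambda>n. prod_encode (f n, g n)"] by (simp add: repf_prod)

end

section \<open>Coded lists of numbers and the values of coded terms\<close>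

lemma list_decode_Suc_prod [simp]: "list_decode (Suc (prod_encode (x, l))) = x # list_decode l"
  by simp

lemma list_code_cases:
  assumes "e = 0 \<Longrightarrow> thesis" "\<And>x l. e = Suc (prod_encode (x, l)) \<Longrightarrow> thesis"
  shows thesis
  using assms by (metis not0_implies_Suc p12_cases)

lemma list_code_less: "x < Suc (prod_encode (x, l))" "l < Suc (prod_encode (x, l))"
  by (simp_all add: le_imp_less_Suc le_prod_encode_1 le_prod_encode_2)

abbreviation "lc x l \<equiv> Suc (prod_encode (x, l))"

context arith
begin

definition Nth :: "nat \<Rightarrow> nat \<Rightarrow> nat \<Rightarrow> bool" where
  "Nth e i c \<longleftrightarrow> i < length (list_decode e) \<and> list_decode e ! i = c"

lemma rep_Nth0: "rep (\<lambda>n. Nth (p1 (n 0)) (p1 (p2 (n 0))) (p2 (p2 (n 0))))"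
proof (rule rep_ind[where P = "\<lambda>m. Nth (p1 m) (p1 (p2 m)) (p2 (p2 m))"
      and A = "\<lambda>m. p1 (p2 m) = 0 \<and> (\<exists>l\<le>p1 m. p1 m = lc (p2 (p2 m)) l)"
      and B = "\<lambda>m p q. (\<exists>i\<le>p1 (p2 m). p1 (p2 m) = Suc i \<and> (\<exists>x\<le>p1 m. \<exists>l\<le>p1 m. p1 m = lc x l \<and> p = t3 l i (p2 (p2 m)))) \<and> q = p"
      and b = "\<lambda>m. m" and m = "\<lambda>m. p1 (p2 m)"])
  fix n
  obtain e i c where n: "n = t3 e i c" by (rule t3_cases)
  have le: "t3 l i' c \<le> n" if "l \<le> e" "i' \<le> i" for l i' unfolding n using that by (intro prod_mono) simp_all
  have "Nth e i c \<longleftrightarrow> i = 0 \<and> (\<exists>l\<le>e. e = lc c l) \<or>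
      (\<exists>i'\<le>i. i = Suc i' \<and> (\<exists>x\<le>e. \<exists>l\<le>e. e = lc x l \<and> Nth l i' c))"
  proof (rule list_code_cases[of e])
    fix x l assume e: "e = lc x l"
    have "x \<le> e" "l \<le> e" unfolding e using list_code_less(1)[of x l] list_code_less(2)[of l x] by simp_all
    then show ?thesis by (cases i) (auto simp: e Nth_def)
  qed (simp add: Nth_def)
  then show "Nth (p1 n) (p1 (p2 n)) (p2 (p2 n)) \<longleftrightarrow> p1 (p2 n) = 0 \<and> (\<exists>l\<le>p1 n. p1 n = lc (p2 (p2 n)) l) \<or>
      (\<exists>p\<le>n. \<exists>q\<le>n. ((\<exists>i\<le>p1 (p2 n). p1 (p2 n) = Suc i \<and> (\<exists>x\<le>p1 n. \<exists>l\<le>p1 n. p1 n = lc x l \<and> p = t3 l i (p2 (p2 n)))) \<and> q = p) \<and>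
        Nth (p1 p) (p1 (p2 p)) (p2 (p2 p)) \<and> Nth (p1 q) (p1 (p2 q)) (p2 (p2 q)))"
    using le unfolding n p12 by (smt (verit) p12)
next
  show "rep (\<lambda>n. (\<exists>i\<le>p1 (p2 (n 0)). p1 (p2 (n 0)) = Suc i \<and> (\<exists>x\<le>p1 (n 0). \<exists>l\<le>p1 (n 0). p1 (n 0) = lc x l \<and>
      n 1 = t3 l i (p2 (p2 (n 0))))) \<and> n 2 = n 1)" by (intro rep_intros1)
qed (auto intro!: rep_intros1)

lemma rep_Nth: "repf f \<Longrightarrow> repf g \<Longrightarrow> repf h \<Longrightarrow> rep (\<lambda>n. Nth (f n) (g n) (h n))"
  using rep_comp[OF rep_Nth0, of "\<lambda>n. t3 (f n) (g n) (h n)"] by (simp add: repf_prod)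

definition Near :: "nat \<Rightarrow> nat \<Rightarrow> nat \<Rightarrow> nat \<Rightarrow> bool" where
  "Near c d x y \<longleftrightarrow> near c d (list_decode x) (list_decode y)"

lemma near_iff: "near c d xs ys \<longleftrightarrow> xs = ys \<or> (\<exists>zs. xs = c # zs \<and> ys = d # zs) \<or>
    (\<exists>z xs' ys'. xs = z # xs' \<and> ys = z # ys' \<and> near c d xs' ys')"
  by (auto elim: near.cases intro: near.intros)

lemma Near_rec: "Near c d x y \<longleftrightarrow> x = y \<or> (\<exists>l\<le>x. x = lc c l \<and> y = lc d l) \<or>
    (\<exists>z\<le>x. \<exists>l\<le>x. \<exists>l'\<le>y. x = lc z l \<and> y = lc z l' \<and> Near c d l l')" (is "?l \<longleftrightarrow> ?r")
proof
  assume ?l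
  then have n: "near c d (list_decode x) (list_decode y)" by (simp add: Near_def)
  from n[unfolded near_iff[of c d "list_decode x"]] show ?r
  proof (elim disjE exE conjE)
    assume "list_decode x = list_decode y"
    then show ?thesis by (metis list_decode_inverse)
  next
    fix zs assume "list_decode x = c # zs" "list_decode y = d # zs"
    then have "x = lc c (list_encode zs)" "y = lc d (list_encode zs)" by (metis list_decode_inverse list_encode.simps(2))+
    then show ?thesis using list_code_less(2)[of "list_encode zs" c] less_imp_le by blast
  next
    fix z xs' ys' assume *: "list_decode x = z # xs'" "list_decode y = z # ys'" "near c d xs' ys'"
    then have xy: "x = lc z (list_encode xs')" "y = lc z (list_encode ys')" by (metis list_decode_inverse list_encode.simps(2))+
    then have "z \<le> x" "list_encode xs' \<le> x" "list_encode ys' \<le> y"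
      using list_code_less(1)[of z "list_encode xs'"] list_code_less(2)[of "list_encode xs'" z] list_code_less(1)[of z "list_encode ys'"] list_code_less(2)[of "list_encode ys'" z] by simp_all
    moreover have "Near c d (list_encode xs') (list_encode ys')" using *(3) by (simp add: Near_def)
    ultimately show ?thesis using xy by blast
  qed
next
  assume ?r
  then show ?l unfolding Near_def by (elim disjE exE conjE) (auto intro: near.intros)
qed

lemma rep_Near0: "rep (\<lambda>n. Near (p1 (n 0)) (p1 (p2 (n 0))) (p1 (p2 (p2 (n 0)))) (p2 (p2 (p2 (n 0)))))"
proof (rule rep_ind[where P = "\<lambda>m. Near (p1 m) (p1 (p2 m)) (p1 (p2 (p2 m))) (p2 (p2 (p2 m)))"
      and A = "\<lambda>m. p1 (p2 (p2 m)) = p2 (p2 (p2 m)) \<or>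
        (\<exists>l\<le>p1 (p2 (p2 m)). p1 (p2 (p2 m)) = lc (p1 m) l \<and> p2 (p2 (p2 m)) = lc (p1 (p2 m)) l)"
      and B = "\<lambda>m p q. (\<exists>z\<le>p1 (p2 (p2 m)). \<exists>l\<le>p1 (p2 (p2 m)). \<exists>l'\<le>p2 (p2 (p2 m)). p1 (p2 (p2 m)) = lc z l \<and>
        p2 (p2 (p2 m)) = lc z l' \<and> p = t4 (p1 m) (p1 (p2 m)) l l') \<and> q = p"
      and b = "\<lambda>m. m" and m = "\<lambda>m. p1 (p2 (p2 m))"])
  fix n
  obtain c d x y where n: "n = t4 c d x y" by (rule t4_cases)
  have le: "t4 c d l l' \<le> n" if "l \<le> x" "l' \<le> y" for l l' unfolding n using that by (intro prod_mono) simp_all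
  show "Near (p1 n) (p1 (p2 n)) (p1 (p2 (p2 n))) (p2 (p2 (p2 n))) \<longleftrightarrow> (p1 (p2 (p2 n)) = p2 (p2 (p2 n)) \<or>
        (\<exists>l\<le>p1 (p2 (p2 n)). p1 (p2 (p2 n)) = lc (p1 n) l \<and> p2 (p2 (p2 n)) = lc (p1 (p2 n)) l)) \<or>
      (\<exists>p\<le>n. \<exists>q\<le>n. ((\<exists>z\<le>p1 (p2 (p2 n)). \<exists>l\<le>p1 (p2 (p2 n)). \<exists>l'\<le>p2 (p2 (p2 n)). p1 (p2 (p2 n)) = lc z l \<and>
        p2 (p2 (p2 n)) = lc z l' \<and> p = t4 (p1 n) (p1 (p2 n)) l l') \<and> q = p) \<and>
        Near (p1 p) (p1 (p2 p)) (p1 (p2 (p2 p))) (p2 (p2 (p2 p))) \<and> Near (p1 q) (p1 (p2 q)) (p1 (p2 (p2 q))) (p2 (p2 (p2 q))))"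
    (is "?l \<longleftrightarrow> ?a \<or> ?r")
  proof
    assume ?l
    then have "Near c d x y" by (simp add: n)
    then show "?a \<or> ?r" unfolding Near_rec[of c d x y]
    proof (elim disjE exE conjE)
      fix z l l' assume *: "z \<le> x" "l \<le> x" "l' \<le> y" "x = lc z l" "y = lc z l'" "Near c d l l'"
      then have r: "\<exists>z\<le>x. \<exists>l\<le>x. \<exists>l'\<le>y. x = lc z l \<and> y = lc z l' \<and> t4 c d l l' = t4 c d l l'" by blast
      show ?thesis using le[OF *(2,3)] *
        by - (rule disjI2, rule exI[of _ "t4 c d l l'"], rule conjI, assumption, rule exI[of _ "t4 c d l l'"],
          rule conjI, assumption, unfold n p12, blast)
    qed (simp_all add: n)
  next
    assume "?a \<or> ?r"
    then have "Near c d x y" unfolding Near_rec[of c d x y] unfolding n p12 by (smt (verit) p12)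
    then show ?l by (simp add: n)
  qed
next
  fix n p q assume "(\<exists>z\<le>p1 (p2 (p2 n)). \<exists>l\<le>p1 (p2 (p2 n)). \<exists>l'\<le>p2 (p2 (p2 n)). p1 (p2 (p2 n)) = lc z l \<and>
        p2 (p2 (p2 n)) = lc z l' \<and> p = t4 (p1 n) (p1 (p2 n)) l l') \<and> q = p"
  then show "p1 (p2 (p2 p)) < p1 (p2 (p2 n)) \<and> p1 (p2 (p2 q)) < p1 (p2 (p2 n))"
    using list_code_less(2) by (elim exE conjE) simp
next
  show "rep (\<lambda>n. (\<exists>z\<le>p1 (p2 (p2 (n 0))). \<exists>l\<le>p1 (p2 (p2 (n 0))). \<exists>l'\<le>p2 (p2 (p2 (n 0))). p1 (p2 (p2 (n 0))) = lc z l \<and>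
        p2 (p2 (p2 (n 0))) = lc z l' \<and> n 1 = t4 (p1 (n 0)) (p1 (p2 (n 0))) l l') \<and> n 2 = n 1)" by (intro rep_intros1)
qed (intro rep_intros1)+

lemma rep_Near: "repf f \<Longrightarrow> repf g \<Longrightarrow> repf h \<Longrightarrow> repf k \<Longrightarrow> rep (\<lambda>n. Near (f n) (g n) (h n) (k n))"
  using rep_comp[OF rep_Near0, of "\<lambda>n. t4 (f n) (g n) (h n) (k n)"] by (simp add: repf_prod)

text \<open>The clauses for equality and relations mention \<open>val\<close>, so the constants
  named by a list of terms are computed along with the reading of its code.\<close>

definition VL :: "nat \<Rightarrow> nat \<Rightarrow> nat \<Rightarrow> nat \<Rightarrow> bool" where
  "VL k z e l \<longleftrightarrow> (\<exists>ts. length ts = k \<and> list_all (wf_tm L' (length (list_decode e))) ts \<and> z = ctms ts \<and>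
    l = list_encode (map (vN (list_decode e)) ts))"

definition VL_B :: "nat \<Rightarrow> nat \<Rightarrow> nat \<Rightarrow> bool" where
  "VL_B m p q \<longleftrightarrow> (\<exists>k\<le>p1 m. p1 m = Suc k \<and> (\<exists>z\<le>p1 (p2 m). \<exists>c\<le>p2 (p2 (p2 m)). \<exists>l\<le>p2 (p2 (p2 m)).
    p2 (p2 (p2 m)) = lc c l \<and> p = t4 k z (p1 (p2 (p2 m))) l \<and>
    ((\<exists>i\<le>p1 (p2 m). Nth (p1 (p2 (p2 m))) i c \<and> p1 (p2 m) = cat (cat 2 (cnat i)) z \<and> q = p) \<or>
     (\<exists>f\<le>p1 (p2 m). \<exists>j\<le>p1 (p2 m). \<exists>z1\<le>p1 (p2 m). \<exists>a\<le>c. (f, j) \<in> funs L' \<and> p1 (p2 m) = cFn f j z1 z \<and>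
        c = Suc (3 * prod_encode (f, a)) \<and> q = t4 j z1 (p1 (p2 (p2 m))) a))))"

lemma VL_rec: "VL k z e l \<longleftrightarrow> k = 0 \<and> z = 1 \<and> l = 0 \<or> (\<exists>k'. k = Suc k' \<and> (\<exists>z'\<le>z. \<exists>c\<le>l. \<exists>l'\<le>l. l = lc c l' \<and> VL k' z' e l' \<and>
    ((\<exists>i\<le>z. Nth e i c \<and> z = cat (cat 2 (cnat i)) z') \<or>
     (\<exists>f\<le>z. \<exists>j\<le>z. \<exists>z1\<le>z. \<exists>a\<le>c. (f, j) \<in> funs L' \<and> z = cFn f j z1 z' \<and> c = Suc (3 * prod_encode (f, a)) \<and> VL j z1 e a))))"
  (is "?l \<longleftrightarrow> ?r")
proof
  assume ?l
  then obtain ts where ts: "length ts = k" "list_all (wf_tm L' (length (list_decode e))) ts" "z = ctms ts"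
    "l = list_encode (map (vN (list_decode e)) ts)" by (auto simp: VL_def)
  show ?r
  proof (cases ts)
    case Nil
    then show ?thesis using ts by (simp add: ctms_simps)
  next
    case (Cons t us)
    let ?l' = "list_encode (map (vN (list_decode e)) us)" and ?c = "vN (list_decode e) t"
    have k: "k = Suc (length us)" and us: "VL (length us) (ctms us) e ?l'" using ts Cons by (auto simp: VL_def)
    have l: "l = lc ?c ?l'" using ts Cons by simp
    then have lb: "?c \<le> l" "?l' \<le> l" using list_code_less(1)[of ?c ?l'] list_code_less(2)[of ?l' ?c] by simp_all
    show ?thesis
    proof (cases t)
      case (Var i)
      then have "ctms us \<le> z" "i \<le> z" "Nth e i ?c" "z = cat (cat 2 (cnat i)) (ctms us)"
        using ts Cons ctms_sub(1)[of i us] ctms_sub(2)[of us i] by (auto simp: ctms_simps Nth_def henkin.val.simps)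
      then show ?thesis using k us l lb by blast
    next
      case (Fn f ws)
      let ?a = "list_encode (map (vN (list_decode e)) ws)"
      have "ctms us \<le> z" "f \<le> z" "length ws \<le> z" "ctms ws \<le> z" "(f, length ws) \<in> funs L'"
        "z = cFn f (length ws) (ctms ws) (ctms us)" "VL (length ws) (ctms ws) e ?a"
        using ts Cons Fn ctms_sub(3-6)[where f = f and us = ws and ts = us] by (auto simp: ctms_simps VL_def)
      moreover have c: "?c = Suc (3 * prod_encode (f, ?a))" using Fn by (simp add: henkin.val.simps fncN_def)
      moreover have "?a \<le> ?c" unfolding c using le_prod_encode_2[of ?a f] by linarith
      ultimately show ?thesis using k us l lb by blast
    qed
  qed
next
  assume ?r
  then show ?l
  proof (elim disjE exE conjE)
    assume "k = 0" "z = 1" "l = 0"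
    then show ?l by (auto simp: VL_def ctms_simps)
  next
    fix k' z' c l' i assume *: "k = Suc k'" "l = lc c l'" "VL k' z' e l'" "Nth e i c" "z = cat (cat 2 (cnat i)) z'"
    then obtain us where "length us = k'" "list_all (wf_tm L' (length (list_decode e))) us" "z' = ctms us"
      "l' = list_encode (map (vN (list_decode e)) us)" by (auto simp: VL_def)
    then show ?l unfolding VL_def using *
      by (intro exI[of _ "Var i # us"]) (simp add: ctms_simps Nth_def henkin.val.simps)
  next
    fix k' z' c l' f j z1 a assume *: "k = Suc k'" "l = lc c l'" "VL k' z' e l'" "(f, j) \<in> funs L'" "z = cFn f j z1 z'"
      "c = Suc (3 * prod_encode (f, a))" "VL j z1 e a"
    obtain us where us: "length us = k'" "list_all (wf_tm L' (length (list_decode e))) us" "z' = ctms us"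
      "l' = list_encode (map (vN (list_decode e)) us)" using *(3) by (auto simp: VL_def)
    obtain ws where ws: "length ws = j" "list_all (wf_tm L' (length (list_decode e))) ws" "z1 = ctms ws"
      "a = list_encode (map (vN (list_decode e)) ws)" using *(7) by (auto simp: VL_def)
    show ?l unfolding VL_def using * us ws
      by (intro exI[of _ "Fn f ws # us"]) (simp add: ctms_simps henkin.val.simps fncN_def)
  qed
qed

lemma rep_VL0: "rep (\<lambda>n. VL (p1 (n 0)) (p1 (p2 (n 0))) (p1 (p2 (p2 (n 0)))) (p2 (p2 (p2 (n 0)))))"
proof (rule rep_ind[where P = "\<lambda>m. VL (p1 m) (p1 (p2 m)) (p1 (p2 (p2 m))) (p2 (p2 (p2 m)))"
      and A = "\<lambda>m. p1 m = 0 \<and> p1 (p2 m) = 1 \<and> p2 (p2 (p2 m)) = 0"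
      and B = VL_B and b = "\<lambda>m. t4 m m m m" and m = "\<lambda>m. p1 (p2 m)"])
  fix n
  obtain k z e l where n: "n = t4 k z e l" by (rule t4_cases)
  have le: "t4 x y u w \<le> t4 n n n n" if "x \<le> n" "y \<le> n" "u \<le> n" "w \<le> n" for x y u w using that by (intro prod_mono)
  have nn: "k \<le> n" "z \<le> n" "e \<le> n" "l \<le> n" unfolding n by (rule le_t4)+
  show "VL (p1 n) (p1 (p2 n)) (p1 (p2 (p2 n))) (p2 (p2 (p2 n))) \<longleftrightarrow> (p1 n = 0 \<and> p1 (p2 n) = 1 \<and> p2 (p2 (p2 n)) = 0) \<or>
      (\<exists>p\<le>t4 n n n n. \<exists>q\<le>t4 n n n n. VL_B n p q \<and> VL (p1 p) (p1 (p2 p)) (p1 (p2 (p2 p))) (p2 (p2 (p2 p))) \<and>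
        VL (p1 q) (p1 (p2 q)) (p1 (p2 (p2 q))) (p2 (p2 (p2 q))))"
    (is "?l \<longleftrightarrow> ?a \<or> ?r")
  proof
    assume ?l
    then have "VL k z e l" by (simp add: n)
    then show "?a \<or> ?r" unfolding VL_rec[of k z e l]
    proof (elim disjE exE conjE)
      fix k' z' c l' i assume *: "k = Suc k'" "z' \<le> z" "c \<le> l" "l' \<le> l" "l = lc c l'" "VL k' z' e l'" "i \<le> z"
        "Nth e i c" "z = cat (cat 2 (cnat i)) z'"
      have "VL_B n (t4 k' z' e l') (t4 k' z' e l')" using * unfolding VL_B_def n p12 by auto
      moreover have "t4 k' z' e l' \<le> t4 n n n n" using * nn by (intro le) simp_all
      ultimately show ?thesis using *(6) by (metis p12)
    next
      fix k' z' c l' f j z1 a assume *: "k = Suc k'" "z' \<le> z" "c \<le> l" "l' \<le> l" "l = lc c l'" "VL k' z' e l'"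
        "f \<le> z" "j \<le> z" "z1 \<le> z" "a \<le> c" "(f, j) \<in> funs L'" "z = cFn f j z1 z'" "c = Suc (3 * prod_encode (f, a))" "VL j z1 e a"
      have "VL_B n (t4 k' z' e l') (t4 j z1 e a)" using * unfolding VL_B_def n p12 by auto
      moreover have "t4 k' z' e l' \<le> t4 n n n n" "t4 j z1 e a \<le> t4 n n n n" using * nn by (intro le; simp)+
      ultimately show ?thesis using *(6,14) by (metis p12)
    qed (simp add: n)
  next
    assume "?a \<or> ?r"
    then show ?l
    proof
      assume ?a
      then show ?l using VL_rec[of k z e l] by (simp add: n)
    next
      assume ?r
      then obtain p q where "VL_B n p q" "VL (p1 p) (p1 (p2 p)) (p1 (p2 (p2 p))) (p2 (p2 (p2 p)))"
        "VL (p1 q) (p1 (p2 q)) (p1 (p2 (p2 q))) (p2 (p2 (p2 q)))" by blast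
      then have "VL k z e l" unfolding VL_rec[of k z e l] unfolding VL_B_def n p12
        by (elim exE conjE disjE) (simp only: p12; blast)+
      then show ?l by (simp add: n)
    qed
  qed
next
  fix n p q assume "VL_B n p q"
  then show "p1 (p2 p) < p1 (p2 n) \<and> p1 (p2 q) < p1 (p2 n)"
    unfolding VL_B_def using cVar_less cFn_less by (elim exE conjE disjE) simp_all
next
  show "rep (\<lambda>n. VL_B (n 0) (n 1) (n 2))" unfolding VL_B_def by (intro rep_intros2 rep_Nth)
qed (auto intro!: rep_intros1)

lemma rep_VL: "repf f \<Longrightarrow> repf g \<Longrightarrow> repf h \<Longrightarrow> repf k \<Longrightarrow> rep (\<lambda>n. VL (f n) (g n) (h n) (k n))"
  using rep_comp[OF rep_VL0, of "\<lambda>n. t4 (f n) (g n) (h n) (k n)"] by (simp add: repf_prod)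

subsection \<open>Signed formulas\<close>

text \<open>The number of admissible variables is coded along, so that well-formedness can be
  followed below quantifiers.\<close>

definition bsc :: "nat \<Rightarrow> sfm \<Rightarrow> nat" where "bsc b k = prod_encode (b, sc k)"

definition conjN :: "nat \<Rightarrow> nat \<Rightarrow> nat \<Rightarrow> bool" where
  "conjN x y z \<longleftrightarrow> (\<exists>b\<le>x. \<exists>p\<le>x. FmC b p \<and>
    (x = prod_encode (b, 2 * cat (cnat 2) p) \<and> y = prod_encode (b, 2 * p + 1) \<and> z = y \<or>
     x = prod_encode (b, 2 * cat (cnat 2) p + 1) \<and> y = prod_encode (b, 2 * p) \<and> z = y \<or>
     (\<exists>q\<le>x. FmC b q \<and>
       (x = prod_encode (b, 2 * cat (cnat 3) (cat p q) + 1) \<and> y = prod_encode (b, 2 * p + 1) \<and> z = prod_encode (b, 2 * q + 1) \<or>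
        x = prod_encode (b, 2 * cat (cnat 4) (cat p q)) \<and> y = prod_encode (b, 2 * p) \<and> z = prod_encode (b, 2 * q)))))"

definition disjN :: "nat \<Rightarrow> nat \<Rightarrow> nat \<Rightarrow> bool" where
  "disjN x y z \<longleftrightarrow> (\<exists>b\<le>x. \<exists>p\<le>x. FmC b p \<and> (\<exists>q\<le>x. FmC b q \<and>
       (x = prod_encode (b, 2 * cat (cnat 4) (cat p q) + 1) \<and> y = prod_encode (b, 2 * p + 1) \<and> z = prod_encode (b, 2 * q + 1) \<or>
        x = prod_encode (b, 2 * cat (cnat 3) (cat p q)) \<and> y = prod_encode (b, 2 * p) \<and> z = prod_encode (b, 2 * q))))"

definition exN :: "nat \<Rightarrow> nat \<Rightarrow> bool" where
  "exN x y \<longleftrightarrow> (\<exists>b\<le>x. \<exists>p\<le>x. FmC (Suc b) p \<and>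
    (x = prod_encode (b, 2 * cat (cnat 5) p + 1) \<and> y = prod_encode (Suc b, 2 * p + 1) \<or>
     x = prod_encode (b, 2 * cat (cnat 6) p) \<and> y = prod_encode (Suc b, 2 * p)))"

definition allN :: "nat \<Rightarrow> nat \<Rightarrow> bool" where
  "allN x y \<longleftrightarrow> (\<exists>b\<le>x. \<exists>p\<le>x. FmC (Suc b) p \<and>
    (x = prod_encode (b, 2 * cat (cnat 6) p + 1) \<and> y = prod_encode (Suc b, 2 * p + 1) \<or>
     x = prod_encode (b, 2 * cat (cnat 5) p) \<and> y = prod_encode (Suc b, 2 * p)))"

lemma rep_kinds:
  "repf f \<Longrightarrow> repf g \<Longrightarrow> repf h \<Longrightarrow> rep (\<lambda>n. conjN (f n) (g n) (h n))"
  "repf f \<Longrightarrow> repf g \<Longrightarrow> repf h \<Longrightarrow> rep (\<lambda>n. disjN (f n) (g n) (h n))"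
  "repf f \<Longrightarrow> repf g \<Longrightarrow> rep (\<lambda>n. exN (f n) (g n))"
  "repf f \<Longrightarrow> repf g \<Longrightarrow> rep (\<lambda>n. allN (f n) (g n))"
proof -
  have 3: "rep (\<lambda>n. R (f n) (g n) (h n))" if "rep (\<lambda>n. R (p1 (n 0)) (p1 (p2 (n 0))) (p2 (p2 (n 0))))"
    "repf f" "repf g" "repf h" for R f g h
    using rep_comp[OF that(1), of "\<lambda>n. t3 (f n) (g n) (h n)"] that by (simp add: repf_prod)
  have 2: "rep (\<lambda>n. R (f n) (g n))" if "rep (\<lambda>n. R (p1 (n 0)) (p2 (n 0)))" "repf f" "repf g" for R f g
    using rep_comp[OF that(1), of "\<lambda>n. prod_encode (f n, g n)"] that by (simp add: repf_prod)
  show "repf f \<Longrightarrow> repf g \<Longrightarrow> repf h \<Longrightarrow> rep (\<lambda>n. conjN (f n) (g n) (h n))"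
    by (rule 3, unfold conjN_def, intro rep_intros2 rep_FmC)
  show "repf f \<Longrightarrow> repf g \<Longrightarrow> repf h \<Longrightarrow> rep (\<lambda>n. disjN (f n) (g n) (h n))"
    by (rule 3, unfold disjN_def, intro rep_intros2 rep_FmC)
  show "repf f \<Longrightarrow> repf g \<Longrightarrow> rep (\<lambda>n. exN (f n) (g n))"
    by (rule 2, unfold exN_def, intro rep_intros2 rep_FmC)
  show "repf f \<Longrightarrow> repf g \<Longrightarrow> rep (\<lambda>n. allN (f n) (g n))"
    by (rule 2, unfold allN_def, intro rep_intros2 rep_FmC)
qed

end

context arith
begin

lemma conjN_iff: "conjN x y z \<longleftrightarrow> (\<exists>b k k1 k2. conjS k k1 k2 \<and> wf_fm L' b (snd k) \<and>
    x = bsc b k \<and> y = bsc b k1 \<and> z = bsc b k2)" (is "?l \<longleftrightarrow> ?r")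
proof
  assume ?l
  then obtain b p where p: "FmC b p" and
    d: "x = prod_encode (b, 2 * cat (cnat 2) p) \<and> y = prod_encode (b, 2 * p + 1) \<and> z = y \<or>
     x = prod_encode (b, 2 * cat (cnat 2) p + 1) \<and> y = prod_encode (b, 2 * p) \<and> z = y \<or>
     (\<exists>q\<le>x. FmC b q \<and>
       (x = prod_encode (b, 2 * cat (cnat 3) (cat p q) + 1) \<and> y = prod_encode (b, 2 * p + 1) \<and> z = prod_encode (b, 2 * q + 1) \<or>
        x = prod_encode (b, 2 * cat (cnat 4) (cat p q)) \<and> y = prod_encode (b, 2 * p) \<and> z = prod_encode (b, 2 * q)))"
    unfolding conjN_def by blast
  obtain \<phi> where \<phi>: "wf_fm L' b \<phi>" "p = godel \<phi>" using p by (auto simp: FmC_def)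
  from d show ?r
  proof (elim disjE exE conjE)
    assume "x = prod_encode (b, 2 * cat (cnat 2) p)" "y = prod_encode (b, 2 * p + 1)" "z = y"
    then show ?thesis using \<phi> conjS.intros(3)[of False \<phi>]
      by (intro exI[of _ b] exI) (auto simp: bsc_def sc_def godel_simps)
  next
    assume "x = prod_encode (b, 2 * cat (cnat 2) p + 1)" "y = prod_encode (b, 2 * p)" "z = y"
    then show ?thesis using \<phi> conjS.intros(3)[of True \<phi>]
      by (intro exI[of _ b] exI) (auto simp: bsc_def sc_def godel_simps)
  next
    fix q assume "FmC b q" and *: "x = prod_encode (b, 2 * cat (cnat 3) (cat p q) + 1)"
      "y = prod_encode (b, 2 * p + 1)" "z = prod_encode (b, 2 * q + 1)"
    then obtain \<psi> where "wf_fm L' b \<psi>" "q = godel \<psi>" by (auto simp: FmC_def)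
    then show ?thesis using \<phi> * conjS.intros(1)[of \<phi> \<psi>]
      by (intro exI[of _ b] exI) (auto simp: bsc_def sc_def godel_simps)
  next
    fix q assume "FmC b q" and *: "x = prod_encode (b, 2 * cat (cnat 4) (cat p q))"
      "y = prod_encode (b, 2 * p)" "z = prod_encode (b, 2 * q)"
    then obtain \<psi> where "wf_fm L' b \<psi>" "q = godel \<psi>" by (auto simp: FmC_def)
    then show ?thesis using \<phi> * conjS.intros(2)[of \<phi> \<psi>]
      by (intro exI[of _ b] exI) (auto simp: bsc_def sc_def godel_simps)
  qed
next
  assume ?r
  then obtain b k k1 k2 where k: "conjS k k1 k2" "wf_fm L' b (snd k)" "x = bsc b k" "y = bsc b k1" "z = bsc b k2"
    by blast
  have bx: "b \<le> x" using k(3) by (simp add: bsc_def le_prod_encode_1)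
  have px: "godel \<phi> \<le> x" if "godel \<phi> < godel (snd k)" for \<phi>
    using that k(3) le_prod_encode_2[of "sc k" b] by (simp add: bsc_def sc_def)
  from k(1) show ?l
  proof cases
    case (1 p q)
    then have "FmC b (godel p)" "FmC b (godel q)" "godel p \<le> x" "godel q \<le> x"
      using k(2) px godel_sub by (auto simp: FmC_def)
    moreover have "x = prod_encode (b, 2 * cat (cnat 3) (cat (godel p) (godel q)) + 1)"
      "y = prod_encode (b, 2 * godel p + 1)" "z = prod_encode (b, 2 * godel q + 1)"
      using k 1 by (simp_all add: bsc_def sc_def godel_simps)
    ultimately show ?l unfolding conjN_def using bx by blast
  next
    case (2 p q)
    then have "FmC b (godel p)" "FmC b (godel q)" "godel p \<le> x" "godel q \<le> x"
      using k(2) px godel_sub by (auto simp: FmC_def)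
    moreover have "x = prod_encode (b, 2 * cat (cnat 4) (cat (godel p) (godel q)))"
      "y = prod_encode (b, 2 * godel p)" "z = prod_encode (b, 2 * godel q)"
      using k 2 by (simp_all add: bsc_def sc_def godel_simps)
    ultimately show ?l unfolding conjN_def using bx by blast
  next
    case (3 s p)
    then have "FmC b (godel p)" "godel p \<le> x"
      using k(2) px godel_sub by (auto simp: FmC_def)
    moreover have "x = prod_encode (b, 2 * cat (cnat 2) (godel p)) \<and> y = prod_encode (b, 2 * godel p + 1) \<and> z = y \<or>
        x = prod_encode (b, 2 * cat (cnat 2) (godel p) + 1) \<and> y = prod_encode (b, 2 * godel p) \<and> z = y"
      using k 3 by (cases s) (simp_all add: bsc_def sc_def godel_simps)
    ultimately show ?l unfolding conjN_def using bx by blast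
  qed
qed

lemma disjN_iff: "disjN x y z \<longleftrightarrow> (\<exists>b k k1 k2. disjS k k1 k2 \<and> wf_fm L' b (snd k) \<and>
    x = bsc b k \<and> y = bsc b k1 \<and> z = bsc b k2)" (is "?l \<longleftrightarrow> ?r")
proof
  assume ?l
  then obtain b p q where "FmC b p" "FmC b q" and
    d: "x = prod_encode (b, 2 * cat (cnat 4) (cat p q) + 1) \<and> y = prod_encode (b, 2 * p + 1) \<and> z = prod_encode (b, 2 * q + 1) \<or>
        x = prod_encode (b, 2 * cat (cnat 3) (cat p q)) \<and> y = prod_encode (b, 2 * p) \<and> z = prod_encode (b, 2 * q)"
    unfolding disjN_def by blast
  then obtain \<phi> \<psi> where "wf_fm L' b \<phi>" "p = godel \<phi>" "wf_fm L' b \<psi>" "q = godel \<psi>" by (auto simp: FmC_def)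
  with d show ?r
  proof (elim disjE conjE)
    assume "x = prod_encode (b, 2 * cat (cnat 4) (cat p q) + 1)" "y = prod_encode (b, 2 * p + 1)" "z = prod_encode (b, 2 * q + 1)"
    then show ?thesis using \<open>p = godel \<phi>\<close> \<open>q = godel \<psi>\<close> \<open>wf_fm L' b \<phi>\<close> \<open>wf_fm L' b \<psi>\<close>
      by (intro exI[of _ b] exI[of _ "(True, Or \<phi> \<psi>)"] exI[of _ "(True, \<phi>)"] exI[of _ "(True, \<psi>)"])
        (simp add: disjS.intros bsc_def sc_def godel_simps)
  next
    assume "x = prod_encode (b, 2 * cat (cnat 3) (cat p q))" "y = prod_encode (b, 2 * p)" "z = prod_encode (b, 2 * q)"
    then show ?thesis using \<open>p = godel \<phi>\<close> \<open>q = godel \<psi>\<close> \<open>wf_fm L' b \<phi>\<close> \<open>wf_fm L' b \<psi>\<close>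
      by (intro exI[of _ b] exI[of _ "(False, And \<phi> \<psi>)"] exI[of _ "(False, \<phi>)"] exI[of _ "(False, \<psi>)"])
        (simp add: disjS.intros bsc_def sc_def godel_simps)
  qed
next
  assume ?r
  then obtain b k k1 k2 where k: "disjS k k1 k2" "wf_fm L' b (snd k)" "x = bsc b k" "y = bsc b k1" "z = bsc b k2"
    by blast
  have bx: "b \<le> x" using k(3) by (simp add: bsc_def le_prod_encode_1)
  have px: "godel \<phi> \<le> x" if "godel \<phi> < godel (snd k)" for \<phi>
    using that k(3) le_prod_encode_2[of "sc k" b] by (simp add: bsc_def sc_def)
  from k(1) obtain p q where pq: "FmC b (godel p)" "FmC b (godel q)" "godel p \<le> x" "godel q \<le> x" and
    "x = prod_encode (b, 2 * cat (cnat 4) (cat (godel p) (godel q)) + 1) \<and> y = prod_encode (b, 2 * godel p + 1) \<and> z = prod_encode (b, 2 * godel q + 1) \<or>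
        x = prod_encode (b, 2 * cat (cnat 3) (cat (godel p) (godel q))) \<and> y = prod_encode (b, 2 * godel p) \<and> z = prod_encode (b, 2 * godel q)"
  proof cases
    case (1 p q)
    then show ?thesis using k px godel_sub
      by (intro that[of p q]) (auto simp: FmC_def bsc_def sc_def godel_simps)
  next
    case (2 p q)
    then show ?thesis using k px godel_sub
      by (intro that[of p q]) (auto simp: FmC_def bsc_def sc_def godel_simps)
  qed
  then show ?l unfolding disjN_def using bx by blast
qed

lemma exN_iff: "exN x y \<longleftrightarrow> (\<exists>b k k'. exS k k' \<and> wf_fm L' b (snd k) \<and> x = bsc b k \<and> y = bsc (Suc b) k')"
  (is "?l \<longleftrightarrow> ?r")
proof
  assume ?l
  then obtain b p where "FmC (Suc b) p" and
    d: "x = prod_encode (b, 2 * cat (cnat 5) p + 1) \<and> y = prod_encode (Suc b, 2 * p + 1) \<or>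
     x = prod_encode (b, 2 * cat (cnat 6) p) \<and> y = prod_encode (Suc b, 2 * p)"
    unfolding exN_def by blast
  then obtain \<phi> where "wf_fm L' (Suc b) \<phi>" "p = godel \<phi>" by (auto simp: FmC_def)
  with d show ?r
  proof (elim disjE conjE)
    assume "x = prod_encode (b, 2 * cat (cnat 5) p + 1)" "y = prod_encode (Suc b, 2 * p + 1)"
    then show ?thesis using \<open>p = godel \<phi>\<close> \<open>wf_fm L' (Suc b) \<phi>\<close>
      by (intro exI[of _ b] exI[of _ "(True, Ex \<phi>)"] exI[of _ "(True, \<phi>)"])
        (simp add: exS.intros bsc_def sc_def godel_simps)
  next
    assume "x = prod_encode (b, 2 * cat (cnat 6) p)" "y = prod_encode (Suc b, 2 * p)"
    then show ?thesis using \<open>p = godel \<phi>\<close> \<open>wf_fm L' (Suc b) \<phi>\<close>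
      by (intro exI[of _ b] exI[of _ "(False, All \<phi>)"] exI[of _ "(False, \<phi>)"])
        (simp add: exS.intros bsc_def sc_def godel_simps)
  qed
next
  assume ?r
  then obtain b k k' where k: "exS k k'" "wf_fm L' b (snd k)" "x = bsc b k" "y = bsc (Suc b) k'" by blast
  have bx: "b \<le> x" using k(3) by (simp add: bsc_def le_prod_encode_1)
  have px: "godel \<phi> \<le> x" if "godel \<phi> < godel (snd k)" for \<phi>
    using that k(3) le_prod_encode_2[of "sc k" b] by (simp add: bsc_def sc_def)
  from k(1) obtain p where "FmC (Suc b) (godel p)" "godel p \<le> x" and
    "x = prod_encode (b, 2 * cat (cnat 5) (godel p) + 1) \<and> y = prod_encode (Suc b, 2 * godel p + 1) \<or>
     x = prod_encode (b, 2 * cat (cnat 6) (godel p)) \<and> y = prod_encode (Suc b, 2 * godel p)"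
  proof cases
    case (1 p)
    then show ?thesis using k px godel_sub
      by (intro that[of p]) (auto simp: FmC_def bsc_def sc_def godel_simps)
  next
    case (2 p)
    then show ?thesis using k px godel_sub
      by (intro that[of p]) (auto simp: FmC_def bsc_def sc_def godel_simps)
  qed
  then show ?l unfolding exN_def using bx by blast
qed

lemma allN_iff: "allN x y \<longleftrightarrow> (\<exists>b k k'. allS k k' \<and> wf_fm L' b (snd k) \<and> x = bsc b k \<and> y = bsc (Suc b) k')"
  (is "?l \<longleftrightarrow> ?r")
proof
  assume ?l
  then obtain b p where "FmC (Suc b) p" and
    d: "x = prod_encode (b, 2 * cat (cnat 6) p + 1) \<and> y = prod_encode (Suc b, 2 * p + 1) \<or>
     x = prod_encode (b, 2 * cat (cnat 5) p) \<and> y = prod_encode (Suc b, 2 * p)"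
    unfolding allN_def by blast
  then obtain \<phi> where "wf_fm L' (Suc b) \<phi>" "p = godel \<phi>" by (auto simp: FmC_def)
  with d show ?r
  proof (elim disjE conjE)
    assume "x = prod_encode (b, 2 * cat (cnat 6) p + 1)" "y = prod_encode (Suc b, 2 * p + 1)"
    then show ?thesis using \<open>p = godel \<phi>\<close> \<open>wf_fm L' (Suc b) \<phi>\<close>
      by (intro exI[of _ b] exI[of _ "(True, All \<phi>)"] exI[of _ "(True, \<phi>)"])
        (simp add: allS.intros bsc_def sc_def godel_simps)
  next
    assume "x = prod_encode (b, 2 * cat (cnat 5) p)" "y = prod_encode (Suc b, 2 * p)"
    then show ?thesis using \<open>p = godel \<phi>\<close> \<open>wf_fm L' (Suc b) \<phi>\<close>
      by (intro exI[of _ b] exI[of _ "(False, Ex \<phi>)"] exI[of _ "(False, \<phi>)"])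
        (simp add: allS.intros bsc_def sc_def godel_simps)
  qed
next
  assume ?r
  then obtain b k k' where k: "allS k k'" "wf_fm L' b (snd k)" "x = bsc b k" "y = bsc (Suc b) k'" by blast
  have bx: "b \<le> x" using k(3) by (simp add: bsc_def le_prod_encode_1)
  have px: "godel \<phi> \<le> x" if "godel \<phi> < godel (snd k)" for \<phi>
    using that k(3) le_prod_encode_2[of "sc k" b] by (simp add: bsc_def sc_def)
  from k(1) obtain p where "FmC (Suc b) (godel p)" "godel p \<le> x" and
    "x = prod_encode (b, 2 * cat (cnat 6) (godel p) + 1) \<and> y = prod_encode (Suc b, 2 * godel p + 1) \<or>
     x = prod_encode (b, 2 * cat (cnat 5) (godel p)) \<and> y = prod_encode (Suc b, 2 * godel p)"
  proof cases
    case (1 p)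
    then show ?thesis using k px godel_sub
      by (intro that[of p]) (auto simp: FmC_def bsc_def sc_def godel_simps)
  next
    case (2 p)
    then show ?thesis using k px godel_sub
      by (intro that[of p]) (auto simp: FmC_def bsc_def sc_def godel_simps)
  qed
  then show ?l unfolding allN_def using bx by blast
qed

lemma bsc_inj: "bsc b k = bsc b' k' \<longleftrightarrow> b = b' \<and> k = k'"
  by (simp add: bsc_def sc_inj)

section \<open>Lists of elements of the structure\<close>

text \<open>The choice of a definable relation which represents \<open>R\<close> and whose second and third argument are
  standard as soon as the first one is.\<close>

definition relM :: "(nat \<Rightarrow> nat \<Rightarrow> nat \<Rightarrow> bool) \<Rightarrow> 'a \<Rightarrow> 'a \<Rightarrow> 'a \<Rightarrow> bool" where
  "relM R = (SOME R'. dfn (\<lambda>v. R' (v 0) (v 1) (v 2)) \<and>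
    (\<forall>a x y z. Nn a x \<longrightarrow> (R' x y z \<longleftrightarrow> (\<exists>b c. Nn b y \<and> Nn c z \<and> R a b c))))"

text \<open>Outputs bounded by a representable function of a standard input are standard themselves.
  This lets \<open>relM\<close> be exact when only its first argument is known to be
  standard.\<close>

definition bdd :: "(nat \<Rightarrow> nat \<Rightarrow> nat \<Rightarrow> bool) \<Rightarrow> bool" where
  "bdd R \<longleftrightarrow> rep (\<lambda>n. R (n 0) (n 1) (n 2)) \<and> (\<exists>h. repf (\<lambda>n. h (n 0)) \<and> (\<forall>a b c. R a b c \<longrightarrow> b \<le> h a \<and> c \<le> h a))"

lemma bddI: "rep (\<lambda>n. R (n 0) (n 1) (n 2)) \<Longrightarrow> repf (\<lambda>n. h (n 0)) \<Longrightarrow> (\<And>a b c. R a b c \<Longrightarrow> b \<le> h a \<and> c \<le> h a) \<Longrightarrow> bdd R"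
  unfolding bdd_def by blast

lemma relM_ex:
  assumes "bdd R"
  shows "\<exists>R'. dfn (\<lambda>v. R' (v 0) (v 1) (v 2)) \<and>
    (\<forall>a x y z. Nn a x \<longrightarrow> (R' x y z \<longleftrightarrow> (\<exists>b c. Nn b y \<and> Nn c z \<and> R a b c)))"
proof -
  obtain h where h: "repf (\<lambda>n. h (n 0))" and hb: "\<And>a b c. R a b c \<Longrightarrow> b \<le> h a \<and> c \<le> h a"
    using assms unfolding bdd_def by blast
  obtain X where X: "dfn X" "\<And>v n. nenv n v \<Longrightarrow> X v \<longleftrightarrow> R (n 0) (n 1) (n 2)"
    using assms unfolding bdd_def rep_def by (elim exE conjE) (rule that, assumption, blast)
  obtain G where G: "dfn G" "\<And>v n y. nenv n v \<Longrightarrow> y \<in> D \<Longrightarrow> G (case_nat y v) \<longleftrightarrow> Nn (h (n 0)) y"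
    using h unfolding repf_def by (elim exE conjE) (rule that, assumption, blast)
  define R' where "R' x y z \<longleftrightarrow> (\<exists>u\<in>D. G (case_nat u (\<lambda>_. x)) \<and> leM y u \<and> leM z u \<and>
      X (case_nat x (case_nat y (\<lambda>_. z))))" for x y z
  have "dfn (\<lambda>v. R' (v 0) (v 1) (v 2))" unfolding R'_def
    by (intro dfn_ex dfn_conj leM_dfn pt_var)
      (rule dfn_subst[OF G(1)], intro pt_case pt_var, rule dfn_subst[OF X(1)], intro pt_case pt_var)
  moreover have "R' x y z \<longleftrightarrow> (\<exists>b c. Nn b y \<and> Nn c z \<and> R a b c)" if a: "Nn a x" for a x y z
  proof -
    have X': "X (case_nat x (case_nat y (\<lambda>_. z))) \<longleftrightarrow> R a b c" if "Nn b y" "Nn c z" for b c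
      using X(2)[of "case_nat a (case_nat b (\<lambda>_. c))" "case_nat x (case_nat y (\<lambda>_. z))"] a that
      by (auto simp: nenv_Cons numeral_2_eq_2) (simp_all add: nenv_def)
    have G': "G (case_nat u (\<lambda>_. x)) \<longleftrightarrow> Nn (h a) u" if "u \<in> D" for u
      using G(2)[of "\<lambda>_. a" "\<lambda>_. x" u] a that by (simp add: nenv_def)
    show ?thesis
    proof
      assume "R' x y z"
      then obtain u where u: "u \<in> D" "Nn (h a) u" "leM y u" "leM z u" "X (case_nat x (case_nat y (\<lambda>_. z)))"
        using G' by (auto simp: R'_def)
      obtain b c where "Nn b y" "Nn c z" using Nn_leMD[OF u(2,3)] Nn_leMD[OF u(2,4)] by blast
      then show "\<exists>b c. Nn b y \<and> Nn c z \<and> R a b c" using X' u(5) by blast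
    next
      assume "\<exists>b c. Nn b y \<and> Nn c z \<and> R a b c"
      then obtain b c where bc: "Nn b y" "Nn c z" "R a b c" by blast
      obtain u where "u \<in> D" "Nn (h a) u" using Nn_ex by blast
      then show "R' x y z" unfolding R'_def using X'[OF bc(1,2)] G' Nn_leM bc hb[OF bc(3)] by blast
    qed
  qed
  ultimately show ?thesis by blast
qed

lemma relM_dfn0: "bdd R \<Longrightarrow> dfn (\<lambda>v. relM R (v 0) (v 1) (v 2))"
  and relM_iff: "bdd R \<Longrightarrow> Nn a x \<Longrightarrow> relM R x y z \<longleftrightarrow> (\<exists>b c. Nn b y \<and> Nn c z \<and> R a b c)"
  using someI_ex[OF relM_ex, of R] unfolding relM_def by blast+

lemma relM_dfn: "bdd R \<Longrightarrow> pt f \<Longrightarrow> pt g \<Longrightarrow> pt h \<Longrightarrow> dfn (\<lambda>v. relM R (f v) (g v) (h v))"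
  by (rule dfn_inst3[OF relM_dfn0])

text \<open>Every element codes the empty list, so a code does not determine the length; hence
  \<open>Ls_unique\<close> compares lists of equal length.\<close>

primrec Ls :: "'a list \<Rightarrow> 'a \<Rightarrow> bool" where
  "Ls [] e \<longleftrightarrow> e \<in> D"
| "Ls (x # xs) e \<longleftrightarrow> e \<in> D \<and> x \<in> D \<and> (\<exists>t\<in>D. pr x t e \<and> Ls xs t)"

lemma Ls_D: "Ls xs e \<Longrightarrow> e \<in> D \<and> set xs \<subseteq> D"
  by (induct xs arbitrary: e) auto

lemma Ls_ex: "set xs \<subseteq> D \<Longrightarrow> \<exists>e. Ls xs e"
proof (induct xs)
  case Nil
  then show ?case using Nn_ex by auto
next
  case (Cons x xs)
  then obtain t where t: "Ls xs t" by auto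
  then obtain p where "p \<in> D" "pr x t p" using pr_ex[of x t] Cons(2) Ls_D[OF t] by auto
  then show ?case using t Ls_D[OF t] Cons(2) by auto
qed

lemma Ls_ConsI: "Ls xs t \<Longrightarrow> pr x t e \<Longrightarrow> e \<in> D \<Longrightarrow> x \<in> D \<Longrightarrow> Ls (x # xs) e"
  using Ls_D by auto

lemma Ls_ConsD:
  assumes "Ls (x # xs) e" "pr y t e" "y \<in> D" "t \<in> D"
  shows "y = x \<and> Ls xs t"
proof -
  obtain t' where "t' \<in> D" "pr x t' e" "Ls xs t'" "x \<in> D" using assms(1) by auto
  then show ?thesis using pr_inj[OF assms(2), of x t'] assms by simp
qed

lemma Ls_unique: "Ls xs l \<Longrightarrow> Ls ys l \<Longrightarrow> length xs = length ys \<Longrightarrow> xs = ys"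
proof (induct xs arbitrary: ys l)
  case (Cons x xs)
  then obtain y ys' where ys: "ys = y # ys'" by (cases ys) auto
  obtain t where t: "t \<in> D" "pr x t l" "Ls xs t" "x \<in> D" using Cons(2) by auto
  then have "x = y \<and> Ls ys' t" using Ls_ConsD[of y ys' l x t] Cons(3) ys by simp
  then show ?case using Cons(1)[OF t(3)] Cons(4) ys by simp
qed simp

lemma pt_shift: "pt f \<Longrightarrow> pt (\<lambda>v. f (\<lambda>i. v (Suc i)))"
  by (auto simp: pt_def)

text \<open>The induction on the length is external: each length has its own defining
  formula.\<close>

lemma Ls_dfn: "list_all pt fs \<Longrightarrow> pt g \<Longrightarrow> dfn (\<lambda>v. Ls (map (\<lambda>f. f v) fs) (g v))"
proof (induct "length fs" arbitrary: fs g)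
  case 0
  have "dfn (\<lambda>v. True)" by (rule dfn_True)
  then show ?case by (rule dfn_cong) (use 0 pt_in in simp)
next
  case (Suc n)
  then obtain f fs' where fs: "fs = f # fs'" "n = length fs'" by (cases fs) auto
  have "dfn (\<lambda>v. Ls (map (\<lambda>f. f v) (map (\<lambda>f v. f (\<lambda>i. v (Suc i))) fs')) (v 0))"
    by (rule Suc(1)) (use Suc fs in \<open>auto simp: list_all_iff intro: pt_shift pt_var\<close>)
  then have "dfn (\<lambda>v. Ls (map (\<lambda>f. f (\<lambda>i. v (Suc i))) fs') (v 0))" by (simp add: comp_def)
  then have "dfn (\<lambda>v. \<exists>t\<in>D. pr (f v) t (g v) \<and> Ls (map (\<lambda>f. f v) fs') t)"
    by (intro dfn_ex dfn_conj pr_dfn pt_shift pt_var) (use Suc fs in simp_all)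
  then show ?case by (rule dfn_cong) (use Suc fs pt_in in auto)
qed

lemma dfn_exs:
  assumes "dfn (\<lambda>v. P (map v [0..<j]) (\<lambda>i. v (i + j)))"
  shows "dfn (\<lambda>v. \<exists>xs. length xs = j \<and> set xs \<subseteq> D \<and> P xs v)"
proof -
  obtain \<psi> k where \<psi>: "wf_fm (lang_diag L' M) k \<psi>" "\<And>v. range v \<subseteq> D \<Longrightarrow>
      sat (struct_diag M) v \<psi> \<longleftrightarrow> P (map v [0..<j]) (\<lambda>i. v (i + j))"
    using assms unfolding dfn_def by blast
  have "sat (struct_diag M) v (exs j \<psi>) \<longleftrightarrow> (\<exists>xs. length xs = j \<and> set xs \<subseteq> D \<and> P xs v)" if v: "range v \<subseteq> D" for v
  proof -
    have "sat (struct_diag M) (ext xs v) \<psi> \<longleftrightarrow> P xs v" if xs: "length xs = j" "set xs \<subseteq> D" for xs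
    proof -
      have "range (ext xs v) \<subseteq> D" using v xs nth_in[of xs D] by (auto simp: ext_def)
      moreover have "map (ext xs v) [0..<j] = xs" using xs by (intro nth_equalityI) (simp_all add: ext_nth)
      moreover have "(\<lambda>i. ext xs v (i + j)) = v" using xs ext_add[of xs v] by auto
      ultimately show ?thesis using \<psi>(2)[of "ext xs v"] by simp
    qed
    then show ?thesis by (auto simp: sat_exs)
  qed
  moreover have "wf_fm (lang_diag L' M) k (exs j \<psi>)" unfolding wf_exs by (rule wf_fm_mono[OF \<psi>(1)]) simp
  ultimately show ?thesis unfolding dfn_def by blast
qed

text \<open>Symbol and arity are external; the finitely many resulting formulas are joined by
  \<open>dfn_finite_disj\<close>.\<close>

definition relT :: "nat \<Rightarrow> nat \<Rightarrow> 'a \<Rightarrow> bool" where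
  "relT R j l \<longleftrightarrow> (\<exists>xs. length xs = j \<and> set xs \<subseteq> D \<and> Ls xs l \<and> rel_of M R xs)"

definition funT :: "nat \<Rightarrow> nat \<Rightarrow> 'a \<Rightarrow> 'a \<Rightarrow> bool" where
  "funT f j l x \<longleftrightarrow> (\<exists>xs. length xs = j \<and> set xs \<subseteq> D \<and> Ls xs l \<and> fun_of M f xs = x)"

lemma Ls_dfn': "pt g \<Longrightarrow> dfn (\<lambda>v. Ls (map v [0..<j]) (g v))"
  using Ls_dfn[of "map (\<lambda>i v. v i) [0..<j]" g] by (simp add: list_all_iff pt_var comp_def)

lemma relT_dfn: "(R, j) \<in> rels L' \<Longrightarrow> pt f \<Longrightarrow> dfn (\<lambda>v. relT R j (f v))"
proof (rule dfn_inst1)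
  assume R: "(R, j) \<in> rels L'"
  have "dfn (\<lambda>v. sat M v (Rel R (map Var [0..<j])))"
    by (rule dfn_fm[of j]) (use R in \<open>simp add: list_all_iff\<close>)
  then have "dfn (\<lambda>v. rel_of M R (map v [0..<j]))" by (simp add: comp_def)
  then show "dfn (\<lambda>v. relT R j (v 0))" unfolding relT_def
    by (intro dfn_exs dfn_conj Ls_dfn' pt_var)
qed

lemma funT_dfn: "(f, j) \<in> funs L' \<Longrightarrow> pt g \<Longrightarrow> pt h \<Longrightarrow> dfn (\<lambda>v. funT f j (g v) (h v))"
proof (rule dfn_inst2)
  assume f: "(f, j) \<in> funs L'"
  have "dfn (\<lambda>v. sat M v (Eq (Fn f (map Var [0..<j])) (Var (1 + j))))"
    by (rule dfn_fm[of "j + 2"]) (use f in \<open>simp add: list_all_iff\<close>)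
  then have "dfn (\<lambda>v. fun_of M f (map v [0..<j]) = v (1 + j))" by (simp add: comp_def)
  then show "dfn (\<lambda>v. funT f j (v 0) (v 1))" unfolding funT_def
    by (intro dfn_exs dfn_conj Ls_dfn' pt_var)
qed

lemma dfn_finite_disj: "finite A \<Longrightarrow> (\<And>a. a \<in> A \<Longrightarrow> dfn (P a)) \<Longrightarrow> dfn (\<lambda>v. \<exists>a\<in>A. P a v)"
proof (induct A rule: finite_induct)
  case empty
  show ?case using dfn_True[of False] by simp
next
  case (insert a A)
  have "dfn (\<lambda>v. P a v \<or> (\<exists>a\<in>A. P a v))" using insert by (intro dfn_disj) simp_all
  then show ?case by simp
qed

end

definition atomic :: "(nat, nat) fm \<Rightarrow> bool" where
  "atomic \<phi> \<longleftrightarrow> (\<exists>t u. \<phi> = Eq t u) \<or> (\<exists>R ts. \<phi> = Rel R ts)"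

context arith
begin

subsection \<open>Evaluation of terms\<close>

lemma bdd_suc: "bdd (\<lambda>a b c. a = Suc b \<and> c = b)"
  by (rule bddI[where h = "\<lambda>a. a"]) (auto intro!: rep_intros1)

text \<open>Look-up in a coded list. Certificates take two arguments, so the list and the value are
  packed into one pair \<open>y\<close>, while the index \<open>i\<close> drives the
  recursion.\<close>

definition LKA :: "'a \<Rightarrow> 'a \<Rightarrow> bool" where
  "LKA i y \<longleftrightarrow> Nn 0 i \<and> (\<exists>e\<in>D. \<exists>x\<in>D. \<exists>t\<in>D. pr e x y \<and> pr x t e)"

definition LKB :: "'a \<Rightarrow> 'a \<Rightarrow> 'a \<Rightarrow> 'a \<Rightarrow> 'a \<Rightarrow> 'a \<Rightarrow> bool" where
  "LKB i y i1 y1 i2 y2 \<longleftrightarrow> i2 = i1 \<and> y2 = y1 \<and> (\<exists>e\<in>D. \<exists>x\<in>D. \<exists>h\<in>D. \<exists>t\<in>D. pr e x y \<and> pr h t e \<and>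
    relM (\<lambda>a b c. a = Suc b \<and> c = b) i i1 i1 \<and> pr t x y1)"

definition LK :: "'a \<Rightarrow> 'a \<Rightarrow> 'a \<Rightarrow> bool" where
  "LK i e x \<longleftrightarrow> (\<exists>y\<in>D. pr e x y \<and> cert LKA LKB i y)"

lemma LK_dfn: "pt f \<Longrightarrow> pt g \<Longrightarrow> pt h \<Longrightarrow> dfn (\<lambda>v. LK (f v) (g v) (h v))"
proof (rule dfn_inst3)
  have "dfn (\<lambda>v. LKA (v 0) (v 1))" unfolding LKA_def by (intro dfn_intros Nn_dfn pr_dfn)
  moreover have "dfn (\<lambda>v. LKB (v 0) (v 1) (v 2) (v 3) (v 4) (v 5))"
    unfolding LKB_def by (intro dfn_intros relM_dfn pr_dfn bdd_suc)
  ultimately show "dfn (\<lambda>v. LK (v 0) (v 1) (v 2))"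
    unfolding LK_def by (intro dfn_intros pr_dfn cert_dfn)
qed

lemma LK_sound0: "Ls xs e \<Longrightarrow> n < length xs \<Longrightarrow> Nn n i \<Longrightarrow> pr e x y \<Longrightarrow> x \<in> D \<Longrightarrow> y \<in> D \<Longrightarrow>
    cert LKA LKB i y \<Longrightarrow> x = xs ! n"
proof (induct n arbitrary: xs e i y)
  case 0
  have e: "e \<in> D" using Ls_D[OF 0(1)] by simp
  obtain z zs where xs: "xs = z # zs" using 0(2) by (cases xs) auto
  from cert_unfold[OF 0(7) Nn_D[OF 0(3)] 0(6)] show ?case
  proof (elim disjE bexE conjE)
    assume "LKA i y"
    then obtain e' x' t where *: "e' \<in> D" "x' \<in> D" "t \<in> D" "pr e' x' y" "pr x' t e'" unfolding LKA_def by blast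
    then have "e' = e" "x' = x" using pr_inj[OF *(4) 0(4)] 0 e by simp_all
    then show ?thesis using * Ls_ConsD[of z zs e x t] 0(1) xs by simp
  next
    fix x1 y1 x2 y2 assume "LKB i y x1 y1 x2 y2"
    then have "relM (\<lambda>a b c. a = Suc b \<and> c = b) i x1 x1" unfolding LKB_def by blast
    then show ?thesis using relM_iff[OF bdd_suc 0(3)] by auto
  qed
next
  case (Suc n)
  have e: "e \<in> D" using Ls_D[OF Suc(2)] by simp
  obtain z zs where xs: "xs = z # zs" using Suc(3) by (cases xs) auto
  from cert_unfold[OF Suc(8) Nn_D[OF Suc(4)] Suc(7)] show ?case
  proof (elim disjE bexE conjE)
    assume "LKA i y"
    then show ?thesis using Nn_unique[OF Suc(4)] unfolding LKA_def by auto
  next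
    fix i1 y1 i2 y2 assume "LKB i y i1 y1 i2 y2" and c: "cert LKA LKB i1 y1" "y1 \<in> D"
    then obtain e' x' h t where *: "e' \<in> D" "x' \<in> D" "h \<in> D" "t \<in> D" "pr e' x' y" "pr h t e'"
      "relM (\<lambda>a b c. a = Suc b \<and> c = b) i i1 i1" "pr t x' y1" unfolding LKB_def by blast
    have ex: "e' = e" "x' = x" using pr_inj[OF *(5) Suc(5)] Suc * e by simp_all
    have "Nn n i1" using *(7) relM_iff[OF bdd_suc Suc(4)] by auto
    moreover have "Ls zs t" using Ls_ConsD[of z zs e h t] * ex Suc(2) xs by simp
    ultimately have "x = zs ! n" using Suc(1)[of zs t i1 y1] Suc(3) xs *(8) ex c Suc(6) by simp
    then show ?thesis using xs by simp
  qed
qed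

lemma LK_compl0: "Ls xs e \<Longrightarrow> n < length xs \<Longrightarrow> Nn n i \<Longrightarrow> pr e (xs ! n) y \<Longrightarrow> y \<in> D \<Longrightarrow> ind LKA LKB i y"
proof (induct n arbitrary: xs e i y)
  case 0
  obtain z zs where xs: "xs = z # zs" using 0(2) by (cases xs) auto
  then obtain t where "t \<in> D" "pr z t e" "z \<in> D" "e \<in> D" using 0(1) by auto
  then have "LKA i y" using 0 xs unfolding LKA_def by auto
  then show ?case by (rule ind_base[OF _ Nn_D[OF 0(3)] 0(5)])
next
  case (Suc n)
  obtain z zs where xs: "xs = z # zs" using Suc(3) by (cases xs) auto
  then obtain t where t: "t \<in> D" "pr z t e" "z \<in> D" "e \<in> D" "Ls zs t" using Suc(2) by auto
  have x: "zs ! n \<in> D" using Ls_D[OF t(5)] Suc(3) xs by (auto intro: nth_in)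
  obtain i1 where i1: "Nn n i1" using Nn_ex by blast
  obtain y1 where y1: "y1 \<in> D" "pr t (zs ! n) y1" using pr_ex[OF t(1) x] by blast
  have ih: "ind LKA LKB i1 y1" using Suc(1)[OF t(5) _ i1 y1(2,1)] Suc(3) xs by simp
  have "relM (\<lambda>a b c. a = Suc b \<and> c = b) i i1 i1" using relM_iff[OF bdd_suc Suc(4)] i1 by auto
  then have "LKB i y i1 y1 i1 y1" using Suc(5) xs t x y1 unfolding LKB_def by auto
  then show ?case by (rule ind_step[OF _ ih ih Nn_D[OF Suc(4)] Suc(6)])
qed

lemma LK_iff:
  assumes "Ls xs e" "n < length xs" "Nn n i" "x \<in> D"
  shows "LK i e x \<longleftrightarrow> x = xs ! n"
proof
  show "LK i e x \<Longrightarrow> x = xs ! n" unfolding LK_def using LK_sound0[OF assms(1-3) _ assms(4)] by blast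
next
  assume x: "x = xs ! n"
  obtain y where "y \<in> D" "pr e x y" using pr_ex[of e x] Ls_D[OF assms(1)] assms(4) by blast
  then show "LK i e x" unfolding LK_def using LK_compl0[OF assms(1-3)] x ind_cert by blast
qed

definition varN :: "nat \<Rightarrow> nat \<Rightarrow> nat \<Rightarrow> bool" where
  "varN m i m1 \<longleftrightarrow> (\<exists>b\<le>m. \<exists>k\<le>m. \<exists>z\<le>m. \<exists>z'\<le>m. m = t3 b (Suc k) z \<and> TL b k z' \<and> i < b \<and> z = cat (cat 2 (cnat i)) z' \<and>
    m1 = t3 b k z')"

definition fnN :: "nat \<Rightarrow> nat \<Rightarrow> nat \<Rightarrow> nat \<Rightarrow> nat \<Rightarrow> bool" where
  "fnN f j m m1 m2 \<longleftrightarrow> (\<exists>b\<le>m. \<exists>k\<le>m. \<exists>z\<le>m. \<exists>z'\<le>m. \<exists>z1\<le>m. m = t3 b (Suc k) z \<and> TL b k z' \<and> TL b j z1 \<and>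
    (f, j) \<in> funs L' \<and> z = cFn f j z1 z' \<and> m1 = t3 b k z' \<and> m2 = t3 b j z1)"

abbreviation tcode :: "nat \<Rightarrow> nat tm list \<Rightarrow> nat" where "tcode b ts \<equiv> t3 b (length ts) (ctms ts)"

lemma varN_iff: "varN m i m1 \<longleftrightarrow> (\<exists>b us. list_all (wf_tm L' b) (Var i # us) \<and> m = tcode b (Var i # us) \<and> m1 = tcode b us)"
proof
  assume "varN m i m1"
  then obtain b k z z' where *: "m = t3 b (Suc k) z" "TL b k z'" "i < b" "z = cat (cat 2 (cnat i)) z'" "m1 = t3 b k z'"
    unfolding varN_def by blast
  then obtain us where "length us = k" "list_all (wf_tm L' b) us" "z' = ctms us" by (auto simp: TL_def)
  then show "\<exists>b us. list_all (wf_tm L' b) (Var i # us) \<and> m = tcode b (Var i # us) \<and> m1 = tcode b us"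
    using * by (intro exI[of _ b] exI[of _ us]) (simp add: ctms_simps)
next
  assume "\<exists>b us. list_all (wf_tm L' b) (Var i # us) \<and> m = tcode b (Var i # us) \<and> m1 = tcode b us"
  then obtain b us where *: "list_all (wf_tm L' b) (Var i # us)" "m = tcode b (Var i # us)" "m1 = tcode b us" by blast
  have "b \<le> m" "length (Var i # us) \<le> m" "ctms (Var i # us) \<le> m" unfolding *(2) by (rule le_t3)+
  then have "b \<le> m" "length us \<le> m" "ctms (Var i # us) \<le> m" "ctms us \<le> m" using ctms_sub(2)[of us i] by simp_all
  moreover have "TL b (length us) (ctms us)" using * by (auto simp: TL_def)
  ultimately show "varN m i m1" unfolding varN_def using * ctms_simps(2)[of i us] by auto
qed

lemma fnN_iff: "fnN f j m m1 m2 \<longleftrightarrow> (\<exists>b us ws. length ws = j \<and> list_all (wf_tm L' b) (Fn f ws # us) \<and>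
    m = tcode b (Fn f ws # us) \<and> m1 = tcode b us \<and> m2 = tcode b ws)"
proof
  assume "fnN f j m m1 m2"
  then obtain b k z z' z1 where *: "m = t3 b (Suc k) z" "TL b k z'" "TL b j z1" "(f, j) \<in> funs L'"
    "z = cFn f j z1 z'" "m1 = t3 b k z'" "m2 = t3 b j z1"
    unfolding fnN_def by blast
  obtain us where "length us = k" "list_all (wf_tm L' b) us" "z' = ctms us" using *(2) by (auto simp: TL_def)
  moreover obtain ws where "length ws = j" "list_all (wf_tm L' b) ws" "z1 = ctms ws" using *(3) by (auto simp: TL_def)
  ultimately show "\<exists>b us ws. length ws = j \<and> list_all (wf_tm L' b) (Fn f ws # us) \<and>
    m = tcode b (Fn f ws # us) \<and> m1 = tcode b us \<and> m2 = tcode b ws"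
    using * by (intro exI[of _ b] exI[of _ us] exI[of _ ws]) (simp add: ctms_simps)
next
  assume "\<exists>b us ws. length ws = j \<and> list_all (wf_tm L' b) (Fn f ws # us) \<and>
    m = tcode b (Fn f ws # us) \<and> m1 = tcode b us \<and> m2 = tcode b ws"
  then obtain b us ws where *: "length ws = j" "list_all (wf_tm L' b) (Fn f ws # us)" "m = tcode b (Fn f ws # us)"
    "m1 = tcode b us" "m2 = tcode b ws" by blast
  have "b \<le> m" "length (Fn f ws # us) \<le> m" "ctms (Fn f ws # us) \<le> m" unfolding *(3) by (rule le_t3)+
  then have "b \<le> m" "length us \<le> m" "ctms (Fn f ws # us) \<le> m" "ctms us \<le> m" "ctms ws \<le> m"
    using ctms_sub(5,6)[where f = f and us = ws and ts = us] by simp_all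
  moreover have "TL b (length us) (ctms us)" "TL b j (ctms ws)" using * by (auto simp: TL_def)
  ultimately show "fnN f j m m1 m2" unfolding fnN_def using * ctms_simps(3)[of f ws us] by auto
qed

lemma tcode_inj: "tcode b ts = tcode b' us \<longleftrightarrow> b = b' \<and> ts = us"
  using ctms_inj[of ts us] by auto

lemma bdd_var: "bdd varN"
proof (rule bddI[where h = "\<lambda>a. t3 a a a"])
  show "rep (\<lambda>n. varN (n 0) (n 1) (n 2))" unfolding varN_def by (intro rep_intros2 rep_TL)
  fix a b c assume "varN a b c"
  then obtain d k z z' where *: "d \<le> a" "k \<le> a" "z' \<le> a" "b < d" "c = t3 d k z'" unfolding varN_def by blast
  then have "c \<le> t3 a a a" by (auto intro!: prod_mono)
  moreover have "b \<le> t3 a a a" using * le_t3(1)[of a a a] by simp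
  ultimately show "b \<le> t3 a a a \<and> c \<le> t3 a a a" by simp
qed (intro rep_intros2)

lemma bdd_fn: "bdd (fnN f j)"
proof (rule bddI[where h = "\<lambda>a. t3 (a + j) (a + j) (a + j)"])
  show "rep (\<lambda>n. fnN f j (n 0) (n 1) (n 2))" unfolding fnN_def by (intro rep_intros2 rep_TL)
  fix a b c assume "fnN f j a b c"
  then obtain d k z z' z1 where "d \<le> a" "k \<le> a" "z' \<le> a" "z1 \<le> a" "b = t3 d k z'" "c = t3 d j z1"
    unfolding fnN_def by blast
  then show "b \<le> t3 (a + j) (a + j) (a + j) \<and> c \<le> t3 (a + j) (a + j) (a + j)" by (auto intro!: prod_mono)
qed (intro rep_intros2)

lemma bdd_nil: "bdd (\<lambda>a b c. p2 a = prod_encode (0, 1) \<and> b = a \<and> c = a)"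
  by (rule bddI[where h = "\<lambda>a. a"]) (auto intro!: rep_intros1)

text \<open>The pair of 0 and 1 consists of the length and the code of the empty list of terms.
  Every element is accepted as its value, since every element codes the empty list.\<close>

definition VMA :: "'a \<Rightarrow> 'a \<Rightarrow> bool" where
  "VMA m y \<longleftrightarrow> relM (\<lambda>a b c. p2 a = prod_encode (0, 1) \<and> b = a \<and> c = a) m m m"

definition VMB :: "'a \<Rightarrow> 'a \<Rightarrow> 'a \<Rightarrow> 'a \<Rightarrow> 'a \<Rightarrow> 'a \<Rightarrow> bool" where
  "VMB m y m1 y1 m2 y2 \<longleftrightarrow> (\<exists>e\<in>D. \<exists>l\<in>D. \<exists>x\<in>D. \<exists>l'\<in>D. pr e l y \<and> pr x l' l \<and> pr e l' y1 \<and>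
    ((\<exists>i\<in>D. relM varN m i m1 \<and> LK i e x \<and> m2 = m1 \<and> y2 = y1) \<or>
     (\<exists>p\<in>funs L'. relM (fnN (fst p) (snd p)) m m1 m2 \<and> (\<exists>a\<in>D. pr e a y2 \<and> funT (fst p) (snd p) a x))))"

definition VM :: "'a \<Rightarrow> 'a \<Rightarrow> 'a \<Rightarrow> bool" where
  "VM m e l \<longleftrightarrow> (\<exists>y\<in>D. pr e l y \<and> cert VMA VMB m y)"

lemma VM_dfn: "pt f \<Longrightarrow> pt g \<Longrightarrow> pt h \<Longrightarrow> dfn (\<lambda>v. VM (f v) (g v) (h v))"
proof (rule dfn_inst3)
  have "dfn (\<lambda>v. VMA (v 0) (v 1))" unfolding VMA_def by (intro relM_dfn pt_var bdd_nil)
  moreover have "dfn (\<lambda>v. VMB (v 0) (v 1) (v 2) (v 3) (v 4) (v 5))"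
    unfolding VMB_def
  proof (intro dfn_intros relM_dfn pr_dfn LK_dfn bdd_var dfn_finite_disj)
    show "finite (funs L')" using finL by (simp add: finite_lang_def)
  qed (auto intro!: dfn_intros relM_dfn pr_dfn bdd_fn funT_dfn)
  ultimately show "dfn (\<lambda>v. VM (v 0) (v 1) (v 2))"
    unfolding VM_def by (intro dfn_intros pr_dfn cert_dfn)
qed

abbreviation env :: "'a list \<Rightarrow> nat \<Rightarrow> 'a" where "env xs \<equiv> \<lambda>i. xs ! i"

lemma evals_in: "list_all (wf_tm L' (length xs)) ts \<Longrightarrow> set xs \<subseteq> D \<Longrightarrow> set (map (eval_tm M (env xs)) ts) \<subseteq> D"
  by (auto simp: list_all_iff intro!: eval_in_dom[OF stM] nth_in)

lemma VM_sound0: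
  assumes "Ls xs e"
  shows "list_all (wf_tm L' (length xs)) ts \<Longrightarrow> Nn (tcode (length xs) ts) m \<Longrightarrow> pr e l y \<Longrightarrow> l \<in> D \<Longrightarrow> y \<in> D \<Longrightarrow>
    cert VMA VMB m y \<Longrightarrow> Ls (map (eval_tm M (env xs)) ts) l"
proof (induct "ctms ts" arbitrary: ts m l y rule: less_induct)
  case less
  have e: "e \<in> D" "set xs \<subseteq> D" using Ls_D[OF assms] by simp_all
  from cert_unfold[OF less(7) Nn_D[OF less(3)] less(6)] show ?case
  proof (elim disjE bexE conjE)
    assume "VMA m y"
    then have "p2 (tcode (length xs) ts) = prod_encode (0, 1)"
      unfolding VMA_def relM_iff[OF bdd_nil less(3)] by blast
    then show ?thesis using less(5) by simp
  next
    fix m1 y1 m2 y2 assume "VMB m y m1 y1 m2 y2" and c: "cert VMA VMB m1 y1" "cert VMA VMB m2 y2" and D: "y1 \<in> D" "y2 \<in> D"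
    then obtain e' l0 x l' where *: "e' \<in> D" "l0 \<in> D" "x \<in> D" "l' \<in> D" "pr e' l0 y" "pr x l' l0" "pr e' l' y1"
      and d: "(\<exists>i\<in>D. relM varN m i m1 \<and> LK i e' x \<and> m2 = m1 \<and> y2 = y1) \<or>
       (\<exists>p\<in>funs L'. relM (fnN (fst p) (snd p)) m m1 m2 \<and> (\<exists>a\<in>D. pr e' a y2 \<and> funT (fst p) (snd p) a x))"
      unfolding VMB_def by blast
    have el: "e' = e" "l0 = l" using pr_inj[OF *(5) less(4)] * less(5) e by simp_all
    from d show ?thesis
    proof (elim disjE bexE conjE)
      fix i assume "i \<in> D" "relM varN m i m1" and lk: "LK i e' x"
      then obtain k n1 where n: "Nn k i" "Nn n1 m1" "varN (tcode (length xs) ts) k n1"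
        using relM_iff[OF bdd_var less(3)] by blast
      then obtain us where us: "ts = Var k # us" "n1 = tcode (length xs) us" unfolding varN_iff tcode_inj by auto
      have "x = xs ! k" using LK_iff[OF assms _ n(1) *(3)] lk el less(2) us by simp
      moreover have "Ls (map (eval_tm M (env xs)) us) l'"
        by (rule less(1)[of us m1 l' y1]) (use us n less(2) * el D c ctms_sub(2) in auto)
      ultimately show ?thesis using us * el by auto
    next
      fix p a assume p: "p \<in> funs L'" "relM (fnN (fst p) (snd p)) m m1 m2" "a \<in> D" "pr e' a y2" "funT (fst p) (snd p) a x"
      then obtain n1 n2 where n: "Nn n1 m1" "Nn n2 m2" "fnN (fst p) (snd p) (tcode (length xs) ts) n1 n2"
        using relM_iff[OF bdd_fn less(3)] by blast
      then obtain us ws where us: "ts = Fn (fst p) ws # us" "n1 = tcode (length xs) us" "n2 = tcode (length xs) ws" "length ws = snd p"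
        unfolding fnN_iff tcode_inj by auto
      have 1: "Ls (map (eval_tm M (env xs)) us) l'"
        by (rule less(1)[of us m1 l' y1]) (use us n less(2) * el D c ctms_sub(6) in auto)
      have 2: "Ls (map (eval_tm M (env xs)) ws) a"
        by (rule less(1)[of ws m2 a y2]) (use us n less(2) * el D c p ctms_sub(5) in auto)
      obtain zs where zs: "length zs = snd p" "Ls zs a" "fun_of M (fst p) zs = x" using p(5) unfolding funT_def by blast
      \<comment> \<open>Both lists are read off the same code \<open>a\<close> and have the same
        length, so they coincide.\<close>
      have "zs = map (eval_tm M (env xs)) ws" using Ls_unique[OF zs(2) 2] zs(1) us(4) by simp
      then show ?thesis using us * el 1 zs(3) by auto
    qed
  qed
qed

lemma VM_compl0:
  assumes "Ls xs e"
  shows "list_all (wf_tm L' (length xs)) ts \<Longrightarrow> Nn (tcode (length xs) ts) m \<Longrightarrow> pr e l y \<Longrightarrow> y \<in> D \<Longrightarrow>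
    Ls (map (eval_tm M (env xs)) ts) l \<Longrightarrow> ind VMA VMB m y"
proof (induct "ctms ts" arbitrary: ts m l y rule: less_induct)
  case less
  have e: "e \<in> D" "set xs \<subseteq> D" using Ls_D[OF assms] by simp_all
  have l: "l \<in> D" using Ls_D[OF less(6)] by simp
  note mD = Nn_D[OF less(3)]
  show ?case
  proof (cases ts)
    case Nil
    then have "VMA m y" unfolding VMA_def relM_iff[OF bdd_nil less(3)] using less(3) by (auto simp: ctms_simps)
    then show ?thesis by (rule ind_base[OF _ mD less(5)])
  next
    case (Cons t us)
    then obtain l' where l': "l' \<in> D" "pr (eval_tm M (env xs) t) l' l" "Ls (map (eval_tm M (env xs)) us) l'"
      and x: "eval_tm M (env xs) t \<in> D" using less(6) by auto
    obtain y1 where y1: "y1 \<in> D" "pr e l' y1" using pr_ex[OF e(1) l'(1)] by blast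
    obtain m1 where m1: "Nn (tcode (length xs) us) m1" using Nn_ex by blast
    have wus: "list_all (wf_tm L' (length xs)) us" using less(2) Cons by simp
    show ?thesis
    proof (cases t)
      case (Var k)
      have i1: "ind VMA VMB m1 y1"
        by (rule less(1)[OF _ wus m1 y1(2,1) l'(3)]) (use Cons Var ctms_sub(2) in simp)
      obtain i where i: "i \<in> D" "Nn k i" using Nn_ex by blast
      have "varN (tcode (length xs) ts) k (tcode (length xs) us)" unfolding varN_iff using Cons Var less(2) by blast
      then have "relM varN m i m1" unfolding relM_iff[OF bdd_var less(3)] using i m1 by blast
      moreover have "LK i e (eval_tm M (env xs) t)" using LK_iff[OF assms _ i(2) x] less(2) Cons Var by simp
      ultimately have "VMB m y m1 y1 m1 y1" unfolding VMB_def using e(1) l x l' y1 less(4) i(1) by blast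
      then show ?thesis by (rule ind_step[OF _ i1 i1 mD less(5)])
    next
      case (Fn f ws)
      have i1: "ind VMA VMB m1 y1"
        by (rule less(1)[OF _ wus m1 y1(2,1) l'(3)]) (use Cons Fn ctms_sub(6) in simp)
      have wws: "list_all (wf_tm L' (length xs)) ws" and f: "(f, length ws) \<in> funs L'" using less(2) Cons Fn by simp_all
      obtain m2 where m2: "Nn (tcode (length xs) ws) m2" using Nn_ex by blast
      have sw: "set (map (eval_tm M (env xs)) ws) \<subseteq> D" by (rule evals_in[OF wws e(2)])
      obtain a where a: "Ls (map (eval_tm M (env xs)) ws) a" using Ls_ex[OF sw] by blast
      then have aD: "a \<in> D" using Ls_D by blast
      obtain y2 where y2: "y2 \<in> D" "pr e a y2" using pr_ex[OF e(1) aD] by blast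
      have i2: "ind VMA VMB m2 y2"
        by (rule less(1)[OF _ wws m2 y2(2,1) a]) (use Cons Fn ctms_sub(5) in simp)
      have "fnN f (length ws) (tcode (length xs) ts) (tcode (length xs) us) (tcode (length xs) ws)"
        unfolding fnN_iff using Cons Fn less(2) by blast
      then have "relM (fnN f (length ws)) m m1 m2" unfolding relM_iff[OF bdd_fn less(3)] using m1 m2 by blast
      moreover have "funT f (length ws) a (eval_tm M (env xs) t)"
        unfolding funT_def using a sw Fn by (intro exI[of _ "map (eval_tm M (env xs)) ws"]) simp
      ultimately have "\<exists>p\<in>funs L'. relM (fnN (fst p) (snd p)) m m1 m2 \<and>
          (\<exists>a\<in>D. pr e a y2 \<and> funT (fst p) (snd p) a (eval_tm M (env xs) t))"
        using aD y2(2) by (intro bexI[OF _ f]) auto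
      then have "VMB m y m1 y1 m2 y2" unfolding VMB_def using e(1) l x l' y1 less(4) by blast
      then show ?thesis by (rule ind_step[OF _ i1 i2 mD less(5)])
    qed
  qed
qed

lemma VM_iff:
  assumes "Ls xs e" "list_all (wf_tm L' (length xs)) ts" "Nn (tcode (length xs) ts) m" "l \<in> D"
  shows "VM m e l \<longleftrightarrow> Ls (map (eval_tm M (env xs)) ts) l"
proof
  show "VM m e l \<Longrightarrow> Ls (map (eval_tm M (env xs)) ts) l"
    unfolding VM_def using VM_sound0[OF assms(1-3) _ assms(4)] by blast
next
  assume l: "Ls (map (eval_tm M (env xs)) ts) l"
  obtain y where "y \<in> D" "pr e l y" using pr_ex[of e l] Ls_D[OF assms(1)] assms(4) by blast
  then show "VM m e l" unfolding VM_def using VM_compl0[OF assms(1-3) _ _ l] ind_cert by blast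
qed

subsection \<open>Partial satisfaction\<close>

definition eqN :: "bool \<Rightarrow> nat \<Rightarrow> nat \<Rightarrow> bool" where
  "eqN s x m \<longleftrightarrow> (\<exists>b\<le>x. \<exists>z\<le>x. x = prod_encode (b, 2 * cat (cnat 0) z + of_bool s) \<and> TL b 2 z \<and> m = t3 b 2 z)"

definition relN :: "bool \<Rightarrow> nat \<Rightarrow> nat \<Rightarrow> nat \<Rightarrow> nat \<Rightarrow> bool" where
  "relN s R j x m \<longleftrightarrow> (\<exists>b\<le>x. \<exists>z\<le>x. x = prod_encode (b, 2 * cat (cnat 1) (cat (cnat R) (cat (cnat j) z)) + of_bool s) \<and>
    (R, j) \<in> rels L' \<and> TL b j z \<and> m = t3 b j z)"

lemma eqN_iff: "eqN s x m \<longleftrightarrow> (\<exists>b t u. wf_fm L' b (Eq t u) \<and> x = bsc b (s, Eq t u) \<and> m = tcode b [t, u])" (is "?l \<longleftrightarrow> ?r")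
proof
  assume ?l
  then obtain b z where *: "x = prod_encode (b, 2 * cat (cnat 0) z + of_bool s)" "TL b 2 z" "m = t3 b 2 z"
    unfolding eqN_def by blast
  then obtain ts where "length ts = 2" "list_all (wf_tm L' b) ts" "z = ctms ts" by (auto simp: TL_def)
  then obtain t u where "wf_tm L' b t" "wf_tm L' b u" "z = ctms [t, u]"
    by (auto simp: numeral_2_eq_2 length_Suc_conv)
  then show ?r using * by (intro exI[of _ b] exI[of _ t] exI[of _ u]) (simp add: bsc_def sc_def godel_simps numeral_2_eq_2)
next
  assume ?r
  then obtain b t u where *: "wf_fm L' b (Eq t u)" "x = bsc b (s, Eq t u)" "m = tcode b [t, u]" by blast
  have "TL b 2 (ctms [t, u])" unfolding TL_def by (rule exI[of _ "[t, u]"]) (use * in simp)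
  moreover have "b \<le> x" "sc (s, Eq t u) \<le> x" using * by (simp_all add: bsc_def le_prod_encode_1 le_prod_encode_2)
  then have "b \<le> x" "ctms [t, u] \<le> x" using godel_sub(1)[of t u] by (simp_all add: sc_def)
  moreover have "x = prod_encode (b, 2 * cat (cnat 0) (ctms [t, u]) + of_bool s)" using * by (simp add: bsc_def sc_def godel_simps)
  moreover have "m = t3 b 2 (ctms [t, u])" using * by (simp add: numeral_2_eq_2)
  ultimately show ?l unfolding eqN_def by blast
qed

lemma relN_iff: "relN s R j x m \<longleftrightarrow> (\<exists>b ts. j = length ts \<and> wf_fm L' b (Rel R ts) \<and> x = bsc b (s, Rel R ts) \<and> m = tcode b ts)" (is "?l \<longleftrightarrow> ?r")
proof
  assume ?l
  then obtain b z where *: "x = prod_encode (b, 2 * cat (cnat 1) (cat (cnat R) (cat (cnat j) z)) + of_bool s)"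
    "(R, j) \<in> rels L'" "TL b j z" "m = t3 b j z"
    unfolding relN_def by blast
  then obtain ts where "length ts = j" "list_all (wf_tm L' b) ts" "z = ctms ts" by (auto simp: TL_def)
  then show ?r using * by (intro exI[of _ b] exI[of _ ts]) (simp add: bsc_def sc_def godel_simps)
next
  assume ?r
  then obtain b ts where *: "j = length ts" "wf_fm L' b (Rel R ts)" "x = bsc b (s, Rel R ts)" "m = tcode b ts" by blast
  have "TL b j (ctms ts)" unfolding TL_def by (rule exI[of _ ts]) (use * in simp)
  moreover have "b \<le> x" "sc (s, Rel R ts) \<le> x" using * by (simp_all add: bsc_def le_prod_encode_1 le_prod_encode_2)
  then have "b \<le> x" "ctms ts \<le> x" using godel_sub(4)[of ts R] by (simp_all add: sc_def)
  moreover have "x = prod_encode (b, 2 * cat (cnat 1) (cat (cnat R) (cat (cnat j) (ctms ts))) + of_bool s)"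
    using * by (simp add: bsc_def sc_def godel_simps)
  ultimately show ?l unfolding relN_def using * by auto
qed

lemma bdd_eqN: "bdd (\<lambda>a b c. eqN s a b \<and> c = b)"
proof (rule bddI[where h = "\<lambda>a. t3 (a + 2) (a + 2) (a + 2)"])
  show "rep (\<lambda>n. eqN s (n 0) (n 1) \<and> n 2 = n 1)" unfolding eqN_def by (intro rep_intros2 rep_TL)
  fix a b c assume "eqN s a b \<and> c = b"
  then show "b \<le> t3 (a + 2) (a + 2) (a + 2) \<and> c \<le> t3 (a + 2) (a + 2) (a + 2)"
    unfolding eqN_def by (auto intro!: prod_mono)
qed (intro rep_intros2)

lemma bdd_relN: "bdd (\<lambda>a b c. relN s R j a b \<and> c = b)"
proof (rule bddI[where h = "\<lambda>a. t3 (a + j) (a + j) (a + j)"])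
  show "rep (\<lambda>n. relN s R j (n 0) (n 1) \<and> n 2 = n 1)" unfolding relN_def by (intro rep_intros2 rep_TL)
  fix a b c assume "relN s R j a b \<and> c = b"
  then show "b \<le> t3 (a + j) (a + j) (a + j) \<and> c \<le> t3 (a + j) (a + j) (a + j)"
    unfolding relN_def by (auto intro!: prod_mono)
qed (intro rep_intros2)

definition eqT :: "'a \<Rightarrow> bool" where
  "eqT l \<longleftrightarrow> (\<exists>c\<in>D. \<exists>t\<in>D. \<exists>t'\<in>D. pr c t l \<and> pr c t' t)"

definition litM :: "'a \<Rightarrow> 'a \<Rightarrow> bool" where
  "litM x e \<longleftrightarrow> (\<exists>s\<in>{True, False}. \<exists>m\<in>D. relM (\<lambda>a b c. eqN s a b \<and> c = b) x m m \<and> (\<exists>l\<in>D. VM m e l \<and> (eqT l \<longleftrightarrow> s))) \<or>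
    (\<exists>s\<in>{True, False}. \<exists>p\<in>rels L'. \<exists>m\<in>D. relM (\<lambda>a b c. relN s (fst p) (snd p) a b \<and> c = b) x m m \<and>
      (\<exists>l\<in>D. VM m e l \<and> (relT (fst p) (snd p) l \<longleftrightarrow> s)))"

lemma litM_dfn: "pt f \<Longrightarrow> pt g \<Longrightarrow> dfn (\<lambda>v. litM (f v) (g v))"
proof (rule dfn_inst2)
  have f: "finite (rels L')" using finL by (simp add: finite_lang_def)
  show "dfn (\<lambda>v. litM (v 0) (v 1))" unfolding litM_def eqT_def
    by (rule dfn_disj; rule dfn_finite_disj, simp)
      (intro dfn_intros relM_dfn bdd_eqN VM_dfn pr_dfn,
        rule dfn_finite_disj[OF f], intro dfn_intros relM_dfn bdd_relN VM_dfn pr_dfn relT_dfn, simp)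
qed

lemma eqT_iff: "Ls [c, d] l \<Longrightarrow> eqT l \<longleftrightarrow> c = d"
proof
  assume l: "Ls [c, d] l" and "eqT l"
  then obtain x t t' where "x \<in> D" "t \<in> D" "t' \<in> D" "pr x t l" "pr x t' t" unfolding eqT_def by blast
  then have "x = c" "Ls [d] t" using Ls_ConsD[OF l] by blast+
  then show "c = d" using Ls_ConsD[of d "[]" t x t'] \<open>pr x t' t\<close> \<open>x \<in> D\<close> \<open>t' \<in> D\<close> by simp
qed (auto simp: eqT_def)

lemma relT_iff: "Ls xs l \<Longrightarrow> relT R (length xs) l \<longleftrightarrow> rel_of M R xs"
  unfolding relT_def using Ls_unique Ls_D by metis

lemma litM_iff:
  assumes e: "Ls xs e" and wf: "wf_fm L' (length xs) (snd k)" and x: "Nn (bsc (length xs) k) x"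
  shows "litM x e \<longleftrightarrow> atomic (snd k) \<and> ssat M (env xs) k"
proof -
  obtain s \<phi> where k: "k = (s, \<phi>)" by (cases k)
  have sx: "set xs \<subseteq> D" using Ls_D[OF e] by simp
  have ev: "(\<exists>l\<in>D. VM m e l \<and> P l) \<longleftrightarrow> (\<exists>l. Ls (map (eval_tm M (env xs)) ts) l \<and> P l)"
    if "list_all (wf_tm L' (length xs)) ts" "Nn (tcode (length xs) ts) m" for m ts P
    using VM_iff[OF e that] Ls_D by blast
  have ex: "\<exists>l. Ls (map (eval_tm M (env xs)) ts) l" if "list_all (wf_tm L' (length xs)) ts" for ts
    using Ls_ex[OF evals_in[OF that sx]] .
  have e1: "(\<exists>m\<in>D. relM (\<lambda>a b c. eqN s' a b \<and> c = b) x m m \<and> (\<exists>l\<in>D. VM m e l \<and> (eqT l \<longleftrightarrow> s'))) \<longleftrightarrow>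
      s' = s \<and> (\<exists>t u. \<phi> = Eq t u) \<and> ssat M (env xs) k" for s'
  proof
    assume "\<exists>m\<in>D. relM (\<lambda>a b c. eqN s' a b \<and> c = b) x m m \<and> (\<exists>l\<in>D. VM m e l \<and> (eqT l \<longleftrightarrow> s'))"
    then obtain m l where m: "relM (\<lambda>a b c. eqN s' a b \<and> c = b) x m m" "l \<in> D" "VM m e l" "eqT l \<longleftrightarrow> s'" by blast
    then obtain t u where tu: "s' = s" "\<phi> = Eq t u" "Nn (tcode (length xs) [t, u]) m"
      unfolding relM_iff[OF bdd_eqN x] unfolding eqN_iff bsc_inj k by auto
    have w: "list_all (wf_tm L' (length xs)) [t, u]" using wf k tu by simp
    have "Ls (map (eval_tm M (env xs)) [t, u]) l" using VM_iff[OF e w tu(3) m(2)] m(3) by blast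
    then have "eqT l \<longleftrightarrow> eval_tm M (env xs) t = eval_tm M (env xs) u" using eqT_iff by simp
    then show "s' = s \<and> (\<exists>t u. \<phi> = Eq t u) \<and> ssat M (env xs) k" using tu m(4) k by (auto simp: ssat_def)
  next
    assume "s' = s \<and> (\<exists>t u. \<phi> = Eq t u) \<and> ssat M (env xs) k"
    then obtain t u where tu: "s' = s" "\<phi> = Eq t u" "ssat M (env xs) k" by blast
    have w: "list_all (wf_tm L' (length xs)) [t, u]" using wf k tu by simp
    obtain m where m: "m \<in> D" "Nn (tcode (length xs) [t, u]) m" using Nn_ex by blast
    have "relM (\<lambda>a b c. eqN s' a b \<and> c = b) x m m"
      unfolding relM_iff[OF bdd_eqN x] unfolding eqN_iff using m(2) k tu wf by auto
    moreover obtain l where l: "Ls (map (eval_tm M (env xs)) [t, u]) l" using ex[OF w] by blast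
    then have "VM m e l" using VM_iff[OF e w m(2)] Ls_D by blast
    moreover have "eqT l \<longleftrightarrow> eval_tm M (env xs) t = eval_tm M (env xs) u" by (rule eqT_iff) (use l in simp)
    then have "eqT l \<longleftrightarrow> s'" using tu k by (simp add: ssat_def)
    ultimately show "\<exists>m\<in>D. relM (\<lambda>a b c. eqN s' a b \<and> c = b) x m m \<and> (\<exists>l\<in>D. VM m e l \<and> (eqT l \<longleftrightarrow> s'))"
      using m(1) l Ls_D by blast
  qed
  have e2: "(\<exists>p\<in>rels L'. \<exists>m\<in>D. relM (\<lambda>a b c. relN s' (fst p) (snd p) a b \<and> c = b) x m m \<and>
      (\<exists>l\<in>D. VM m e l \<and> (relT (fst p) (snd p) l \<longleftrightarrow> s'))) \<longleftrightarrow> s' = s \<and> (\<exists>R ts. \<phi> = Rel R ts) \<and> ssat M (env xs) k" for s'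
  proof
    assume "\<exists>p\<in>rels L'. \<exists>m\<in>D. relM (\<lambda>a b c. relN s' (fst p) (snd p) a b \<and> c = b) x m m \<and>
      (\<exists>l\<in>D. VM m e l \<and> (relT (fst p) (snd p) l \<longleftrightarrow> s'))"
    then obtain p m l where m: "relM (\<lambda>a b c. relN s' (fst p) (snd p) a b \<and> c = b) x m m" "l \<in> D" "VM m e l"
      "relT (fst p) (snd p) l \<longleftrightarrow> s'" by blast
    then obtain ts where tu: "s' = s" "\<phi> = Rel (fst p) ts" "snd p = length ts" "Nn (tcode (length xs) ts) m"
      unfolding relM_iff[OF bdd_relN x] unfolding relN_iff bsc_inj k by auto
    have w: "list_all (wf_tm L' (length xs)) ts" using wf k tu by simp
    have "Ls (map (eval_tm M (env xs)) ts) l" using VM_iff[OF e w tu(4) m(2)] m(3) by blast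
    then have "relT (fst p) (snd p) l \<longleftrightarrow> rel_of M (fst p) (map (eval_tm M (env xs)) ts)"
      using relT_iff[of "map (eval_tm M (env xs)) ts" l] tu(3) by simp
    then show "s' = s \<and> (\<exists>R ts. \<phi> = Rel R ts) \<and> ssat M (env xs) k" using tu m(4) k by (auto simp: ssat_def)
  next
    assume "s' = s \<and> (\<exists>R ts. \<phi> = Rel R ts) \<and> ssat M (env xs) k"
    then obtain R ts where tu: "s' = s" "\<phi> = Rel R ts" "ssat M (env xs) k" by blast
    have w: "list_all (wf_tm L' (length xs)) ts" and R: "(R, length ts) \<in> rels L'" using wf k tu by simp_all
    obtain m where m: "m \<in> D" "Nn (tcode (length xs) ts) m" using Nn_ex by blast
    have "relM (\<lambda>a b c. relN s' R (length ts) a b \<and> c = b) x m m"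
      unfolding relM_iff[OF bdd_relN x] unfolding relN_iff using m(2) k tu wf by auto
    moreover obtain l where l: "Ls (map (eval_tm M (env xs)) ts) l" using ex[OF w] by blast
    then have "VM m e l" using VM_iff[OF e w m(2)] Ls_D by blast
    moreover have "relT R (length ts) l \<longleftrightarrow> s'" using relT_iff[OF l, of R] tu k by (simp add: ssat_def)
    ultimately show "\<exists>p\<in>rels L'. \<exists>m\<in>D. relM (\<lambda>a b c. relN s' (fst p) (snd p) a b \<and> c = b) x m m \<and>
      (\<exists>l\<in>D. VM m e l \<and> (relT (fst p) (snd p) l \<longleftrightarrow> s'))"
      using m(1) l Ls_D[OF l] by (intro bexI[OF _ R]) (simp only: fst_conv snd_conv, blast)
  qed
  have "(\<exists>s'\<in>{True, False}. s' = s \<and> A \<and> S) \<or> (\<exists>s'\<in>{True, False}. s' = s \<and> B \<and> S) \<longleftrightarrow> (A \<or> B) \<and> S" for A B S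
    by (cases s) auto
  then show ?thesis unfolding litM_def e1 e2 unfolding atomic_def k snd_conv .
qed

end

text \<open>The sign \<open>False\<close> stands for negation, and a negated \<open>\<Pi>\<close>
  formula is \<open>\<Sigma>\<close>; so this is the class of \<open>\<Sigma>\<close> formulas of
  level \<open>n\<close> in signed notation.\<close>

fun Sig :: "nat \<Rightarrow> sfm \<Rightarrow> bool" where
  "Sig n (s, \<phi>) = (if s then Sigma_star n \<phi> else Pi_star n \<phi>)"

inductive_cases Sigma_starE:
  "Sigma_star n (And p q)" "Sigma_star n (Or p q)" "Sigma_star n (Neg p)" "Sigma_star n (Ex p)" "Sigma_star n (All p)"
inductive_cases Pi_starE:
  "Pi_star n (And p q)" "Pi_star n (Or p q)" "Pi_star n (Neg p)" "Pi_star n (Ex p)" "Pi_star n (All p)"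

lemma not_Sigma_star_0: "\<not> Sigma_star 0 \<phi>" "\<not> Pi_star 0 \<phi>"
  by (auto elim: Sigma_star.cases Pi_star.cases)

lemma Sig_conj: "conjS k k1 k2 \<Longrightarrow> Sig n k \<Longrightarrow> Sig n k1 \<and> Sig n k2"
  by (erule conjS.cases) (auto elim: Sigma_starE Pi_starE split: if_splits)

lemma Sig_disj: "disjS k k1 k2 \<Longrightarrow> Sig n k \<Longrightarrow> Sig n k1 \<and> Sig n k2"
  by (erule disjS.cases) (auto elim: Sigma_starE Pi_starE)

lemma Sig_ex: "exS k k' \<Longrightarrow> Sig n k \<Longrightarrow> Sig n k'"
  by (erule exS.cases) (auto elim: Sigma_starE Pi_starE)

abbreviation comp :: "sfm \<Rightarrow> sfm" where "comp k \<equiv> (\<not> fst k, snd k)"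

text \<open>The only step at which the level drops: a counterexample to a universal formula
  satisfies the complemented instance, which is one alternation lower.\<close>

lemma Sig_all: "allS k k' \<Longrightarrow> Sig (Suc n) k \<Longrightarrow> Sig n (comp k')"
  by (erule allS.cases) (auto elim: Sigma_starE Pi_starE)

lemma ssat_comp: "ssat M v (comp k) \<longleftrightarrow> \<not> ssat M v k"
  by (auto simp: ssat_def)

lemma sfm_cases:
  obtains "atomic (snd k)" | k1 k2 where "conjS k k1 k2" | k1 k2 where "disjS k k1 k2"
  | k' where "exS k k'" | k' where "allS k k'"
proof -
  obtain s \<phi> where k: "k = (s, \<phi>)" by (rule prod.exhaust)
  show ?thesis
  proof (cases \<phi>)
    case (Neg p)
    show ?thesis by (rule that(2)) (simp only: k Neg, rule conjS.intros)
  next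
    case (And p q)
    show ?thesis
    proof (cases s)
      case True then show ?thesis by (intro that(2)) (simp only: k And, rule conjS.intros)
    next
      case False then show ?thesis by (intro that(3)) (simp only: k And, rule disjS.intros)
    qed
  next
    case (Or p q)
    show ?thesis
    proof (cases s)
      case True then show ?thesis by (intro that(3)) (simp only: k Or, rule disjS.intros)
    next
      case False then show ?thesis by (intro that(2)) (simp only: k Or, rule conjS.intros)
    qed
  next
    case (Ex p)
    show ?thesis
    proof (cases s)
      case True then show ?thesis by (intro that(4)) (simp only: k Ex, rule exS.intros)
    next
      case False then show ?thesis by (intro that(5)) (simp only: k Ex, rule allS.intros)
    qed
  next
    case (All p)
    show ?thesis
    proof (cases s)
      case True then show ?thesis by (intro that(5)) (simp only: k All, rule allS.intros)
    next
      case False then show ?thesis by (intro that(4)) (simp only: k All, rule exS.intros)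
    qed
  qed (use that(1) k in \<open>simp_all add: atomic_def\<close>)
qed

lemma kind_size:
  "conjS k k1 k2 \<Longrightarrow> size (snd k1) < size (snd k) \<and> size (snd k2) < size (snd k)"
  "disjS k k1 k2 \<Longrightarrow> size (snd k1) < size (snd k) \<and> size (snd k2) < size (snd k)"
  "exS k k' \<Longrightarrow> size (snd k') < size (snd k)"
  by (auto elim: conjS.cases disjS.cases exS.cases)

lemma kind_wf:
  "conjS k k1 k2 \<Longrightarrow> wf_fm L b (snd k) \<longleftrightarrow> wf_fm L b (snd k1) \<and> wf_fm L b (snd k2)"
  "disjS k k1 k2 \<Longrightarrow> wf_fm L b (snd k) \<longleftrightarrow> wf_fm L b (snd k1) \<and> wf_fm L b (snd k2)"
  "exS k k' \<Longrightarrow> wf_fm L b (snd k) \<longleftrightarrow> wf_fm L (Suc b) (snd k')"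
  "allS k k' \<Longrightarrow> wf_fm L b (snd k) \<longleftrightarrow> wf_fm L (Suc b) (snd k')"
  by (auto elim: conjS.cases disjS.cases exS.cases allS.cases)

lemma env_Cons: "(\<lambda>i. (y # xs) ! i) = case_nat y (\<lambda>i. xs ! i)"
  by (rule HOL.ext) (simp split: nat.split)

context arith
begin

definition allcN :: "nat \<Rightarrow> nat \<Rightarrow> bool" where
  "allcN x y \<longleftrightarrow> (\<exists>u\<le>prod_encode (2 * x + 1, 2 * x + 1). allN x u \<and>
    (\<exists>s\<le>1. p2 u mod 2 + s = 1 \<and> y = prod_encode (p1 u, 2 * (p2 u div 2) + s)))"

lemma allN_bound: "allN x u \<Longrightarrow> u \<le> prod_encode (2 * x + 1, 2 * x + 1)"
  and exN_bound: "exN x u \<Longrightarrow> u \<le> prod_encode (2 * x + 1, 2 * x + 1)"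
  and conjN_bound: "conjN x y z \<Longrightarrow> y \<le> prod_encode (2 * x + 1, 2 * x + 1) \<and> z \<le> prod_encode (2 * x + 1, 2 * x + 1)"
  and disjN_bound: "disjN x y z \<Longrightarrow> y \<le> prod_encode (2 * x + 1, 2 * x + 1) \<and> z \<le> prod_encode (2 * x + 1, 2 * x + 1)"
  unfolding allN_def exN_def conjN_def disjN_def
  by (elim exE conjE disjE; simp only:; intro conjI prod_mono; simp)+

lemma allcN_iff: "allcN x y \<longleftrightarrow> (\<exists>b k k'. allS k k' \<and> wf_fm L' b (snd k) \<and> x = bsc b k \<and> y = bsc (Suc b) (comp k'))"
proof -
  have c: "(\<exists>s\<le>1. p2 u mod 2 + s = 1 \<and> y = prod_encode (p1 u, 2 * (p2 u div 2) + s)) \<longleftrightarrow> y = bsc b (comp k)"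
    if "u = bsc b k" for u b k
  proof -
    have "(\<exists>s\<le>1. of_bool t + s = 1 \<and> y = f s) \<longleftrightarrow> y = f (of_bool (\<not> t))" for t and f :: "nat \<Rightarrow> nat"
      by (cases t) (auto simp: le_Suc_eq)
    from this[of "fst k" "\<lambda>s. prod_encode (b, 2 * godel (snd k) + s)"] show ?thesis
      by (simp add: that bsc_def sc_def)
  qed
  have "allcN x y \<longleftrightarrow> (\<exists>u. allN x u \<and> (\<exists>s\<le>1. p2 u mod 2 + s = 1 \<and> y = prod_encode (p1 u, 2 * (p2 u div 2) + s)))"
    unfolding allcN_def using allN_bound by blast
  then show ?thesis unfolding allN_iff using c by blast
qed

lemma bdd_kinds:
  "bdd conjN" "bdd disjN" "bdd (\<lambda>a b c. exN a b \<and> c = b)" "bdd (\<lambda>a b c. allcN a b \<and> c = b)"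
proof -
  have h: "repf (\<lambda>n. prod_encode (2 * n 0 + 1, 2 * n 0 + 1))" "repf (\<lambda>n. t3 2 (n 0) (n 0))" by (intro rep_intros2)+
  show "bdd conjN" by (rule bddI[OF _ h(1)]) (intro rep_kinds repf_var, rule conjN_bound)
  show "bdd disjN" by (rule bddI[OF _ h(1)]) (intro rep_kinds repf_var, rule disjN_bound)
  show "bdd (\<lambda>a b c. exN a b \<and> c = b)"
    by (rule bddI[OF _ h(1)]) (intro rep_intros2 rep_kinds, use exN_bound in blast)
  have h': "repf (\<lambda>n. prod_encode (prod_encode (2 * n 0 + 1, 2 * n 0 + 1), 2 * prod_encode (2 * n 0 + 1, 2 * n 0 + 1) + 1))"
    by (intro rep_intros2)
  show "bdd (\<lambda>a b c. allcN a b \<and> c = b)"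
  proof (rule bddI[OF _ h'])
    show "rep (\<lambda>n. allcN (n 0) (n 1) \<and> n 2 = n 1)" unfolding allcN_def by (intro rep_intros2 rep_kinds)
    fix a b c assume "allcN a b \<and> c = b"
    then obtain u s where u: "u \<le> prod_encode (2 * a + 1, 2 * a + 1)" "s \<le> 1" "b = prod_encode (p1 u, 2 * (p2 u div 2) + s)"
      "c = b" unfolding allcN_def by blast
    have "p1 u \<le> u" "p2 u \<le> u" by (rule p12_cases[of u], simp add: le_prod_encode_1, rule p12_cases[of u], simp add: le_prod_encode_2)
    then have "p1 u \<le> prod_encode (2 * a + 1, 2 * a + 1)" "2 * (p2 u div 2) + s \<le> 2 * prod_encode (2 * a + 1, 2 * a + 1) + 1"
      using u(1,2) by linarith+
    then show "b \<le> prod_encode (prod_encode (2 * a + 1, 2 * a + 1), 2 * prod_encode (2 * a + 1, 2 * a + 1) + 1) \<and>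
        c \<le> prod_encode (prod_encode (2 * a + 1, 2 * a + 1), 2 * prod_encode (2 * a + 1, 2 * a + 1) + 1)"
      unfolding u(4) u(3) by (intro conjI prod_mono)
  qed
qed

text \<open>A universal formula has infinitely many instances, too many for a finite certificate. It
  is accepted at once if the predicate \<open>S\<close> of the previous level finds no
  counterexample.\<close>

definition satA :: "('a \<Rightarrow> 'a \<Rightarrow> bool) \<Rightarrow> 'a \<Rightarrow> 'a \<Rightarrow> bool" where
  "satA S x e \<longleftrightarrow> litM x e \<or> (\<exists>x'\<in>D. relM (\<lambda>a b c. allcN a b \<and> c = b) x x' x' \<and>
    (\<forall>y\<in>D. \<forall>e'\<in>D. pr y e e' \<longrightarrow> \<not> S x' e'))"

text \<open>Disjunctions and existential formulas have a single premise and repeat it, to fit the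
  format of \<open>cert\<close>. The environment is part of the judgement and is extended at an
  existential formula.\<close>

definition satB :: "'a \<Rightarrow> 'a \<Rightarrow> 'a \<Rightarrow> 'a \<Rightarrow> 'a \<Rightarrow> 'a \<Rightarrow> bool" where
  "satB x e x1 e1 x2 e2 \<longleftrightarrow> (relM conjN x x1 x2 \<and> e1 = e \<and> e2 = e) \<or>
    ((\<exists>z\<in>D. relM disjN x x1 z \<or> relM disjN x z x1) \<and> e1 = e \<and> x2 = x1 \<and> e2 = e) \<or>
    (relM (\<lambda>a b c. exN a b \<and> c = b) x x1 x1 \<and> (\<exists>y\<in>D. pr y e e1) \<and> x2 = x1 \<and> e2 = e1)"

lemma sat_step_dfn:
  assumes "dfn (\<lambda>v. S (v 0) (v 1))"
  shows "dfn (\<lambda>v. cert (satA S) satB (v 0) (v 1))"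
proof (intro cert_dfn pt_var)
  show "dfn (\<lambda>v. satA S (v 0) (v 1))" unfolding satA_def
    by (intro dfn_intros litM_dfn relM_dfn bdd_kinds pr_dfn dfn_inst2[OF assms])
  show "dfn (\<lambda>v. satB (v 0) (v 1) (v 2) (v 3) (v 4) (v 5))" unfolding satB_def
    by (intro dfn_intros relM_dfn bdd_kinds pr_dfn)
qed

definition sound_on :: "(sfm \<Rightarrow> bool) \<Rightarrow> ('a \<Rightarrow> 'a \<Rightarrow> bool) \<Rightarrow> bool" where
  "sound_on C S \<longleftrightarrow> (\<forall>k x e xs. C k \<longrightarrow> Nn (bsc (length xs) k) x \<longrightarrow> Ls xs e \<longrightarrow> wf_fm L' (length xs) (snd k) \<longrightarrow>
    S x e \<longrightarrow> ssat M (env xs) k)"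

definition complete_on :: "(sfm \<Rightarrow> bool) \<Rightarrow> ('a \<Rightarrow> 'a \<Rightarrow> bool) \<Rightarrow> bool" where
  "complete_on C S \<longleftrightarrow> (\<forall>k x e xs. C k \<longrightarrow> Nn (bsc (length xs) k) x \<longrightarrow> Ls xs e \<longrightarrow> wf_fm L' (length xs) (snd k) \<longrightarrow>
    ssat M (env xs) k \<longrightarrow> S x e)"

text \<open>\<open>C\<close> is the class that the new predicate treats, and \<open>G\<close>
  receives the complemented instances of its universal formulas.\<close>

definition closed_under :: "(sfm \<Rightarrow> bool) \<Rightarrow> (sfm \<Rightarrow> bool) \<Rightarrow> bool" where
  "closed_under C G \<longleftrightarrow> (\<forall>k k1 k2. conjS k k1 k2 \<or> disjS k k1 k2 \<longrightarrow> C k \<longrightarrow> C k1 \<and> C k2) \<and>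
    (\<forall>k k'. exS k k' \<longrightarrow> C k \<longrightarrow> C k') \<and> (\<forall>k k'. allS k k' \<longrightarrow> C k \<longrightarrow> G (comp k'))"

lemma relM_D:
  "relM conjN x x1 x2 \<Longrightarrow> Nn (bsc b k) x \<Longrightarrow> \<exists>k1 k2. conjS k k1 k2 \<and> wf_fm L' b (snd k) \<and> Nn (bsc b k1) x1 \<and> Nn (bsc b k2) x2"
  "relM disjN x x1 x2 \<Longrightarrow> Nn (bsc b k) x \<Longrightarrow> \<exists>k1 k2. disjS k k1 k2 \<and> wf_fm L' b (snd k) \<and> Nn (bsc b k1) x1 \<and> Nn (bsc b k2) x2"
  "relM (\<lambda>a b c. exN a b \<and> c = b) x x1 x1 \<Longrightarrow> Nn (bsc b k) x \<Longrightarrow> \<exists>k1. exS k k1 \<and> wf_fm L' b (snd k) \<and> Nn (bsc (Suc b) k1) x1"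
  "relM (\<lambda>a b c. allcN a b \<and> c = b) x x1 x1 \<Longrightarrow> Nn (bsc b k) x \<Longrightarrow> \<exists>k1. allS k k1 \<and> wf_fm L' b (snd k) \<and> Nn (bsc (Suc b) (comp k1)) x1"
proof -
  assume x: "Nn (bsc b k) x"
  show "relM conjN x x1 x2 \<Longrightarrow> \<exists>k1 k2. conjS k k1 k2 \<and> wf_fm L' b (snd k) \<and> Nn (bsc b k1) x1 \<and> Nn (bsc b k2) x2"
    by (simp only: relM_iff[OF bdd_kinds(1) x], unfold conjN_iff bsc_inj, blast)
  show "relM disjN x x1 x2 \<Longrightarrow> \<exists>k1 k2. disjS k k1 k2 \<and> wf_fm L' b (snd k) \<and> Nn (bsc b k1) x1 \<and> Nn (bsc b k2) x2"
    by (simp only: relM_iff[OF bdd_kinds(2) x], unfold disjN_iff bsc_inj, blast)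
  show "relM (\<lambda>a b c. exN a b \<and> c = b) x x1 x1 \<Longrightarrow> \<exists>k1. exS k k1 \<and> wf_fm L' b (snd k) \<and> Nn (bsc (Suc b) k1) x1"
    by (simp only: relM_iff[OF bdd_kinds(3) x], unfold exN_iff bsc_inj, blast)
  show "relM (\<lambda>a b c. allcN a b \<and> c = b) x x1 x1 \<Longrightarrow> \<exists>k1. allS k k1 \<and> wf_fm L' b (snd k) \<and> Nn (bsc (Suc b) (comp k1)) x1"
    by (simp only: relM_iff[OF bdd_kinds(4) x], unfold allcN_iff bsc_inj, blast)
qed

lemma sound_onD:
  "sound_on C S \<Longrightarrow> C k \<Longrightarrow> Nn (bsc (length xs) k) x \<Longrightarrow> Ls xs e \<Longrightarrow> wf_fm L' (length xs) (snd k) \<Longrightarrow>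
    S x e \<Longrightarrow> ssat M (env xs) k"
  unfolding sound_on_def by blast

lemma complete_onD:
  "complete_on C S \<Longrightarrow> C k \<Longrightarrow> Nn (bsc (length xs) k) x \<Longrightarrow> Ls xs e \<Longrightarrow> wf_fm L' (length xs) (snd k) \<Longrightarrow>
    ssat M (env xs) k \<Longrightarrow> S x e"
  unfolding complete_on_def by blast

lemma relM_I:
  "conjS k k1 k2 \<Longrightarrow> wf_fm L' b (snd k) \<Longrightarrow> Nn (bsc b k) x \<Longrightarrow> Nn (bsc b k1) x1 \<Longrightarrow> Nn (bsc b k2) x2 \<Longrightarrow> relM conjN x x1 x2"
  "disjS k k1 k2 \<Longrightarrow> wf_fm L' b (snd k) \<Longrightarrow> Nn (bsc b k) x \<Longrightarrow> Nn (bsc b k1) x1 \<Longrightarrow> Nn (bsc b k2) x2 \<Longrightarrow> relM disjN x x1 x2"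
  "exS k k1 \<Longrightarrow> wf_fm L' b (snd k) \<Longrightarrow> Nn (bsc b k) x \<Longrightarrow> Nn (bsc (Suc b) k1) x1 \<Longrightarrow> relM (\<lambda>a b c. exN a b \<and> c = b) x x1 x1"
  "allS k k1 \<Longrightarrow> wf_fm L' b (snd k) \<Longrightarrow> Nn (bsc b k) x \<Longrightarrow> Nn (bsc (Suc b) (comp k1)) x1 \<Longrightarrow>
    relM (\<lambda>a b c. allcN a b \<and> c = b) x x1 x1"
  by (subst relM_iff[OF bdd_kinds(1)], assumption, unfold conjN_iff, blast)
    (subst relM_iff[OF bdd_kinds(2)], assumption, unfold disjN_iff, blast,
     subst relM_iff[OF bdd_kinds(3)], assumption, unfold exN_iff, blast,
     subst relM_iff[OF bdd_kinds(4)], assumption, unfold allcN_iff, blast)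

text \<open>Universal formulas are accepted because \<open>S\<close> fails, so soundness of the new
  predicate consumes completeness of \<open>S\<close>; in \<open>sat_complete\<close> the roles are
  exchanged.\<close>

lemma sat_sound:
  assumes cl: "closed_under C G" and S: "complete_on G S"
  shows "sound_on C (cert (satA S) satB)"
proof -
  have "C k \<Longrightarrow> Nn (bsc (length xs) k) x \<Longrightarrow> Ls xs e \<Longrightarrow> wf_fm L' (length xs) (snd k) \<Longrightarrow>
    cert (satA S) satB x e \<Longrightarrow> ssat M (env xs) k" for k x e xs
  proof (induct "size (snd k)" arbitrary: k x e xs rule: less_induct)
    case less
    have e: "e \<in> D" "set xs \<subseteq> D" using Ls_D[OF less(4)] by simp_all
    have len: "length (y # xs) = Suc (length xs)" for y by simp
    from cert_unfold[OF less(6) Nn_D[OF less(3)] e(1)] show ?case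
    proof (elim disjE bexE conjE)
      assume "satA S x e"
      then show ?thesis unfolding satA_def
      proof (elim disjE bexE conjE)
        assume "litM x e"
        then show ?thesis using litM_iff[OF less(4,5,3)] by simp
      next
        fix x' assume x': "relM (\<lambda>a b c. allcN a b \<and> c = b) x x' x'" "\<forall>y\<in>D. \<forall>e'\<in>D. pr y e e' \<longrightarrow> \<not> S x' e'"
        obtain k1 where k1: "allS k k1" "Nn (bsc (Suc (length xs)) (comp k1)) x'" using relM_D(4)[OF x'(1) less(3)] by blast
        have G: "G (comp k1)" using cl less(2) k1(1) unfolding closed_under_def by blast
        have "ssat M (case_nat y (env xs)) k1" if y: "y \<in> D" for y
        proof -
          obtain e' where e': "e' \<in> D" "pr y e e'" using pr_ex[OF y e(1)] by blast
          have L: "Ls (y # xs) e'" by (rule Ls_ConsI[OF less(4) e'(2,1) y])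
          have "wf_fm L' (length (y # xs)) (snd (comp k1))" using kind_wf(4)[OF k1(1)] less(5) by simp
          then have "\<not> ssat M (env (y # xs)) (comp k1)"
            using complete_onD[OF S G _ L] k1(2) x'(2) e' y unfolding len by blast
          then show ?thesis by (simp add: ssat_comp env_Cons)
        qed
        then show ?thesis using ssat_all[OF k1(1)] by blast
      qed
    next
      fix x1 e1 x2 e2 assume "satB x e x1 e1 x2 e2" and c: "cert (satA S) satB x1 e1" "cert (satA S) satB x2 e2" and D: "e1 \<in> D"
      then show ?thesis unfolding satB_def
      proof (elim disjE bexE conjE)
        assume "relM conjN x x1 x2" and ee: "e1 = e" "e2 = e"
        then obtain k1 k2 where k: "conjS k k1 k2" "Nn (bsc (length xs) k1) x1" "Nn (bsc (length xs) k2) x2"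
          using relM_D(1)[OF _ less(3)] by blast
        have "C k1 \<and> C k2" using cl less(2) k(1) unfolding closed_under_def by blast
        then have "ssat M (env xs) k1" "ssat M (env xs) k2"
          using less(1)[of k1 xs x1 e] less(1)[of k2 xs x2 e] kind_size(1)[OF k(1)] kind_wf(1)[OF k(1)] less(4,5) k c ee by blast+
        then show ?thesis using ssat_conj[OF k(1)] by blast
      next
        fix z assume "relM disjN x x1 z" and ee: "e1 = e"
        then obtain k1 k2 where k: "disjS k k1 k2" "Nn (bsc (length xs) k1) x1"
          using relM_D(2)[OF _ less(3)] by blast
        have "C k1" using cl less(2) k(1) unfolding closed_under_def by blast
        then have "ssat M (env xs) k1"
          using less(1)[of k1 xs x1 e] kind_size(2)[OF k(1)] kind_wf(2)[OF k(1)] less(4,5) k c ee by blast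
        then show ?thesis using ssat_disj[OF k(1)] by blast
      next
        fix z assume "relM disjN x z x1" and ee: "e1 = e"
        then obtain k1 k2 where k: "disjS k k1 k2" "Nn (bsc (length xs) k2) x1"
          using relM_D(2)[OF _ less(3)] by blast
        have "C k2" using cl less(2) k(1) unfolding closed_under_def by blast
        then have "ssat M (env xs) k2"
          using less(1)[of k2 xs x1 e] kind_size(2)[OF k(1)] kind_wf(2)[OF k(1)] less(4,5) k c ee by blast
        then show ?thesis using ssat_disj[OF k(1)] by blast
      next
        fix y assume "relM (\<lambda>a b c. exN a b \<and> c = b) x x1 x1" and y: "y \<in> D" "pr y e e1"
        then obtain k1 where k: "exS k k1" "Nn (bsc (Suc (length xs)) k1) x1" using relM_D(3)[OF _ less(3)] by blast
        have C1: "C k1" using cl less(2) k(1) unfolding closed_under_def by blast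
        have L: "Ls (y # xs) e1" by (rule Ls_ConsI[OF less(4) y(2) D y(1)])
        have "ssat M (env (y # xs)) k1"
          using less(1)[OF kind_size(3)[OF k(1)] C1 _ L _ c(1)] k(2) kind_wf(3)[OF k(1)] less(5) by simp
        then show ?thesis using ssat_ex[OF k(1)] y(1) by (auto simp: env_Cons)
      qed
    qed
  qed
  then show ?thesis unfolding sound_on_def by blast
qed

lemma sat_complete:
  assumes cl: "closed_under C G" and S: "sound_on G S"
  shows "complete_on C (cert (satA S) satB)"
proof -
  have "C k \<Longrightarrow> Nn (bsc (length xs) k) x \<Longrightarrow> Ls xs e \<Longrightarrow> wf_fm L' (length xs) (snd k) \<Longrightarrow>
    ssat M (env xs) k \<Longrightarrow> ind (satA S) satB x e" for k x e xs
  proof (induct "size (snd k)" arbitrary: k x e xs rule: less_induct)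
    case less
    have e: "e \<in> D" "set xs \<subseteq> D" using Ls_D[OF less(4)] by simp_all
    note xD = Nn_D[OF less(3)]
    have len: "length (y # xs) = Suc (length xs)" for y by simp
    show ?case
    proof (cases k rule: sfm_cases)
      case 1
      then have "litM x e" using litM_iff[OF less(4,5,3)] less(6) by simp
      then show ?thesis by (intro ind_base xD e) (simp add: satA_def)
    next
      case (2 k1 k2)
      obtain x1 x2 where x: "Nn (bsc (length xs) k1) x1" "Nn (bsc (length xs) k2) x2" using Nn_ex by blast
      have "C k1 \<and> C k2" using cl less(2) 2 unfolding closed_under_def by blast
      then have i: "ind (satA S) satB x1 e" "ind (satA S) satB x2 e"
        using less(1)[of k1 xs x1 e] less(1)[of k2 xs x2 e] kind_size(1)[OF 2] kind_wf(1)[OF 2] less(4-6) x ssat_conj[OF 2] by blast+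
      have "relM conjN x x1 x2" by (rule relM_I(1)[OF 2 less(5,3) x])
      then have "satB x e x1 e x2 e" by (simp add: satB_def)
      then show ?thesis by (rule ind_step[OF _ i xD e(1)])
    next
      case (3 k1 k2)
      obtain x1 x2 where x: "Nn (bsc (length xs) k1) x1" "Nn (bsc (length xs) k2) x2" using Nn_ex by blast
      have C: "C k1 \<and> C k2" using cl less(2) 3 unfolding closed_under_def by blast
      have r: "relM disjN x x1 x2" by (rule relM_I(2)[OF 3 less(5,3) x])
      have "ssat M (env xs) k1 \<or> ssat M (env xs) k2" using ssat_disj[OF 3] less(6) by blast
      then show ?thesis
      proof
        assume "ssat M (env xs) k1"
        then have i: "ind (satA S) satB x1 e"
          using less(1)[of k1 xs x1 e] kind_size(2)[OF 3] kind_wf(2)[OF 3] less(4,5) x C by blast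
        have "satB x e x1 e x1 e" using r Nn_D[OF x(2)] by (auto simp: satB_def)
        then show ?thesis by (rule ind_step[OF _ i i xD e(1)])
      next
        assume "ssat M (env xs) k2"
        then have i: "ind (satA S) satB x2 e"
          using less(1)[of k2 xs x2 e] kind_size(2)[OF 3] kind_wf(2)[OF 3] less(4,5) x C by blast
        have "satB x e x2 e x2 e" using r Nn_D[OF x(1)] by (auto simp: satB_def)
        then show ?thesis by (rule ind_step[OF _ i i xD e(1)])
      qed
    next
      case (4 k1)
      obtain x1 where x: "Nn (bsc (Suc (length xs)) k1) x1" using Nn_ex by blast
      have C: "C k1" using cl less(2) 4 unfolding closed_under_def by blast
      obtain y where y: "y \<in> D" "ssat M (case_nat y (env xs)) k1" using less(6) by (auto simp only: ssat_ex[OF 4])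
      obtain e' where e': "e' \<in> D" "pr y e e'" using pr_ex[OF y(1) e(1)] by blast
      have L: "Ls (y # xs) e'" by (rule Ls_ConsI[OF less(4) e'(2,1) y(1)])
      have i: "ind (satA S) satB x1 e'"
        using less(1)[OF kind_size(3)[OF 4] C _ L] x kind_wf(3)[OF 4] less(5) y(2) by (simp add: env_Cons)
      have "relM (\<lambda>a b c. exN a b \<and> c = b) x x1 x1" by (rule relM_I(3)[OF 4 less(5,3) x])
      then have "satB x e x1 e' x1 e'" using y(1) e' by (auto simp: satB_def)
      then show ?thesis by (rule ind_step[OF _ i i xD e(1)])
    next
      case (5 k1)
      obtain x1 where x: "Nn (bsc (Suc (length xs)) (comp k1)) x1" using Nn_ex by blast
      have G: "G (comp k1)" using cl less(2) 5 unfolding closed_under_def by blast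
      have r: "relM (\<lambda>a b c. allcN a b \<and> c = b) x x1 x1" by (rule relM_I(4)[OF 5 less(5,3) x])
      have "\<not> S x1 e'" if y: "y \<in> D" "e' \<in> D" "pr y e e'" for y e'
      proof
        assume s: "S x1 e'"
        have L: "Ls (y # xs) e'" by (rule Ls_ConsI[OF less(4) y(3,2,1)])
        have "wf_fm L' (length (y # xs)) (snd (comp k1))" using kind_wf(4)[OF 5] less(5) by simp
        then have "ssat M (env (y # xs)) (comp k1)" using sound_onD[OF S G _ L _ s] x unfolding len by blast
        then have "\<not> ssat M (case_nat y (env xs)) k1" by (simp add: ssat_comp env_Cons)
        then show False using bspec[OF iffD1[OF ssat_all[OF 5] less(6)] y(1)] by simp
      qed
      then have "satA S x e" using r Nn_D[OF x] unfolding satA_def by blast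
      then show ?thesis by (rule ind_base[OF _ xD e(1)])
    qed
  qed
  then show ?thesis unfolding complete_on_def using ind_cert by blast
qed

text \<open>The strict predicate is sound for all formulas and complete for those in the class, the lax one
  conversely; each is used at the alternations of the other. So membership in \<open>\<Sigma>\<^sup>*\<^sub>n\<close> need not be
  expressed inside the structure.\<close>

theorem partial_satisfaction:
  "\<exists>S T. dfn (\<lambda>v. S (v 0) (v 1)) \<and> dfn (\<lambda>v. T (v 0) (v 1)) \<and>
    sound_on (\<lambda>_. True) S \<and> complete_on (Sig n) S \<and> complete_on (\<lambda>_. True) T \<and> sound_on (Sig n) T"
proof (induct n)
  case 0
  \<comment> \<open>At level 0 the class is empty, so the constantly false predicate is complete for
    it and the constantly true one sound for it.\<close>
  have "\<not> Sig 0 k" for k by (cases k) (simp add: not_Sigma_star_0)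
  then show ?case
    by (intro exI[of _ "\<lambda>_ _. False"] exI[of _ "\<lambda>_ _. True"]) (simp add: dfn_True sound_on_def complete_on_def)
next
  case (Suc n)
  then obtain S T where ST: "dfn (\<lambda>v. S (v 0) (v 1))" "dfn (\<lambda>v. T (v 0) (v 1))"
    "sound_on (\<lambda>_. True) S" "complete_on (Sig n) S" "complete_on (\<lambda>_. True) T" "sound_on (Sig n) T" by blast
  have c: "closed_under (\<lambda>_. True) (\<lambda>_. True)" "closed_under (Sig (Suc n)) (Sig n)"
    unfolding closed_under_def using Sig_conj Sig_disj Sig_ex Sig_all by blast+
  show ?case
    by (intro exI[of _ "cert (satA T) satB"] exI[of _ "cert (satA S) satB"] conjI sat_step_dfn ST(1,2)
        sat_sound[OF c(1) ST(5)] sat_complete[OF c(2) ST(6)] sat_complete[OF c(1) ST(3)] sat_sound[OF c(2) ST(4)])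
qed

end

section \<open>Bounded computations\<close>

inductive_cases computesE:
  "computes Zr xs y" "computes Sr xs y" "computes (Pr i) xs y" "computes (Comp f gs) xs y"
  "computes (Prec f g) xs y" "computes (Mn f) xs y"

lemma computes_Zr: "computes Zr xs y \<longleftrightarrow> y = 0"
  by (auto elim: computesE intro: computes.intros)

lemma computes_Sr: "computes Sr xs y \<longleftrightarrow> (\<exists>x xs'. xs = x # xs' \<and> y = Suc x)"
  by (auto elim: computesE intro: computes.intros)

lemma computes_Pr: "computes (Pr i) xs y \<longleftrightarrow> i < length xs \<and> xs ! i = y"
  by (auto elim: computesE intro: computes.intros)

lemma computes_Comp:
  "computes (Comp f gs) xs z \<longleftrightarrow> (\<exists>ys. list_all2 (\<lambda>g y. computes g xs y) gs ys \<and> computes f ys z)"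
  by (blast elim: computesE intro: computes.intros)

lemma computes_Prec:
  "computes (Prec f g) xs y \<longleftrightarrow> (\<exists>xs'. xs = 0 # xs' \<and> computes f xs' y) \<or>
    (\<exists>n xs' z. xs = Suc n # xs' \<and> computes (Prec f g) (n # xs') z \<and> computes g (n # z # xs') y)"
  by (blast elim: computesE intro: computes.intros)

lemma computes_Mn:
  "computes (Mn f) xs n \<longleftrightarrow> computes f (n # xs) 0 \<and> (\<forall>m<n. \<exists>y. computes f (m # xs) (Suc y))"
proof
  show "computes (Mn f) xs n \<Longrightarrow> computes f (n # xs) 0 \<and> (\<forall>m<n. \<exists>y. computes f (m # xs) (Suc y))"
    by (erule computesE) simp
qed (simp add: computes.intros)

text \<open>In \<open>F w l y\<close> the argument list is coded by \<open>l\<close>, the value is \<open>y\<close>, and all searches are cut off at \<open>w\<close>.\<close>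

primrec prec_below :: "(nat \<Rightarrow> nat \<Rightarrow> nat \<Rightarrow> bool) \<Rightarrow> (nat \<Rightarrow> nat \<Rightarrow> nat \<Rightarrow> bool) \<Rightarrow>
    nat \<Rightarrow> nat \<Rightarrow> nat \<Rightarrow> nat \<Rightarrow> bool" where
  "prec_below F G w l 0 y \<longleftrightarrow> F w l y"
| "prec_below F G w l (Suc n) y \<longleftrightarrow> (\<exists>z\<le>w. prec_below F G w l n z \<and> G w (lc n (lc z l)) y)"

text \<open>\<open>F\<close> approximates \<open>R\<close> from below, increasingly in the stage
  \<open>w\<close> and exhaustively. Monotonicity allows finitely many stages to be merged by taking
  their maximum.\<close>

definition stages :: "(nat \<Rightarrow> nat \<Rightarrow> nat \<Rightarrow> bool) \<Rightarrow> (nat \<Rightarrow> nat \<Rightarrow> bool) \<Rightarrow> bool" where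
  "stages F R \<longleftrightarrow> (\<forall>w w' l y. F w l y \<longrightarrow> w \<le> w' \<longrightarrow> F w' l y) \<and> (\<forall>l y. (\<exists>w. F w l y) \<longleftrightarrow> R l y)"

lemma stages_mono: "stages F R \<Longrightarrow> F w l y \<Longrightarrow> w \<le> w' \<Longrightarrow> F w' l y"
  unfolding stages_def by blast

lemma stages_ex: "stages F R \<Longrightarrow> (\<exists>w. F w l y) \<longleftrightarrow> R l y"
  unfolding stages_def by blast

lemma stagesI:
  "(\<And>w w' l y. F w l y \<Longrightarrow> w \<le> w' \<Longrightarrow> F w' l y) \<Longrightarrow> (\<And>w l y. F w l y \<Longrightarrow> R l y) \<Longrightarrow>
    (\<And>l y. R l y \<Longrightarrow> \<exists>w. F w l y) \<Longrightarrow> stages F R"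
  unfolding stages_def by blast

lemma stages_const: "stages (\<lambda>_. R) R"
  unfolding stages_def by blast

lemma stages_conj:
  assumes "stages F R" "stages G S"
  shows "stages (\<lambda>w l y. F w l y \<and> G w l y) (\<lambda>l y. R l y \<and> S l y)"
proof (rule stagesI)
  fix l y assume "R l y \<and> S l y"
  then obtain w w' where "F w l y" "G w' l y" using stages_ex[OF assms(1)] stages_ex[OF assms(2)] by blast
  then have "F (max w w') l y \<and> G (max w w') l y"
    using stages_mono[OF assms(1)] stages_mono[OF assms(2)] max.cobounded1 max.cobounded2 by blast
  then show "\<exists>w. F w l y \<and> G w l y" ..
qed (use stages_mono[OF assms(1)] stages_mono[OF assms(2)] stages_ex[OF assms(1)] stages_ex[OF assms(2)] in blast)+

lemma stages_args: "stages F R \<Longrightarrow> stages (\<lambda>w l y. F w (p l y) (q l y)) (\<lambda>l y. R (p l y) (q l y))"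
  unfolding stages_def by blast

lemma stages_Ex:
  assumes "\<And>z. stages (F z) (R z)"
  shows "stages (\<lambda>w l y. \<exists>z\<le>w. F z w l y) (\<lambda>l y. \<exists>z. R z l y)"
proof (rule stagesI)
  fix w w' l y assume "\<exists>z\<le>w. F z w l y" "w \<le> w'"
  then show "\<exists>z\<le>w'. F z w' l y" using stages_mono[OF assms] order_trans by blast
next
  fix w l y assume "\<exists>z\<le>w. F z w l y"
  then show "\<exists>z. R z l y" using stages_ex[OF assms] by blast
next
  fix l y assume "\<exists>z. R z l y"
  then obtain z w where "F z w l y" using stages_ex[OF assms] by blast
  then have "F z (max z w) l y" using stages_mono[OF assms] by simp
  then show "\<exists>w. \<exists>z\<le>w. F z w l y" by (intro exI[of _ "max z w"] exI[of _ z]) simp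
qed

lemma stages_Bex:
  assumes "\<And>z. stages (F z) (R z)"
  shows "stages (\<lambda>w l y. \<exists>z\<le>b l y. F z w l y) (\<lambda>l y. \<exists>z\<le>b l y. R z l y)"
  using stages_ex[OF assms] stages_mono[OF assms] by (intro stagesI) blast+

text \<open>Finitely many instances have a common stage, by induction on the bound.\<close>

lemma stages_Ball:
  fixes b :: "nat \<Rightarrow> nat \<Rightarrow> nat"
  assumes "\<And>z. stages (F z) (R z)"
  shows "stages (\<lambda>w l y. \<forall>z\<le>b l y. F z w l y) (\<lambda>l y. \<forall>z\<le>b l y. R z l y)"
proof (rule stagesI)
  fix l y assume *: "\<forall>z\<le>b l y. R z l y"
  have "\<exists>w. \<forall>z\<le>k. F z w l y" if "k \<le> b l y" for k
    using that
  proof (induct k)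
    case 0
    then show ?case using * stages_ex[OF assms] by auto
  next
    case (Suc k)
    then obtain w w' where "\<forall>z\<le>k. F z w l y" "F (Suc k) w' l y" using * stages_ex[OF assms] by (metis Suc_leD)
    then have "\<forall>z\<le>Suc k. F z (max w w') l y" using stages_mono[OF assms] max.cobounded1 max.cobounded2 by (metis le_Suc_eq)
    then show ?case ..
  qed
  then show "\<exists>w. \<forall>z\<le>b l y. F z w l y" by blast
qed (use stages_ex[OF assms] stages_mono[OF assms] in blast)+

lemma stages_cong: "stages F R \<Longrightarrow> (\<And>w l y. F w l y \<longleftrightarrow> F' w l y) \<Longrightarrow> (\<And>l y. R l y \<longleftrightarrow> R' l y) \<Longrightarrow> stages F' R'"
  unfolding stages_def by simp

lemma stages_prec_below:
  assumes "stages F (\<lambda>l. computes f (list_decode l))" "stages G (\<lambda>l. computes g (list_decode l))"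
  shows "stages (\<lambda>w l y. prec_below F G w l n y) (\<lambda>l. computes (Prec f g) (n # list_decode l))"
proof (induct n)
  case 0
  show ?case by (rule stages_cong[OF assms(1)]) (simp_all add: computes_Prec[of f g "0 # _"])
next
  case (Suc n)
  have "stages (\<lambda>w l y. \<exists>z\<le>w. prec_below F G w l n z \<and> G w (lc n (lc z l)) y)
      (\<lambda>l y. \<exists>z. computes (Prec f g) (n # list_decode l) z \<and> computes g (list_decode (lc n (lc z l))) y)"
    by (intro stages_Ex stages_conj stages_args[OF Suc] stages_args[OF assms(2)])
  then show ?case by (rule stages_cong) (simp_all add: computes_Prec[of f g "Suc n # _"])
qed

context arith
begin

definition rep3 :: "(nat \<Rightarrow> nat \<Rightarrow> nat \<Rightarrow> bool) \<Rightarrow> bool" where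
  "rep3 F \<longleftrightarrow> rep (\<lambda>n. F (p1 (n 0)) (p1 (p2 (n 0))) (p2 (p2 (n 0))))"

lemma rep3_comp: "rep3 F \<Longrightarrow> repf f \<Longrightarrow> repf g \<Longrightarrow> repf h \<Longrightarrow> rep (\<lambda>n. F (f n) (g n) (h n))"
  unfolding rep3_def
  using rep_comp[where P = "\<lambda>m. F (p1 m) (p1 (p2 m)) (p2 (p2 m))" and f = "\<lambda>n. t3 (f n) (g n) (h n)"] by (simp add: repf_prod)

lemma rep3_prec_below:
  assumes F: "rep3 F" and G: "rep3 G"
  shows "rep (\<lambda>n. prec_below F G (p1 (n 0)) (p1 (p2 (p2 (n 0)))) (p1 (p2 (n 0))) (p2 (p2 (p2 (n 0)))))"
\<comment> \<open>Intermediate values may exceed the final value \<open>y\<close> but not the stage,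
  so \<open>w\<close> takes the last place of the bound.\<close>
proof (rule rep_ind[where P = "\<lambda>m. prec_below F G (p1 m) (p1 (p2 (p2 m))) (p1 (p2 m)) (p2 (p2 (p2 m)))"
      and A = "\<lambda>m. p1 (p2 m) = 0 \<and> F (p1 m) (p1 (p2 (p2 m))) (p2 (p2 (p2 m)))"
      and B = "\<lambda>m p q. (\<exists>n\<le>p1 (p2 m). p1 (p2 m) = Suc n \<and> (\<exists>z\<le>p1 m. p = t4 (p1 m) n (p1 (p2 (p2 m))) z \<and>
        G (p1 m) (lc n (lc z (p1 (p2 (p2 m))))) (p2 (p2 (p2 m))))) \<and> q = p"
      and b = "\<lambda>m. t4 (p1 m) (p1 (p2 m)) (p1 (p2 (p2 m))) (p1 m)" and m = "\<lambda>m. p1 (p2 m)"])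
  fix m
  obtain w n l y where m: "m = t4 w n l y" by (rule t4_cases)
  have le: "t4 w k l z \<le> t4 w n l w" if "k \<le> n" "z \<le> w" for k z using that by (intro prod_mono) simp_all
  have "prec_below F G w l n y \<longleftrightarrow> n = 0 \<and> F w l y \<or> (\<exists>k\<le>n. n = Suc k \<and> (\<exists>z\<le>w. prec_below F G w l k z \<and> G w (lc k (lc z l)) y))"
    by (cases n) auto
  also have "\<dots> \<longleftrightarrow> n = 0 \<and> F w l y \<or> (\<exists>p\<le>t4 w n l w. \<exists>q\<le>t4 w n l w.
      ((\<exists>k\<le>n. n = Suc k \<and> (\<exists>z\<le>w. p = t4 w k l z \<and> G w (lc k (lc z l)) y)) \<and> q = p) \<and>
      prec_below F G (p1 p) (p1 (p2 (p2 p))) (p1 (p2 p)) (p2 (p2 (p2 p))) \<and>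
      prec_below F G (p1 q) (p1 (p2 (p2 q))) (p1 (p2 q)) (p2 (p2 (p2 q))))" (is "_ \<or> ?l \<longleftrightarrow> _ \<or> ?r")
  proof -
    have "?l \<Longrightarrow> ?r"
    proof (elim exE conjE)
      fix k z assume *: "k \<le> n" "n = Suc k" "z \<le> w" "prec_below F G w l k z" "G w (lc k (lc z l)) y"
      show ?r using le[OF *(1,3)] *
        by (intro exI[of _ "t4 w k l z"] conjI exI[of _ k] exI[of _ z]) simp_all
    qed
    moreover have "?r \<Longrightarrow> ?l"
    proof (elim exE conjE)
      fix p q k z assume *: "k \<le> n" "n = Suc k" "z \<le> w" "p = t4 w k l z" "G w (lc k (lc z l)) y"
        "prec_below F G (p1 p) (p1 (p2 (p2 p))) (p1 (p2 p)) (p2 (p2 (p2 p)))"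
      then show ?l by (intro exI[of _ k] conjI exI[of _ z]) simp_all
    qed
    ultimately show ?thesis by blast
  qed
  finally show "prec_below F G (p1 m) (p1 (p2 (p2 m))) (p1 (p2 m)) (p2 (p2 (p2 m))) \<longleftrightarrow>
      p1 (p2 m) = 0 \<and> F (p1 m) (p1 (p2 (p2 m))) (p2 (p2 (p2 m))) \<or>
      (\<exists>p\<le>t4 (p1 m) (p1 (p2 m)) (p1 (p2 (p2 m))) (p1 m). \<exists>q\<le>t4 (p1 m) (p1 (p2 m)) (p1 (p2 (p2 m))) (p1 m).
        ((\<exists>n\<le>p1 (p2 m). p1 (p2 m) = Suc n \<and> (\<exists>z\<le>p1 m. p = t4 (p1 m) n (p1 (p2 (p2 m))) z \<and>
          G (p1 m) (lc n (lc z (p1 (p2 (p2 m))))) (p2 (p2 (p2 m))))) \<and> q = p) \<and>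
        prec_below F G (p1 p) (p1 (p2 (p2 p))) (p1 (p2 p)) (p2 (p2 (p2 p))) \<and>
        prec_below F G (p1 q) (p1 (p2 (p2 q))) (p1 (p2 q)) (p2 (p2 (p2 q))))"
    unfolding m p12 .
next
  show "rep (\<lambda>n. p1 (p2 (n 0)) = 0 \<and> F (p1 (n 0)) (p1 (p2 (p2 (n 0)))) (p2 (p2 (p2 (n 0)))))"
    by (intro rep_intros1 rep3_comp[OF F])
  show "rep (\<lambda>n. (\<exists>k\<le>p1 (p2 (n 0)). p1 (p2 (n 0)) = Suc k \<and> (\<exists>z\<le>p1 (n 0). n 1 = t4 (p1 (n 0)) k (p1 (p2 (p2 (n 0)))) z \<and>
        G (p1 (n 0)) (lc k (lc z (p1 (p2 (p2 (n 0)))))) (p2 (p2 (p2 (n 0)))))) \<and> n 2 = n 1)"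
    by (intro rep_intros1 rep3_comp[OF G])
qed (auto intro!: rep_intros1)

theorem computes_stages:
  "\<exists>F. rep3 F \<and> stages F (\<lambda>l. computes f (list_decode l))"
proof (induct f)
  case Zr
  have "rep3 (\<lambda>w l y. y = 0)" unfolding rep3_def by (intro rep_intros1)
  moreover have "stages (\<lambda>w l y. y = 0) (\<lambda>l. computes Zr (list_decode l))"
    by (rule stages_cong[OF stages_const]) (auto simp: computes_Zr)
  ultimately show ?case by blast
next
  case Sr
  have "rep3 (\<lambda>w l y. \<exists>x\<le>l. \<exists>l'\<le>l. l = lc x l' \<and> y = Suc x)" unfolding rep3_def by (intro rep_intros1)
  moreover have "(\<exists>x\<le>l. \<exists>l'\<le>l. l = lc x l' \<and> y = Suc x) \<longleftrightarrow> computes Sr (list_decode l) y" for l y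
  proof (rule list_code_cases[of l])
    fix x l' assume "l = lc x l'"
    then show ?thesis using less_imp_le[OF list_code_less(1)[of x l']] less_imp_le[OF list_code_less(2)[of l' x]]
      by (auto simp: computes_Sr)
  qed (simp add: computes_Sr)
  then have "stages (\<lambda>w l y. \<exists>x\<le>l. \<exists>l'\<le>l. l = lc x l' \<and> y = Suc x) (\<lambda>l. computes Sr (list_decode l))"
    by (intro stages_cong[OF stages_const]) auto
  ultimately show ?case by blast
next
  case (Pr i)
  have "rep3 (\<lambda>w l y. Nth l i y)" unfolding rep3_def by (intro rep_intros1 rep_Nth)
  moreover have "stages (\<lambda>w l y. Nth l i y) (\<lambda>l. computes (Pr i) (list_decode l))"
    by (rule stages_cong[OF stages_const]) (auto simp: computes_Pr Nth_def)
  ultimately show ?case by blast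
next
  case (Comp f gs)
  then obtain F where F: "rep3 F" "stages F (\<lambda>l. computes f (list_decode l))" by blast
  \<comment> \<open>The values of the inner functions are collected in one coded list, by induction
    on the list of functions.\<close>
  have "\<exists>G. rep3 G \<and> stages G (\<lambda>l m. list_all2 (\<lambda>g y. computes g (list_decode l) y) gs (list_decode m))"
    using Comp(2)
  proof (induct gs)
    case Nil
    have "rep3 (\<lambda>w l m. m = 0)" unfolding rep3_def by (intro rep_intros1)
    moreover have "m = 0 \<longleftrightarrow> list_decode m = []" for m by (rule list_code_cases[of m]) simp_all
    then have "stages (\<lambda>w l m. m = 0) (\<lambda>l m. list_all2 (\<lambda>g y. computes g (list_decode l) y) [] (list_decode m))"
      by (intro stages_cong[OF stages_const]) auto
    ultimately show ?case by blast
  next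
    case (Cons g gs)
    then obtain H G where H: "rep3 H" "stages H (\<lambda>l. computes g (list_decode l))" and
      G: "rep3 G" "stages G (\<lambda>l m. list_all2 (\<lambda>g y. computes g (list_decode l) y) gs (list_decode m))"
      by (metis list.set_intros)
    have "rep3 (\<lambda>w l m. \<exists>y\<le>m. \<exists>m'\<le>m. m = lc y m' \<and> H w l y \<and> G w l m')"
      unfolding rep3_def by (intro rep_intros1 rep3_comp[OF H(1)] rep3_comp[OF G(1)])
    moreover have "stages (\<lambda>w l m. \<exists>y\<le>m. \<exists>m'\<le>m. m = lc y m' \<and> H w l y \<and> G w l m')
        (\<lambda>l m. \<exists>y\<le>m. \<exists>m'\<le>m. m = lc y m' \<and> computes g (list_decode l) y \<and>
          list_all2 (\<lambda>g y. computes g (list_decode l) y) gs (list_decode m'))"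
      by (intro stages_Bex stages_conj stages_const stages_args[OF H(2)] stages_args[OF G(2)])
    moreover have "(\<exists>y\<le>m. \<exists>m'\<le>m. m = lc y m' \<and> computes g (list_decode l) y \<and>
          list_all2 (\<lambda>g y. computes g (list_decode l) y) gs (list_decode m')) \<longleftrightarrow>
        list_all2 (\<lambda>g y. computes g (list_decode l) y) (g # gs) (list_decode m)" for l m
    proof (rule list_code_cases[of m])
      fix x l' assume "m = lc x l'"
      then show ?thesis using less_imp_le[OF list_code_less(1)[of x l']] less_imp_le[OF list_code_less(2)[of l' x]]
        by auto
    qed simp
    ultimately show ?case by (simp cong del: ex_cong1) blast
  qed
  then obtain G where G: "rep3 G" "stages G (\<lambda>l m. list_all2 (\<lambda>g y. computes g (list_decode l) y) gs (list_decode m))" by blast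
  have "rep3 (\<lambda>w l y. \<exists>m\<le>w. G w l m \<and> F w m y)"
    unfolding rep3_def by (intro rep_intros1 rep3_comp[OF F(1)] rep3_comp[OF G(1)])
  moreover have "stages (\<lambda>w l y. \<exists>m\<le>w. G w l m \<and> F w m y) (\<lambda>l. computes (Comp f gs) (list_decode l))"
  proof (rule stages_cong)
    show "stages (\<lambda>w l y. \<exists>m\<le>w. G w l m \<and> F w m y) (\<lambda>l y. \<exists>m. list_all2 (\<lambda>g y. computes g (list_decode l) y) gs (list_decode m) \<and>
        computes f (list_decode m) y)"
      by (intro stages_Ex stages_conj stages_args[OF F(2)] stages_args[OF G(2)])
    show "(\<exists>m. list_all2 (\<lambda>g y. computes g (list_decode l) y) gs (list_decode m) \<and> computes f (list_decode m) y) \<longleftrightarrow>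
        computes (Comp f gs) (list_decode l) y" for l y
      unfolding computes_Comp by (metis list_encode_inverse)
  qed simp
  ultimately show ?case by blast
next
  case (Prec f g)
  then obtain F G where F: "rep3 F" "stages F (\<lambda>l. computes f (list_decode l))"
    and G: "rep3 G" "stages G (\<lambda>l. computes g (list_decode l))" by blast
  have "rep3 (\<lambda>w l y. \<exists>n\<le>l. \<exists>l'\<le>l. l = lc n l' \<and> prec_below F G w l' n y)" unfolding rep3_def
    using rep_comp[OF rep3_prec_below[OF F(1) G(1)], where f = "\<lambda>n. t4 (p1 (n 2)) (n 1) (n 0) (p2 (p2 (n 2)))"]
    by (intro rep_intros1) (simp add: rep_intros1 numeral_2_eq_2)
  moreover have "stages (\<lambda>w l y. \<exists>n\<le>l. \<exists>l'\<le>l. l = lc n l' \<and> prec_below F G w l' n y) (\<lambda>l. computes (Prec f g) (list_decode l))"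
  proof (rule stages_cong)
    show "stages (\<lambda>w l y. \<exists>n\<le>l. \<exists>l'\<le>l. l = lc n l' \<and> prec_below F G w l' n y)
        (\<lambda>l y. \<exists>n\<le>l. \<exists>l'\<le>l. l = lc n l' \<and> computes (Prec f g) (n # list_decode l') y)"
      by (intro stages_Bex stages_conj stages_const stages_args[OF stages_prec_below[OF F(2) G(2)]])
    show "(\<exists>n\<le>l. \<exists>l'\<le>l. l = lc n l' \<and> computes (Prec f g) (n # list_decode l') y) \<longleftrightarrow> computes (Prec f g) (list_decode l) y" for l y
    proof (rule list_code_cases[of l])
      fix n l' assume "l = lc n l'"
      then show ?thesis using less_imp_le[OF list_code_less(1)[of n l']] less_imp_le[OF list_code_less(2)[of l' n]] by auto
    qed (simp add: computes_Prec[of f g "[]"])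
  qed simp
  ultimately show ?case by blast
next
  case (Mn f)
  then obtain F where F: "rep3 F" "stages F (\<lambda>l. computes f (list_decode l))" by blast
  have "rep3 (\<lambda>w l y. F w (lc y l) 0 \<and> (\<forall>m\<le>y. m < y \<longrightarrow> (\<exists>z\<le>w. F w (lc m l) (Suc z))))"
    unfolding rep3_def by (intro rep_intros1 rep3_comp[OF F(1)])
  moreover have "stages (\<lambda>w l y. F w (lc y l) 0 \<and> (\<forall>m\<le>y. m < y \<longrightarrow> (\<exists>z\<le>w. F w (lc m l) (Suc z)))) (\<lambda>l. computes (Mn f) (list_decode l))"
  proof (rule stages_cong)
    have i: "stages F' R' \<Longrightarrow> stages (\<lambda>w l y. P l y \<longrightarrow> F' w l y) (\<lambda>l y. P l y \<longrightarrow> R' l y)" for F' R' P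
      unfolding stages_def by blast
    show "stages (\<lambda>w l y. F w (lc y l) 0 \<and> (\<forall>m\<le>y. m < y \<longrightarrow> (\<exists>z\<le>w. F w (lc m l) (Suc z))))
        (\<lambda>l y. computes f (list_decode (lc y l)) 0 \<and> (\<forall>m\<le>y. m < y \<longrightarrow> (\<exists>z. computes f (list_decode (lc m l)) (Suc z))))"
      by (intro stages_conj stages_Ball i stages_Ex stages_args[OF F(2)])
  qed (auto simp: computes_Mn)
  ultimately show ?case by blast
qed

text \<open>The stage is also a bound on the halting value.\<close>

corollary re_stages:
  assumes "re_set A"
  shows "\<exists>P. (\<forall>f g. repf f \<longrightarrow> repf g \<longrightarrow> rep (\<lambda>n. P (f n) (g n))) \<and> (\<forall>w w' u. P w u \<longrightarrow> w \<le> w' \<longrightarrow> P w' u) \<and>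
    (\<forall>u. u \<in> A \<longleftrightarrow> (\<exists>w. P w u))"
proof -
  obtain f where f: "\<And>n. n \<in> A \<longleftrightarrow> (\<exists>y. computes f [n] y)" using assms unfolding re_set_def by blast
  obtain F where F: "rep3 F" "stages F (\<lambda>l. computes f (list_decode l))" using computes_stages by blast
  have s: "stages (\<lambda>w u (_::nat). \<exists>y\<le>w. F w (lc u 0) y) (\<lambda>u (_::nat). \<exists>y. computes f (list_decode (lc u 0)) y)"
    by (intro stages_Ex stages_args[OF F(2)])
  have r: "rep3 (\<lambda>w u _. \<exists>y\<le>w. F w (lc u 0) y)" unfolding rep3_def by (intro rep_intros1 rep3_comp[OF F(1)])
  show ?thesis
  proof (intro exI[of _ "\<lambda>w u. \<exists>y\<le>w. F w (lc u 0) y"] conjI allI impI)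
    show "rep (\<lambda>n. \<exists>y\<le>f n. F (f n) (lc (g n) 0) y)" if "repf f" "repf g" for f g
      by (rule rep3_comp[OF r that repf_const])
    show "\<exists>y\<le>w'. F w' (lc u 0) y" if "\<exists>y\<le>w. F w (lc u 0) y" "w \<le> w'" for w w' u
      by (rule stages_mono[OF s that])
    show "u \<in> A \<longleftrightarrow> (\<exists>w. \<exists>y\<le>w. F w (lc u 0) y)" for u
      using stages_ex[OF s, of u] by (simp add: f)
  qed
qed

end

section \<open>Clauses on the natural numbers\<close>

lemma list_decode_less: "x \<in> set (list_decode n) \<Longrightarrow> x < n"
proof (induct n rule: less_induct)
  case (less n)
  show ?case
  proof (rule list_code_cases[of n])
    fix y l assume n: "n = lc y l"
    then have "x = y \<or> x \<in> set (list_decode l)" using less(2) by simp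
    then show ?thesis
      using less(1)[of l] list_code_less(1)[of y l] list_code_less(2)[of l y] unfolding n by (elim disjE) simp_all
  qed (use less(2) in simp)
qed

lemma list_decode_p2_less: "x \<in> set (list_decode (p2 m)) \<Longrightarrow> x < Suc (3 * m)"
proof -
  assume "x \<in> set (list_decode (p2 m))"
  then have "x < p2 m" by (rule list_decode_less)
  also have "p2 m \<le> m" by (rule p12_cases[of m]) (simp add: le_prod_encode_2)
  finally show ?thesis by simp
qed

text \<open>Evaluates a number as a formal term. The residue modulo 3 gives the sort, and the
  components are smaller than the number.\<close>

function freeN :: "(nat \<Rightarrow> 'n) \<Rightarrow> (nat \<Rightarrow> 'n list \<Rightarrow> 'n) \<Rightarrow> (sfm \<Rightarrow> 'n list \<Rightarrow> 'n) \<Rightarrow> nat \<Rightarrow> 'n" where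
  "freeN hp hf hw n = (let m = n div 3 in
    if n mod 3 = 0 then hp m
    else if n mod 3 = 1 then hf (p1 m) (map (freeN hp hf hw) (list_decode (p2 m)))
    else hw (inv sc (p1 m)) (map (freeN hp hf hw) (list_decode (p2 m))))"
  by auto
termination
proof (relation "Wellfounded.measure (\<lambda>(_, _, _, n). n)", goal_cases)
  case (2 hp hf hw n m x)
  then have "n mod 3 \<noteq> 0" "m = n div 3" by simp_all
  then have "Suc (3 * m) \<le> n" by presburger
  then show ?case using list_decode_p2_less[OF 2(4)] by simp
next
  case (3 hp hf hw n m x)
  then have "n mod 3 \<noteq> 0" "m = n div 3" by simp_all
  then have "Suc (3 * m) \<le> n" by presburger
  then show ?case using list_decode_p2_less[OF 3(4)] by simp
qed simp

declare freeN.simps [simp del]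

lemma inj_sc: "inj sc"
  by (rule injI) (simp add: sc_inj)

text \<open>The universal property demanded by \<open>clauses_satisfiable\<close>, for numbers as
  constants.\<close>

lemma free_nat:
  fixes hp :: "nat \<Rightarrow> 'n"
  assumes "range hp \<subseteq> D" "\<And>f xs. hf f xs \<in> D" "\<And>k xs. hw k xs \<in> D"
  shows "\<exists>I. range I \<subseteq> D \<and> (\<forall>p. I (parN p) = hp p) \<and> (\<forall>f cs. I (fncN f cs) = hf f (map I cs)) \<and>
    (\<forall>k cs. I (witN k cs) = hw k (map I cs))"
proof (intro exI[of _ "freeN hp hf hw"] conjI allI)
  have "freeN hp hf hw n \<in> D" for n
    using assms by (subst freeN.simps) (auto simp: Let_def)
  then show "range (freeN hp hf hw) \<subseteq> D" by blast
  show "freeN hp hf hw (parN p) = hp p" for p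
    by (subst freeN.simps) (simp add: parN_def)
  show "freeN hp hf hw (fncN f cs) = hf f (map (freeN hp hf hw) cs)" for f cs
  proof -
    have "fncN f cs div 3 = prod_encode (f, list_encode cs)" "fncN f cs mod 3 = 1" unfolding fncN_def by presburger+
    then show ?thesis by (subst freeN.simps) simp
  qed
  show "freeN hp hf hw (witN k cs) = hw k (map (freeN hp hf hw) cs)" for k cs
  proof -
    have "witN k cs div 3 = prod_encode (sc k, list_encode cs)" "witN k cs mod 3 = 2" unfolding witN_def by presburger+
    then show ?thesis by (subst freeN.simps) (simp add: inv_f_f[OF inj_sc])
  qed
qed

section \<open>Arithmetisation of literals and clauses\<close>

type_synonym clit = "bool \<times> (nat, nat) fm \<times> nat list"

definition lcode :: "clit \<Rightarrow> nat" where
  "lcode l = 2 * prod_encode (godel (fst (snd l)), list_encode (snd (snd l))) + of_bool (fst l)"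

text \<open>A signed code \<open>x\<close> is twice a formula code plus the sign, so a literal keeps
  its parity and inserts the environment into its half. Its complement \<open>NT\<close> shifts
  \<open>x\<close> by one before taking the parity.\<close>

definition LT :: "nat \<Rightarrow> nat \<Rightarrow> nat" where "LT x e = 2 * prod_encode (x div 2, e) + x mod 2"
definition NT :: "nat \<Rightarrow> nat \<Rightarrow> nat" where "NT x e = 2 * prod_encode (x div 2, e) + Suc x mod 2"

lemma LT_lit: "LT (sc k) (list_encode e) = lcode (lit k e)"
  by (auto simp: LT_def lcode_def sc_def)

lemma NT_nlit: "NT (sc k) (list_encode e) = lcode (nlit k e)"
  by (auto simp: NT_def lcode_def sc_def)

lemma lcode_div: "lcode l div 2 = prod_encode (godel (fst (snd l)), list_encode (snd (snd l)))" "odd (lcode l) = fst l"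
  by (auto simp: lcode_def)

text \<open>The code of the negative literal of \<open>q0\<close>; the sign is the last bit, so the
  successor codes the positive literal.\<close>

definition eqL :: "nat \<Rightarrow> nat \<Rightarrow> nat" where "eqL c d = 2 * prod_encode (godel q0, lc c (lc d 0))"

lemma eqL: "lcode (False, q0, [c, d]) = eqL c d" "lcode (True, q0, [c, d]) = Suc (eqL c d)"
  by (simp_all add: eqL_def lcode_def)

text \<open>Shorter clauses are padded by repeating their first literal, so that all clauses become
  triples with the same satisfying valuations.\<close>

definition pad3 :: "clit list \<Rightarrow> nat \<Rightarrow> nat \<Rightarrow> nat \<Rightarrow> bool" where
  "pad3 cl a b c \<longleftrightarrow> map lcode cl = [a] \<and> b = a \<and> c = a \<or> map lcode cl = [a, b] \<and> c = a \<or> map lcode cl = [a, b, c]"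

text \<open>\<open>AxP\<close> enumerates the axioms by stages, in the form that
  \<open>re_stages\<close> supplies.\<close>

locale recursive_theory = arith +
  fixes U :: "(nat, nat) fm set" and AxP :: "nat \<Rightarrow> nat \<Rightarrow> bool"
  assumes rep_AxP: "repf f \<Longrightarrow> repf g \<Longrightarrow> rep (\<lambda>n. AxP (f n) (g n))"
    and AxP_mono: "AxP w u \<Longrightarrow> w \<le> w' \<Longrightarrow> AxP w' u"
    and AxP_iff: "u \<in> godel ` U \<longleftrightarrow> (\<exists>w. AxP w u)"
begin

lemma pad3_holds:
  assumes p: "pad3 cl a b c" and X: "\<And>\<phi> e. (\<phi>, e) \<in> X' \<longleftrightarrow> prod_encode (godel \<phi>, list_encode e) \<in> X"
  shows "csat X' cl \<longleftrightarrow> holds_in a X \<or> holds_in b X \<or> holds_in c X"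
proof -
  have S: "set (map lcode cl) = {a, b, c}" using p unfolding pad3_def by (elim disjE conjE) auto
  have h: "holds_in (lcode l) X \<longleftrightarrow> (snd l \<in> X') = fst l" for l
    using X[of "fst (snd l)" "snd (snd l)"] unfolding lcode_div by simp
  have "csat X' cl \<longleftrightarrow> (\<exists>l\<in>set cl. (snd l \<in> X') = fst l)" unfolding csat_def by (rule bex_cong[OF refl]) (simp only: split_beta)
  also have "\<dots> \<longleftrightarrow> (\<exists>l\<in>set cl. holds_in (lcode l) X)" by (rule bex_cong[OF refl h[symmetric]])
  also have "\<dots> \<longleftrightarrow> (\<exists>x\<in>set (map lcode cl). holds_in x X)" unfolding set_map by (rule bex_simps(7)[symmetric])
  also have "\<dots> \<longleftrightarrow> holds_in a X \<or> holds_in b X \<or> holds_in c X" unfolding S by (simp only: bex_simps simp_thms)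
  finally show ?thesis .
qed

text \<open>The constant \<open>parN 0\<close> stands for the free variable. Refuting this set
  amounts to showing from \<open>U\<close> that \<open>\<sigma>\<close> implies
  \<open>\<phi>\<close>, or its negation if \<open>s\<close> is \<open>False\<close>.\<close>

definition tests :: "(nat, nat) fm \<Rightarrow> bool \<Rightarrow> (nat, nat) fm \<Rightarrow> (sfm \<times> nat list) set" where
  "tests \<sigma> s \<phi> = (\<lambda>u. ((True, u), [])) ` U \<union> {((True, \<sigma>), [parN 0]), ((\<not> s, \<phi>), [parN 0])}"

abbreviation "hclauses \<equiv> henkin.clauses L' fncN witN"

text \<open>0 codes the empty environment and \<open>lc 0 0\<close> the environment that consists of
  \<open>parN 0\<close>; \<open>Suc s mod 2\<close> is the sign opposite to
  \<open>s\<close>.\<close>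

definition unitN :: "nat \<Rightarrow> nat \<Rightarrow> nat \<Rightarrow> nat \<Rightarrow> nat \<Rightarrow> bool" where
  "unitN w x s g a \<longleftrightarrow> (\<exists>u\<le>w. AxP w u \<and> a = 2 * prod_encode (u, 0) + 1) \<or>
    a = 2 * prod_encode (x, lc 0 0) + 1 \<or> a = 2 * prod_encode (g, lc 0 0) + Suc s mod 2"

text \<open>Literals are coded without the bound on variables that \<open>x\<close> and
  \<open>y\<close> carry, hence \<open>p2\<close>. All quantifiers are bounded by \<open>w\<close>,
  which makes the definition representable and monotone in \<open>w\<close>.\<close>

definition logicN :: "nat \<Rightarrow> nat \<Rightarrow> nat \<Rightarrow> nat \<Rightarrow> bool" where
  "logicN w a b c \<longleftrightarrow> (\<exists>x\<le>w. \<exists>y\<le>w. \<exists>e\<le>w. a = NT (p2 x) e \<and>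
    ((\<exists>z\<le>w. conjN x y z \<and> (b = LT (p2 y) e \<or> b = LT (p2 z) e) \<and> c = a) \<or>
     (\<exists>z\<le>w. disjN x y z \<and> b = LT (p2 y) e \<and> c = LT (p2 z) e) \<or>
     exN x y \<and> b = LT (p2 y) (lc (Suc (Suc (3 * prod_encode (p2 y, e)))) e) \<and> c = a \<or>
     (\<exists>d\<le>w. allN x y \<and> b = LT (p2 y) (lc d e) \<and> c = a)))"

text \<open>The disjuncts correspond in this order to \<open>cl_eq\<close>, \<open>cl_refl\<close>,
  \<open>cl_eucl\<close>, \<open>cl_fun\<close> and \<open>cl_rel\<close>.\<close>

definition eqlN :: "nat \<Rightarrow> nat \<Rightarrow> nat \<Rightarrow> nat \<Rightarrow> bool" where
  "eqlN w a b c \<longleftrightarrow>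
    (\<exists>z\<le>w. \<exists>e\<le>w. \<exists>l\<le>w. \<exists>s\<le>1. VL 2 z e l \<and> a = 2 * prod_encode (cat (cnat 0) z, e) + Suc s mod 2 \<and>
      b = 2 * prod_encode (godel q0, l) + s \<and> c = a) \<or>
    (\<exists>d\<le>w. a = Suc (eqL d d) \<and> b = a \<and> c = a) \<or>
    (\<exists>d\<le>w. \<exists>d'\<le>w. a = eqL d d' \<and> ((\<exists>d''\<le>w. b = eqL d d'' \<and> c = Suc (eqL d' d'')) \<or>
      (\<exists>f\<le>w. \<exists>x\<le>w. \<exists>y\<le>w. Near d d' x y \<and>
        b = Suc (eqL (Suc (3 * prod_encode (f, x))) (Suc (3 * prod_encode (f, y)))) \<and> c = a) \<or>
      (\<exists>R\<le>w. \<exists>j\<le>w. \<exists>z\<le>w. \<exists>e\<le>w. \<exists>l\<le>w. \<exists>z'\<le>w. \<exists>e'\<le>w. \<exists>l'\<le>w. (R, j) \<in> rels L' \<and> VL j z e l \<and> VL j z' e' l' \<and>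
        Near d d' l l' \<and> b = 2 * prod_encode (cat (cnat 1) (cat (cnat R) (cat (cnat j) z)), e) \<and>
        c = Suc (2 * prod_encode (cat (cnat 1) (cat (cnat R) (cat (cnat j) z')), e')))))"

definition ClN :: "nat \<Rightarrow> nat \<Rightarrow> nat \<Rightarrow> nat \<Rightarrow> nat \<Rightarrow> nat \<Rightarrow> nat \<Rightarrow> bool" where
  "ClN w x s g a b c \<longleftrightarrow> unitN w x s g a \<and> b = a \<and> c = a \<or> logicN w a b c \<or> eqlN w a b c"

lemma rep_ClN: "rep (\<lambda>n. ClN (p1 (n 0)) (p1 (p2 (n 0))) (p1 (p2 (p2 (n 0)))) (p2 (p2 (p2 (n 0)))) (n 1) (n 2) (n 3))"
proof -
  have "rep (\<lambda>n. unitN (p1 (n 0)) (p1 (p2 (n 0))) (p1 (p2 (p2 (n 0)))) (p2 (p2 (p2 (n 0)))) (n 1))"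
    unfolding unitN_def by (intro rep_intros2 rep_AxP)
  moreover have "rep (\<lambda>n. logicN (p1 (n 0)) (n 1) (n 2) (n 3))"
    unfolding logicN_def LT_def NT_def by (intro rep_intros2 rep_kinds)
  moreover have "rep (\<lambda>n. eqlN (p1 (n 0)) (n 1) (n 2) (n 3))"
    unfolding eqlN_def eqL_def by (intro rep_intros2 rep_VL rep_Near)
  ultimately show ?thesis unfolding ClN_def by (intro rep_intros2)
qed

text \<open>\<open>w\<close> occurs only in bounds of positive existential quantifiers and in
  \<open>AxP\<close>, which is monotone.\<close>

lemma ClN_mono:
  assumes "ClN w x s g a b c" "w \<le> w'"
  shows "ClN w' x s g a b c"
proof -
  have ex: "v \<le> v' \<Longrightarrow> (\<And>x. P x \<longrightarrow> Q x) \<Longrightarrow> (\<exists>x\<le>v. P x) \<longrightarrow> (\<exists>x\<le>v'. Q x)" for v v' :: nat and P Q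
    using order_trans by blast
  note mono = ex[OF assms(2)] ex[OF order_refl] conj_mono disj_mono
  have "AxP w u \<longrightarrow> AxP w' u" for u using AxP_mono assms(2) by blast
  then have "unitN w x s g a \<longrightarrow> unitN w' x s g a" unfolding unitN_def by (intro mono imp_refl)
  moreover have "logicN w a b c \<longrightarrow> logicN w' a b c" unfolding logicN_def
    by (rule imp_refl mono | (rule ex[OF assms(2)]))+
  moreover have "eqlN w a b c \<longrightarrow> eqlN w' a b c" unfolding eqlN_def
    by (rule imp_refl mono | (rule ex[OF assms(2)]))+
  ultimately show ?thesis using assms(1) unfolding ClN_def by blast
qed

lemma LT_dec: "LT (sc k) e = lcode (lit k (list_decode e))"
  using LT_lit[of k "list_decode e"] by simp

lemma NT_dec: "NT (sc k) e = lcode (nlit k (list_decode e))"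
  using NT_nlit[of k "list_decode e"] by simp

lemma p2_bsc: "p2 (bsc b k) = sc k"
  by (simp add: bsc_def)

lemma logicN_sound:
  assumes "logicN w a b c"
  shows "\<exists>cl\<in>hclauses T. pad3 cl a b c"
proof -
  obtain x y e where a: "a = NT (p2 x) e" and
    "(\<exists>z. conjN x y z \<and> (b = LT (p2 y) e \<or> b = LT (p2 z) e) \<and> c = a) \<or>
     (\<exists>z. disjN x y z \<and> b = LT (p2 y) e \<and> c = LT (p2 z) e) \<or>
     exN x y \<and> b = LT (p2 y) (lc (Suc (Suc (3 * prod_encode (p2 y, e)))) e) \<and> c = a \<or>
     (\<exists>d. allN x y \<and> b = LT (p2 y) (lc d e) \<and> c = a)"
    using assms unfolding logicN_def by blast
  then show ?thesis
  proof (elim disjE exE conjE)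
    fix z assume k: "conjN x y z" and b: "b = LT (p2 y) e" and c: "c = a"
    obtain n k k1 k2 where k: "conjS k k1 k2" "wf_fm L' n (snd k)" "x = bsc n k" "y = bsc n k1" using k unfolding conjN_iff by blast
    have "formula_of L' (snd k)" using k(2) by (auto simp: formula_of_def)
    note henkin.cl_conj1[OF k(1) this, of "list_decode e"]
    then show ?thesis by (rule bexI[rotated]) (simp add: pad3_def a b c k(3,4) p2_bsc LT_dec NT_dec)
  next
    fix z assume k: "conjN x y z" and b: "b = LT (p2 z) e" and c: "c = a"
    obtain n k k1 k2 where k: "conjS k k1 k2" "wf_fm L' n (snd k)" "x = bsc n k" "z = bsc n k2" using k unfolding conjN_iff by blast
    have "formula_of L' (snd k)" using k(2) by (auto simp: formula_of_def)
    note henkin.cl_conj2[OF k(1) this, of "list_decode e"]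
    then show ?thesis by (rule bexI[rotated]) (simp add: pad3_def a b c k(3,4) p2_bsc LT_dec NT_dec)
  next
    fix z assume k: "disjN x y z" and b: "b = LT (p2 y) e" "c = LT (p2 z) e"
    obtain n k k1 k2 where k: "disjS k k1 k2" "wf_fm L' n (snd k)" "x = bsc n k" "y = bsc n k1" "z = bsc n k2" using k unfolding disjN_iff by blast
    have "formula_of L' (snd k)" using k(2) by (auto simp: formula_of_def)
    note henkin.cl_disj[OF k(1) this, of "list_decode e"]
    then show ?thesis by (rule bexI[rotated]) (simp add: pad3_def a b k(3-5) p2_bsc LT_dec NT_dec)
  next
    assume k: "exN x y" and b: "b = LT (p2 y) (lc (Suc (Suc (3 * prod_encode (p2 y, e)))) e)" and c: "c = a"
    obtain n k k1 where k: "exS k k1" "wf_fm L' n (snd k)" "x = bsc n k" "y = bsc (Suc n) k1" using k unfolding exN_iff by blast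
    have "formula_of L' (snd k)" using k(2) by (auto simp: formula_of_def)
    note henkin.cl_ex[OF k(1) this, of "list_decode e" witN]
    then show ?thesis by (rule bexI[rotated]) (simp add: pad3_def a b c k(3,4) p2_bsc LT_dec NT_dec witN_def)
  next
    fix d assume k: "allN x y" and b: "b = LT (p2 y) (lc d e)" and c: "c = a"
    obtain n k k1 where k: "allS k k1" "wf_fm L' n (snd k)" "x = bsc n k" "y = bsc (Suc n) k1" using k unfolding allN_iff by blast
    have "formula_of L' (snd k)" using k(2) by (auto simp: formula_of_def)
    note henkin.cl_all[OF k(1) this, of "list_decode e" d]
    then show ?thesis by (rule bexI[rotated]) (simp add: pad3_def a b c k(3,4) p2_bsc LT_dec NT_dec)
  qed
qed

lemma godel_Eq: "godel (Eq t u) = cat (cnat 0) (ctms [t, u])"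
  by (simp add: godel_simps)

lemma godel_Rel: "godel (Rel R ts) = cat (cnat 1) (cat (cnat R) (cat (cnat (length ts)) (ctms ts)))"
  by (simp add: godel_simps)

lemma VL_2: "VL 2 z e l \<longleftrightarrow> (\<exists>t u. wf_tm L' (length (list_decode e)) t \<and> wf_tm L' (length (list_decode e)) u \<and> z = ctms [t, u] \<and>
    l = list_encode [vN (list_decode e) t, vN (list_decode e) u])"
proof
  assume "VL 2 z e l"
  then obtain ts where ts: "length ts = 2" "list_all (wf_tm L' (length (list_decode e))) ts" "z = ctms ts"
    "l = list_encode (map (vN (list_decode e)) ts)" unfolding VL_def by blast
  then obtain t u where "ts = [t, u]" by (auto simp: numeral_2_eq_2 length_Suc_conv)
  then show "\<exists>t u. wf_tm L' (length (list_decode e)) t \<and> wf_tm L' (length (list_decode e)) u \<and> z = ctms [t, u] \<and>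
    l = list_encode [vN (list_decode e) t, vN (list_decode e) u]" using ts by auto
next
  assume "\<exists>t u. wf_tm L' (length (list_decode e)) t \<and> wf_tm L' (length (list_decode e)) u \<and> z = ctms [t, u] \<and>
    l = list_encode [vN (list_decode e) t, vN (list_decode e) u]"
  then obtain t u where "wf_tm L' (length (list_decode e)) t" "wf_tm L' (length (list_decode e)) u" "z = ctms [t, u]"
    "l = list_encode [vN (list_decode e) t, vN (list_decode e) u]" by blast
  then show "VL 2 z e l" unfolding VL_def by (intro exI[of _ "[t, u]"]) simp
qed

lemma eqlN_sound:
  assumes "eqlN w a b c"
  shows "\<exists>cl\<in>hclauses T. pad3 cl a b c"
proof -
  from assms show ?thesis unfolding eqlN_def
  proof (elim disjE exE conjE)
    fix z e l s assume s: "s \<le> (1::nat)" and V: "VL 2 z e l" and a: "a = 2 * prod_encode (cat (cnat 0) z, e) + Suc s mod 2"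
      and b: "b = 2 * prod_encode (godel q0, l) + s" and c: "c = a"
    obtain t u where t: "wf_tm L' (length (list_decode e)) t" "wf_tm L' (length (list_decode e)) u" "z = ctms [t, u]"
      "l = list_encode [vN (list_decode e) t, vN (list_decode e) u]" using V unfolding VL_2 by blast
    have s': "s = of_bool (s = 1)" "Suc s mod 2 = of_bool (\<not> s = 1)" using s by (cases s; simp)+
    have a': "a = lcode (nlit (s = 1, Eq t u) (list_decode e))" unfolding a s'(2) t(3) by (simp add: lcode_def godel_Eq)
    have b': "b = lcode (lit (s = 1, q0) [vN (list_decode e) t, vN (list_decode e) u])" unfolding b t(4)
      using s'(1) by (simp add: lcode_def)
    show ?thesis by (rule bexI[OF _ henkin.cl_eq[OF t(1,2)]]) (simp add: pad3_def a' b' c)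
  next
    fix d assume "a = Suc (eqL d d)" "b = a" "c = a"
    then show ?thesis by (intro bexI[OF _ henkin.cl_refl[of d]]) (simp add: pad3_def eqL)
  next
    fix d d' d'' assume "a = eqL d d'" "b = eqL d d''" "c = Suc (eqL d' d'')"
    then show ?thesis by (intro bexI[OF _ henkin.cl_eucl[of d d' d'']]) (simp add: pad3_def eqL)
  next
    fix d d' f x y assume a: "a = eqL d d'" and n: "Near d d' x y"
      and b: "b = Suc (eqL (Suc (3 * prod_encode (f, x))) (Suc (3 * prod_encode (f, y))))" and c: "c = a"
    have e: "Suc (3 * prod_encode (f, x)) = fncN f (list_decode x)" for x by (simp add: fncN_def)
    show ?thesis by (rule bexI[OF _ henkin.cl_fun[OF n[unfolded Near_def]]]) (simp add: pad3_def a b c eqL e)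
  next
    fix d d' R j z e l z' e' l' assume a: "a = eqL d d'" and R: "(R, j) \<in> rels L'" and V: "VL j z e l" "VL j z' e' l'"
      and n: "Near d d' l l'" and b: "b = 2 * prod_encode (cat (cnat 1) (cat (cnat R) (cat (cnat j) z)), e)"
        "c = Suc (2 * prod_encode (cat (cnat 1) (cat (cnat R) (cat (cnat j) z')), e'))"
    obtain ts where ts: "length ts = j" "list_all (wf_tm L' (length (list_decode e))) ts" "z = ctms ts"
      "l = list_encode (map (vN (list_decode e)) ts)" using V(1) unfolding VL_def by blast
    obtain ts' where ts': "length ts' = j" "list_all (wf_tm L' (length (list_decode e'))) ts'" "z' = ctms ts'"
      "l' = list_encode (map (vN (list_decode e')) ts')" using V(2) unfolding VL_def by blast
    have b': "b = lcode (nlit (True, Rel R ts) (list_decode e))" "c = lcode (lit (True, Rel R ts') (list_decode e'))"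
      unfolding b ts(3) ts'(3) using ts(1) ts'(1) by (simp_all add: lcode_def godel_Rel)
    have R': "(R, length ts) \<in> rels L'" using R ts(1) by simp
    have n': "near d d' (map (vN (list_decode e)) ts) (map (vN (list_decode e')) ts')"
      using n unfolding Near_def ts(4) ts'(4) list_encode_inverse .
    show ?thesis by (rule bexI[OF _ henkin.cl_rel[OF R' ts(2) ts'(2) n']]) (simp add: pad3_def a b' eqL)
  qed
qed

lemma lcode_unit: "lcode (lit k [parN 0]) = 2 * prod_encode (godel (snd k), lc 0 0) + of_bool (fst k)"
  by (simp add: lcode_def parN_def)

lemma ClN_sound:
  assumes "ClN w (godel \<sigma>) (of_bool s) (godel \<phi>) a b c"
  shows "\<exists>cl\<in>hclauses (tests \<sigma> s \<phi>). pad3 cl a b c"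
  using assms unfolding ClN_def
proof (elim disjE conjE)
  assume u: "unitN w (godel \<sigma>) (of_bool s) (godel \<phi>) a" and bc: "b = a" "c = a"
  have "\<exists>k e. (k, e) \<in> tests \<sigma> s \<phi> \<and> a = lcode (lit k e)"
    using u unfolding unitN_def
  proof (elim disjE exE conjE)
    fix u assume "AxP w u" and a: "a = 2 * prod_encode (u, 0) + 1"
    then obtain u' where "u' \<in> U" "u = godel u'" using AxP_iff by blast
    then show ?thesis by (intro exI[of _ "(True, u')"] exI[of _ "[]"]) (simp add: a tests_def lcode_def)
  next
    assume a: "a = 2 * prod_encode (godel \<sigma>, lc 0 0) + 1"
    show ?thesis by (rule exI[of _ "(True, \<sigma>)"], rule exI[of _ "[parN 0]"], subst lcode_unit) (simp add: a tests_def)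
  next
    assume a: "a = 2 * prod_encode (godel \<phi>, lc 0 0) + Suc (of_bool s) mod 2"
    show ?thesis by (rule exI[of _ "(\<not> s, \<phi>)"], rule exI[of _ "[parN 0]"], subst lcode_unit) (cases s; simp add: a tests_def)
  qed
  then obtain k e where k: "(k, e) \<in> tests \<sigma> s \<phi>" "a = lcode (lit k e)" by (elim exE conjE)
  show ?thesis by (rule bexI[OF _ henkin.cl_unit[OF k(1)]]) (simp add: pad3_def k(2) bc)
qed (use logicN_sound eqlN_sound in blast)+

lemma le_exI: "x \<le> w \<Longrightarrow> P x \<Longrightarrow> \<exists>x\<le>w. P x" for x w :: nat
  by blast

text \<open>For most clauses the sum of the codes involved is a sufficient \<open>w\<close>; for an
  axiom it is the maximum of its code and the stage at which it is enumerated.\<close>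

lemma ClN_complete:
  assumes "cl \<in> hclauses (tests \<sigma> s \<phi>)"
  shows "\<exists>w a b c. pad3 cl a b c \<and> ClN w (godel \<sigma>) (of_bool s) (godel \<phi>) a b c"
    (is "?Q cl")
proof (rule henkin.clauses.induct[OF assms])
  fix k and e :: "nat list"
  assume c1: "(k, e) \<in> tests \<sigma> s \<phi>"
  from c1 consider (u) u where "u \<in> U" "k = (True, u)" "e = []" | (\<sigma>) "k = (True, \<sigma>)" "e = [parN 0]" | (\<phi>) "k = (\<not> s, \<phi>)" "e = [parN 0]"
    unfolding tests_def by blast
  then have "\<exists>w. unitN w (godel \<sigma>) (of_bool s) (godel \<phi>) (lcode (lit k e))"
  proof cases
    case (u u)
    then obtain w where w: "AxP w (godel u)" using AxP_iff by blast
    have "AxP (max w (godel u)) (godel u)" using AxP_mono[OF w] by simp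
    then have "unitN (max w (godel u)) (godel \<sigma>) (of_bool s) (godel \<phi>) (lcode (lit k e))"
      unfolding unitN_def using u by (intro disjI1 exI[of _ "godel u"]) (simp add: lcode_def)
    then show ?thesis ..
  next
    case \<sigma>
    then show ?thesis unfolding unitN_def by (simp only: lcode_unit) simp
  next
    case \<phi>
    have "of_bool (\<not> s) = Suc (of_bool s) mod 2" by (cases s) simp_all
    then show ?thesis using \<phi> unfolding unitN_def by (simp only: lcode_unit) simp
  qed
  then show "?Q [lit k e]" unfolding ClN_def pad3_def by auto
next
  fix k k1 k2 and e :: "nat list"
  assume c2: "conjS k k1 k2" "formula_of L' (snd k)"
  from c2(2) obtain n where n: "wf_fm L' n (snd k)" by (auto simp: formula_of_def)
  let ?e = "list_encode e" and ?x = "bsc n k" and ?y = "bsc n k1" and ?z = "bsc n k2"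
  have F: "conjN ?x ?y ?z" unfolding conjN_iff using c2(1) n by blast
  have "logicN (?x + ?y + ?z + ?e) (NT (p2 ?x) ?e) (LT (p2 ?y) ?e) (NT (p2 ?x) ?e)" unfolding logicN_def
    by (rule le_exI[of ?x], simp, rule le_exI[of ?y], simp, rule le_exI[of ?e], simp, rule conjI[OF refl], rule disjI1, rule le_exI[of ?z]) (simp_all add: F)
  then show "?Q [nlit k e, lit k1 e]" unfolding p2_bsc LT_lit NT_nlit ClN_def pad3_def by auto
next
  fix k k1 k2 and e :: "nat list"
  assume c3: "conjS k k1 k2" "formula_of L' (snd k)"
  from c3(2) obtain n where n: "wf_fm L' n (snd k)" by (auto simp: formula_of_def)
  let ?e = "list_encode e" and ?x = "bsc n k" and ?y = "bsc n k1" and ?z = "bsc n k2"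
  have F: "conjN ?x ?y ?z" unfolding conjN_iff using c3(1) n by blast
  have "logicN (?x + ?y + ?z + ?e) (NT (p2 ?x) ?e) (LT (p2 ?z) ?e) (NT (p2 ?x) ?e)" unfolding logicN_def
    by (rule le_exI[of ?x], simp, rule le_exI[of ?y], simp, rule le_exI[of ?e], simp, rule conjI[OF refl], rule disjI1, rule le_exI[of ?z]) (simp_all add: F)
  then show "?Q [nlit k e, lit k2 e]" unfolding p2_bsc LT_lit NT_nlit ClN_def pad3_def by auto
next
  fix k k1 k2 and e :: "nat list"
  assume c4: "disjS k k1 k2" "formula_of L' (snd k)"
  from c4(2) obtain n where n: "wf_fm L' n (snd k)" by (auto simp: formula_of_def)
  let ?e = "list_encode e" and ?x = "bsc n k" and ?y = "bsc n k1" and ?z = "bsc n k2"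
  have F: "disjN ?x ?y ?z" unfolding disjN_iff using c4(1) n by blast
  have "logicN (?x + ?y + ?z + ?e) (NT (p2 ?x) ?e) (LT (p2 ?y) ?e) (LT (p2 ?z) ?e)" unfolding logicN_def
    by (rule le_exI[of ?x], simp, rule le_exI[of ?y], simp, rule le_exI[of ?e], simp, rule conjI[OF refl], rule disjI2, rule disjI1, rule le_exI[of ?z]) (simp_all add: F)
  then show "?Q [nlit k e, lit k1 e, lit k2 e]" unfolding p2_bsc LT_lit NT_nlit ClN_def pad3_def by auto
next
  fix k k1 and e :: "nat list"
  assume c5: "exS k k1" "formula_of L' (snd k)"
  from c5(2) obtain n where n: "wf_fm L' n (snd k)" by (auto simp: formula_of_def)
  let ?e = "list_encode e" and ?x = "bsc n k" and ?y = "bsc (Suc n) k1"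
  have F: "exN ?x ?y" unfolding exN_iff using c5(1) n by blast
  have "logicN (?x + ?y + ?e) (NT (p2 ?x) ?e) (LT (p2 ?y) (list_encode (witN k1 e # e))) (NT (p2 ?x) ?e)" unfolding logicN_def
    by (rule le_exI[of ?x], simp, rule le_exI[of ?y], simp, rule le_exI[of ?e], simp, rule conjI[OF refl]) (simp add: witN_def p2_bsc F)
  then show "?Q [nlit k e, lit k1 (witN k1 e # e)]" unfolding p2_bsc LT_lit NT_nlit ClN_def pad3_def by auto
next
  fix k k1 d and e :: "nat list"
  assume c6: "allS k k1" "formula_of L' (snd k)"
  from c6(2) obtain n where n: "wf_fm L' n (snd k)" by (auto simp: formula_of_def)
  let ?e = "list_encode e" and ?x = "bsc n k" and ?y = "bsc (Suc n) k1"
  have F: "allN ?x ?y" unfolding allN_iff using c6(1) n by blast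
  have "logicN (?x + ?y + ?e + d) (NT (p2 ?x) ?e) (LT (p2 ?y) (list_encode (d # e))) (NT (p2 ?x) ?e)" unfolding logicN_def
    by (rule le_exI[of ?x], simp, rule le_exI[of ?y], simp, rule le_exI[of ?e], simp, rule conjI[OF refl], rule disjI2, rule disjI2, rule disjI2, rule le_exI[of d]) (simp_all add: F)
  then show "?Q [nlit k e, lit k1 (d # e)]" unfolding p2_bsc LT_lit NT_nlit ClN_def pad3_def by auto
next
  fix t u s' and e :: "nat list"
  assume c7: "wf_tm L' (length e) t" "wf_tm L' (length e) u"
  let ?z = "ctms [t, u]" and ?e = "list_encode e" and ?l = "list_encode [vN e t, vN e u]" and ?s = "of_bool s' :: nat"
  have V: "VL 2 ?z ?e ?l" unfolding VL_2 list_encode_inverse using c7 by blast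
  have s: "Suc ?s mod 2 = of_bool (\<not> s')" "?s \<le> 1" by (cases s'; simp)+
  have "eqlN (?z + ?e + ?l) (lcode (nlit (s', Eq t u) e)) (lcode (lit (s', q0) [vN e t, vN e u])) (lcode (nlit (s', Eq t u) e))"
    unfolding eqlN_def
    by (rule disjI1, rule le_exI[of ?z], simp, rule le_exI[of ?e], simp, rule le_exI[of ?l], simp,
      rule le_exI[OF s(2)], rule conjI[OF V]) (simp_all add: lcode_def godel_Eq s(1))
  then show "?Q [nlit (s', Eq t u) e, lit (s', q0) [vN e t, vN e u]]" unfolding ClN_def pad3_def by auto
next
  fix d
  have "eqlN d (Suc (eqL d d)) (Suc (eqL d d)) (Suc (eqL d d))"
    unfolding eqlN_def by (rule disjI2, rule disjI1, rule le_exI[of d]) simp_all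
  then show "?Q [lit (True, q0) [d, d]]" unfolding ClN_def pad3_def by (auto simp: eqL)
next
  fix d d' d''
  have "eqlN (d + d' + d'') (eqL d d') (eqL d d'') (Suc (eqL d' d''))"
    unfolding eqlN_def
    by (rule disjI2, rule disjI2, rule le_exI[of d], simp, rule le_exI[of d'], simp, rule conjI[OF refl], rule disjI1, rule le_exI[of d'']) simp_all
  then show "?Q [nlit (True, q0) [d, d'], nlit (True, q0) [d, d''], lit (True, q0) [d', d'']]" unfolding ClN_def pad3_def by (auto simp: eqL)
next
  fix d d' cs ds and f :: nat
  assume c10: "near d d' cs (ds :: nat list)"
  let ?x = "list_encode cs" and ?y = "list_encode ds"
  have F: "Near d d' ?x ?y" using c10 by (simp add: Near_def)
  have "eqlN (d + d' + f + ?x + ?y) (eqL d d') (Suc (eqL (fncN f cs) (fncN f ds))) (eqL d d')"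
    unfolding eqlN_def fncN_def
    by (rule disjI2, rule disjI2, rule le_exI[of d], simp, rule le_exI[of d'], simp, rule conjI[OF refl], rule disjI2, rule disjI1,
      rule le_exI[of f], simp, rule le_exI[of ?x], simp, rule le_exI[of ?y], (simp_all add: F))
  then show "?Q [nlit (True, q0) [d, d'], lit (True, q0) [fncN f cs, fncN f ds]]" unfolding ClN_def pad3_def by (auto simp: eqL)
next
  fix R ts ts' d d' and e e' :: "nat list"
  assume c11: "(R, length ts) \<in> rels L'" "list_all (wf_tm L' (length e)) ts" "list_all (wf_tm L' (length e')) ts'" "near d d' (map (vN e) ts) (map (vN e') ts')"
  have len: "length ts' = length ts" using near_length[OF c11(4)] by simp
  let ?j = "length ts" and ?z = "ctms ts" and ?e = "list_encode e" and ?l = "list_encode (map (vN e) ts)"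
  let ?z' = "ctms ts'" and ?e' = "list_encode e'" and ?l' = "list_encode (map (vN e') ts')"
  have V: "VL ?j ?z ?e ?l" "VL ?j ?z' ?e' ?l'" unfolding VL_def list_encode_inverse using c11(2,3) len by blast+
  have n: "Near d d' ?l ?l'" unfolding Near_def list_encode_inverse by (rule c11(4))
  have "eqlN (d + d' + R + ?j + ?z + ?e + ?l + ?z' + ?e' + ?l') (eqL d d') (lcode (nlit (True, Rel R ts) e)) (lcode (lit (True, Rel R ts') e'))"
    unfolding eqlN_def
    by (rule disjI2, rule disjI2, rule le_exI[of d], simp, rule le_exI[of d'], simp, rule conjI[OF refl], rule disjI2, rule disjI2,
      rule le_exI[of R], simp, rule le_exI[of ?j], simp, rule le_exI[of ?z], simp, rule le_exI[of ?e], simp,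
      rule le_exI[of ?l], simp, rule le_exI[of ?z'], simp, rule le_exI[of ?e'], simp, rule le_exI[of ?l'], simp, intro conjI V n c11(1))
      (simp_all add: lcode_def godel_Rel len)
  then show "?Q [nlit (True, q0) [d, d'], nlit (True, Rel R ts) e, lit (True, Rel R ts') e']" unfolding ClN_def pad3_def by (auto simp: eqL)
qed

text \<open>Propositional unsatisfiability of a finite set of Henkin clauses takes the place of a formalised
  proof predicate: \<open>w\<close> bounds a refutation of \<open>U\<close>, \<open>x\<close> and the formula \<open>g\<close> with sign opposite to \<open>s\<close>.\<close>

definition Rn :: "nat \<Rightarrow> nat \<Rightarrow> nat \<Rightarrow> nat \<Rightarrow> bool" where
  "Rn w x s g \<longleftrightarrow> \<not> (\<exists>X. \<forall>a\<le>w. \<forall>b\<le>w. \<forall>c\<le>w. ClN w x s g a b c \<longrightarrow>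
    holds_in a X \<or> holds_in b X \<or> holds_in c X)"

lemma rep_Rn:
  assumes "repf w" "repf x" "repf s" "repf g"
  shows "rep (\<lambda>n. Rn (w n) (x n) (s n) (g n))"
proof -
  let ?C = "\<lambda>m. ClN (p1 m) (p1 (p2 m)) (p1 (p2 (p2 m))) (p2 (p2 (p2 m)))"
  have "rep (\<lambda>n. \<exists>X. \<forall>a\<le>p1 (n 0). \<forall>b\<le>p1 (n 0). \<forall>c\<le>p1 (n 0). ?C (n 0) a b c \<longrightarrow>
      holds_in a X \<or> holds_in b X \<or> holds_in c X)"
    by (rule rep_clauses[where w = p1 and C = ?C]) (intro rep_ClN rep_intros2)+
  from rep_comp[where P = "\<lambda>m. \<exists>X. \<forall>a\<le>p1 m. \<forall>b\<le>p1 m. \<forall>c\<le>p1 m. ?C m a b c \<longrightarrow>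
      holds_in a X \<or> holds_in b X \<or> holds_in c X" and f = "\<lambda>n. t4 (w n) (x n) (s n) (g n)", OF this]
  have "rep (\<lambda>n. \<exists>X. \<forall>a\<le>w n. \<forall>b\<le>w n. \<forall>c\<le>w n. ClN (w n) (x n) (s n) (g n) a b c \<longrightarrow>
      holds_in a X \<or> holds_in b X \<or> holds_in c X)"
    using assms by (simp add: repf_prod)
  then show ?thesis unfolding Rn_def by (rule rep_not)
qed

lemma Rn_mono:
  assumes "Rn w x s g" "w \<le> w'"
  shows "Rn w' x s g"
proof -
  have *: "\<forall>a\<le>w. \<forall>b\<le>w. \<forall>c\<le>w. ClN w x s g a b c \<longrightarrow> holds_in a X \<or> holds_in b X \<or> holds_in c X"
    if X: "\<forall>a\<le>w'. \<forall>b\<le>w'. \<forall>c\<le>w'. ClN w' x s g a b c \<longrightarrow> holds_in a X \<or> holds_in b X \<or> holds_in c X" for X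
  proof (intro allI impI)
    fix a b c assume "a \<le> w" "b \<le> w" "c \<le> w" "ClN w x s g a b c"
    then show "holds_in a X \<or> holds_in b X \<or> holds_in c X"
      using X[rule_format, of a b c] assms(2) ClN_mono[OF _ assms(2)] by simp
  qed
  then show ?thesis using assms(1) unfolding Rn_def by (elim contrapos_nn exE) (rule exI, erule *)
qed

text \<open>Each finite set of clauses is contained in some stage and the stages increase, so
  satisfiability of all stages gives satisfiability of the whole set by propositional compactness.
  Conversely one valuation of the whole set serves every stage.\<close>

lemma Rn_iff:
  "(\<exists>w. Rn w (godel \<sigma>) (of_bool s) (godel \<phi>)) \<longleftrightarrow> \<not> (\<exists>X. \<forall>cl\<in>hclauses (tests \<sigma> s \<phi>). csat X cl)"
proof -
  let ?C = "\<lambda>w. ClN w (godel \<sigma>) (of_bool s) (godel \<phi>)"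
  have 1: "\<exists>X. \<forall>a\<le>w. \<forall>b\<le>w. \<forall>c\<le>w. ?C w a b c \<longrightarrow> holds_in a X \<or> holds_in b X \<or> holds_in c X"
    if X: "\<forall>cl\<in>hclauses (tests \<sigma> s \<phi>). csat X cl" for X w
  proof (intro exI allI impI)
    fix a b c assume "?C w a b c"
    then obtain cl where cl: "cl \<in> hclauses (tests \<sigma> s \<phi>)" "pad3 cl a b c" using ClN_sound by blast
    have "(\<phi>', e) \<in> X \<longleftrightarrow> prod_encode (godel \<phi>', list_encode e) \<in> (\<lambda>(\<phi>, e). prod_encode (godel \<phi>, list_encode e)) ` X" for \<phi>' e
      by (auto simp: godel_inj intro: rev_image_eqI) (metis list_encode_inverse)
    from pad3_holds[OF cl(2) this] X cl(1)
    show "holds_in a ((\<lambda>(\<phi>, e). prod_encode (godel \<phi>, list_encode e)) ` X) \<or>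
      holds_in b ((\<lambda>(\<phi>, e). prod_encode (godel \<phi>, list_encode e)) ` X) \<or>
      holds_in c ((\<lambda>(\<phi>, e). prod_encode (godel \<phi>, list_encode e)) ` X)" by blast
  qed
  have 2: "\<exists>X. \<forall>cl\<in>hclauses (tests \<sigma> s \<phi>). csat X cl"
    if W: "\<forall>w. \<exists>X. \<forall>a\<le>w. \<forall>b\<le>w. \<forall>c\<le>w. ?C w a b c \<longrightarrow> holds_in a X \<or> holds_in b X \<or> holds_in c X"
  proof (rule prop_compactness, unfold finsat_def, intro allI impI)
    fix F assume F: "finite F" "F \<subseteq> hclauses (tests \<sigma> s \<phi>)"
    \<comment> \<open>The literals are required to lie below \<open>w\<close> as well, since
      \<open>Rn\<close> looks at triples below \<open>w\<close> only.\<close>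
    define G where "G w cl \<longleftrightarrow> (\<exists>a\<le>w. \<exists>b\<le>w. \<exists>c\<le>w. pad3 cl a b c \<and> ?C w a b c)" for w cl
    have G: "\<exists>w1. \<forall>w\<ge>w1. G w cl" if "cl \<in> F" for cl
    proof -
      from ClN_complete[OF subsetD[OF F(2) that]]
      obtain w1 a b c where p: "pad3 cl a b c" "?C w1 a b c" by (elim exE conjE)
      have "G w cl" if "w \<ge> w1 + a + b + c" for w
      proof -
        have le: "w1 \<le> w" "a \<le> w" "b \<le> w" "c \<le> w" using that by simp_all
        show ?thesis unfolding G_def
          by (rule le_exI[OF le(2)], rule le_exI[OF le(3)], rule le_exI[OF le(4)], rule conjI[OF p(1) ClN_mono[OF p(2) le(1)]])
      qed
      then show ?thesis by blast
    qed
    have "\<exists>w. \<forall>cl\<in>F. G w cl"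
    proof -
      obtain f where f: "\<And>cl w. cl \<in> F \<Longrightarrow> w \<ge> f cl \<Longrightarrow> G w cl" using G by metis
      have "G (Max (f ` F)) cl" if "cl \<in> F" for cl using f[OF that] F(1) that by simp
      then show ?thesis by blast
    qed
    then obtain w where w: "\<forall>cl\<in>F. \<exists>a\<le>w. \<exists>b\<le>w. \<exists>c\<le>w. pad3 cl a b c \<and> ?C w a b c" unfolding G_def ..
    obtain X where X: "\<forall>a\<le>w. \<forall>b\<le>w. \<forall>c\<le>w. ?C w a b c \<longrightarrow> holds_in a X \<or> holds_in b X \<or> holds_in c X" using W[rule_format, of w] ..
    define X' where "X' = {(\<phi>, e :: nat list). prod_encode (godel \<phi>, list_encode e) \<in> X}"
    have X': "(\<phi>, e) \<in> X' \<longleftrightarrow> prod_encode (godel \<phi>, list_encode e) \<in> X" for \<phi> e by (simp add: X'_def)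
    have "csat X' cl" if cl: "cl \<in> F" for cl
    proof -
      from bspec[OF w cl]
      obtain a b c where abc: "a \<le> w" "b \<le> w" "c \<le> w" "pad3 cl a b c" "?C w a b c" by (elim exE conjE)
      have "holds_in a X \<or> holds_in b X \<or> holds_in c X" by (rule X[rule_format, OF abc(1-3,5)])
      then show ?thesis by (simp only: pad3_holds[OF abc(4) X'])
    qed
    then show "\<exists>X. \<forall>c\<in>F. csat X c" by blast
  qed
  have "(\<forall>w. \<exists>X. \<forall>a\<le>w. \<forall>b\<le>w. \<forall>c\<le>w. ?C w a b c \<longrightarrow> holds_in a X \<or> holds_in b X \<or> holds_in c X) \<longleftrightarrow>
      (\<exists>X. \<forall>cl\<in>hclauses (tests \<sigma> s \<phi>). csat X cl)"
    by (rule iffI, erule 2, rule allI, erule exE, erule 1)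
  then show ?thesis unfolding Rn_def not_all[symmetric] by (rule arg_cong)
qed

text \<open>A refutation at a standard stage is a genuine one and excludes counterexamples over any
  carrier type; in the end it is applied to \<open>tot M\<close>.\<close>

lemma Rn_sound:
  fixes K :: "(nat, nat, 'n) struct"
  assumes R: "Rn w (godel \<sigma>) (of_bool s) (godel \<phi>)" and K: "total K" and a: "a \<in> dom K"
    and U: "\<And>u. u \<in> U \<Longrightarrow> sat K (\<lambda>_. a) u" and \<sigma>: "sat K (\<lambda>_. a) \<sigma>"
  shows "sat K (\<lambda>_. a) \<phi> = s"
proof (rule ccontr)
  assume n: "sat K (\<lambda>_. a) \<phi> \<noteq> s"
  have "\<exists>X. \<forall>cl\<in>hclauses (tests \<sigma> s \<phi>). csat X cl"
  proof (rule henkin.clauses_satisfiable[where N = K and hp = "\<lambda>_. a" and ?a0.0 = a and par = parN])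
    fix D and hp :: "nat \<Rightarrow> 'n" and hf :: "nat \<Rightarrow> 'n list \<Rightarrow> 'n" and hw :: "sfm \<Rightarrow> 'n list \<Rightarrow> 'n" assume "range hp \<subseteq> D" "\<And>(f :: nat) xs. hf f xs \<in> D" "\<And>k xs. hw k xs \<in> D"
    then show "\<exists>I. range I \<subseteq> D \<and> (\<forall>p. I (parN p) = hp p) \<and> (\<forall>f cs. I (fncN f cs) = hf f (map I cs)) \<and>
      (\<forall>k cs. I (witN k cs) = hw k (map I cs))" by (rule free_nat)
  next
    fix k e assume "(k, e) \<in> tests \<sigma> s \<phi>"
    then have k: "(e = [] \<or> e = [parN 0]) \<and> ssat K (\<lambda>_. a) k"
      unfolding tests_def using U \<sigma> n by (auto simp: ssat_def)
    have x: "ext (map (\<lambda>_. a) ps) (\<lambda>_. a) = (\<lambda>_. a)" for ps :: "nat list" by (rule ext) (simp add: ext_def)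
    have "e = map parN (map (\<lambda>_. 0) e)" using k by auto
    then show "\<exists>ps. e = map parN ps \<and> ssat K (ext (map (\<lambda>_. a) ps) (\<lambda>_. a)) k" unfolding x by (intro exI[of _ "map (\<lambda>_. 0) e"] conjI) (assumption, rule conjunct2[OF k])
  qed (use K a in auto)
  then show False using R Rn_iff by blast
qed

text \<open>If no stage refuted the set, the clauses would be satisfiable and their term model would
  have numbers as elements. A hypothesis about structures on \<open>nat\<close> is therefore
  enough.\<close>

lemma Rn_complete:
  assumes wf: "theory_in L' U" "wf_fm L' 1 \<sigma>" "wf_fm L' 1 \<phi>"
    and A: "\<And>(K :: (nat, nat, nat) struct) v. total K \<Longrightarrow> model L' U K \<Longrightarrow> range v \<subseteq> dom K \<Longrightarrow> sat K v \<sigma> \<Longrightarrow> sat K v \<phi> = s"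
  shows "\<exists>w. Rn w (godel \<sigma>) (of_bool s) (godel \<phi>)"
  unfolding Rn_iff
proof
  assume "\<exists>X. \<forall>cl\<in>hclauses (tests \<sigma> s \<phi>). csat X cl"
  then obtain X where "\<forall>cl\<in>hclauses (tests \<sigma> s \<phi>). csat X cl" ..
  from henkin.model_existence[OF this] obtain K :: "(nat, nat, nat) struct" and \<rho> where K: "total K" "range \<rho> = dom K"
    and T: "\<forall>(k, e)\<in>tests \<sigma> s \<phi>. \<forall>v. wf_fm L' (length e) (snd k) \<longrightarrow> range v \<subseteq> dom K \<longrightarrow>
      (\<forall>i<length e. v i = \<rho> (e ! i)) \<longrightarrow> ssat K v k" by (elim exE conjE)
  have T: "ssat K v k" if "(k, e) \<in> tests \<sigma> s \<phi>" "wf_fm L' (length e) (snd k)" "range v \<subseteq> dom K" "\<forall>i<length e. v i = \<rho> (e ! i)" for k e v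
    using bspec[OF T that(1)] that(2-4) by simp
  have "sat K v u" if u: "u \<in> U" and v: "range v \<subseteq> dom K" for u v
  proof -
    have "((True, u), []) \<in> tests \<sigma> s \<phi>" "wf_fm L' 0 u" using u wf(1) by (simp_all add: tests_def theory_in_def)
    then show ?thesis using T[of "(True, u)" "[]" v] v by (simp add: ssat_def)
  qed
  then have m: "model L' U K" using K(1) unfolding model_def total_def structure_for_def by auto
  let ?v = "\<lambda>_. \<rho> (parN 0)"
  have v: "range ?v \<subseteq> dom K" using K(2) by auto
  have "((True, \<sigma>), [parN 0]) \<in> tests \<sigma> s \<phi>" "((\<not> s, \<phi>), [parN 0]) \<in> tests \<sigma> s \<phi>" by (simp_all add: tests_def)
  note t = this
  have "ssat K ?v (True, \<sigma>)" by (rule T[OF t(1) _ v]) (use wf(2) in simp_all)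
  moreover have "ssat K ?v (\<not> s, \<phi>)" by (rule T[OF t(2) _ v]) (use wf(3) in simp_all)
  ultimately show False using A[OF K(1) m v] by (auto simp: ssat_def)
qed

end

section \<open>Compactness over an infinite structure\<close>

text \<open>Formal names of Henkin constants over arbitrary parameters, to be embedded into the
  carrier type.\<close>

datatype 'p cterm = Par 'p | FnC nat "'p cterm list" | WitC nat "'p cterm list"

primrec list_code :: "('a \<times> 'a \<Rightarrow> 'a) \<Rightarrow> (nat \<Rightarrow> 'a) \<Rightarrow> 'a list \<Rightarrow> 'a" where
  "list_code j c [] = j (c 0, c 0)"
| "list_code j c (x # xs) = j (c 1, j (x, list_code j c xs))"

primrec cterm_code :: "('a \<times> 'a \<Rightarrow> 'a) \<Rightarrow> (nat \<Rightarrow> 'a) \<Rightarrow> 'a cterm \<Rightarrow> 'a" where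
  "cterm_code j c (Par a) = j (c 0, a)"
| "cterm_code j c (FnC f ts) = j (c 1, j (c f, list_code j c (map (cterm_code j c) ts)))"
| "cterm_code j c (WitC f ts) = j (c 2, j (c f, list_code j c (map (cterm_code j c) ts)))"

primrec cterm_val :: "('p \<Rightarrow> 'n) \<Rightarrow> (nat \<Rightarrow> 'n list \<Rightarrow> 'n) \<Rightarrow> (nat \<Rightarrow> 'n list \<Rightarrow> 'n) \<Rightarrow> 'p cterm \<Rightarrow> 'n" where
  "cterm_val hp hf hw (Par a) = hp a"
| "cterm_val hp hf hw (FnC f ts) = hf f (map (cterm_val hp hf hw) ts)"
| "cterm_val hp hf hw (WitC f ts) = hw f (map (cterm_val hp hf hw) ts)"

lemma list_code_inj:
  assumes "inj j" "inj c"
  shows "list_code j c xs = list_code j c ys \<longleftrightarrow> xs = ys"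
proof (induct xs arbitrary: ys)
  case Nil
  then show ?case using assms by (cases ys) (auto simp: inj_eq)
next
  case (Cons x xs)
  then show ?case using assms by (cases ys) (auto simp: inj_eq)
qed

lemma cterm_code_inj:
  assumes "inj j" "inj c"
  shows "inj (cterm_code j c)"
proof (rule injI)
  fix t u show "cterm_code j c t = cterm_code j c u \<Longrightarrow> t = u"
  proof (induct t arbitrary: u)
    case (Par a)
    then show ?case using assms by (cases u) (auto simp: inj_eq)
  next
    case (FnC f ts)
    then show ?case using assms
      by (cases u) (auto simp: inj_eq list_code_inj simp del: map_eq_conv intro: list.inj_map_strong[of ts _ "cterm_code j c" "cterm_code j c"])
  next
    case (WitC f ts)
    then show ?case using assms
      by (cases u) (auto simp: inj_eq list_code_inj simp del: map_eq_conv intro: list.inj_map_strong[of ts _ "cterm_code j c" "cterm_code j c"])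
  qed
qed

text \<open>An infinite type has an injective pairing, so the terms over it can be coded in it. The
  term model then has its carrier in that same type, about which the elementarity hypothesis
  speaks.\<close>

lemma free_infinite:
  assumes "infinite (UNIV :: 'a set)"
  shows "\<exists>(par :: 'a \<Rightarrow> 'a) (fnc :: nat \<Rightarrow> 'a list \<Rightarrow> 'a) (wit :: sfm \<Rightarrow> 'a list \<Rightarrow> 'a).
    \<forall>D (hp :: 'a \<Rightarrow> 'n) hf hw. range hp \<subseteq> D \<longrightarrow> (\<forall>f xs. hf f xs \<in> D) \<longrightarrow> (\<forall>k xs. hw k xs \<in> D) \<longrightarrow>
      (\<exists>I. range I \<subseteq> D \<and> (\<forall>p. I (par p) = hp p) \<and> (\<forall>f cs. I (fnc f cs) = hf f (map I cs)) \<and>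
        (\<forall>k cs. I (wit k cs) = hw k (map I cs)))"
proof -
  \<comment> \<open>An infinite set is equipotent with its square.\<close>
  obtain j :: "'a \<times> 'a \<Rightarrow> 'a" where j: "inj j"
    using card_of_Times_same_infinite[OF assms] unfolding card_of_ordIso[symmetric] bij_betw_def by auto
  obtain c :: "nat \<Rightarrow> 'a" where c: "inj c" using infinite_countable_subset[OF assms] by blast
  define cd where "cd = cterm_code j c"
  have cd: "inv cd (cd t) = t" for t unfolding cd_def by (rule inv_f_f[OF cterm_code_inj[OF j c]])
  show ?thesis
  proof (intro exI[of _ "\<lambda>a. cd (Par a)"] exI[of _ "\<lambda>f cs. cd (FnC f (map (inv cd) cs))"]
      exI[of _ "\<lambda>k cs. cd (WitC (sc k) (map (inv cd) cs))"] allI impI)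
    fix D and hp :: "'a \<Rightarrow> 'n" and hf and hw :: "sfm \<Rightarrow> 'n list \<Rightarrow> 'n"
    assume D: "range hp \<subseteq> D" "\<forall>(f :: nat) (xs :: 'n list). hf f xs \<in> D" "\<forall>k xs. hw k xs \<in> D"
    define V where "V = cterm_val hp hf (\<lambda>k. hw (inv sc k))"
    have V: "V t \<in> D" for t unfolding V_def using D by (induct t) (auto simp del: split_paired_All)
    show "\<exists>I. range I \<subseteq> D \<and> (\<forall>p. I (cd (Par p)) = hp p) \<and> (\<forall>f cs. I (cd (FnC f (map (inv cd) cs))) = hf f (map I cs)) \<and>
        (\<forall>k cs. I (cd (WitC (sc k) (map (inv cd) cs))) = hw k (map I cs))"
    proof (intro exI[of _ "\<lambda>x. V (inv cd x)"] conjI allI)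
      show "range (\<lambda>x. V (inv cd x)) \<subseteq> D" using V by auto
    qed (simp_all add: cd V_def comp_def inv_f_f[OF inj_sc])
  qed
qed

section \<open>Closure properties of the hierarchy and the diagram of \<open>M\<close>\<close>

lemma Sigma_star_Suc: "Sigma_star n \<phi> \<Longrightarrow> Sigma_star (Suc n) \<phi>" "Pi_star n \<phi> \<Longrightarrow> Pi_star (Suc n) \<phi>"
  by (induct rule: Sigma_star_Pi_star.inducts) (auto intro: Sigma_star_Pi_star.intros)

lemma Sigma_star_subst: "Sigma_star n \<phi> \<Longrightarrow> Sigma_star n (subst \<sigma> \<phi>)" "Pi_star n \<phi> \<Longrightarrow> Pi_star n (subst \<sigma> \<phi>)"
  by (induct arbitrary: \<sigma> and \<sigma> rule: Sigma_star_Pi_star.inducts) (auto intro: Sigma_star_Pi_star.intros)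

lemma Sigma_star_exs: "Sigma_star (Suc n) \<phi> \<Longrightarrow> Sigma_star (Suc n) (exs k \<phi>)"
  unfolding exs_def by (induct k) (auto intro: Sigma_star_Pi_star.intros)

text \<open>\<open>conjs\<close> ends in a universal formula, which is not \<open>\<Sigma>\<close>
  at level 1. An equation as empty conjunction keeps the level, at the price of one free
  variable.\<close>

definition conj_list :: "('f, 'r) fm list \<Rightarrow> ('f, 'r) fm" where
  "conj_list \<psi>s = foldr And \<psi>s (Eq (Var 0) (Var 0))"

lemma sat_conj_list: "sat K v (conj_list \<psi>s) \<longleftrightarrow> (\<forall>\<psi>\<in>set \<psi>s. sat K v \<psi>)"
  by (induct \<psi>s) (simp_all add: conj_list_def)

lemma wf_conj_list: "0 < k \<Longrightarrow> wf_fm L k (conj_list \<psi>s) \<longleftrightarrow> (\<forall>\<psi>\<in>set \<psi>s. wf_fm L k \<psi>)"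
  by (induct \<psi>s) (simp_all add: conj_list_def)

lemma Sigma_star_conj_list: "\<forall>\<psi>\<in>set \<psi>s. Sigma_star (Suc n) \<psi> \<Longrightarrow> Sigma_star (Suc n) (conj_list \<psi>s)"
  by (induct \<psi>s) (auto simp: conj_list_def intro: Sigma_star_Pi_star.intros)

text \<open>A finite part of the \<open>\<Sigma>\<^sup>*\<close> diagram as one formula about \<open>a\<close>.\<close>

lemma merge_diagram:
  fixes M :: "(nat, nat, 'a) struct"
  assumes F: "finite F" "\<forall>(\<sigma>, es)\<in>F. wf_fm L (length es) \<sigma> \<and> Sigma_star (Suc n) \<sigma> \<and> set es \<subseteq> dom M \<and> sat M (ext es (\<lambda>_. a)) \<sigma>"
    and a: "a \<in> dom M"
  shows "\<exists>\<tau>. wf_fm L 1 \<tau> \<and> Sigma_star (Suc n) \<tau> \<and> sat M (\<lambda>_. a) \<tau> \<and>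
    (\<forall>(K :: (nat, nat, 'n) struct) v. range v \<subseteq> dom K \<longrightarrow> sat K v \<tau> \<longrightarrow>
      (\<exists>hp. range hp \<subseteq> dom K \<and> hp a = v 0 \<and> (\<forall>(\<sigma>, es)\<in>F. sat K (ext (map hp es) (\<lambda>_. v 0)) \<sigma>)))"
proof -
  have "finite ((\<Union>(\<sigma>, es)\<in>F. set es) - {a})" using F(1) by auto
  from finite_distinct_list[OF this]
  obtain cs where cs: "set cs = (\<Union>(\<sigma>, es)\<in>F. set es) - {a}" "distinct cs" by (elim exE conjE)
  \<comment> \<open>\<open>a\<close> is put last, so that it becomes variable 0 once
    \<open>exs\<close> has bound the other parameters.\<close>
  let ?bs = "cs @ [a]" and ?m = "Suc (length cs)"
  have bs: "distinct ?bs" using cs by auto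
  have "\<exists>i<?m. ?bs ! i = b" if "b = a \<or> b \<in> set cs" for b
    using that in_set_conv_nth[of b ?bs] by auto
  then obtain idx where idx: "\<And>b. b = a \<or> b \<in> set cs \<Longrightarrow> idx b < ?m \<and> ?bs ! idx b = b" by metis
  have ies: "idx b < ?m \<and> ?bs ! idx b = b" if "(\<sigma>, es) \<in> F" "b \<in> set es" for \<sigma> es b
    using idx[of b] that cs(1) by blast
  have ia: "idx a = length cs"
    using idx[of a] bs nth_eq_iff_index_eq[OF bs, of "idx a" "length cs"] by simp
  define rn where "rn = (\<lambda>(\<sigma>, es). subst (\<lambda>j. Var (if j < length es then idx (es ! j) else 0)) \<sigma> :: (nat, nat) fm)"
  obtain Fs where Fs: "set Fs = F" using finite_list[OF F(1)] by blast
  have rn: "Sigma_star (Suc n) (rn p) \<and> wf_fm L ?m (rn p)" if "p \<in> F" for p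
  proof -
    obtain \<sigma> es where p: "p = (\<sigma>, es)" by (cases p)
    have "wf_fm L (length es) \<sigma>" "Sigma_star (Suc n) \<sigma>" using F(2) that p by auto
    then show ?thesis using ies[OF that[unfolded p] nth_mem] unfolding p rn_def prod.case
      by (intro conjI Sigma_star_subst wf_fm_subst[of L "length es"]) auto
  qed
  have rs: "sat K v (rn (\<sigma>, es)) \<longleftrightarrow> sat K w \<sigma>" if "(\<sigma>, es) \<in> F" "\<forall>j<length es. w j = v (idx (es ! j))"
    for K :: "(nat, nat, 'k) struct" and v w \<sigma> es
  proof -
    have "wf_fm L (length es) \<sigma>" using F(2) that by auto
    then show ?thesis unfolding rn_def prod.case sat_subst by (rule sat_cong) (simp add: that(2))
  qed
  define \<sigma> where "\<sigma> = conj_list (map rn Fs)"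
  have s: "Sigma_star (Suc n) \<sigma>" "wf_fm L ?m \<sigma>"
    unfolding \<sigma>_def by (rule Sigma_star_conj_list, use rn Fs in force) (use rn Fs in \<open>auto simp: wf_conj_list\<close>)
  have e: "ext cs (\<lambda>_. a) i = ?bs ! i" if "i < ?m" for i
    using that by (auto simp: ext_def nth_append)
  have "sat M (ext cs (\<lambda>_. a)) \<sigma>" unfolding \<sigma>_def sat_conj_list
  proof
    fix \<psi> assume "\<psi> \<in> set (map rn Fs)"
    then obtain \<sigma> es where p: "(\<sigma>, es) \<in> F" "\<psi> = rn (\<sigma>, es)" using Fs by auto
    have "sat M (ext cs (\<lambda>_. a)) (rn (\<sigma>, es)) \<longleftrightarrow> sat M (ext es (\<lambda>_. a)) \<sigma>"
    proof (rule rs[OF p(1)], intro allI impI)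
      fix j assume j: "j < length es"
      show "ext es (\<lambda>_. a) j = ext cs (\<lambda>_. a) (idx (es ! j))"
        using e[of "idx (es ! j)"] ies[OF p(1) nth_mem[OF j]] j by (simp add: ext_def)
    qed
    then show "sat M (ext cs (\<lambda>_. a)) \<psi>" using F(2) p by auto
  qed
  moreover have "set cs \<subseteq> dom M" using cs(1) F(2) by auto
  ultimately have M: "sat M (\<lambda>_. a) (exs (length cs) \<sigma>)" unfolding sat_exs by blast
  have K: "\<exists>hp. range hp \<subseteq> dom K \<and> hp a = v 0 \<and> (\<forall>(\<sigma>, es)\<in>F. sat K (ext (map hp es) (\<lambda>_. v 0)) \<sigma>)"
    if K: "range v \<subseteq> dom K" "sat K v (exs (length cs) \<sigma>)" for K :: "(nat, nat, 'n) struct" and v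
  proof -
    obtain xs where xs: "length xs = length cs" "set xs \<subseteq> dom K" "sat K (ext xs v) \<sigma>" using K(2) unfolding sat_exs by blast
    \<comment> \<open>\<open>idx\<close> is arbitrary on elements that occur nowhere in the diagram;
      the case distinction keeps the value in \<open>dom K\<close> there too.\<close>
    define hp where "hp b = (if idx b < length xs then ext xs v (idx b) else v 0)" for b
    have "hp b \<in> dom K" for b unfolding hp_def ext_def using xs(2) K(1) nth_mem[of "idx b" xs] by auto
    then have r: "range hp \<subseteq> dom K" by blast
    have ha: "hp a = v 0" by (simp add: hp_def ia xs(1))
    have hi: "hp b = ext xs v (idx b)" if "idx b < ?m" for b
      using that by (auto simp: hp_def ext_def xs(1) less_Suc_eq)
    have "sat K (ext (map hp es) (\<lambda>_. v 0)) \<sigma>'" if p: "(\<sigma>', es) \<in> F" for \<sigma>' es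
    proof -
      have "sat K (ext xs v) (rn (\<sigma>', es))" using xs(3) p Fs unfolding \<sigma>_def sat_conj_list by auto
      moreover have "sat K (ext xs v) (rn (\<sigma>', es)) \<longleftrightarrow> sat K (ext (map hp es) (\<lambda>_. v 0)) \<sigma>'"
        by (rule rs[OF p]) (use ies[OF p nth_mem] hi in \<open>simp add: ext_def\<close>)
      ultimately show ?thesis by simp
    qed
    then show ?thesis using r ha by blast
  qed
  have "wf_fm L 1 (exs (length cs) \<sigma>)" using s(2) by (simp add: wf_exs)
  then show ?thesis using Sigma_star_exs[OF s(1)] M K by blast
qed

text \<open>The two truth values of \<open>\<phi>\<close> at \<open>a\<close> are treated together
  through the sign \<open>s\<close>. Finite parts of the theory \<open>T\<close> are satisfied in
  structures on \<open>nat\<close>, while the model of all of \<open>T\<close> is built on the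
  carrier type of \<open>M\<close>, where \<open>imp\<close> applies.\<close>

theorem uniform_sigma:
  fixes M :: "(nat, nat, 'a) struct"
  assumes mod: "model L' U M" and th: "theory_in L' U" and inf: "infinite (dom M)"
    and imp: "\<And>(N :: (nat, nat, 'a) struct) h. model L' U N \<Longrightarrow> sigma_elementary L' (Suc n) h M N \<Longrightarrow> elementary L h M N"
    and sub: "sublang L L'" and \<phi>: "wf_fm L 1 \<phi>" "wf_fm L' 1 \<phi>" and a: "a \<in> dom M"
  shows "\<exists>\<sigma>. wf_fm L' 1 \<sigma> \<and> Sigma_star (Suc n) \<sigma> \<and> sat M (\<lambda>_. a) \<sigma> \<and>
    (\<forall>(K :: (nat, nat, nat) struct) v. total K \<longrightarrow> model L' U K \<longrightarrow> range v \<subseteq> dom K \<longrightarrow> sat K v \<sigma> \<longrightarrow> sat K v \<phi> = sat M (\<lambda>_. a) \<phi>)"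
proof (rule ccontr)
  assume no: "\<not> ?thesis"
  define s where "s = sat M (\<lambda>_. a) \<phi>"
  define G where "G = {(\<sigma>, es). wf_fm L' (length es) \<sigma> \<and> Sigma_star (Suc n) \<sigma> \<and> set es \<subseteq> dom M \<and> sat M (ext es (\<lambda>_. a)) \<sigma>}"
  have infU: "infinite (UNIV :: 'a set)" using inf finite_subset[OF subset_UNIV] by (rule contrapos_nn)
  obtain par :: "'a \<Rightarrow> 'a" and fnc :: "nat \<Rightarrow> 'a list \<Rightarrow> 'a" and wit :: "sfm \<Rightarrow> 'a list \<Rightarrow> 'a" where
    free: "\<forall>D (hp :: 'a \<Rightarrow> nat) hf hw. range hp \<subseteq> D \<longrightarrow> (\<forall>f xs. hf f xs \<in> D) \<longrightarrow> (\<forall>k xs. hw k xs \<in> D) \<longrightarrow>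
      (\<exists>I. range I \<subseteq> D \<and> (\<forall>p. I (par p) = hp p) \<and> (\<forall>f cs. I (fnc f cs) = hf f (map I cs)) \<and>
        (\<forall>k cs. I (wit k cs) = hw k (map I cs)))"
    using free_infinite[OF infU, where 'n = nat] by (elim exE)
  define dg where "dg = (\<lambda>(\<sigma>, es). ((True, \<sigma>), map par es) :: sfm \<times> 'a list)"
  define T where "T = (\<lambda>u. ((True, u), [])) ` U \<union> dg ` G \<union> {((\<not> s, \<phi>), [par a])}"
  let ?cl = "henkin.clauses L' fnc wit"
  have "\<exists>X. \<forall>c\<in>?cl T. csat X c"
  proof (rule prop_compactness, unfold finsat_def, intro allI impI)
    fix F assume F: "finite F" "F \<subseteq> ?cl T"
    obtain T0 where T0: "finite T0" "T0 \<subseteq> T" "F \<subseteq> ?cl T0" using henkin.clauses_compact[OF F] by blast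
    have "finite (T0 \<inter> dg ` G)" using T0(1) by simp
    then obtain G0 where G0: "G0 \<subseteq> G" "finite G0" "T0 \<inter> dg ` G = dg ` G0"
      using finite_subset_image[of "T0 \<inter> dg ` G" dg G] by auto
    have "\<forall>(\<sigma>, es)\<in>G0. wf_fm L' (length es) \<sigma> \<and> Sigma_star (Suc n) \<sigma> \<and> set es \<subseteq> dom M \<and> sat M (ext es (\<lambda>_. a)) \<sigma>"
      using G0(1) unfolding G_def by blast
    from merge_diagram[OF G0(2) this a, where 'n = nat]
    obtain \<tau> where \<tau>: "wf_fm L' 1 \<tau>" "Sigma_star (Suc n) \<tau>" "sat M (\<lambda>_. a) \<tau>"
      "\<And>(K :: (nat, nat, nat) struct) v. range v \<subseteq> dom K \<Longrightarrow> sat K v \<tau> \<Longrightarrow>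
        (\<exists>hp. range hp \<subseteq> dom K \<and> hp a = v 0 \<and> (\<forall>(\<sigma>, es)\<in>G0. sat K (ext (map hp es) (\<lambda>_. v 0)) \<sigma>))" by blast
    \<comment> \<open>The merged formula \<open>\<tau>\<close> is a candidate for
      \<open>\<sigma>\<close>, so by \<open>no\<close> it holds in some structure on
      \<open>nat\<close> where \<open>\<phi>\<close> has the other truth value.\<close>
    obtain K :: "(nat, nat, nat) struct" and v where K: "total K" "model L' U K" "range v \<subseteq> dom K" "sat K v \<tau>" "sat K v \<phi> \<noteq> s"
      using no \<tau>(1-3) unfolding s_def by blast
    obtain hp where hp: "range hp \<subseteq> dom K" "hp a = v 0" "\<forall>(\<sigma>, es)\<in>G0. sat K (ext (map hp es) (\<lambda>_. v 0)) \<sigma>"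
      using \<tau>(4)[OF K(3,4)] by blast
    have v0: "v 0 \<in> dom K" using K(3) by blast
    have "\<exists>X. \<forall>c\<in>?cl T0. csat X c"
    proof (rule henkin.clauses_satisfiable[where N = K and hp = hp and ?a0.0 = "v 0" and par = par])
      fix D and hp :: "'a \<Rightarrow> nat" and hf :: "nat \<Rightarrow> nat list \<Rightarrow> nat" and hw :: "sfm \<Rightarrow> nat list \<Rightarrow> nat"
      assume "range hp \<subseteq> D" "\<And>f xs. hf f xs \<in> D" "\<And>k xs. hw k xs \<in> D"
      then show "\<exists>I. range I \<subseteq> D \<and> (\<forall>p. I (par p) = hp p) \<and> (\<forall>f cs. I (fnc f cs) = hf f (map I cs)) \<and>
        (\<forall>k cs. I (wit k cs) = hw k (map I cs))" using free[rule_format, of hp D hf hw] by blast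
    next
      fix k e assume ke: "(k, e) \<in> T0"
      then have "(k, e) \<in> T" using T0(2) by blast
      then consider u where "u \<in> U" "k = (True, u)" "e = []" | "(k, e) \<in> dg ` G" | "k = (\<not> s, \<phi>)" "e = [par a]"
        unfolding T_def by blast
      then show "\<exists>ps. e = map par ps \<and> ssat K (ext (map hp ps) (\<lambda>_. v 0)) k"
      proof cases
        case 1
        have "sat K (\<lambda>_. v 0) u" using K(2) 1(1) v0 unfolding model_def by auto
        then show ?thesis using 1 by (intro exI[of _ "[]"]) (simp add: ssat_def)
      next
        case 2
        then have "(k, e) \<in> dg ` G0" using ke G0(3) by blast
        then obtain \<sigma> es where "(\<sigma>, es) \<in> G0" "k = (True, \<sigma>)" "e = map par es" by (auto simp: dg_def)
        then show ?thesis using hp(3) by (intro exI[of _ es]) (auto simp: ssat_def)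
      next
        case 3
        have "sat K (ext (map hp [a]) (\<lambda>_. v 0)) \<phi> = sat K v \<phi>" by (rule sat_cong[OF \<phi>(1)]) (simp add: ext_def hp(2))
        then show ?thesis using 3 K(5) by (intro exI[of _ "[a]"]) (auto simp: ssat_def)
      qed
    qed (use K(1) hp(1) v0 in auto)
    then show "\<exists>X. \<forall>c\<in>F. csat X c" using T0(3) by blast
  qed
  then obtain X where "\<forall>c\<in>?cl T. csat X c" ..
  from henkin.model_existence[OF this] obtain K :: "(nat, nat, 'a) struct" and \<rho> where K: "total K" "range \<rho> = dom K"
    and T: "\<forall>(k, e)\<in>T. \<forall>v. wf_fm L' (length e) (snd k) \<longrightarrow> range v \<subseteq> dom K \<longrightarrow>
      (\<forall>i<length e. v i = \<rho> (e ! i)) \<longrightarrow> ssat K v k" by (elim exE conjE)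
  have T: "ssat K v k" if "(k, e) \<in> T" "wf_fm L' (length e) (snd k)" "range v \<subseteq> dom K" "\<forall>i<length e. v i = \<rho> (e ! i)" for k e v
    using bspec[OF T that(1)] that(2-4) by simp
  have "sat K v u" if u: "u \<in> U" and v: "range v \<subseteq> dom K" for u v
  proof -
    have "((True, u), []) \<in> T" "wf_fm L' 0 u" using u th by (simp_all add: T_def theory_in_def)
    then show ?thesis using T[of "(True, u)" "[]" v] v by (simp add: ssat_def)
  qed
  then have m: "model L' U K" using K(1) unfolding model_def total_def structure_for_def by auto
  define h where "h = \<rho> \<circ> par"
  have hD: "h x \<in> dom K" for x unfolding h_def using K(2) by auto
  have dgm: "sat K (h \<circ> v) \<psi>" if p: "wf_fm L' k \<psi>" "Sigma_star (Suc n) \<psi>" "range v \<subseteq> dom M" "sat M v \<psi>" for \<psi> v k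
  proof -
    let ?es = "map v [0..<k]"
    have "sat M (ext ?es (\<lambda>_. a)) \<psi> = sat M v \<psi>" by (rule sat_cong[OF p(1)]) (simp add: ext_def)
    then have "(\<psi>, ?es) \<in> G" using p unfolding G_def by auto
    then have t: "((True, \<psi>), map par ?es) \<in> T" unfolding T_def dg_def by force
    have "ssat K (h \<circ> v) (True, \<psi>)" by (rule T[OF t]) (use p(1) hD in \<open>auto simp: h_def\<close>)
    then show ?thesis by (simp add: ssat_def)
  qed
  \<comment> \<open>Inequations are \<open>\<Sigma>\<close> at every positive level, so they are
    part of the diagram.\<close>
  have "inj_on h (dom M)"
  proof (rule inj_onI, rule ccontr)
    fix b c assume bc: "b \<in> dom M" "c \<in> dom M" "h b = h c" "b \<noteq> c"
    have "sat K (h \<circ> case_nat b (\<lambda>_. c)) (Neg (Eq (Var 0) (Var 1)))"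
      by (rule dgm[of 2]) (use bc in \<open>auto intro: Sigma_star_Pi_star.intros split: nat.splits\<close>)
    then show False using bc(3) by simp
  qed
  moreover have "h ` dom M \<subseteq> dom K" using hD by blast
  ultimately have "sigma_elementary L' (Suc n) h M K"
    unfolding sigma_elementary_def formula_of_def by (intro conjI allI impI; (elim conjE exE)?) (assumption | erule (3) dgm)+
  from imp[OF m this, unfolded elementary_def, THEN conjunct2, THEN conjunct2, rule_format, of \<phi> "\<lambda>_. a"]
  have "s = sat K (h \<circ> (\<lambda>_. a)) \<phi>" using \<phi>(1) a by (auto simp: formula_of_def s_def)
  moreover have "ssat K (h \<circ> (\<lambda>_. a)) (\<not> s, \<phi>)"
    by (rule T[of _ "[par a]"]) (use \<phi>(2) hD in \<open>auto simp: T_def h_def\<close>)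
  ultimately show False by (auto simp: ssat_def)
qed

text \<open>Russell's paradox: if the domain were finite, the set of all \<open>x\<close> without
  \<open>E x x\<close> would have a code.\<close>

lemma (in seqmodel) infinite_dom: "infinite D"
proof
  assume "finite D"
  then have "finite {x \<in> D. \<not> E x x}" by simp
  from finite_set_code[OF this] obtain s where "s \<in> D" "\<forall>x\<in>D. E x s \<longleftrightarrow> x \<in> {x \<in> D. \<not> E x x}" by blast
  then show False by blast
qed

section \<open>The Rosser predicate\<close>

context recursive_theory
begin

text \<open>Further variables are filled by a representative of 0, so that the result is a relation
  with four arguments.\<close>

lemma rep4:
  assumes "rep (\<lambda>n. P (n 0) (n 1) (n 2) (n 3))"
  shows "\<exists>Y. dfn (\<lambda>v. Y (v 0) (v 1) (v 2) (v 3)) \<and> (\<forall>m0 m1 m2 m3 x0 x1 x2 x3.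
    Nn m0 x0 \<longrightarrow> Nn m1 x1 \<longrightarrow> Nn m2 x2 \<longrightarrow> Nn m3 x3 \<longrightarrow> (Y x0 x1 x2 x3 \<longleftrightarrow> P m0 m1 m2 m3))"
proof -
  obtain X where X: "dfn X" "\<And>v n. nenv n v \<Longrightarrow> X v \<longleftrightarrow> P (n 0) (n 1) (n 2) (n 3)"
    using assms unfolding rep_def by (elim exE conjE) (rule that, assumption, blast)
  obtain z where z: "z \<in> D" "Nn 0 z" using Nn_ex by blast
  have "dfn (\<lambda>v. X (case_nat (v 0) (case_nat (v 1) (case_nat (v 2) (case_nat (v 3) (\<lambda>_. z))))))"
    by (rule dfn_subst[OF X(1)]) (intro pt_case pt_var pt_const z(1))
  moreover have "X (case_nat x0 (case_nat x1 (case_nat x2 (case_nat x3 (\<lambda>_. z))))) \<longleftrightarrow> P m0 m1 m2 m3"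
    if "Nn m0 x0" "Nn m1 x1" "Nn m2 x2" "Nn m3 x3" for m0 m1 m2 m3 x0 x1 x2 x3
  proof -
    have "nenv (case_nat m0 (case_nat m1 (case_nat m2 (case_nat m3 (\<lambda>_. 0)))))
        (case_nat x0 (case_nat x1 (case_nat x2 (case_nat x3 (\<lambda>_. z)))))"
      using that z(2) unfolding nenv_Cons by (simp add: nenv_def)
    from X(2)[OF this] show ?thesis by (simp add: numeral_2_eq_2 numeral_3_eq_3)
  qed
  ultimately show ?thesis
    by (intro exI[of _ "\<lambda>x0 x1 x2 x3. X (case_nat x0 (case_nat x1 (case_nat x2 (case_nat x3 (\<lambda>_. z)))))"] conjI allI impI)
qed

text \<open>In a nonstandard structure a witness may be nonstandard and then proves nothing; comparing
  witnesses for a formula and its negation, as Rosser did, makes the smaller standard one decide.\<close>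

lemma rosser_predicate:
  assumes U: "theory_in L' U" "model L' U M" and sub: "\<And>\<phi>. wf_fm L 1 \<phi> \<Longrightarrow> wf_fm L' 1 \<phi>"
    and ex: "\<And>\<phi> a. wf_fm L 1 \<phi> \<Longrightarrow> a \<in> D \<Longrightarrow> \<exists>\<sigma>. wf_fm L' 1 \<sigma> \<and> Sigma_star (Suc n) \<sigma> \<and> sat M (\<lambda>_. a) \<sigma> \<and>
      (\<forall>(K :: (nat, nat, nat) struct) v. total K \<longrightarrow> model L' U K \<longrightarrow> range v \<subseteq> dom K \<longrightarrow> sat K v \<sigma> \<longrightarrow> sat K v \<phi> = sat M (\<lambda>_. a) \<phi>)"
  shows "\<exists>\<Phi>. dfn (\<lambda>v. \<Phi> (v 0) (v 1)) \<and>
    (\<forall>\<phi> x a. wf_fm L 1 \<phi> \<longrightarrow> a \<in> D \<longrightarrow> Nn (godel \<phi>) x \<longrightarrow> (\<Phi> x a \<longleftrightarrow> sat M (\<lambda>_. a) \<phi>))"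
proof -
  obtain S where S: "dfn (\<lambda>v. S (v 0) (v 1))" "sound_on (\<lambda>_. True) S" "complete_on (Sig (Suc n)) S"
    using partial_satisfaction[of "Suc n"] by (elim exE conjE)
  \<comment> \<open>\<open>w\<close> bounds the refutation and the codes, \<open>x\<close> codes the
    \<open>\<Sigma>\<close> formula, \<open>z\<close> is the same formula in the form
    \<open>bsc 1 (True, \<psi>)\<close> that \<open>S\<close> expects, and \<open>g\<close> codes
    the formula to be decided.\<close>
  define P where "P b w x z g \<longleftrightarrow> x \<le> w \<and> z \<le> w \<and> FmC 1 x \<and> z = prod_encode (1, 2 * x + 1) \<and> Rn w x (of_bool b) g" for b w x z g
  have "rep (\<lambda>n. P b (n 0) (n 1) (n 2) (n 3))" for b
    unfolding P_def by (intro rep_intros2 rep_FmC rep_Rn)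
  then have "\<exists>Y. \<forall>b. dfn (\<lambda>v. Y b (v 0) (v 1) (v 2) (v 3)) \<and> (\<forall>m0 m1 m2 m3 x0 x1 x2 x3.
    Nn m0 x0 \<longrightarrow> Nn m1 x1 \<longrightarrow> Nn m2 x2 \<longrightarrow> Nn m3 x3 \<longrightarrow> (Y b x0 x1 x2 x3 \<longleftrightarrow> P b m0 m1 m2 m3))"
    by (intro choice allI rep4)
  then obtain Y where Yb: "\<forall>b. dfn (\<lambda>v. Y b (v 0) (v 1) (v 2) (v 3)) \<and> (\<forall>m0 m1 m2 m3 x0 x1 x2 x3.
    Nn m0 x0 \<longrightarrow> Nn m1 x1 \<longrightarrow> Nn m2 x2 \<longrightarrow> Nn m3 x3 \<longrightarrow> (Y b x0 x1 x2 x3 \<longleftrightarrow> P b m0 m1 m2 m3))" ..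
  note Y = Yb[rule_format, THEN conjunct1] Yb[rule_format, THEN conjunct2, rule_format]
  \<comment> \<open>The two comparisons with \<open>w\<close> make the codes \<open>y\<close> and
    \<open>z\<close> standard whenever \<open>w\<close> is, and only for standard arguments is
    \<open>Y\<close> known to express \<open>P\<close>.\<close>
  define Wt where "Wt b w x a \<longleftrightarrow> (\<exists>y\<in>D. \<exists>z\<in>D. \<exists>e\<in>D. leM y w \<and> leM z w \<and> Y b w y z x \<and> Ls [a] e \<and> S z e)" for b w x a
  have Ls1: "pt f \<Longrightarrow> pt g \<Longrightarrow> dfn (\<lambda>v. Ls [f v] (g v))" for f g using Ls_dfn[of "[f]" g] by simp
  have Wt_dfn0: "dfn (\<lambda>v. Wt b (v 0) (v 1) (v 2))" for b
    unfolding Wt_def by (intro dfn_intros leM_dfn Ls1 dfn_inst4[OF Y(1)] dfn_inst2[OF S(1)])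
  define \<Phi> where "\<Phi> x a \<longleftrightarrow> (\<exists>w\<in>D. w \<in> tdom N M \<and> Wt True w x a \<and> (\<forall>w'\<in>D. leM w' w \<longrightarrow> \<not> Wt False w' x a))" for x a
  have "dfn (\<lambda>v. \<Phi> (v 0) (v 1))"
    unfolding \<Phi>_def by (intro dfn_intros leM_dfn tdom_dfn dfn_inst3[OF Wt_dfn0])
  moreover have "\<Phi> x a \<longleftrightarrow> sat M (\<lambda>_. a) \<phi>" if \<phi>: "wf_fm L 1 \<phi>" and a: "a \<in> D" and x: "Nn (godel \<phi>) x" for \<phi> x a
  proof -
    have \<phi>': "wf_fm L' 1 \<phi>" by (rule sub[OF \<phi>])
    \<comment> \<open>At a standard \<open>w\<close> the witness is genuine: the coded formula is
      true of \<open>a\<close>, and relative to \<open>U\<close> it forces the truth value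
      \<open>b\<close> of \<open>\<phi>\<close>.\<close>
    have sound: "sat M (\<lambda>_. a) \<phi> = b" if w: "Nn m w" "Wt b w x a" for b m w
    proof -
      obtain y z e where h: "leM y w" "leM z w" "Y b w y z x" "Ls [a] e" "S z e" using w(2) unfolding Wt_def by blast
      obtain y' where y': "Nn y' y" using Nn_leMD[OF w(1) h(1)] by blast
      obtain z' where z': "Nn z' z" using Nn_leMD[OF w(1) h(2)] by blast
      have p: "FmC 1 y'" "z' = prod_encode (1, 2 * y' + 1)" "Rn m y' (of_bool b) (godel \<phi>)"
        using h(3) unfolding Y(2)[OF w(1) y' z' x] P_def by blast+
      obtain \<psi> where \<psi>: "wf_fm L' 1 \<psi>" "y' = godel \<psi>" using p(1) unfolding FmC_def by blast
      have "Nn (bsc (length [a]) (True, \<psi>)) z" using z' p(2) \<psi>(2) by (simp add: bsc_def sc_def)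
      from sound_onD[OF S(2) TrueI this h(4) _ h(5)] have "sat M (env [a]) \<psi>" using \<psi>(1) by (simp add: ssat_def)
      moreover have "sat M (env [a]) \<psi> = sat M (\<lambda>_. a) \<psi>" by (rule sat_cong[OF \<psi>(1)]) simp
      \<comment> \<open>\<open>Rn_sound\<close> is about total structures, so the argument passes to
        \<open>tot M\<close> and back.\<close>
      ultimately have s: "sat (tot M) (\<lambda>_. a) \<psi>" using sat_tot[OF stM \<psi>(1)] a by simp
      have u: "sat (tot M) (\<lambda>_. a) u" if "u \<in> U" for u
      proof -
        have "wf_fm L' 0 u" using U(1) that by (simp add: theory_in_def)
        from sat_tot[OF stM this] show ?thesis using U(2) that a unfolding model_def by auto
      qed
      have "total (tot M)" using a by (intro total_tot) blast
      from Rn_sound[OF p(3)[unfolded \<psi>(2)] this _ u s] a have "sat (tot M) (\<lambda>_. a) \<phi> = b" by simp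
      then show ?thesis using sat_tot[OF stM \<phi>'] a by simp
    qed
    obtain m w where w: "Nn m w" "Wt (sat M (\<lambda>_. a) \<phi>) w x a"
    proof -
      from ex[OF \<phi> a] obtain \<sigma> where \<sigma>: "wf_fm L' 1 \<sigma>" "Sigma_star (Suc n) \<sigma>" "sat M (\<lambda>_. a) \<sigma>"
        "\<forall>(K :: (nat, nat, nat) struct) v. total K \<longrightarrow> model L' U K \<longrightarrow> range v \<subseteq> dom K \<longrightarrow> sat K v \<sigma> \<longrightarrow> sat K v \<phi> = sat M (\<lambda>_. a) \<phi>"
        by (elim exE conjE)
      obtain w0 where w0: "Rn w0 (godel \<sigma>) (of_bool (sat M (\<lambda>_. a) \<phi>)) (godel \<phi>)"
        using Rn_complete[OF U(1) \<sigma>(1) \<phi>'] \<sigma>(4) by blast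
      \<comment> \<open>A stage above the refutation and above both codes.\<close>
      define m where "m = w0 + godel \<sigma> + bsc 1 (True, \<sigma>)"
      obtain w y z where n: "Nn m w" "Nn (godel \<sigma>) y" "Nn (bsc 1 (True, \<sigma>)) z" using Nn_ex by meson
      obtain e where e: "Ls [a] e" using Ls_ex[of "[a]"] a by auto
      have "sat M (env [a]) \<sigma> = sat M (\<lambda>_. a) \<sigma>" by (rule sat_cong[OF \<sigma>(1)]) simp
      then have s: "S z e"
        using complete_onD[OF S(3), of "(True, \<sigma>)" "[a]" z e] n(3) e \<sigma>(1-3) by (simp add: ssat_def)
      have "Rn m (godel \<sigma>) (of_bool (sat M (\<lambda>_. a) \<phi>)) (godel \<phi>)" by (rule Rn_mono[OF w0]) (simp add: m_def)
      then have "P (sat M (\<lambda>_. a) \<phi>) m (godel \<sigma>) (bsc 1 (True, \<sigma>)) (godel \<phi>)"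
        unfolding P_def FmC_def using \<sigma>(1) by (auto simp: m_def bsc_def sc_def)
      then have "Y (sat M (\<lambda>_. a) \<phi>) w y z x" unfolding Y(2)[OF n x] .
      moreover have "leM y w" "leM z w" unfolding Nn_leM[OF n(2,1)] Nn_leM[OF n(3,1)] m_def by simp_all
      ultimately have "Wt (sat M (\<lambda>_. a) \<phi>) w x a" unfolding Wt_def
        using Nn_D[OF n(2)] Nn_D[OF n(3)] Ls_D[OF e] e s by blast
      then show thesis using n(1) by (intro that)
    qed
    show ?thesis
    proof
      assume "\<Phi> x a"
      then obtain w1 where w1: "w1 \<in> tdom N M" "Wt True w1 x a" "\<forall>w'\<in>D. leM w' w1 \<longrightarrow> \<not> Wt False w' x a"
        unfolding \<Phi>_def by blast
      show "sat M (\<lambda>_. a) \<phi>"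
      proof (rule ccontr)
        assume f: "\<not> sat M (\<lambda>_. a) \<phi>"
        \<comment> \<open>The standard witness \<open>w\<close> for the negation cannot lie below
          \<open>w1\<close>. So \<open>w1\<close> lies below \<open>w\<close>, is standard itself,
          and soundness applies to it.\<close>
        then have "\<not> leM w w1" using w w1(3) Nn_D[OF w(1)] by auto
        then have "leM w1 w" using Nn_le_total[OF w(1) w1(1)] by blast
        then obtain m' where "Nn m' w1" using Nn_leMD[OF w(1)] by blast
        then show False using sound[OF _ w1(2)] f by blast
      qed
    next
      assume t: "sat M (\<lambda>_. a) \<phi>"
      have "\<not> Wt False w' x a" if "leM w' w" for w'
      proof
        assume f: "Wt False w' x a"
        obtain m' where "Nn m' w'" using Nn_leMD[OF w(1) \<open>leM w' w\<close>] by blast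
        then show False using sound[OF _ f] t by blast
      qed
      moreover have "w \<in> tdom N M" using w(1) by (simp add: Nn_def)
      ultimately show "\<Phi> x a" unfolding \<Phi>_def using w(2) t Nn_D[OF w(1)] by (intro bexI[of _ w]) auto
    qed
  qed
  ultimately show ?thesis by blast
qed

end

section \<open>Direct translations\<close>

lemma eval_reduct: "fun_of M' = fun_of M \<Longrightarrow> eval_tm M' v t = eval_tm M v t"
proof (induct t)
  case (Fn f ts)
  then have "map (eval_tm M' v) ts = map (eval_tm M v) ts" by simp
  then show ?case using Fn(2) by (simp del: map_eq_conv)
qed simp

lemma sat_reduct:
  assumes "dom M' = dom M" "fun_of M' = fun_of M" "\<And>R k. (R, k) \<in> rels L \<Longrightarrow> rel_of M' R = rel_of M R"
  shows "wf_fm L k \<phi> \<Longrightarrow> sat M' v \<phi> = sat M v \<phi>"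
proof (induct \<phi> arbitrary: k v)
  case (Rel R ts)
  have "eval_tm M' v = eval_tm M v" using eval_reduct[OF assms(2)] by blast
  then show ?case using Rel assms(3)[of R "length ts"] by simp
qed (simp_all add: assms(1) eval_reduct[OF assms(2)], blast+)

lemma wf_fm_sublang: "sublang L L' \<Longrightarrow> wf_fm L k \<phi> \<Longrightarrow> wf_fm L' k \<phi>"
proof (induct \<phi> arbitrary: k)
  have t: "sublang L L' \<Longrightarrow> wf_tm L k t \<Longrightarrow> wf_tm L' k t" for k and t :: "'a tm"
    by (induct t) (auto simp: sublang_def list_all_iff)
  {
    case (Eq s u) then show ?case using t by simp
  next
    case (Rel R ts) then show ?case using t by (auto simp: sublang_def list_all_iff)
  }
qed auto

abbreviation graph_fm :: "'f \<Rightarrow> nat \<Rightarrow> ('f, 'r) fm" where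
  "graph_fm f k \<equiv> Eq (Fn f (map Var [0..<k])) (Var k)"

lemma satl_graph: "length xs = k \<Longrightarrow> satl M (graph_fm f k) (xs @ [y]) \<longleftrightarrow> fun_of M f xs = y"
proof -
  assume k: "length xs = k"
  then have "map (\<lambda>i. (xs @ [y]) ! i) [0..<k] = xs" by (intro nth_equalityI) (simp_all add: nth_append)
  then show ?thesis unfolding k[symmetric] by (simp add: satl_def comp_def)
qed

text \<open>Identity is translated to true identity on the whole domain and functions to their
  graphs, so the conditions reduce to facts about equality and to totality of the functions.\<close>

lemma direct_conditions:
  fixes W :: "('f, 'r, 'a) struct"
  assumes d: "direct \<tau>" and wf: "wf_trans \<tau> LV LW" and W: "structure_for LW W" and fs: "funs LV \<subseteq> funs LW"
    and g: "\<And>f k. (f, k) \<in> funs LV \<Longrightarrow> tr_fun \<tau> (f, k) = graph_fm f k"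
    and \<phi>: "\<phi> \<in> trans_conditions \<tau> LV" and v: "range v \<subseteq> dom W"
  shows "sat W v \<phi>"
proof -
  have at: "dom_at \<tau> i = Eq (Var i) (Var i)" "eq_at \<tau> i j = Eq (Var i) (Var j)" for i j
    using d by (simp_all add: direct_def vapp_def)
  have ne: "dom W \<noteq> {}" using W by (simp add: structure_for_def)
  have cong: "sat W v (congruence \<tau> k \<chi>)" if "wf_fm LW k \<chi>" for k \<chi>
    unfolding congruence_def at sat_alls
  proof (intro allI impI)
    fix xs :: "'a list" assume "length xs = 2 * k"
    let ?v = "ext xs v"
    have "sat W ?v (vapp \<chi> [0..<k]) \<longleftrightarrow> satl W \<chi> (map ?v [0..<k])" "sat W ?v (vapp \<chi> [k..<2 * k]) \<longleftrightarrow> satl W \<chi> (map ?v [k..<2 * k])"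
      using that by (simp_all add: sat_vapp[of LW])
    moreover have "map ?v [0..<k] = map ?v [k..<2 * k]" if "\<forall>i<k. ?v i = ?v (k + i)"
      using that by (intro nth_equalityI) simp_all
    moreover have "\<forall>i<k. ?v i = ?v (k + i)"
      if "sat W ?v (conjs (map (\<lambda>i. Eq (Var i) (Var i)) [0..<2 * k] @ map (\<lambda>i. Eq (Var i) (Var (k + i))) [0..<k]))"
      using that by (simp add: sat_conjs ball_Un)
    ultimately show "sat W ?v (Imp (conjs (map (\<lambda>i. Eq (Var i) (Var i)) [0..<2 * k] @ map (\<lambda>i. Eq (Var i) (Var (k + i))) [0..<k]))
        (Imp (vapp \<chi> [0..<k]) (vapp \<chi> [k..<2 * k])))"
      unfolding sat.simps by metis
  qed
  have wfs: "wf_fm LW k (tr_rel \<tau> (R, k))" if "(R, k) \<in> rels LV" for R k using wf that by (auto simp: wf_trans_def)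
  have wff: "wf_fm LW (Suc k) (tr_fun \<tau> (f, k))" if "(f, k) \<in> funs LV" for f k using wf that by (auto simp: wf_trans_def)
  from \<phi> show ?thesis unfolding trans_conditions_def
  proof (elim UnE insertE emptyE CollectE exE conjE)
    show "\<phi> = exs 1 (dom_at \<tau> 0) \<Longrightarrow> ?thesis" using ne by (auto simp: at exs_def)
    show "\<phi> = alls 1 (Imp (dom_at \<tau> 0) (eq_at \<tau> 0 0)) \<Longrightarrow> ?thesis" by (simp add: at sat_alls)
    show "\<phi> = alls 2 (Imp (conjs [dom_at \<tau> 0, dom_at \<tau> 1, eq_at \<tau> 0 1]) (eq_at \<tau> 1 0)) \<Longrightarrow> ?thesis" by (simp add: at sat_alls sat_conjs)
    show "\<phi> = alls 3 (Imp (conjs [dom_at \<tau> 0, dom_at \<tau> 1, dom_at \<tau> 2, eq_at \<tau> 0 1, eq_at \<tau> 1 2]) (eq_at \<tau> 0 2)) \<Longrightarrow> ?thesis"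
      by (simp add: at sat_alls sat_conjs)
    show "\<phi> = congruence \<tau> k (tr_rel \<tau> (R, k)) \<Longrightarrow> (R, k) \<in> rels LV \<Longrightarrow> ?thesis" for R k using cong wfs by blast
    show "\<phi> = congruence \<tau> (Suc k) (tr_fun \<tau> (f, k)) \<Longrightarrow> (f, k) \<in> funs LV \<Longrightarrow> ?thesis" for f k using cong wff by blast
  next
    fix f k assume e: "\<phi> = alls k (Imp (conjs (map (dom_at \<tau>) [0..<k])) (Ex (And (dom_at \<tau> 0) (vapp (tr_fun \<tau> (f, k)) ([1..<Suc k] @ [0])))))"
      and f: "(f, k) \<in> funs LV"
    have "\<exists>a\<in>dom W. sat W (case_nat a (ext xs v)) (vapp (tr_fun \<tau> (f, k)) ([1..<Suc k] @ [0]))"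
      if xs: "length xs = k" "set xs \<subseteq> dom W" for xs
    proof -
      have y: "fun_of W f xs \<in> dom W" using W f fs xs unfolding structure_for_def by fastforce
      let ?v = "case_nat (fun_of W f xs) (ext xs v)"
      have "map ?v ([1..<Suc k] @ [0]) = xs @ [fun_of W f xs]"
      proof -
        have "map (ext xs v) [0..<k] = xs" using xs(1) by (intro nth_equalityI) (simp_all add: ext_def)
        moreover have "[1..<Suc k] = map Suc [0..<k]" by (simp add: map_Suc_upt del: upt_Suc)
        ultimately show ?thesis by (simp add: comp_def del: upt_Suc)
      qed
      moreover have "sat W ?v (vapp (tr_fun \<tau> (f, k)) ([1..<Suc k] @ [0])) = satl W (tr_fun \<tau> (f, k)) (map ?v ([1..<Suc k] @ [0]))"
        by (rule sat_vapp[of LW]) (use wff[OF f] in \<open>simp del: upt_Suc\<close>)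
      ultimately have "sat W ?v (vapp (tr_fun \<tau> (f, k)) ([1..<Suc k] @ [0]))" using satl_graph[OF xs(1)] g[OF f] by metis
      then show ?thesis using y by blast
    qed
    then show ?thesis unfolding e sat_alls by (simp add: at del: upt_Suc)
  next
    fix f k assume e: "\<phi> = alls (k + 2) (Imp (conjs (map (dom_at \<tau>) [0..<k + 2] @
           [vapp (tr_fun \<tau> (f, k)) ([0..<k] @ [k]), vapp (tr_fun \<tau> (f, k)) ([0..<k] @ [k + 1])]))
         (eq_at \<tau> k (k + 1)))" and f: "(f, k) \<in> funs LV"
    have s: "sat W w (vapp (tr_fun \<tau> (f, k)) ([0..<k] @ [j])) \<longleftrightarrow> fun_of W f (map w [0..<k]) = w j" for w j
      using sat_vapp[of LW "[0..<k] @ [j]" "tr_fun \<tau> (f, k)" W w] wff[OF f] satl_graph[of "map w [0..<k]" k W f "w j"] g[OF f] by simp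
    show ?thesis unfolding e sat_alls by (auto simp: sat_conjs s at)
  qed
qed

section \<open>The definition of satisfaction inside the elementary diagram\<close>

context seqmodel
begin

lemma sat_numeral_fm:
  assumes "v 0 \<in> D"
  shows "sat M v (numeral_fm N n) \<longleftrightarrow> Nn n (v 0)"
proof -
  have wf: "wf_fm L' (length [v 0]) (tr_dom N)" using wft by (simp add: wf_trans_def)
  have "sat M v (tr_dom N) = satl M (tr_dom N) [v 0]" by (rule satlI[OF wf]) simp
  then have d: "sat M v (tr_dom N) \<longleftrightarrow> v 0 \<in> tdom N M" using assms by (simp add: tdom_def)
  have "wf_fm lang_S12 1 (Eq (Var 0) (numeral_tm n))" by (simp add: wf_numeral)
  from sat_tr_fm[OF this, of v] show ?thesis unfolding numeral_fm_def by (auto simp: d Nn_def eval_numeral simp del: tr_fm.simps)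
qed

lemma wf_numeral_fm: "wf_fm L' 1 (numeral_fm N n)"
proof -
  have "wf_fm lang_S12 1 (Eq (Var 0) (numeral_tm n))" by (simp add: wf_numeral)
  from wf_tr_fm[OF wft this] show ?thesis unfolding numeral_fm_def using wft by (simp add: wf_trans_def)
qed

text \<open>\<open>dfn\<close> leaves the number of free variables open; those beyond the first two
  are replaced by the constant for a fixed element.\<close>

lemma dfn_binary:
  assumes "dfn (\<lambda>v. \<Phi> (v 0) (v 1))"
  shows "\<exists>\<psi>. wf_fm (lang_diag L' M) 2 \<psi> \<and> (\<forall>a\<in>D. \<forall>b\<in>D. \<forall>v. v 0 = a \<longrightarrow> v 1 = b \<longrightarrow> (sat (struct_diag M) v \<psi> \<longleftrightarrow> \<Phi> a b))"
proof -
  obtain \<psi> k where \<psi>: "wf_fm (lang_diag L' M) k \<psi>" "\<And>v. range v \<subseteq> D \<Longrightarrow> sat (struct_diag M) v \<psi> \<longleftrightarrow> \<Phi> (v 0) (v 1)"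
    using assms unfolding dfn_def by blast
  obtain z where z: "z \<in> D" using Nn_ex by blast
  let ?s = "\<lambda>i. if i < 2 then Var i else Fn (Inr z) []"
  have "wf_fm (lang_diag L' M) 2 (subst ?s \<psi>)" by (rule wf_fm_subst[OF \<psi>(1)]) (simp add: z)
  moreover have "sat (struct_diag M) v (subst ?s \<psi>) \<longleftrightarrow> \<Phi> (v 0) (v 1)" if "v 0 \<in> D" "v 1 \<in> D" for v
  proof -
    have e: "(\<lambda>i. eval_tm (struct_diag M) v (?s i)) = (\<lambda>i. if i < 2 then v i else z)" by auto
    have "range (\<lambda>i. if i < 2 then v i else z) \<subseteq> D" using that z by (auto simp: less_2_cases_iff)
    from \<psi>(2)[OF this] show ?thesis unfolding sat_subst e by simp
  qed
  ultimately show ?thesis by blast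
qed

text \<open>The elementary diagram contains every true sentence with parameters, so provability
  reduces to truth in \<open>M\<close>. Translated axioms are evaluated in the expansion
  \<open>M'\<close> of \<open>M\<close> by \<open>\<Phi>\<close>, with the identity as quotient
  map.\<close>

lemma USB_definable:
  assumes mod: "model L' U M" and th: "theory_in L' U" and sub: "sublang L L'" and Sat: "\<forall>k. (Sat, k) \<notin> rels L'"
    and \<Phi>: "dfn (\<lambda>v. \<Phi> (v 0) (v 1))"
    and spec: "\<And>\<phi> x a. wf_fm L 1 \<phi> \<Longrightarrow> a \<in> D \<Longrightarrow> Nn (godel \<phi>) x \<Longrightarrow> \<Phi> x a \<longleftrightarrow> sat M (\<lambda>_. a) \<phi>"
  shows "syntactically_defines (lang_diag L' M) (ElDiag L' M) (lang_diag (add_rel Sat 2 L') M)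
    (map_fm Inl id ` USB U N Sat L) (lang_diag L M)"
proof -
  obtain \<psi> where \<psi>: "wf_fm (lang_diag L' M) 2 \<psi>"
    "\<And>v. v 0 \<in> D \<Longrightarrow> v 1 \<in> D \<Longrightarrow> sat (struct_diag M) v \<psi> \<longleftrightarrow> \<Phi> (v 0) (v 1)" using dfn_binary[OF \<Phi>] by blast
  let ?LV = "lang_diag (add_rel Sat 2 L') M" and ?LW = "lang_diag L' M" and ?W = "struct_diag M"
  define \<tau> :: "(nat + 'a, nat, nat + 'a, nat) trans" where
    "\<tau> = \<lparr>tr_dom = Eq (Var 0) (Var 0), tr_eq = Eq (Var 0) (Var 1), tr_fun = \<lambda>(f, k). graph_fm f k,
      tr_rel = \<lambda>(R, k). if R = Sat then \<psi> else Rel R (map Var [0..<k])\<rparr>"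
  define M' where "M' = M\<lparr>rel_of := (rel_of M)(Sat := \<lambda>xs. \<Phi> (xs ! 0) (xs ! 1))\<rparr>"
  have M': "dom M' = D" "fun_of M' = fun_of M" "rel_of M' = (rel_of M)(Sat := \<lambda>xs. \<Phi> (xs ! 0) (xs ! 1))"
    by (simp_all add: M'_def)
  have rels: "rels ?LV = insert (Sat, 2) (rels L')" by (simp add: add_rel_def)
  have funs: "funs ?LV = funs ?LW" by (simp add: add_rel_def lang_diag_def)
  have dir: "direct \<tau>" by (simp add: \<tau>_def direct_def)
  have wf\<tau>: "wf_trans \<tau> ?LV ?LW"
    unfolding wf_trans_def funs rels using \<psi>(1) Sat
    by (auto simp: \<tau>_def list_all_iff simp del: lang_diag_simps(1,2) split: prod.splits)
  have id: "identity_on (lang_diag L M) \<tau>"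
    unfolding identity_on_def using Sat sub by (auto simp: \<tau>_def sublang_def split: prod.splits)
  have W: "structure_for ?LW ?W"
    using structure_diag[OF stM] .
  have td: "tdom \<tau> ?W = D" by (auto simp: tdom_def satl_def \<tau>_def)
  have int: "interp_struct \<tau> ?LV ?LW ?W (struct_diag M') id"
  proof
    show "wf_trans \<tau> ?LV ?LW" by (rule wf\<tau>)
    show "structure_for ?LV (struct_diag M')"
      using W unfolding structure_for_def funs by (simp add: struct_diag_def M')
    show "id ` tdom \<tau> ?W = dom (struct_diag M')" by (simp add: td M')
    show "satl ?W (tr_eq \<tau>) [a, b] \<longleftrightarrow> id a = id b" for a b by (simp add: satl_def \<tau>_def)
    show "satl ?W (tr_fun \<tau> (f, length xs)) (xs @ [y]) \<longleftrightarrow> fun_of (struct_diag M') f (map id xs) = id y" for f xs y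
      using satl_graph[of xs "length xs" ?W f y] by (simp add: \<tau>_def struct_diag_def M')
    show "satl ?W (tr_rel \<tau> (R, length xs)) xs \<longleftrightarrow> rel_of (struct_diag M') R (map id xs)"
      if "(R, length xs) \<in> rels ?LV" "set xs \<subseteq> tdom \<tau> ?W" for R xs
    proof (cases "R = Sat")
      case True
      then have l: "length xs = 2" using that(1) Sat unfolding rels by auto
      then have "xs ! 0 \<in> D" "xs ! 1 \<in> D" using that(2) nth_mem[of 0 xs] nth_mem[of 1 xs] unfolding td by auto
      then show ?thesis using \<psi>(2)[of "\<lambda>i. xs ! i"] True by (simp add: satl_def \<tau>_def M')
    next
      case False
      then show ?thesis by (simp add: satl_def \<tau>_def M' comp_def map_nth)
    qed
  qed
  then interpret T: interp_struct \<tau> ?LV ?LW ?W "struct_diag M'" id .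
  \<comment> \<open>\<open>rel_of\<close> takes a symbol without arity, so redefining it at
    \<open>Sat\<close> changes that symbol at every arity; therefore \<open>Sat\<close> has to be
    foreign to \<open>L'\<close> at all arities.\<close>
  have red: "sat M' v \<phi> = sat M v \<phi>" if "wf_fm L' k \<phi>" for k \<phi> v
    by (rule sat_reduct[OF M'(1,2) _ that]) (use Sat in \<open>auto simp: M'\<close>)
  have sl: "sublang L' (add_rel Sat 2 L')" by (auto simp: sublang_def add_rel_def)
  have ax: "tr_fm \<tau> (map_fm Inl id \<phi>) \<in> ElDiag L' M"
    if wf: "wf_fm (add_rel Sat 2 L') 0 \<phi>" and t: "\<And>v. range v \<subseteq> D \<Longrightarrow> sat M' v \<phi>" for \<phi>
  proof -
    have w: "wf_fm ?LV 0 (map_fm Inl id \<phi>)" using wf wf_map_fm by blast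
    have "sat ?W v (tr_fm \<tau> (map_fm Inl id \<phi>))" if "range v \<subseteq> D" for v
      using T.sat_tr_fm[OF w, of v] t[OF that] by (simp add: sat_map_fm)
    then show ?thesis unfolding ElDiag_def using wf_tr_fm[OF wf\<tau> w] by simp
  qed
  have "tr_fm \<tau> (map_fm Inl id \<phi>) \<in> ElDiag L' M" if "\<phi> \<in> USB U N Sat L" for \<phi>
    using that unfolding USB_def
  proof (elim UnE CollectE exE conjE)
    assume u: "\<phi> \<in> U"
    then have w: "wf_fm L' 0 \<phi>" using th by (simp add: theory_in_def)
    show ?thesis by (rule ax[OF wf_fm_sublang[OF sl w]]) (use red[OF w] mod u in \<open>auto simp: model_def\<close>)
  next
    fix \<chi> assume e: "\<phi> = All (Iff (Ex (And (numeral_fm N (godel \<chi>)) (Rel Sat [Var 0, Var 1]))) \<chi>)" and \<chi>: "wf_fm L 1 \<chi>"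
    have \<chi>': "wf_fm L' 1 \<chi>" by (rule wf_fm_sublang[OF sub \<chi>])
    have nf: "wf_fm (add_rel Sat 2 L') 2 (numeral_fm N (godel \<chi>))"
      by (rule wf_fm_mono[OF wf_fm_sublang[OF sl wf_numeral_fm]]) simp
    show ?thesis
    proof (rule ax)
      show "wf_fm (add_rel Sat 2 L') 0 \<phi>" unfolding e
        using nf wf_fm_sublang[OF sl \<chi>'] by (simp add: numeral_2_eq_2 add_rel_def)
      fix v :: "nat \<Rightarrow> 'a" assume v: "range v \<subseteq> D"
      have "(\<exists>x\<in>D. sat M' (case_nat x (case_nat a v)) (numeral_fm N (godel \<chi>)) \<and> \<Phi> x a) \<longleftrightarrow> sat M' (case_nat a v) \<chi>"
        if a: "a \<in> D" for a
      proof -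
        have "sat M' (case_nat a v) \<chi> = sat M (\<lambda>_. a) \<chi>" unfolding red[OF \<chi>'] by (rule sat_cong[OF \<chi>']) simp
        moreover have "sat M' (case_nat x (case_nat a v)) (numeral_fm N (godel \<chi>)) \<longleftrightarrow> Nn (godel \<chi>) x" if "x \<in> D" for x
          unfolding red[OF wf_numeral_fm] using sat_numeral_fm[of "case_nat x (case_nat a v)"] that by simp
        ultimately show ?thesis using spec[OF \<chi> a] Nn_ex[of "godel \<chi>"] by blast
      qed
      then show "sat M' v \<phi>" unfolding e by (auto simp: M')
    qed
  qed
  moreover have "\<phi> \<in> ElDiag L' M" if "\<phi> \<in> trans_conditions \<tau> ?LV" for \<phi>
  proof -
    have "sat ?W v \<phi>" if "range v \<subseteq> D" for v
      by (rule direct_conditions[OF dir wf\<tau> W _ _ \<open>\<phi> \<in> trans_conditions \<tau> ?LV\<close>]) (use that in \<open>simp_all add: funs\<close>, simp add: \<tau>_def)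
    then show ?thesis unfolding ElDiag_def using wf_trans_conditions[OF wf\<tau> that] by simp
  qed
  ultimately have "interprets \<tau> ?LV (map_fm Inl id ` USB U N Sat L) ?LW (ElDiag L' M)"
    unfolding interprets_def using wf\<tau> Hyp by blast
  then show ?thesis unfolding syntactically_defines_def using dir id by blast
qed

end

section \<open>Assembly of the theorem\<close>

lemma wf_BASIC: "\<phi> \<in> BASIC \<Longrightarrow> wf_fm lang_S12 4 \<phi>"
  unfolding BASIC_def by (elim insertE emptyE) (simp_all add: lang_S12_def)

theorem theorem24:
  fixes U :: "(nat, nat) fm set"
    and L L' :: "(nat, nat) lang"
    and N :: "(ba_fun, ba_rel, nat, nat) trans"
    and Sat :: nat
  assumes "finite_lang L'"
    and "theory_in L' U"
    and "re_theory U"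
    and "sequential L' U"
    and "sublang L L'"
    and "imposes_elementarity TYPE('a) L' U L"
    and "interprets N lang_S12 S12 L' U"
    and "\<forall>k. (Sat, k) \<notin> rels L'"
  shows "semantically_defines TYPE('a) L' U (add_rel Sat 2 L') (USB U N Sat L) L"
  unfolding semantically_defines_def
proof (intro allI impI)
  fix M :: "(nat, nat, 'a) struct" assume mod: "model L' U M"
  then have stM: "structure_for L' M" by (simp add: model_def)
  then have "dom M \<noteq> {}" by (simp add: structure_for_def)
  then obtain d where d: "d \<in> dom M" by blast
  then have vd: "range (\<lambda>_. d) \<subseteq> dom M" by auto
  interpret defmodel L' M by (rule defmodel.intro[OF stM])
  obtain \<tau> where \<tau>: "direct \<tau>" "interprets \<tau> lang_AS AS L' U" using assms(4) unfolding sequential_def by blast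
  have wf\<tau>: "wf_trans \<tau> lang_AS L'" using \<tau>(2) by (simp add: interprets_def)
  define E where "E x y = satl M (tr_rel \<tau> (Mem, 2)) [x, y]" for x y
  \<comment> \<open>A direct translation needs no quotient: \<open>A\<close> has the domain of
    \<open>M\<close>. The element \<open>d\<close> is a filler, as the language of \<open>AS\<close>
    has no function symbols.\<close>
  define A :: "(unit, as_rel, 'a) struct" where "A = \<lparr>dom = dom M, fun_of = \<lambda>_ _. d, rel_of = \<lambda>_ xs. satl M (tr_rel \<tau> (Mem, 2)) xs\<rparr>"
  have td: "tdom \<tau> M = dom M" using \<tau>(1) by (auto simp: tdom_def direct_def satl_def)
  have "interp_struct \<tau> lang_AS L' M A id"
    by unfold_locales (use \<tau>(1) wf\<tau> d td in \<open>auto simp: A_def structure_for_def lang_AS_def direct_def satl_def\<close>)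
  then interpret As: interp_struct \<tau> lang_AS L' M A id .
  have AS: "sat A (\<lambda>_. d) \<phi>" if "\<phi> \<in> AS" "wf_fm lang_AS 0 \<phi>" for \<phi>
  proof -
    have "U \<turnstile> tr_fm \<tau> \<phi>" using \<tau>(2) that(1) by (simp add: interprets_def)
    from model_proves[OF mod assms(2) this wf_tr_fm[OF wf\<tau> that(2)] vd] show ?thesis using As.sat_tr_fm[OF that(2)] by simp
  qed
  have "sat A (\<lambda>_. d) (Ex (All (Neg (mem 0 1))))" by (rule AS) (simp_all add: AS_def lang_AS_def)
  then have E_empty: "\<exists>s\<in>dom M. \<forall>x\<in>dom M. \<not> E x s" by (simp add: A_def E_def)
  have "sat A (\<lambda>_. d) (All (All (Ex (All (Iff (mem 0 1) (Or (mem 0 3) (Eq (Var 0) (Var 2))))))))"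
    by (rule AS) (simp_all add: AS_def lang_AS_def)
  note adj = this
  have E_adj: "\<forall>s\<in>dom M. \<forall>y\<in>dom M. \<exists>t\<in>dom M. \<forall>x\<in>dom M. E x t \<longleftrightarrow> E x s \<or> x = y"
  proof (intro ballI)
    fix s y assume sy: "s \<in> dom M" "y \<in> dom M"
    have A: "dom A = dom M" "rel_of A Mem [a, b] = E a b" for a b by (simp_all add: A_def E_def)
    from adj have "\<forall>s\<in>dom M. \<forall>y\<in>dom M. \<exists>t\<in>dom M. \<forall>x\<in>dom M. (\<not> E x t \<or> E x s \<or> x = y) \<and> (\<not> (E x s \<or> x = y) \<or> E x t)"
      by (simp only: sat.simps eval_tm.simps A list.map nat.case numeral_2_eq_2 numeral_3_eq_3 One_nat_def)
    from bspec[OF bspec[OF this sy(1)] sy(2)] obtain t where t: "t \<in> dom M"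
      "\<forall>x\<in>dom M. (\<not> E x t \<or> E x s \<or> x = y) \<and> (\<not> (E x s \<or> x = y) \<or> E x t)" ..
    show "\<exists>t\<in>dom M. \<forall>x\<in>dom M. E x t \<longleftrightarrow> E x s \<or> x = y" by (rule bexI[OF _ t(1)], rule ballI, drule bspec[OF t(2)]) argo
  qed
  have wfE: "wf_fm L' 2 (tr_rel \<tau> (Mem, 2))" using wf\<tau> by (simp add: wf_trans_def lang_AS_def)
  have E_dfn: "dfn (\<lambda>v. E (v 0) (v 1))"
  proof (rule dfn_cong[OF dfn_fm[OF wfE]])
    fix v show "sat M v (tr_rel \<tau> (Mem, 2)) \<longleftrightarrow> E (v 0) (v 1)" unfolding E_def
      by (rule satlI[of L']) (use wfE in \<open>simp_all add: less_Suc_eq numeral_2_eq_2\<close>)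
  qed
  have N: "wf_trans N lang_S12 L'" "\<And>\<phi>. \<phi> \<in> trans_conditions N lang_S12 \<Longrightarrow> U \<turnstile> \<phi>" "\<And>\<phi>. \<phi> \<in> S12 \<Longrightarrow> U \<turnstile> tr_fm N \<phi>"
    using assms(7) by (auto simp: interprets_def)
  have "\<exists>(Q :: (ba_fun, ba_rel, 'a) struct) r. interp_struct N lang_S12 L' M Q r"
    by (rule interp_exists[OF \<open>dom M \<noteq> {}\<close> N(1)]) (rule model_proves[OF mod assms(2) N(2) wf_trans_conditions[OF N(1)]])
  then obtain Q :: "(ba_fun, ba_rel, 'a) struct" and r where "interp_struct N lang_S12 L' M Q r" by blast
  then interpret Qs: interp_struct N lang_S12 L' M Q r .
  have basic: "sat Q v \<phi>" if \<phi>: "\<phi> \<in> BASIC" and v: "range v \<subseteq> dom Q" for \<phi> v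
  proof -
    have wf: "wf_fm lang_S12 0 (alls 4 \<phi>)" using wf_BASIC[OF \<phi>] by (simp add: wf_alls)
    have "alls 4 \<phi> \<in> S12" using \<phi> by (simp add: S12_def)
    from model_proves[OF mod assms(2) N(3)[OF this] wf_tr_fm[OF N(1) wf] vd]
    have "sat Q (\<lambda>_. r d) (alls 4 \<phi>)" using Qs.sat_tr_fm[OF wf] by simp
    \<comment> \<open>An axiom of \<open>BASIC\<close> has at most four free variables, so its
      closure is instantiated with the first four values of \<open>v\<close>.\<close>
    then have "sat Q (ext (map v [0..<4]) (\<lambda>_. r d)) \<phi>" by (rule sat_allsD) (use v in auto)
    moreover have "sat Q (ext (map v [0..<4]) (\<lambda>_. r d)) \<phi> = sat Q v \<phi>" by (rule sat_cong[OF wf_BASIC[OF \<phi>]]) (simp add: ext_def)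
    ultimately show ?thesis by simp
  qed
  interpret arith L' M N Q r E
    by unfold_locales (use E_dfn E_empty E_adj basic assms(1) in blast)+
  from re_stages[OF assms(3)[unfolded re_theory_def]] obtain AxP where
    AxP: "\<forall>f g. repf f \<longrightarrow> repf g \<longrightarrow> rep (\<lambda>n. AxP (f n) (g n))" "\<forall>w w' u. AxP w u \<longrightarrow> w \<le> w' \<longrightarrow> AxP w' u"
    "\<forall>u. u \<in> godel ` U \<longleftrightarrow> (\<exists>w. AxP w u)" by (elim exE conjE)
  interpret recursive_theory L' M N Q r E U AxP
    by unfold_locales (use AxP in blast)+
  from assms(6)[unfolded imposes_elementarity_def, rule_format, OF mod] obtain n where
    n: "\<And>(K :: (nat, nat, 'a) struct) h. model L' U K \<Longrightarrow> sigma_elementary L' n h M K \<Longrightarrow> elementary L h M K" by blast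
  \<comment> \<open>Passing to \<open>Suc n\<close> ensures a positive level, where inequations and
    conjunctions are available; the hypothesis on \<open>h\<close> only becomes stronger.\<close>
  have imp: "elementary L h M K" if "model L' U K" "sigma_elementary L' (Suc n) h M K" for K :: "(nat, nat, 'a) struct" and h
    by (rule n[OF that(1)]) (use that(2) Sigma_star_Suc(1) in \<open>unfold sigma_elementary_def, blast\<close>)
  have sub: "wf_fm L k \<phi> \<Longrightarrow> wf_fm L' k \<phi>" for k \<phi> by (rule wf_fm_sublang[OF assms(5)])
  have "\<exists>\<Phi>. dfn (\<lambda>v. \<Phi> (v 0) (v 1)) \<and>
    (\<forall>\<phi> x a. wf_fm L 1 \<phi> \<longrightarrow> a \<in> dom M \<longrightarrow> Nn (godel \<phi>) x \<longrightarrow> (\<Phi> x a \<longleftrightarrow> sat M (\<lambda>_. a) \<phi>))"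
    by (rule rosser_predicate[OF assms(2) mod sub]) (assumption, rule uniform_sigma[OF mod assms(2) infinite_dom imp assms(5) _ sub])
  then obtain \<Phi> where \<Phi>: "dfn (\<lambda>v. \<Phi> (v 0) (v 1))"
    "\<forall>\<phi> x a. wf_fm L 1 \<phi> \<longrightarrow> a \<in> dom M \<longrightarrow> Nn (godel \<phi>) x \<longrightarrow> (\<Phi> x a \<longleftrightarrow> sat M (\<lambda>_. a) \<phi>)" by (elim exE conjE)
  show "syntactically_defines (lang_diag L' M) (ElDiag L' M) (lang_diag (add_rel Sat 2 L') M)
      (map_fm Inl id ` USB U N Sat L) (lang_diag L M)"
    by (rule USB_definable[OF mod assms(2,5,8) \<Phi>(1)]) (use \<Phi>(2) in blast)
qed

end
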